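(* Let $\mu$ be a global Keisler measure which is $irgs$ over a small model $M$, and let $\lambda$ be a global Keisler measure which is finitely satisfiable in $M$. Then: (i) the Morley product $\lambda\otimes\mu$ is well-defined, and $\mu\otimes\lambda=\lambda\otimes\mu$ (i.e. $\mu_x\otimes\lambda_y=\lambda_y\otimes\mu_x$); (ii) $\mu$ is symmetric: for every $n$ and every permutation $\sigma$ of $\{1,\dots,n\}$, $$\mu_{x_1}\otimes\cdots\otimes\mu_{x_n}=\mu_{x_{\sigma(1)}}\otimes\cdots\otimes\mu_{x_{\sigma(n)}}.$$
   Context: **Classical setting.** $T$ is a complete first-order theory in a countable language $L$, $\mathcal U$ is its monster model, and small models $M$ satisfy $M\preceq\mathcal U$. A global (Keisler) measure $\mu(x)$ is a finitely additive probability measure on $L(\mathcal U)$-formulas in $x$, identified with a regular Borel probability measure on $S_x(\mathcal U)$. It is definable over $M$ if it is $M$-invariant and for each $L$-formula $\varphi(x;y)$ the map $S_y(M)\to[0,1]$, $\mathrm{tp}(b/M)\mapsto\mu(\varphi(x;b))$, is continuous. It is finitely satisfiable in $M$ if every $L(\mathcal U)$-formula of positive measure is satisfied by a tuple from $M$. **Morley product.** Let $\lambda(x),\nu(y)$ be global measures with $\lambda$ $M$-invariant. For an $L(\mathcal U)$-formula $\varphi(x,y)$ and a small model $N\supseteq M$ containing its parameters, let $F_{\lambda}^{\varphi}:S_y(N)\to[0,1]$, $F_\lambda^\varphi(q)=\lambda(\varphi(x,b))$ for any $b\models q$. The Morley product $\lambda_x\otimes\nu_y$ is well-defined if $F^\varphi_\lambda$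 is measurable with respect to (the completion of) $\nu|_N$ for all such $\varphi,N$; then $(\lambda_x\otimes\nu_y)(\varphi(x,y))=\int_{S_y(N)}F_\lambda^\varphi\,d\nu|_N$ (independent of $N$). **Randomization.** For an atomless probability space $(\Omega,\mathcal B,\mathcal P)$, $M_0^\Omega$ is the set of measurable functions $\Omega\to M$ with finite range, written $f=\sum_{i\le n}a_i^{A_i}$ ($f=a_i$ on $A_i$, $(A_i)$ a measurable partition of $\Omega$). For a classical formula $\varphi$, $\llbracket\varphi(f_1,\dots,f_n)\rrbracket=\{\omega: M\models\varphi(f_1(\omega),\dots,f_n(\omega))\}$ and $\mathbb P\llbracket\varphi(\bar f)\rrbracket=\mathcal P(\llbracket\varphi(\bar f)\rrbracket)$. The metric is $d(f,g)=\mathbb P\llbracket f\ne g\rrbracket$; $M^\Omega$ is the completion. $a\in M$ is identified with the constant function $a^\Omega$. $T^R$ is the (complete, continuous) theory of these structures (Ben Yaacov–Keisler randomization); it has quantifier elimination, so types are determined by the values of $\mathbb P\llbracket\varphi\rrbracket$, $\varphi$ a classical formula. $\mathcal C$ is the monster model of $T^R$, with $M^\Omega\preceq\mathcal U^\Omega\preceq\mathcal C$. A global random type is an element of $S_x(\mathcal C)$; for such $p$, $\mathbb P^{p}\llbracket\varphi(x;g)\rrbracket$ denotes the value that $p$ assigns to $\mathbb P\llbracket\varphi(x;g)\rrbracket$. **Generic stability (continuous logic).** A type $p\in S_x(\mathcal C)$ invariant over $N\preceq\mathcal C$ is generically stable over $N$ if there do not exist a formula $\varphi(x;y)$, a Morley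 sequence $(a_i)_{i<\omega}$ in $p$ over $N$ (i.e. $a_i\models p|_{Na_{<i}}$), a sequence $(b_i)_{i<\omega}$ in $\mathcal C^y$ and reals $r<s$ such that $\varphi(a_i;b_j)\le r$ if $i\le j$ and $\varphi(a_i;b_j)\ge s$ if $i>j$. **Canonical random extension $r_\mu$ and $irgs$.** Let $\mu$ be a global measure definable over $M$. The type $r_\mu\in S_x(\mathcal C)$ is defined by $\mathbb P^{r_\mu}\llbracket\varphi(x;g)\rrbracket=\sum_{i=1}^k\mathcal P(A_i)\,\mu(\varphi(x;a_i))$ for $g=\sum_{i=1}^k a_i^{A_i}$ in $M_0^\Omega$, and for arbitrary $g$ in $\mathcal C$ by $\mathbb P^{r_\mu}\llbracket\varphi(x;g)\rrbracket=\lim_j\mathbb P^{r_\mu}\llbracket\varphi(x;g_j)\rrbracket$, where $(g_j)$ is any net in $M_0^\Omega$ with $\mathrm{tp}(g_j/M_0^\Omega)\to\mathrm{tp}(g/M_0^\Omega)$ (this is known to be well defined). The measure $\mu$ is $irgs$ over $M$ if it is definable over $M$ and $r_\mu$ is generically stable over $M^\Omega$ (for some atomless probability space $(\Omega,\mathcal P)$). *)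

theory Defs
  imports "HOL-Probability.Probability" "HOL-Combinatorics.Permutations"
begin

section \<open>First-order logic\<close>

definition tuples :: "nat \<Rightarrow> 'a set \<Rightarrow> 'a list set" where
  "tuples n S = {xs. length xs = n \<and> set xs \<subseteq> S}"

text \<open>A language is a set of function symbols and a set of relation symbols, each with its arity.\<close>

record ('f, 'r) lang =
  funs :: "('f \<times> nat) set"
  rels :: "('r \<times> nat) set"

definition countable_lang :: "('f, 'r) lang \<Rightarrow> bool" where
  "countable_lang L \<longleftrightarrow> countable (funs L) \<and> countable (rels L)"

datatype 'f trm = Var nat | App 'f "'f trm list"

datatype ('f, 'r) form =
    Eq "'f trm" "'f trm"
  | Rel 'r "'f trm list"
  | Neg "('f, 'r) form"
  | Conj "('f, 'r) form" "('f, 'r) form"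
  | Ex nat "('f, 'r) form"

primrec tvars :: "'f trm \<Rightarrow> nat set" where
  "tvars (Var i) = {i}"
| "tvars (App f ts) = \<Union>(set (map tvars ts))"

primrec fvars :: "('f, 'r) form \<Rightarrow> nat set" where
  "fvars (Eq s t) = tvars s \<union> tvars t"
| "fvars (Rel r ts) = \<Union>(set (map tvars ts))"
| "fvars (Neg \<phi>) = fvars \<phi>"
| "fvars (Conj \<phi> \<psi>) = fvars \<phi> \<union> fvars \<psi>"
| "fvars (Ex i \<phi>) = fvars \<phi> - {i}"

primrec wf_trm :: "('f, 'r) lang \<Rightarrow> 'f trm \<Rightarrow> bool" where
  "wf_trm L (Var i) \<longleftrightarrow> True"
| "wf_trm L (App f ts) \<longleftrightarrow> (f, length ts) \<in> funs L \<and> list_all id (map (wf_trm L) ts)"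

primrec wf_form :: "('f, 'r) lang \<Rightarrow> ('f, 'r) form \<Rightarrow> bool" where
  "wf_form L (Eq s t) \<longleftrightarrow> wf_trm L s \<and> wf_trm L t"
| "wf_form L (Rel r ts) \<longleftrightarrow> (r, length ts) \<in> rels L \<and> list_all (wf_trm L) ts"
| "wf_form L (Neg \<phi>) \<longleftrightarrow> wf_form L \<phi>"
| "wf_form L (Conj \<phi> \<psi>) \<longleftrightarrow> wf_form L \<phi> \<and> wf_form L \<psi>"
| "wf_form L (Ex i \<phi>) \<longleftrightarrow> wf_form L \<phi>"

text \<open>\<open>fm L n \<phi>\<close>: an \<open>L\<close>-formula whose free variables are among the first \<open>n\<close>.  A partitioned
  formula \<open>\<phi>(x; y)\<close> with \<open>|x| = m\<close> has the variables \<open>0..<m\<close> for \<open>x\<close> and the following ones for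
  \<open>y\<close>; an \<open>L(A)\<close>-formula \<open>\<phi>(x; c)\<close> is the pair \<open>(\<phi>, c)\<close> with \<open>c\<close> a list over \<open>A\<close>.\<close>

definition fm :: "('f, 'r) lang \<Rightarrow> nat \<Rightarrow> ('f, 'r) form \<Rightarrow> bool" where
  "fm L n \<phi> \<longleftrightarrow> wf_form L \<phi> \<and> fvars \<phi> \<subseteq> {..<n}"

record ('a, 'f, 'r) struct =
  univ :: "'a set"
  fint :: "'f \<Rightarrow> 'a list \<Rightarrow> 'a"
  rint :: "'r \<Rightarrow> 'a list \<Rightarrow> bool"

definition is_struct :: "('f, 'r) lang \<Rightarrow> ('a, 'f, 'r) struct \<Rightarrow> bool" where
  "is_struct L U \<longleftrightarrow> univ U \<noteq> {} \<and>
     (\<forall>f n. (f, n) \<in> funs L \<longrightarrow> (\<forall>xs\<in>tuples n (univ U). fint U f xs \<in> univ U))"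

primrec tval :: "('a, 'f, 'r) struct \<Rightarrow> (nat \<Rightarrow> 'a) \<Rightarrow> 'f trm \<Rightarrow> 'a" where
  "tval U e (Var i) = e i"
| "tval U e (App f ts) = fint U f (map (tval U e) ts)"

primrec sat :: "('a, 'f, 'r) struct \<Rightarrow> ('f, 'r) form \<Rightarrow> (nat \<Rightarrow> 'a) \<Rightarrow> bool" where
  "sat U (Eq s t) e \<longleftrightarrow> tval U e s = tval U e t"
| "sat U (Rel r ts) e \<longleftrightarrow> rint U r (map (tval U e) ts)"
| "sat U (Neg \<phi>) e \<longleftrightarrow> \<not> sat U \<phi> e"
| "sat U (Conj \<phi> \<psi>) e \<longleftrightarrow> sat U \<phi> e \<and> sat U \<psi> e"
| "sat U (Ex i \<phi>) e \<longleftrightarrow> (\<exists>x\<in>univ U. sat U \<phi> (e(i := x)))"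

text \<open>Satisfaction by a tuple.  The value of \<open>nth xs\<close> beyond the length of \<open>xs\<close> is irrelevant
  for formulas with \<open>fm L (length xs) \<phi>\<close>.\<close>

abbreviation holds :: "('a, 'f, 'r) struct \<Rightarrow> ('f, 'r) form \<Rightarrow> 'a list \<Rightarrow> bool" where
  "holds U \<phi> xs \<equiv> sat U \<phi> (nth xs)"

definition elem_sub :: "('f, 'r) lang \<Rightarrow> ('a, 'f, 'r) struct \<Rightarrow> 'a set \<Rightarrow> bool" where
  "elem_sub L U N \<longleftrightarrow> N \<subseteq> univ U \<and> is_struct L (U\<lparr>univ := N\<rparr>) \<and>
     (\<forall>\<phi> xs. fm L (length xs) \<phi> \<and> set xs \<subseteq> N \<longrightarrow> holds (U\<lparr>univ := N\<rparr>) \<phi> xs = holds U \<phi> xs)"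

definition param_fms :: "('f, 'r) lang \<Rightarrow> 'a set \<Rightarrow> nat \<Rightarrow> (('f, 'r) form \<times> 'a list) set" where
  "param_fms L A n = {(\<phi>, c). fm L (n + length c) \<phi> \<and> set c \<subseteq> A}"

definition tp :: "('f, 'r) lang \<Rightarrow> ('a, 'f, 'r) struct \<Rightarrow> 'a set \<Rightarrow> 'a list
    \<Rightarrow> (('f, 'r) form \<times> 'a list) set" where
  "tp L U A b = {(\<phi>, c) \<in> param_fms L A (length b). holds U \<phi> (b @ c)}"

text \<open>\<open>types L U A n\<close> is the set $S_n(A)$ of complete \<open>n\<close>-types over \<open>A\<close>, i.e. of the maximal
  sets of \<open>L(A)\<close>-formulas that are finitely satisfiable in \<open>U\<close>.\<close>

definition types :: "('f, 'r) lang \<Rightarrow> ('a, 'f, 'r) struct \<Rightarrow> 'a set \<Rightarrow> nat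
    \<Rightarrow> (('f, 'r) form \<times> 'a list) set set" where
  "types L U A n = {p. p \<subseteq> param_fms L A n \<and>
     (\<forall>F\<subseteq>p. finite F \<longrightarrow> (\<exists>b\<in>tuples n (univ U). \<forall>(\<phi>, c)\<in>F. holds U \<phi> (b @ c))) \<and>
     (\<forall>(\<phi>, c)\<in>param_fms L A n. (\<phi>, c) \<in> p \<or> (Neg \<phi>, c) \<in> p)}"

definition basic_open :: "('f, 'r) lang \<Rightarrow> ('a, 'f, 'r) struct \<Rightarrow> 'a set \<Rightarrow> nat
    \<Rightarrow> ('f, 'r) form \<times> 'a list \<Rightarrow> (('f, 'r) form \<times> 'a list) set set" where
  "basic_open L U A n \<phi>c = {p \<in> types L U A n. \<phi>c \<in> p}"

definition type_space :: "('f, 'r) lang \<Rightarrow> ('a, 'f, 'r) struct \<Rightarrow> 'a set \<Rightarrow> nat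
    \<Rightarrow> (('f, 'r) form \<times> 'a list) set topology" where
  "type_space L U A n = topology_generated_by (basic_open L U A n ` param_fms L A n)"

text \<open>A chosen realization in \<open>U\<close>; one exists for every complete type over a small set.\<close>

definition realization :: "('f, 'r) lang \<Rightarrow> ('a, 'f, 'r) struct \<Rightarrow> 'a set \<Rightarrow> nat
    \<Rightarrow> (('f, 'r) form \<times> 'a list) set \<Rightarrow> 'a list" where
  "realization L U A n q = (SOME b. b \<in> tuples n (univ U) \<and> tp L U A b = q)"

definition automorphism :: "('f, 'r) lang \<Rightarrow> ('a, 'f, 'r) struct \<Rightarrow> ('a \<Rightarrow> 'a) \<Rightarrow> bool" where
  "automorphism L U g \<longleftrightarrow> bij_betw g (univ U) (univ U) \<and>
     (\<forall>f n. (f, n) \<in> funs L \<longrightarrow>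
        (\<forall>xs\<in>tuples n (univ U). g (fint U f xs) = fint U f (map g xs))) \<and>
     (\<forall>r n. (r, n) \<in> rels L \<longrightarrow>
        (\<forall>xs\<in>tuples n (univ U). rint U r (map g xs) = rint U r xs))"

definition partial_elementary ::
    "('f, 'r) lang \<Rightarrow> ('a, 'f, 'r) struct \<Rightarrow> 'a set \<Rightarrow> ('a \<Rightarrow> 'a) \<Rightarrow> bool" where
  "partial_elementary L U A h \<longleftrightarrow> h ` A \<subseteq> univ U \<and>
     (\<forall>\<phi> xs. fm L (length xs) \<phi> \<and> set xs \<subseteq> A \<longrightarrow> holds U \<phi> (map h xs) = holds U \<phi> xs)"

text \<open>A set is small if its cardinality is less than that of \<open>\<kappa>\<close>.\<close>

definition small :: "'k rel \<Rightarrow> 'a set \<Rightarrow> bool" where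
  "small \<kappa> A \<longleftrightarrow> (card_of A, \<kappa>) \<in> ordLess"

definition uncountable_card :: "'k rel \<Rightarrow> bool" where
  "uncountable_card \<kappa> \<longleftrightarrow> Card_order \<kappa> \<and> (natLeq, \<kappa>) \<in> ordLess"

text \<open>The monster model of its complete theory: \<open>\<kappa>\<close>-saturated and strongly \<open>\<kappa>\<close>-homogeneous.\<close>

definition monster :: "('f, 'r) lang \<Rightarrow> 'k rel \<Rightarrow> ('a, 'f, 'r) struct \<Rightarrow> bool" where
  "monster L \<kappa> U \<longleftrightarrow> is_struct L U \<and> uncountable_card \<kappa> \<and>
     (\<forall>A n p. A \<subseteq> univ U \<and> small \<kappa> A \<and> p \<in> types L U A n \<longrightarrow>
        (\<exists>b\<in>tuples n (univ U). tp L U A b = p)) \<and>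
     (\<forall>A h. A \<subseteq> univ U \<and> small \<kappa> A \<and> partial_elementary L U A h \<longrightarrow>
        (\<exists>g. automorphism L U g \<and> (\<forall>x\<in>A. g x = h x)))"

definition small_model :: "('f, 'r) lang \<Rightarrow> 'k rel \<Rightarrow> ('a, 'f, 'r) struct \<Rightarrow> 'a set \<Rightarrow> bool" where
  "small_model L \<kappa> U N \<longleftrightarrow> elem_sub L U N \<and> small \<kappa> N"


section \<open>Keisler measures\<close>

text \<open>\<open>L(U)\<close>-formulas up to equivalence are identified with the definable sets they define.\<close>

definition defset :: "('a, 'f, 'r) struct \<Rightarrow> nat \<Rightarrow> ('f, 'r) form \<Rightarrow> 'a list \<Rightarrow> 'a list set" where
  "defset U n \<phi> c = {b \<in> tuples n (univ U). holds U \<phi> (b @ c)}"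

definition definable :: "('f, 'r) lang \<Rightarrow> ('a, 'f, 'r) struct \<Rightarrow> 'a set \<Rightarrow> nat \<Rightarrow> 'a list set set" where
  "definable L U A n = {defset U n \<phi> c | \<phi> c. (\<phi>, c) \<in> param_fms L A n}"

definition keisler :: "('f, 'r) lang \<Rightarrow> ('a, 'f, 'r) struct \<Rightarrow> nat \<Rightarrow> ('a list set \<Rightarrow> real) \<Rightarrow> bool" where
  "keisler L U n \<mu> \<longleftrightarrow> (\<forall>D\<in>definable L U (univ U) n. 0 \<le> \<mu> D) \<and>
     \<mu> (tuples n (univ U)) = 1 \<and> additive (definable L U (univ U) n) \<mu>"

definition invariant_measure :: "('f, 'r) lang \<Rightarrow> ('a, 'f, 'r) struct \<Rightarrow> 'a set \<Rightarrow> nat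
    \<Rightarrow> ('a list set \<Rightarrow> real) \<Rightarrow> bool" where
  "invariant_measure L U M m \<mu> \<longleftrightarrow>
     (\<forall>\<phi> k. \<forall>b\<in>tuples k (univ U). \<forall>b'\<in>tuples k (univ U).
        fm L (m + k) \<phi> \<and> tp L U M b = tp L U M b' \<longrightarrow> \<mu> (defset U m \<phi> b) = \<mu> (defset U m \<phi> b'))"

definition definable_measure :: "('f, 'r) lang \<Rightarrow> ('a, 'f, 'r) struct \<Rightarrow> 'a set \<Rightarrow> nat
    \<Rightarrow> ('a list set \<Rightarrow> real) \<Rightarrow> bool" where
  "definable_measure L U M m \<mu> \<longleftrightarrow> invariant_measure L U M m \<mu> \<and>
     (\<forall>\<phi> k. fm L (m + k) \<phi> \<longrightarrow>
        continuous_map (type_space L U M k) euclideanreal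
          (\<lambda>q. \<mu> (defset U m \<phi> (realization L U M k q))))"

definition fin_sat_measure :: "('f, 'r) lang \<Rightarrow> ('a, 'f, 'r) struct \<Rightarrow> 'a set \<Rightarrow> nat
    \<Rightarrow> ('a list set \<Rightarrow> real) \<Rightarrow> bool" where
  "fin_sat_measure L U M n \<nu> \<longleftrightarrow>
     (\<forall>D\<in>definable L U (univ U) n. \<nu> D > 0 \<longrightarrow> (\<exists>b\<in>tuples n M. b \<in> D))"

definition regular_borel_prob :: "'p topology \<Rightarrow> 'p measure \<Rightarrow> bool" where
  "regular_borel_prob X P \<longleftrightarrow>
     space P = topspace X \<and> sets P = sigma_sets (topspace X) {V. openin X V} \<and> prob_space P \<and>
     (\<forall>A\<in>sets P.
        emeasure P A = (SUP K\<in>{K. K \<subseteq> A \<and> closedin X K}. emeasure P K) \<and>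
        emeasure P A = (INF V\<in>{V. A \<subseteq> V \<and> openin X V}. emeasure P V))"

text \<open>The regular Borel probability measure on $S_n(N)$ corresponding to the restriction
  $\nu|_N$.\<close>

definition borel_restr :: "('f, 'r) lang \<Rightarrow> ('a, 'f, 'r) struct \<Rightarrow> 'a set \<Rightarrow> nat
    \<Rightarrow> ('a list set \<Rightarrow> real) \<Rightarrow> (('f, 'r) form \<times> 'a list) set measure" where
  "borel_restr L U N n \<nu> = (THE P. regular_borel_prob (type_space L U N n) P \<and>
     (\<forall>(\<phi>, c)\<in>param_fms L N n. measure P (basic_open L U N n (\<phi>, c)) = \<nu> (defset U n \<phi> c)))"

text \<open>\<open>D\<close> is the set defined in the variables \<open>(x, y)\<close>, \<open>|x| = m\<close>, \<open>|y| = k\<close>, by an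
  \<open>L(N)\<close>-formula \<open>\<phi>(x, y)\<close>; then \<open>fibre_measure\<close> is the function
  $F_\mu^\varphi : S_y(N) \to [0,1]$, $q \mapsto \mu(\varphi(x, b))$ with $b \models q$.\<close>

definition fibre_measure :: "('f, 'r) lang \<Rightarrow> ('a, 'f, 'r) struct \<Rightarrow> 'a set \<Rightarrow> nat \<Rightarrow> nat
    \<Rightarrow> ('a list set \<Rightarrow> real) \<Rightarrow> 'a list set \<Rightarrow> (('f, 'r) form \<times> 'a list) set \<Rightarrow> real" where
  "fibre_measure L U N m k \<mu> D q =
     \<mu> {a \<in> tuples m (univ U). a @ realization L U N k q \<in> D}"

definition morley_wd :: "('f, 'r) lang \<Rightarrow> 'k rel \<Rightarrow> ('a, 'f, 'r) struct \<Rightarrow> 'a set \<Rightarrow> nat \<Rightarrow> nat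
    \<Rightarrow> ('a list set \<Rightarrow> real) \<Rightarrow> ('a list set \<Rightarrow> real) \<Rightarrow> bool" where
  "morley_wd L \<kappa> U M m k \<mu> \<nu> \<longleftrightarrow>
     (\<forall>N D. small_model L \<kappa> U N \<and> M \<subseteq> N \<and> D \<in> definable L U N (m + k) \<longrightarrow>
        fibre_measure L U N m k \<mu> D \<in> borel_measurable (completion (borel_restr L U N k \<nu>)))"

text \<open>$\mu_x \otimes \nu_y$ as a measure in the variables \<open>(x, y)\<close>.  If the product is well-defined
  the value does not depend on the chosen \<open>N\<close>.\<close>

definition morley :: "('f, 'r) lang \<Rightarrow> 'k rel \<Rightarrow> ('a, 'f, 'r) struct \<Rightarrow> 'a set \<Rightarrow> nat \<Rightarrow> nat
    \<Rightarrow> ('a list set \<Rightarrow> real) \<Rightarrow> ('a list set \<Rightarrow> real) \<Rightarrow> 'a list set \<Rightarrow> real" where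
  "morley L \<kappa> U M m k \<mu> \<nu> D =
     (let N = (SOME N. small_model L \<kappa> U N \<and> M \<subseteq> N \<and> D \<in> definable L U N (m + k))
      in integral\<^sup>L (completion (borel_restr L U N k \<nu>)) (fibre_measure L U N m k \<mu> D))"

text \<open>The iterated product $\mu_{x_1} \otimes \cdots \otimes \mu_{x_n}$, bracketed to the right, as a
  measure in \<open>(x_1, \<dots>, x_n)\<close>; the empty product is the unique measure in no variables.\<close>

fun morley_power :: "('f, 'r) lang \<Rightarrow> 'k rel \<Rightarrow> ('a, 'f, 'r) struct \<Rightarrow> 'a set \<Rightarrow> nat
    \<Rightarrow> ('a list set \<Rightarrow> real) \<Rightarrow> nat \<Rightarrow> 'a list set \<Rightarrow> real" where
  "morley_power L \<kappa> U M m \<mu> 0 = (\<lambda>D. if [] \<in> D then 1 else 0)"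
| "morley_power L \<kappa> U M m \<mu> (Suc 0) = \<mu>"
| "morley_power L \<kappa> U M m \<mu> (Suc (Suc n)) =
     morley L \<kappa> U M m (Suc n * m) \<mu> (morley_power L \<kappa> U M m \<mu> (Suc n))"

text \<open>Renaming of variables: \<open>swap_blocks m\<close> turns the set defined by \<open>\<phi>\<close> in the variables
  \<open>(x, y)\<close>, \<open>|x| = m\<close>, into the set it defines in the variables \<open>(y, x)\<close>; \<open>permute_blocks\<close> turns the
  set defined by \<open>\<phi>\<close> in the variables \<open>(x_0, \<dots>, x_(n-1))\<close>, \<open>|x_i| = m\<close>, into the set it defines in
  the variables \<open>(x_(\<sigma> 0), \<dots>, x_(\<sigma> (n-1)))\<close>.\<close>

definition swap_blocks :: "nat \<Rightarrow> 'a list set \<Rightarrow> 'a list set" where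
  "swap_blocks m D = {b @ a | a b. length a = m \<and> a @ b \<in> D}"

definition permute_blocks :: "nat \<Rightarrow> nat \<Rightarrow> (nat \<Rightarrow> nat) \<Rightarrow> 'a list set \<Rightarrow> 'a list set" where
  "permute_blocks m n \<sigma> D = {concat (map (\<lambda>i. xs ! \<sigma> i) [0..<n]) | xs.
     length xs = n \<and> (\<forall>x\<in>set xs. length x = m) \<and> concat xs \<in> D}"


section \<open>Continuous logic in the language of randomizations\<close>

text \<open>The language has an \<open>n\<close>-ary predicate $\mathbb{P}[\![\varphi]\!]$ for each \<open>L\<close>-formula \<open>\<phi>\<close> with
  \<open>fm L n \<phi>\<close>, besides the metric.  \<open>CProb \<phi> vs\<close> applies it to the variables \<open>vs\<close>.  The connectives
  are all continuous functions $u : [0,1]^n \to [0,1]$; such a \<open>u\<close> is given by a continuous function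
  on $[0,1]^\omega$ (product topology), of which only the values at sequences vanishing from \<open>n\<close> on
  matter.\<close>

datatype ('f, 'r) cform =
    CDist nat nat
  | CProb "('f, 'r) form" "nat list"
  | CConn "(nat \<Rightarrow> real) \<Rightarrow> real" "('f, 'r) cform list"
  | CSup nat "('f, 'r) cform"
  | CInf nat "('f, 'r) cform"

primrec cfvars :: "('f, 'r) cform \<Rightarrow> nat set" where
  "cfvars (CDist i j) = {i, j}"
| "cfvars (CProb \<phi> vs) = set vs"
| "cfvars (CConn u \<psi>s) = \<Union>(set (map cfvars \<psi>s))"
| "cfvars (CSup i \<psi>) = cfvars \<psi> - {i}"
| "cfvars (CInf i \<psi>) = cfvars \<psi> - {i}"

definition unit_cube :: "(nat \<Rightarrow> real) set" where
  "unit_cube = {v. \<forall>i. v i \<in> {0..1}}"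

primrec wf_cform :: "('f, 'r) lang \<Rightarrow> ('f, 'r) cform \<Rightarrow> bool" where
  "wf_cform L (CDist i j) \<longleftrightarrow> True"
| "wf_cform L (CProb \<phi> vs) \<longleftrightarrow> fm L (length vs) \<phi>"
| "wf_cform L (CConn u \<psi>s) \<longleftrightarrow>
     continuous_on unit_cube u \<and> u ` unit_cube \<subseteq> {0..1} \<and> list_all id (map (wf_cform L) \<psi>s)"
| "wf_cform L (CSup i \<psi>) \<longleftrightarrow> wf_cform L \<psi>"
| "wf_cform L (CInf i \<psi>) \<longleftrightarrow> wf_cform L \<psi>"

definition cfm :: "('f, 'r) lang \<Rightarrow> nat \<Rightarrow> ('f, 'r) cform \<Rightarrow> bool" where
  "cfm L n \<psi> \<longleftrightarrow> wf_cform L \<psi> \<and> cfvars \<psi> \<subseteq> {..<n}"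

record ('c, 'f, 'r) cstruct =
  cuniv :: "'c set"
  cdist :: "'c \<Rightarrow> 'c \<Rightarrow> real"
  cprob :: "('f, 'r) form \<Rightarrow> 'c list \<Rightarrow> real"

text \<open>The predicates $\mathbb{P}[\![\varphi]\!]$ have the modulus of uniform continuity that they have
  in randomizations: they are 1-Lipschitz in each argument.\<close>

definition is_cstruct :: "('f, 'r) lang \<Rightarrow> ('c, 'f, 'r) cstruct \<Rightarrow> bool" where
  "is_cstruct L C \<longleftrightarrow> cuniv C \<noteq> {} \<and> Metric_space (cuniv C) (cdist C) \<and>
     Metric_space.mcomplete (cuniv C) (cdist C) \<and>
     (\<forall>x\<in>cuniv C. \<forall>y\<in>cuniv C. cdist C x y \<le> 1) \<and>
     (\<forall>\<phi> n. fm L n \<phi> \<longrightarrow>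
        (\<forall>xs\<in>tuples n (cuniv C). cprob C \<phi> xs \<in> {0..1}) \<and>
        (\<forall>xs\<in>tuples n (cuniv C). \<forall>ys\<in>tuples n (cuniv C).
           \<bar>cprob C \<phi> xs - cprob C \<phi> ys\<bar> \<le> (\<Sum>i<n. cdist C (xs ! i) (ys ! i))))"

primrec cval_env :: "('c, 'f, 'r) cstruct \<Rightarrow> ('f, 'r) cform \<Rightarrow> (nat \<Rightarrow> 'c) \<Rightarrow> real" where
  "cval_env C (CDist i j) = (\<lambda>e. cdist C (e i) (e j))"
| "cval_env C (CProb \<phi> vs) = (\<lambda>e. cprob C \<phi> (map e vs))"
| "cval_env C (CConn u \<psi>s) =
     (\<lambda>e. let vals = map (cval_env C) \<psi>s in u (\<lambda>i. if i < length \<psi>s then (vals ! i) e else 0))"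
| "cval_env C (CSup i \<psi>) = (\<lambda>e. SUP x\<in>cuniv C. cval_env C \<psi> (e(i := x)))"
| "cval_env C (CInf i \<psi>) = (\<lambda>e. INF x\<in>cuniv C. cval_env C \<psi> (e(i := x)))"

abbreviation cval :: "('c, 'f, 'r) cstruct \<Rightarrow> ('f, 'r) cform \<Rightarrow> 'c list \<Rightarrow> real" where
  "cval C \<psi> xs \<equiv> cval_env C \<psi> (nth xs)"

definition celem_sub :: "('f, 'r) lang \<Rightarrow> ('c, 'f, 'r) cstruct \<Rightarrow> 'c set \<Rightarrow> bool" where
  "celem_sub L C N \<longleftrightarrow> N \<subseteq> cuniv C \<and> is_cstruct L (C\<lparr>cuniv := N\<rparr>) \<and>
     (\<forall>\<psi> xs. cfm L (length xs) \<psi> \<and> set xs \<subseteq> N \<longrightarrow> cval (C\<lparr>cuniv := N\<rparr>) \<psi> xs = cval C \<psi> xs)"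

definition param_cfms :: "('f, 'r) lang \<Rightarrow> 'c set \<Rightarrow> nat \<Rightarrow> (('f, 'r) cform \<times> 'c list) set" where
  "param_cfms L A n = {(\<psi>, c). cfm L (n + length c) \<psi> \<and> set c \<subseteq> A}"

text \<open>A complete \<open>n\<close>-type over \<open>A\<close> assigns a value to every continuous formula with parameters
  in \<open>A\<close> so that finitely many of these values are approximately attained in \<open>C\<close>.  The values of the
  function \<open>p\<close> outside \<open>param_cfms L A n\<close> carry no information.\<close>

definition is_ctype :: "('f, 'r) lang \<Rightarrow> ('c, 'f, 'r) cstruct \<Rightarrow> 'c set \<Rightarrow> nat
    \<Rightarrow> (('f, 'r) cform \<Rightarrow> 'c list \<Rightarrow> real) \<Rightarrow> bool" where
  "is_ctype L C A n p \<longleftrightarrow>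
     (\<forall>F\<subseteq>param_cfms L A n. finite F \<longrightarrow> (\<forall>\<epsilon>>0. \<exists>a\<in>tuples n (cuniv C).
        \<forall>(\<psi>, c)\<in>F. \<bar>cval C \<psi> (a @ c) - p \<psi> c\<bar> \<le> \<epsilon>))"

definition crealizes :: "('f, 'r) lang \<Rightarrow> ('c, 'f, 'r) cstruct \<Rightarrow> 'c set \<Rightarrow> nat
    \<Rightarrow> (('f, 'r) cform \<Rightarrow> 'c list \<Rightarrow> real) \<Rightarrow> 'c list \<Rightarrow> bool" where
  "crealizes L C A n p a \<longleftrightarrow> a \<in> tuples n (cuniv C) \<and>
     (\<forall>(\<psi>, c)\<in>param_cfms L A n. cval C \<psi> (a @ c) = p \<psi> c)"

definition cautomorphism :: "('f, 'r) lang \<Rightarrow> ('c, 'f, 'r) cstruct \<Rightarrow> ('c \<Rightarrow> 'c) \<Rightarrow> bool" where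
  "cautomorphism L C g \<longleftrightarrow> bij_betw g (cuniv C) (cuniv C) \<and>
     (\<forall>x\<in>cuniv C. \<forall>y\<in>cuniv C. cdist C (g x) (g y) = cdist C x y) \<and>
     (\<forall>\<phi> n. fm L n \<phi> \<longrightarrow> (\<forall>xs\<in>tuples n (cuniv C). cprob C \<phi> (map g xs) = cprob C \<phi> xs))"

definition cpartial_elementary ::
    "('f, 'r) lang \<Rightarrow> ('c, 'f, 'r) cstruct \<Rightarrow> 'c set \<Rightarrow> ('c \<Rightarrow> 'c) \<Rightarrow> bool" where
  "cpartial_elementary L C A h \<longleftrightarrow> h ` A \<subseteq> cuniv C \<and>
     (\<forall>\<psi> xs. cfm L (length xs) \<psi> \<and> set xs \<subseteq> A \<longrightarrow> cval C \<psi> (map h xs) = cval C \<psi> xs)"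

definition cmonster :: "('f, 'r) lang \<Rightarrow> 'k rel \<Rightarrow> ('c, 'f, 'r) cstruct \<Rightarrow> bool" where
  "cmonster L \<kappa> C \<longleftrightarrow> is_cstruct L C \<and> uncountable_card \<kappa> \<and>
     (\<forall>A n p. A \<subseteq> cuniv C \<and> small \<kappa> A \<and> is_ctype L C A n p \<longrightarrow> (\<exists>a. crealizes L C A n p a)) \<and>
     (\<forall>A h. A \<subseteq> cuniv C \<and> small \<kappa> A \<and> cpartial_elementary L C A h \<longrightarrow>
        (\<exists>g. cautomorphism L C g \<and> (\<forall>x\<in>A. g x = h x)))"

definition cinvariant :: "('f, 'r) lang \<Rightarrow> ('c, 'f, 'r) cstruct \<Rightarrow> 'c set \<Rightarrow> nat
    \<Rightarrow> (('f, 'r) cform \<Rightarrow> 'c list \<Rightarrow> real) \<Rightarrow> bool" where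
  "cinvariant L C N n p \<longleftrightarrow>
     (\<forall>\<psi> k. \<forall>b\<in>tuples k (cuniv C). \<forall>b'\<in>tuples k (cuniv C).
        cfm L (n + k) \<psi> \<and>
        (\<forall>(\<theta>, c)\<in>param_cfms L N k. cval C \<theta> (b @ c) = cval C \<theta> (b' @ c)) \<longrightarrow> p \<psi> b = p \<psi> b')"

definition morley_sequence :: "('f, 'r) lang \<Rightarrow> ('c, 'f, 'r) cstruct \<Rightarrow> 'c set \<Rightarrow> nat
    \<Rightarrow> (('f, 'r) cform \<Rightarrow> 'c list \<Rightarrow> real) \<Rightarrow> (nat \<Rightarrow> 'c list) \<Rightarrow> bool" where
  "morley_sequence L C N n p a \<longleftrightarrow> (\<forall>i. crealizes L C (N \<union> (\<Union>j<i. set (a j))) n p (a i))"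

definition generically_stable :: "('f, 'r) lang \<Rightarrow> ('c, 'f, 'r) cstruct \<Rightarrow> 'c set \<Rightarrow> nat
    \<Rightarrow> (('f, 'r) cform \<Rightarrow> 'c list \<Rightarrow> real) \<Rightarrow> bool" where
  "generically_stable L C N n p \<longleftrightarrow> cinvariant L C N n p \<and>
     \<not> (\<exists>\<psi> k a b r s. cfm L (n + k) \<psi> \<and> morley_sequence L C N n p a \<and>
          (\<forall>j. b j \<in> tuples k (cuniv C)) \<and> r < s \<and>
          (\<forall>i j. i \<le> j \<longrightarrow> cval C \<psi> (a i @ b j) \<le> r) \<and>
          (\<forall>i j. i > j \<longrightarrow> cval C \<psi> (a i @ b j) \<ge> s))"


section \<open>Randomizations\<close>

definition atomless_prob_space :: "'w measure \<Rightarrow> bool" where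
  "atomless_prob_space \<Omega> \<longleftrightarrow> prob_space \<Omega> \<and>
     (\<forall>A\<in>sets \<Omega>. measure \<Omega> A > 0 \<longrightarrow>
        (\<exists>B\<in>sets \<Omega>. B \<subseteq> A \<and> 0 < measure \<Omega> B \<and> measure \<Omega> B < measure \<Omega> A))"

text \<open>\<open>simple_rvs \<Omega> M\<close> is $M_0^\Omega$.\<close>

definition simple_rvs :: "'w measure \<Rightarrow> 'a set \<Rightarrow> ('w \<Rightarrow> 'a) set" where
  "simple_rvs \<Omega> M = {f. simple_function \<Omega> f \<and> f ` space \<Omega> \<subseteq> M}"

abbreviation at_point :: "('w \<Rightarrow> 'a) list \<Rightarrow> 'w \<Rightarrow> 'a list" where
  "at_point fs \<omega> \<equiv> map (\<lambda>f. f \<omega>) fs"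

definition prob_of :: "('a, 'f, 'r) struct \<Rightarrow> 'w measure \<Rightarrow> ('f, 'r) form \<Rightarrow> ('w \<Rightarrow> 'a) list \<Rightarrow> real" where
  "prob_of U \<Omega> \<phi> fs = measure \<Omega> {\<omega> \<in> space \<Omega>. holds U \<phi> (at_point fs \<omega>)}"

text \<open>\<open>randomize\<close> is $M^\Omega$ for \<open>M \<subseteq> U\<close> as a subset of \<open>C\<close>: as \<open>C\<close> is complete, the
  completion of $M_0^\Omega$ is the closure of its image under the embedding \<open>\<iota>\<close>.\<close>

definition randomize :: "('c, 'f, 'r) cstruct \<Rightarrow> (('w \<Rightarrow> 'a) \<Rightarrow> 'c) \<Rightarrow> 'w measure \<Rightarrow> 'a set \<Rightarrow> 'c set" where
  "randomize C \<iota> \<Omega> M =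
     (Metric_space.mtopology (cuniv C) (cdist C)) closure_of (\<iota> ` simple_rvs \<Omega> M)"

text \<open>\<open>C\<close> is a monster model of the randomized theory in which $M^\Omega$ is small, and \<open>\<iota>\<close> identifies
  $U_0^\Omega$ with a subset of \<open>C\<close> in such a way that $U^\Omega \preceq C$.\<close>

definition random_monster :: "('f, 'r) lang \<Rightarrow> ('a, 'f, 'r) struct \<Rightarrow> 'a set \<Rightarrow> 'w measure
    \<Rightarrow> 'k rel \<Rightarrow> ('c, 'f, 'r) cstruct \<Rightarrow> (('w \<Rightarrow> 'a) \<Rightarrow> 'c) \<Rightarrow> bool" where
  "random_monster L U M \<Omega> \<kappa> C \<iota> \<longleftrightarrow> cmonster L \<kappa> C \<and>
     \<iota> ` simple_rvs \<Omega> (univ U) \<subseteq> cuniv C \<and>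
     (\<forall>f\<in>simple_rvs \<Omega> (univ U). \<forall>g\<in>simple_rvs \<Omega> (univ U).
        cdist C (\<iota> f) (\<iota> g) = measure \<Omega> {\<omega> \<in> space \<Omega>. f \<omega> \<noteq> g \<omega>}) \<and>
     (\<forall>\<phi> n. fm L n \<phi> \<longrightarrow> (\<forall>fs\<in>tuples n (simple_rvs \<Omega> (univ U)).
        cprob C \<phi> (map \<iota> fs) = prob_of U \<Omega> \<phi> fs)) \<and>
     celem_sub L C (randomize C \<iota> \<Omega> (univ U)) \<and>
     small \<kappa> (randomize C \<iota> \<Omega> M)"

text \<open>$\sum_i \mathcal{P}(A_i)\, \mu(\varphi(x; a_i))$ for $g = \sum_i a_i^{A_i}$ (a tuple of simple random
  variables, its distinct values being the \<open>a_i\<close>).\<close>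

definition r_simple :: "('a, 'f, 'r) struct \<Rightarrow> 'w measure \<Rightarrow> nat \<Rightarrow> ('a list set \<Rightarrow> real)
    \<Rightarrow> ('f, 'r) form \<Rightarrow> ('w \<Rightarrow> 'a) list \<Rightarrow> real" where
  "r_simple U \<Omega> m \<mu> \<phi> gs =
     (\<Sum>a\<in>at_point gs ` space \<Omega>.
        measure \<Omega> {\<omega> \<in> space \<Omega>. at_point gs \<omega> = a} * \<mu> (defset U m \<phi> a))"

text \<open>The value that the type \<open>p\<close> in \<open>m\<close> variables assigns to $\mathbb{P}[\![\varphi(x; g)]\!]$.\<close>

definition type_prob :: "nat \<Rightarrow> (('f, 'r) cform \<Rightarrow> 'c list \<Rightarrow> real) \<Rightarrow> ('f, 'r) form \<Rightarrow> 'c list \<Rightarrow> real" where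
  "type_prob m p \<phi> g = p (CProb \<phi> [0..<m + length g]) g"

text \<open>Convergence of $\mathrm{tp}(g_j/M_0^\Omega)$ to $\mathrm{tp}(h/M_0^\Omega)$ in the logic topology.  Here and in
  the next definition a net $(g_j)$ in $M_0^\Omega$ is represented by its filter of tails.\<close>

definition types_tendsto :: "('f, 'r) lang \<Rightarrow> 'a set \<Rightarrow> 'w measure \<Rightarrow> ('c, 'f, 'r) cstruct
    \<Rightarrow> (('w \<Rightarrow> 'a) \<Rightarrow> 'c) \<Rightarrow> 'c list \<Rightarrow> ('w \<Rightarrow> 'a) list filter \<Rightarrow> bool" where
  "types_tendsto L M \<Omega> C \<iota> h F \<longleftrightarrow>
     (\<forall>(\<psi>, c)\<in>param_cfms L (\<iota> ` simple_rvs \<Omega> M) (length h).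
        ((\<lambda>g. cval C \<psi> (map \<iota> g @ c)) \<longlongrightarrow> cval C \<psi> (h @ c)) F)"

text \<open>\<open>p\<close> is the global random type $r_\mu \in S_x(C)$, \<open>|x| = m\<close>.\<close>

definition is_r :: "('f, 'r) lang \<Rightarrow> ('a, 'f, 'r) struct \<Rightarrow> 'a set \<Rightarrow> nat \<Rightarrow> ('a list set \<Rightarrow> real)
    \<Rightarrow> 'w measure \<Rightarrow> ('c, 'f, 'r) cstruct \<Rightarrow> (('w \<Rightarrow> 'a) \<Rightarrow> 'c)
    \<Rightarrow> (('f, 'r) cform \<Rightarrow> 'c list \<Rightarrow> real) \<Rightarrow> bool" where
  "is_r L U M m \<mu> \<Omega> C \<iota> p \<longleftrightarrow> is_ctype L C (cuniv C) m p \<and>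
     (\<forall>\<phi> k. fm L (m + k) \<phi> \<longrightarrow>
        (\<forall>g\<in>tuples k (simple_rvs \<Omega> M). type_prob m p \<phi> (map \<iota> g) = r_simple U \<Omega> m \<mu> \<phi> g) \<and>
        (\<forall>h\<in>tuples k (cuniv C). \<forall>F. F \<noteq> bot \<and>
           eventually (\<lambda>g. g \<in> tuples k (simple_rvs \<Omega> M)) F \<and> types_tendsto L M \<Omega> C \<iota> h F \<longrightarrow>
           (r_simple U \<Omega> m \<mu> \<phi> \<longlongrightarrow> type_prob m p \<phi> h) F))"

definition irgs :: "('f, 'r) lang \<Rightarrow> ('a, 'f, 'r) struct \<Rightarrow> 'a set \<Rightarrow> nat \<Rightarrow> ('a list set \<Rightarrow> real)
    \<Rightarrow> 'w measure \<Rightarrow> ('c, 'f, 'r) cstruct \<Rightarrow> (('w \<Rightarrow> 'a) \<Rightarrow> 'c) \<Rightarrow> bool" where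
  "irgs L U M m \<mu> \<Omega> C \<iota> \<longleftrightarrow> definable_measure L U M m \<mu> \<and>
     (\<exists>p. is_r L U M m \<mu> \<Omega> C \<iota> p \<and> generically_stable L C (randomize C \<iota> \<Omega> M) m p)"

end

theory Submission
 imports Defs
begin

text \<open>
The theorem compares two orders of integration.  For a definable set \<open>D\<close> in the variables \<open>(x, y)\<close>
put \<open>F(b) = \<mu>{a. (a, b) \<in> D}\<close> and \<open>f(a) = \<nu>{b. (a, b) \<in> D}\<close>.  As \<open>\<mu>\<close> is definable, \<open>F\<close> is a uniform
limit of step functions and \<open>\<mu> \<otimes> \<nu>\<close> is simply the integral of \<open>F\<close> (\<open>morley_lint\<close>).  Nothing of the
kind is known about \<open>f\<close>, so it only has a lower integral, the supremum \<open>lint\<close> of the integrals of the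
definable step functions below it.

The heart of the proof is the inequality \<open>iterated_integrals_le\<close>: the integral of \<open>F\<close> is at most the
lower integral of \<open>f\<close>, for every Keisler measure \<open>\<nu>\<close> whatsoever.  Suppose that it fails, with \<open>B < I\<close> for
the two sides.  In the monster model of the randomization one builds a Morley sequence \<open>a_0, a_1, \<dots>\<close>
of the random type of \<open>\<mu>\<close> together with tuples \<open>g_0, g_1, \<dots>\<close> such that the probability of
\<open>(a_i, g_j) \<in> D\<close> is about \<open>B\<close> or less for \<open>i \<le> j\<close> and about \<open>I\<close> or more for \<open>i > j\<close>.  This contradicts
generic stability.  The tuple \<open>g_j\<close> is a random element whose conditional law, given the values of
\<open>a_0, \<dots>, a_j\<close>, looks like \<open>\<nu>\<close>: then the probability of \<open>(a_i, g_j) \<in> D\<close> is the mean of \<open>f\<close> at \<open>a_i\<close>,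
while for later \<open>a_i\<close> the type of \<open>\<mu>\<close> computes the integral of \<open>F\<close> against the law of \<open>g_j\<close>, that is,
against \<open>\<nu>\<close> (\<open>type_prob_approx\<close>).

The difficulty is that the \<open>a_i\<close> are no random variables and \<open>f\<close> is no continuous function of them, so
\<open>mean of f at a_i\<close> has no meaning.  It is replaced by a finitely supported law on tuples of the
classical model that agrees with \<open>a_0, \<dots>, a_j\<close> on finitely many formulas and for which the mean of
\<open>f\<close> in each coordinate is at most \<open>B\<close>, up to a small error (\<open>law_of_morley_list\<close>, which rests on the
finite representation of finitely additive probabilities in \<open>sampling\<close>).  The existence of a good
\<open>g_j\<close> is expressed by a continuous formula.  Its truth is verified for simple random variables with
this law (\<open>witness_exists\<close>) and carried back to the \<open>a_i\<close> by approximate quantifier elimination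
(\<open>simple_QE\<close>) and elementarity.  Atomlessness provides the random variables
(\<open>kernel_realization\<close>, \<open>pattern_coupling\<close>).

Applied to \<open>D\<close> and to its complement, the inequality shows that \<open>f\<close> has equal lower and upper
integrals; if \<open>\<nu>\<close> is finitely satisfiable in \<open>M\<close>, then \<open>f\<close> is a function on types over small models, and
it follows that \<open>\<nu> \<otimes> \<mu>\<close> is well-defined and that the two products agree
(\<open>commuting_products\<close>).  The passage from step functions with arbitrary parameters to functions on the
type space over a small model uses compactness and saturation (\<open>invariant_integral\<close>).

With \<open>\<nu> = \<mu>\<close> the inequality says that the two iterated integrals of \<open>\<mu>\<close> agree, hence that \<open>\<mu>\<^sub>x \<otimes> \<mu>\<^sub>y\<close> is
symmetric.  Since products with definable measures can be integrated iteratively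
(\<open>iterate_integrals\<close>), the first two variables of each power of \<open>\<mu>\<close> may be exchanged; this and the
permutations of the remaining variables generate all permutations.
\<close>

section \<open>Definable sets\<close>

lemma tval_cong: "(!!i. i \<in> tvars t ==> e i = e' i) ==> tval U e t = tval U e' t"
proof (induction t)
 case (App f ts)
 then have "map (tval U e) ts = map (tval U e') ts" by (auto intro!: map_cong)
 then show ?case by (metis tval.simps(2))
qed simp

lemma sat_cong: "(!!i. i \<in> fvars \<phi> ==> e i = e' i) ==> sat U \<phi> e = sat U \<phi> e'"
proof (induction \<phi> arbitrary: e e')
 case (Eq s t)
 then show ?case using tval_cong[of s e e' U] tval_cong[of t e e' U] by simp
next
 case (Rel r ts)
 have "map (tval U e) ts = map (tval U e') ts"
  by (rule map_cong[OF refl], rule tval_cong, use Rel in auto)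
 then show ?case by (metis sat.simps(2))
next
 case (Neg \<phi>)
 then show ?case by (metis fvars.simps(3) sat.simps(3))
next
 case (Conj \<phi> \<psi>)
 then show ?case by (metis Un_iff fvars.simps(4) sat.simps(4))
next
 case (Ex i \<phi>)
 have "sat U \<phi> (e(i := x)) = sat U \<phi> (e'(i := x))" for x
  by (rule Ex.IH) (use Ex.prems in auto)
 then show ?case by simp
qed

lemma finite_tvars: "finite (tvars t)"
 by (induction t) auto

lemma finite_fvars: "finite (fvars \<phi>)"
 by (induction \<phi>) (auto simp: finite_tvars)

primrec rename_trm :: "(nat => nat) => 'f trm => 'f trm" where
 "rename_trm \<pi> (Var i) = Var (\<pi> i)"
| "rename_trm \<pi> (App f ts) = App f (map (rename_trm \<pi>) ts)"

lemma tvars_rename: "tvars (rename_trm \<pi> t) = \<pi> ` tvars t"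
 by (induction t) auto

lemma wf_rename: "wf_trm L (rename_trm \<pi> t) = wf_trm L t"
 by (induction t) (auto simp: list_all_iff)

lemma tval_rename: "tval U e (rename_trm \<pi> t) = tval U (\<lambda>i. e (\<pi> i)) t"
proof (induction t)
 case (App f ts)
 then have "map (tval U e \<circ> rename_trm \<pi>) ts = map (tval U (\<lambda>i. e (\<pi> i))) ts" by auto
 then show ?case by (metis map_map rename_trm.simps(2) tval.simps(2))
qed simp

text \<open>Free variables may be substituted by arbitrary, not necessarily distinct, variables: bound
 variables are renamed to fresh ones on the way.  This one fact is behind all closure properties of
 definable sets under permuting, identifying, adding and specializing variables.\<close>

lemma form_subst:
 fixes U :: "('a, 'f, 'r) struct"
 shows "\<exists>\<phi>'. (wf_form L \<phi> --> wf_form L \<phi>') \<and> fvars \<phi>' \<subseteq> \<pi> ` fvars \<phi> \<and>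
  (\<forall>e. sat U \<phi>' e = sat U \<phi> (\<lambda>i. e (\<pi> i)))"
proof (induction \<phi> arbitrary: \<pi>)
 case (Eq s t)
 show ?case
  by (rule exI[of _ "Eq (rename_trm \<pi> s) (rename_trm \<pi> t)"])
   (auto simp: wf_rename tvars_rename tval_rename)
next
 case (Rel r ts)
 have "map (tval U e) (map (rename_trm \<pi>) ts) = map (tval U (\<lambda>i. e (\<pi> i))) ts" for e
  by (simp add: tval_rename)
 then show ?case
  by (intro exI[of _ "Rel r (map (rename_trm \<pi>) ts)"])
   (auto simp: wf_rename tvars_rename list_all_iff simp del: map_map)
next
 case (Neg \<phi>)
 then obtain \<phi>' where "(wf_form L \<phi> --> wf_form L \<phi>') \<and> fvars \<phi>' \<subseteq> \<pi> ` fvars \<phi> \<and>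
  (\<forall>e. sat U \<phi>' e = sat U \<phi> (\<lambda>i. e (\<pi> i)))" by blast
 then show ?case by (intro exI[of _ "Neg \<phi>'"]) auto
next
 case (Conj \<phi> \<psi>)
 obtain \<phi>' where "(wf_form L \<phi> --> wf_form L \<phi>') \<and> fvars \<phi>' \<subseteq> \<pi> ` fvars \<phi> \<and>
  (\<forall>e. sat U \<phi>' e = sat U \<phi> (\<lambda>i. e (\<pi> i)))" using Conj by blast
 moreover obtain \<psi>' where "(wf_form L \<psi> --> wf_form L \<psi>') \<and> fvars \<psi>' \<subseteq> \<pi> ` fvars \<psi> \<and>
  (\<forall>e. sat U \<psi>' e = sat U \<psi> (\<lambda>i. e (\<pi> i)))" using Conj by blast
 ultimately show ?case by (intro exI[of _ "Conj \<phi>' \<psi>'"]) auto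
next
 case (Ex i \<phi>)
 obtain j where j: "j \<notin> \<pi> ` fvars \<phi>"
  using ex_new_if_finite[of "\<pi> ` fvars \<phi>"] finite_fvars by auto
 obtain \<phi>' where \<phi>': "wf_form L \<phi> --> wf_form L \<phi>'" "fvars \<phi>' \<subseteq> (\<pi>(i := j)) ` fvars \<phi>"
  "!!e. sat U \<phi>' e = sat U \<phi> (\<lambda>k. e ((\<pi>(i := j)) k))" using Ex by blast
 have "sat U \<phi> (\<lambda>k. (e(j := x)) ((\<pi>(i := j)) k)) = sat U \<phi> ((\<lambda>i. e (\<pi> i))(i := x))" for e x
  by (rule sat_cong) (use j in auto)
 then show ?case using \<phi>' by (intro exI[of _ "Ex j \<phi>'"]) (auto split: if_splits)
qed

lemma fm_subst:
 assumes "fm L n \<phi>" "length vs = n" "set vs \<subseteq> {..<n'}"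
 shows "\<exists>\<phi>'. fm L n' \<phi>' \<and> (\<forall>e. sat U \<phi>' e = holds U \<phi> (map e vs))"
proof -
 obtain \<phi>' where \<phi>': "wf_form L \<phi>'" "fvars \<phi>' \<subseteq> (nth vs) ` fvars \<phi>"
  "!!e. sat U \<phi>' e = sat U \<phi> (\<lambda>i. e (vs ! i))"
  using form_subst[of L \<phi> "nth vs" U] assms by (auto simp: fm_def)
 have "sat U \<phi> (\<lambda>i. e (vs ! i)) = holds U \<phi> (map e vs)" for e
  by (rule sat_cong) (use assms in \<open>auto simp: fm_def\<close>)
 moreover have "(nth vs) ` fvars \<phi> \<subseteq> {..<n'}"
  using assms by (force simp: fm_def)
 ultimately show ?thesis using \<phi>' by (intro exI[of _ \<phi>']) (simp add: fm_def)
qed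

lemma holds_append: "fm L (length xs) \<phi> ==> holds U \<phi> (xs @ ys) = holds U \<phi> xs"
 by (rule sat_cong) (auto simp: fm_def nth_append)

lemma fm_mono: "fm L n \<phi> ==> n \<le> n' ==> fm L n' \<phi>"
 by (auto simp: fm_def)

lemma fm_Neg: "fm L n (Neg \<phi>) = fm L n \<phi>"
 by (auto simp: fm_def)

lemma fm_Conj: "fm L n (Conj \<phi> \<psi>) \<longleftrightarrow> fm L n \<phi> \<and> fm L n \<psi>"
 by (auto simp: fm_def)

definition Truth :: "('f, 'r) form" where
 "Truth = Ex 0 (Eq (Var 0) (Var 0))"

lemma fm_Truth: "fm L n Truth"
 by (auto simp: fm_def Truth_def)

lemma sat_Truth: "univ U \<noteq> {} ==> sat U Truth e"
 by (auto simp: Truth_def)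

definition Conjs :: "('f, 'r) form list => ('f, 'r) form" where
 "Conjs \<phi>s = foldr Conj \<phi>s Truth"

lemma fm_Conjs: "fm L n (Conjs \<phi>s) \<longleftrightarrow> (\<forall>\<phi>\<in>set \<phi>s. fm L n \<phi>)"
 by (induction \<phi>s) (auto simp: Conjs_def fm_Truth fm_Conj)

lemma sat_Conjs: "univ U \<noteq> {} ==> sat U (Conjs \<phi>s) e \<longleftrightarrow> (\<forall>\<phi>\<in>set \<phi>s. sat U \<phi> e)"
 by (induction \<phi>s) (auto simp: Conjs_def sat_Truth)

lemma tuples_append: "xs \<in> tuples m S ==> ys \<in> tuples n S ==> xs @ ys \<in> tuples (m + n) S"
 by (auto simp: tuples_def)

lemma tuplesD: "xs \<in> tuples n S ==> length xs = n" "xs \<in> tuples n S ==> set xs \<subseteq> S"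
 by (auto simp: tuples_def)

lemma tuples_splitE:
 assumes "xs \<in> tuples (m + n) S"
 obtains ys zs where "xs = ys @ zs" "ys \<in> tuples m S" "zs \<in> tuples n S"
 using assms
 by (intro that[of "take m xs" "drop m xs"])
  (auto simp: tuples_def dest: in_set_takeD in_set_dropD)

lemma tuples_mono: "A \<subseteq> B ==> tuples n A \<subseteq> tuples n B"
 by (auto simp: tuples_def)

lemma definableI: "fm L (n + length c) \<phi> ==> set c \<subseteq> A ==> defset U n \<phi> c \<in> definable L U A n"
 by (auto simp: definable_def param_fms_def)

lemma definableE:
 assumes "D \<in> definable L U A n"
 obtains \<phi> c where "fm L (n + length c) \<phi>" "set c \<subseteq> A" "D = defset U n \<phi> c"
 using assms by (auto simp: definable_def param_fms_def)

lemma definable_mono: "A \<subseteq> B ==> definable L U A n \<subseteq> definable L U B n"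
 by (auto simp: definable_def param_fms_def)

lemma definable_tuples: "D \<in> definable L U A n ==> D \<subseteq> tuples n (univ U)"
 by (auto simp: definable_def defset_def)

text \<open>Preimages of definable sets under coordinate maps, with parameters from \<open>b\<close>.\<close>

lemma definable_preimage:
 assumes "D \<in> definable L U A n" "length vs = n" "set vs \<subseteq> {..<n' + length b}" "set b \<subseteq> univ U"
 shows "{xs \<in> tuples n' (univ U). map (nth (xs @ b)) vs \<in> D} \<in> definable L U (A \<union> set b) n'"
proof -
 obtain \<phi> c where \<phi>: "fm L (n + length c) \<phi>" "set c \<subseteq> A" "D = defset U n \<phi> c"
  using assms(1) by (rule definableE)
 let ?ws = "vs @ [n' + length b..<n' + length b + length c]"
 have "length ?ws = n + length c" "set ?ws \<subseteq> {..<n' + length (b @ c)}"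
  using assms by auto
 from fm_subst[OF \<phi>(1) this] obtain \<phi>' where \<phi>': "fm L (n' + length (b @ c)) \<phi>'"
  "!!e. sat U \<phi>' e = holds U \<phi> (map e ?ws)" by blast
 have "holds U \<phi>' (xs @ b @ c) = holds U \<phi> (map (nth (xs @ b)) vs @ c)"
  if "length xs = n'" for xs
 proof -
  have e1: "map (nth (xs @ b @ c)) vs = map (nth (xs @ b)) vs"
   using assms that by (auto simp: nth_append less_diff_conv2)
  have e2: "map (nth (xs @ b @ c)) [n' + length b..<n' + length b + length c] = c"
   using that by (auto intro!: nth_equalityI simp: nth_append)
  show ?thesis unfolding \<phi>'(2) map_append e1 e2 ..
 qed
 moreover have "map (nth (xs @ b)) vs \<in> tuples n (univ U)" if "xs \<in> tuples n' (univ U)" for xs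
 proof -
  have "(xs @ b) ! v \<in> univ U" if "v \<in> set vs" for v
   using assms(3,4) \<open>xs \<in> _\<close> that nth_mem[of v "xs @ b"] by (auto simp: tuples_def)
  then show ?thesis using assms(2) by (auto simp: tuples_def)
 qed
 ultimately have "{xs \<in> tuples n' (univ U). map (nth (xs @ b)) vs \<in> D} = defset U n' \<phi>' (b @ c)"
  unfolding \<phi>(3) defset_def by (auto simp: tuplesD)
 then show ?thesis using definableI[OF \<phi>'(1), of "A \<union> set b" U] \<phi>(2) by auto
qed

text \<open>Finitely many sets definable over \<open>A\<close> can be defined with the same parameters.\<close>

lemma common_parameters:
 assumes "finite \<D>" "\<D> \<subseteq> definable L U A n"
 shows "\<exists>c. set c \<subseteq> A \<and> (\<forall>D\<in>\<D>. \<exists>\<phi>. fm L (n + length c) \<phi> \<and> D = defset U n \<phi> c)"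
 using assms
proof (induction \<D> rule: finite_induct)
 case empty
 show ?case by (rule exI[of _ "[]"]) auto
next
 case (insert D \<D>)
 then obtain c where c: "set c \<subseteq> A" "!!D. D \<in> \<D> ==> \<exists>\<phi>. fm L (n + length c) \<phi> \<and> D = defset U n \<phi> c"
  by auto
 obtain \<phi> d where \<phi>: "fm L (n + length d) \<phi>" "set d \<subseteq> A" "D = defset U n \<phi> d"
  using insert.prems by (auto elim: definableE)
 have "\<exists>\<phi>. fm L (n + length (c @ d)) \<phi> \<and> E = defset U n \<phi> (c @ d)" if "E \<in> insert D \<D>" for E
 proof (cases "E = D")
  case True
  let ?vs = "[0..<n] @ [n + length c..<n + length c + length d]"
  have "length ?vs = n + length d" "set ?vs \<subseteq> {..<n + length (c @ d)}" by auto
  from fm_subst[OF \<phi>(1) this] obtain \<phi>' where \<phi>': "fm L (n + length (c @ d)) \<phi>'"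
   "!!e. sat U \<phi>' e = holds U \<phi> (map e ?vs)" by blast
  have "map (nth (xs @ c @ d)) ?vs = xs @ d" if "length xs = n" for xs
   using that by (auto intro!: nth_equalityI simp: nth_append)
  then have "D = defset U n \<phi>' (c @ d)"
   unfolding \<phi>(3) defset_def \<phi>'(2) by (auto simp del: map_append dest: tuplesD)
  then show ?thesis using \<phi>' True by auto
 next
  case False
  with that c obtain \<psi> where \<psi>: "fm L (n + length c) \<psi>" "E = defset U n \<psi> c" by auto
  have "holds U \<psi> (xs @ c @ d) = holds U \<psi> (xs @ c)" if "length xs = n" for xs
   using holds_append[of L "xs @ c" \<psi> U d] \<psi> that by simp
  then have "E = defset U n \<psi> (c @ d)"
   unfolding \<psi>(2) defset_def by (auto dest: tuplesD)
  then show ?thesis using fm_mono[OF \<psi>(1), of "n + length (c @ d)"] by auto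
 qed
 then show ?case using c(1) \<phi>(2) by (intro exI[of _ "c @ d"]) auto
qed

lemma definable_common:
 assumes "finite \<D>" "\<D> \<subseteq> definable L U A n"
 shows "\<exists>c \<theta>. set c \<subseteq> A \<and>
  (\<forall>D\<in>\<D>. fm L (n + length c) (\<theta> D) \<and> D = defset U n (\<theta> D) c)"
 using common_parameters[OF assms] by metis

lemma definable_algebra:
 assumes "univ U \<noteq> {}" "A \<subseteq> univ U"
 shows "algebra (tuples n (univ U)) (definable L U A n)"
proof -
 have compl: "tuples n (univ U) - D \<in> definable L U A n" if D: "D \<in> definable L U A n" for D
 proof -
  obtain \<phi> c where \<phi>: "fm L (n + length c) \<phi>" "set c \<subseteq> A" "D = defset U n \<phi> c"
   using D by (rule definableE)
  then have "tuples n (univ U) - D = defset U n (Neg \<phi>) c" by (auto simp: defset_def)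
  then show ?thesis using \<phi> definableI[of L n c "Neg \<phi>" A U] by (simp add: fm_Neg)
 qed
 have inter: "D \<inter> E \<in> definable L U A n" if "D \<in> definable L U A n" "E \<in> definable L U A n" for D E
 proof -
  have "finite {D, E}" "{D, E} \<subseteq> definable L U A n" using that by auto
  from common_parameters[OF this] obtain c \<phi> \<psi> where c: "set c \<subseteq> A"
   and \<phi>: "fm L (n + length c) \<phi>" "D = defset U n \<phi> c"
   and \<psi>: "fm L (n + length c) \<psi>" "E = defset U n \<psi> c"
   by (metis insertCI)
  have "D \<inter> E = defset U n \<phi> c \<inter> defset U n \<psi> c" using \<phi>(2) \<psi>(2) by (rule arg_cong2)
  also have "\<dots> = defset U n (Conj \<phi> \<psi>) c" by (auto simp: defset_def)
  finally show ?thesis using c \<phi>(1) \<psi>(1) definableI[of L n c "Conj \<phi> \<psi>" A U] by (simp add: fm_Conj)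
 qed
 have empty: "{} \<in> definable L U A n"
  using definableI[of L n "[]" "Neg Truth" A U] assms(1) sat_Truth[of U]
  by (auto simp: fm_Neg fm_Truth defset_def)
 have "D \<union> E \<in> definable L U A n" if "D \<in> definable L U A n" "E \<in> definable L U A n" for D E
 proof -
  have "D \<union> E = tuples n (univ U) - ((tuples n (univ U) - D) \<inter> (tuples n (univ U) - E))"
   using that by (auto dest: definable_tuples)
  then show ?thesis using that compl inter by metis
 qed
 then show ?thesis
  unfolding algebra_iff_Un using empty compl by (auto dest: definable_tuples)
qed


section \<open>Small elementary submodels\<close>

lemma uncountable_card_infinite: "uncountable_card \<kappa> ==> \<not> finite (Field \<kappa>)"
 unfolding uncountable_card_def
 using card_of_mono2[of natLeq \<kappa>] card_of_ordLeq_infinite[of "UNIV :: nat set" "Field \<kappa>"]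
 by (auto simp: Field_natLeq dest: ordLess_imp_ordLeq)

lemma small_countable: "uncountable_card \<kappa> ==> countable B ==> small \<kappa> B"
 unfolding small_def uncountable_card_def countable_def
 using card_of_ordLeq[of B "UNIV :: nat set"] card_of_nat
 by (meson ordIso_ordLess_trans ordLeq_ordLess_trans subset_UNIV)

lemma small_Plus: "uncountable_card \<kappa> ==> small \<kappa> A ==> small \<kappa> B ==> small \<kappa> (A <+> B)"
 using uncountable_card_infinite[of \<kappa>] unfolding small_def uncountable_card_def
 by (simp add: card_of_Plus_ordLess_infinite_Field)

lemma small_Un_countable:
 assumes "uncountable_card \<kappa>" "small \<kappa> A" "countable B"
 shows "small \<kappa> (A \<union> B)"
 using small_Plus[OF assms(1,2) small_countable[OF assms(1,3)]] card_of_Un_Plus_ordLeq[of A B]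
 unfolding small_def by (meson ordLeq_ordLess_trans)

instance trm :: (countable) countable
 by countable_datatype

instance form :: (countable, countable) countable
 by countable_datatype

lemma wf_trm_set: "wf_trm L t ==> set_trm t \<subseteq> fst ` funs L"
proof (induction t)
 case (App f ts)
 then have "set_trm t \<subseteq> fst ` funs L" if "t \<in> set ts" for t
  using that by (simp add: list_all_iff)
 moreover have "f \<in> fst ` funs L" using App.prems image_eqI[of f fst "(f, length ts)"] by simp
 ultimately show ?case by auto
qed simp

lemma wf_form_set:
 "wf_form L \<phi> ==> set1_form \<phi> \<subseteq> fst ` funs L \<and> set2_form \<phi> \<subseteq> fst ` rels L"
proof (induction \<phi>)
 case (Rel r ts)
 have "set_trm t \<subseteq> fst ` funs L" if "t \<in> set ts" for t
  using Rel that by (simp add: list_all_iff wf_trm_set)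
 moreover have "r \<in> fst ` rels L" using Rel image_eqI[of r fst "(r, length ts)"] by simp
 ultimately show ?case by auto
qed (simp_all add: wf_trm_set)

lemma countable_wf_form:
 fixes L :: "('f, 'r) lang"
 assumes "countable_lang L"
 shows "countable {\<phi>. wf_form L \<phi>}"
proof -
 let ?F = "fst ` funs L" and ?R = "fst ` rels L"
 have c: "countable ?F" "countable ?R" using assms by (auto simp: countable_lang_def)
 have "inj_on (map_form (to_nat_on ?F) (to_nat_on ?R)) {\<phi>. wf_form L \<phi>}"
 proof (rule inj_onI, clarify)
  fix \<phi> \<psi> assume wf: "wf_form L \<phi>" "wf_form L \<psi>"
   and eq: "map_form (to_nat_on ?F) (to_nat_on ?R) \<phi> = map_form (to_nat_on ?F) (to_nat_on ?R) \<psi>"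
  show "\<phi> = \<psi>"
  proof (rule form.inj_map_strong[OF _ _ eq])
   fix x y assume "x \<in> set1_form \<phi>" "y \<in> set1_form \<psi>" "to_nat_on ?F x = to_nat_on ?F y"
   then show "x = y" using wf_form_set[OF wf(1)] wf_form_set[OF wf(2)] inj_on_to_nat_on[OF c(1)]
    by (meson inj_onD subsetD)
  next
   fix x y assume "x \<in> set2_form \<phi>" "y \<in> set2_form \<psi>" "to_nat_on ?R x = to_nat_on ?R y"
   then show "x = y" using wf_form_set[OF wf(1)] wf_form_set[OF wf(2)] inj_on_to_nat_on[OF c(2)]
    by (meson inj_onD subsetD)
  qed
 qed
 then show ?thesis by (rule countableI')
qed

lemma tval_restrict: "tval (U\<lparr>univ := N\<rparr>) e t = tval U e t"
proof (induction t)
 case (App f ts)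
 then show ?case by (simp cong: map_cong)
qed simp

text \<open>The Tarski-Vaught test.\<close>

lemma tarski_vaught:
 fixes U :: "('a, 'f, 'r) struct"
 assumes U: "is_struct L U" and N: "N \<subseteq> univ U" "N \<noteq> {}"
  and wit: "!!\<phi> i e. wf_form L \<phi> ==> range e \<subseteq> N ==> sat U (Ex i \<phi>) e ==>
   \<exists>x\<in>N. sat U \<phi> (e(i := x))"
 shows "elem_sub L U N"
proof -
 have sat_eq: "sat (U\<lparr>univ := N\<rparr>) \<phi> e = sat U \<phi> e" if "wf_form L \<phi>" "range e \<subseteq> N" for \<phi> e
  using that
 proof (induction \<phi> arbitrary: e)
  case (Ex i \<phi>)
  have "sat (U\<lparr>univ := N\<rparr>) \<phi> (e(i := x)) = sat U \<phi> (e(i := x))" if "x \<in> N" for x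
   by (rule Ex.IH) (use Ex.prems that in auto)
  moreover have "(\<exists>x\<in>N. sat U \<phi> (e(i := x))) = sat U (Ex i \<phi>) e"
   using wit[of \<phi> e i] Ex.prems N(1) by auto
  ultimately show ?case by simp
 qed (simp_all add: tval_restrict cong: map_cong)
 have closed: "fint U f xs \<in> N" if "(f, n) \<in> funs L" "xs \<in> tuples n N" for f n xs
 proof -
  obtain z where z: "z \<in> N" using N(2) by blast
  define e where "e = (\<lambda>i. if i < n then xs ! i else z)"
  have e: "range e \<subseteq> N" using z that(2) nth_mem[of _ xs] by (auto simp: e_def tuples_def)
  let ?\<phi> = "Eq (Var n) (App f (map Var [0..<n]))"
  have wf: "wf_form L ?\<phi>" using that(1) by (auto simp: list_all_iff)
  have val: "sat U ?\<phi> (e(n := x)) \<longleftrightarrow> x = fint U f xs" for x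
  proof -
   have "map (tval U (e(n := x))) (map Var [0..<n]) = xs"
    using that(2) by (intro nth_equalityI) (auto simp: e_def tuples_def)
   then show ?thesis by (simp del: map_map)
  qed
  have "fint U f xs \<in> univ U"
   using U that N(1) tuples_mono[of N "univ U" n] by (auto simp: is_struct_def)
  then have "sat U (Ex n ?\<phi>) e" using val by auto
  from wit[OF wf e this] show ?thesis using val by auto
 qed
 have "holds (U\<lparr>univ := N\<rparr>) \<phi> xs = holds U \<phi> xs" if "fm L (length xs) \<phi>" "set xs \<subseteq> N" for \<phi> xs
 proof -
  obtain z where z: "z \<in> N" using N(2) by blast
  define e where "e = (\<lambda>i. if i < length xs then xs ! i else z)"
  have e: "range e \<subseteq> N" using z that(2) nth_mem[of _ xs] by (auto simp: e_def)
  have "sat V \<phi> e = holds V \<phi> xs" for V :: "('a, 'f, 'r) struct"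
   by (rule sat_cong) (use that in \<open>auto simp: fm_def e_def\<close>)
  then show ?thesis using sat_eq[OF _ e] that(1) by (metis fm_def)
 qed
 moreover have "is_struct L (U\<lparr>univ := N\<rparr>)"
  using closed N(2) by (auto simp: is_struct_def)
 ultimately show ?thesis using N(1) by (auto simp: elem_sub_def)
qed

lemma card_lists_le:
 assumes inf: "\<not> finite B" and S: "(card_of S, card_of B) \<in> ordLeq"
 shows "(card_of (lists S), card_of B) \<in> ordLeq"
proof -
 have nat: "(card_of (UNIV :: nat set), card_of B) \<in> ordLeq"
  using inf infinite_iff_card_of_nat by blast
 have len: "(card_of (tuples n S), card_of B) \<in> ordLeq" for n
 proof (induction n)
  case 0
  have "tuples 0 S = {[]}" by (auto simp: tuples_def)
  then show ?case using inf
   by (metis card_of_ordLeq_infinite finite.emptyI finite.insertI ordLeq_total card_of_Well_order)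
 next
  case (Suc n)
  have "tuples (Suc n) S = (\<lambda>(x, xs). x # xs) ` (S \<times> tuples n S)"
   by (auto simp: tuples_def length_Suc_conv image_iff)
  moreover have "(card_of (S \<times> tuples n S), card_of B) \<in> ordLeq"
   using card_of_Sigma_ordLeq_infinite[OF inf S, of "\<lambda>_. tuples n S"] Suc by blast
  ultimately show ?case using card_of_image ordLeq_transitive by metis
 qed
 have "lists S = (\<Union>n. tuples n S)" by (auto simp: tuples_def)
 then show ?thesis
  using card_of_UNION_ordLeq_infinite[OF inf nat, of "\<lambda>n. tuples n S"] len by simp
qed

text \<open>The downward Loewenheim-Skolem theorem: close under Skolem functions.  Morley products are
 computed over a small model that contains the parameters at hand, so one has to exist.\<close>

lemma exists_small_model:
 fixes U :: "('a, 'f, 'r) struct"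
 assumes L: "countable_lang L" and U: "monster L \<kappa> U"
  and M: "small_model L \<kappa> U M" and c: "set c \<subseteq> univ U"
 shows "\<exists>N. small_model L \<kappa> U N \<and> M \<subseteq> N \<and> set c \<subseteq> N"
proof -
 have struct: "is_struct L U" and \<kappa>: "uncountable_card \<kappa>" using U by (auto simp: monster_def)
 have MU: "M \<subseteq> univ U" "small \<kappa> M" "M \<noteq> {}"
  using M by (auto simp: small_model_def elem_sub_def is_struct_def)
 define wit where "wit = (\<lambda>(\<phi>, i, xs). SOME x. x \<in> univ U \<and> sat U \<phi> ((nth xs)(i := x)))"
 define good where "good S = {(\<phi>, i, xs). wf_form L \<phi> \<and> xs \<in> lists S \<and>
  (\<exists>x\<in>univ U. sat U \<phi> ((nth xs)(i := x)))}" for S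
 define N where "N = rec_nat (M \<union> set c) (\<lambda>_ S. S \<union> wit ` good S)"
 have N0: "N 0 = M \<union> set c" and NS: "N (Suc n) = N n \<union> wit ` good (N n)" for n
  by (simp_all add: N_def)
 have wit: "wit (\<phi>, i, xs) \<in> univ U \<and> sat U \<phi> ((nth xs)(i := wit (\<phi>, i, xs)))"
  if "(\<phi>, i, xs) \<in> good S" for \<phi> i xs S
  unfolding wit_def prod.case by (rule someI_ex) (use that in \<open>auto simp: good_def\<close>)
 define B where "B = (M \<union> set c) <+> (UNIV :: nat set)"
 have inf: "\<not> finite B" by (simp add: B_def)
 have smallB: "small \<kappa> B"
  unfolding B_def by (intro small_Plus small_Un_countable \<kappa> MU small_countable) (auto intro: countable_finite)
 have nat: "(card_of (UNIV :: nat set), card_of B) \<in> ordLeq"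
  using inf infinite_iff_card_of_nat by blast
 have cntB: "(card_of X, card_of B) \<in> ordLeq" if "countable X" for X :: "'x set"
  using that nat card_of_ordLeq[of X "UNIV :: nat set"] unfolding countable_def
  by (meson ordLeq_transitive subset_UNIV)
 have cardN: "(card_of (N n), card_of B) \<in> ordLeq" for n
 proof (induction n)
  case 0
  show ?case unfolding N0 B_def by (rule card_of_Plus1)
 next
  case (Suc n)
  have "good (N n) \<subseteq> {\<phi>. wf_form L \<phi>} \<times> UNIV \<times> lists (N n)" by (auto simp: good_def)
  moreover have "(card_of ({\<phi>. wf_form L \<phi>} \<times> (UNIV :: nat set) \<times> lists (N n)), card_of B) \<in> ordLeq"
   using inf cntB[OF countable_wf_form[OF L]] nat card_lists_le[OF inf Suc]
   by (intro card_of_Sigma_ordLeq_infinite ballI)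
  ultimately have "(card_of (good (N n)), card_of B) \<in> ordLeq"
   using card_of_mono1 ordLeq_transitive by blast
  then have "(card_of (wit ` good (N n)), card_of B) \<in> ordLeq"
   using card_of_image ordLeq_transitive by blast
  then show ?case unfolding NS
   using card_of_UNION_ordLeq_infinite[OF inf cntB, of "UNIV :: bool set"
     "\<lambda>b. if b then N n else wit ` good (N n)"] Suc
   by (simp add: UNIV_bool Un_commute)
 qed
 have small: "small \<kappa> (\<Union>n. N n)"
  using card_of_UNION_ordLeq_infinite[OF inf nat, of N] cardN smallB
  unfolding small_def by (auto intro: ordLeq_ordLess_trans)
 have NU: "N n \<subseteq> univ U" for n
  by (induction n) (use MU c wit in \<open>auto simp: N0 NS\<close>)
 have mono: "N n \<subseteq> N n'" if "n \<le> n'" for n n'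
  using that by (induction rule: dec_induct) (auto simp: NS)
 have fin: "\<exists>n. S \<subseteq> N n" if "finite S" "S \<subseteq> (\<Union>n. N n)" for S
  using that
 proof (induction S)
  case (insert x S)
  then obtain n n' where "S \<subseteq> N n" "x \<in> N n'" by auto
  then have "insert x S \<subseteq> N (max n n')"
   using mono[of n "max n n'"] mono[of n' "max n n'"] by auto
  then show ?case ..
 qed simp
 have "elem_sub L U (\<Union>n. N n)"
 proof (rule tarski_vaught[OF struct])
  show "(\<Union>n. N n) \<subseteq> univ U" using NU by blast
  show "(\<Union>n. N n) \<noteq> {}" using N0 MU(3) by blast
  fix \<phi> :: "('f, 'r) form" and i e
  assume wf: "wf_form L \<phi>" and e: "range e \<subseteq> (\<Union>n. N n)" and sat: "sat U (Ex i \<phi>) e"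
  obtain K where K: "fvars \<phi> \<subseteq> {..<K}"
   using finite_nat_iff_bounded finite_fvars by blast
  define xs where "xs = map e [0..<K]"
  have "set xs \<subseteq> (\<Union>n. N n)" using e by (auto simp: xs_def)
  then obtain n where n: "set xs \<subseteq> N n" using fin[of "set xs"] by auto
  have eq: "sat U \<phi> ((nth xs)(i := x)) = sat U \<phi> (e(i := x))" for x
   by (rule sat_cong) (use K in \<open>auto simp: xs_def\<close>)
  have g: "(\<phi>, i, xs) \<in> good (N n)" using wf n sat eq by (auto simp: good_def)
  then have "wit (\<phi>, i, xs) \<in> N (Suc n)" unfolding NS by blast
  then show "\<exists>x\<in>\<Union>n. N n. sat U \<phi> (e(i := x))" using wit[OF g] eq by blast
 qed
 then show ?thesis using small N0 by (intro exI[of _ "\<Union>n. N n"]) (auto simp: small_model_def)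
qed

section \<open>Finitely additive probabilities\<close>

text \<open>Keisler measures are only finitely additive on the algebra of definable sets.  Integration
 against them is done with definable step functions; \<open>lint\<close> is the lower integral.\<close>

definition step :: "'x set => 'x set set => ('x => real) => bool" where
 "step X \<A> h \<longleftrightarrow> finite (h ` X) \<and> (\<forall>r. {x \<in> X. h x = r} \<in> \<A>)"

definition sint :: "'x set => ('x set => real) => ('x => real) => real" where
 "sint X \<nu> h = (\<Sum>r\<in>h ` X. r * \<nu> {x \<in> X. h x = r})"

definition lint :: "'x set => 'x set set => ('x set => real) => ('x => real) => real" where
 "lint X \<A> \<nu> f = (SUP h\<in>{h. step X \<A> h \<and> (\<forall>x\<in>X. h x \<le> f x)}. sint X \<nu> h)"

definition tame :: "'x set => 'x set set => ('x => real) => bool" where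
 "tame X \<A> f \<longleftrightarrow> (\<forall>eps>0. \<exists>h. step X \<A> h \<and> (\<forall>x\<in>X. \<bar>f x - h x\<bar> \<le> eps))"

locale charge = algebra X \<A> for X :: "'x set" and \<A> +
 fixes \<nu> :: "'x set => real"
 assumes nonneg: "D \<in> \<A> ==> 0 \<le> \<nu> D"
  and total: "\<nu> X = 1"
  and additive: "additive \<A> \<nu>"
begin

lemma nu_Un: "D \<in> \<A> ==> E \<in> \<A> ==> D \<inter> E = {} ==> \<nu> (D \<union> E) = \<nu> D + \<nu> E"
 using additive by (auto simp: additive_def)

lemma nu_empty: "\<nu> {} = 0"
 using nu_Un[of "{}" "{}"] by simp

lemma nu_UN:
 assumes "finite I" "!!i. i \<in> I ==> D i \<in> \<A>" "disjoint_family_on D I"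
 shows "\<nu> (\<Union>i\<in>I. D i) = (\<Sum>i\<in>I. \<nu> (D i))"
 using assms
proof (induction I rule: finite_induct)
 case (insert i I)
 have "\<nu> (D i \<union> (\<Union>i\<in>I. D i)) = \<nu> (D i) + \<nu> (\<Union>i\<in>I. D i)"
  using insert by (intro nu_Un) (auto simp: disjoint_family_on_def)
 then show ?case using insert by (auto simp: disjoint_family_on_def)
qed (simp add: nu_empty)

lemma nu_mono:
 assumes "D \<in> \<A>" "E \<in> \<A>" "D \<subseteq> E"
 shows "\<nu> D \<le> \<nu> E"
proof -
 have "\<nu> (D \<union> (E - D)) = \<nu> D + \<nu> (E - D)" using assms by (intro nu_Un) auto
 moreover have "D \<union> (E - D) = E" using assms by auto
 ultimately show ?thesis using nonneg[of "E - D"] assms by auto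
qed

lemma nu_le_1: "D \<in> \<A> ==> \<nu> D \<le> 1"
 using nu_mono[of D X] total sets_into_space[of D] by auto

lemma nu_compl: "D \<in> \<A> ==> \<nu> (X - D) = 1 - \<nu> D"
 using nu_Un[of D "X - D"] total sets_into_space[of D] compl_sets[of D] by (simp add: Un_absorb1)

lemma step_const: "step X \<A> (\<lambda>_. c)"
proof -
 have "{x \<in> X. c = r} \<in> \<A>" for r by (cases "c = r") auto
 then show ?thesis by (auto simp: step_def intro: finite_subset[of _ "{c}"])
qed

lemma step_finite_range:
 assumes "finite (p ` X)" "!!T. T \<in> p ` X ==> {x \<in> X. p x = T} \<in> \<A>"
 shows "{x \<in> X. p x \<in> S} \<in> \<A>" "step X \<A> (\<lambda>x. k (p x))"
proof -
 have *: "{x \<in> X. p x \<in> S} \<in> \<A>" for S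
 proof -
  have "{x \<in> X. p x \<in> S} = (\<Union>T\<in>p ` X \<inter> S. {x \<in> X. p x = T})" by auto
  also have "\<dots> \<in> \<A>" using assms by (intro finite_UN) auto
  finally show ?thesis .
 qed
 show "{x \<in> X. p x \<in> S} \<in> \<A>" by (rule *)
 have "{x \<in> X. k (p x) = r} \<in> \<A>" for r using *[of "{T. k T = r}"] by simp
 moreover have "finite ((\<lambda>x. k (p x)) ` X)"
  using finite_imageI[OF assms(1), of k] by (simp add: image_image)
 ultimately show "step X \<A> (\<lambda>x. k (p x))" by (simp add: step_def)
qed

lemma step_combine:
 assumes "step X \<A> g" "step X \<A> h"
 shows "step X \<A> (\<lambda>x. k (g x) (h x))"
proof -
 have "finite ((\<lambda>x. (g x, h x)) ` X)"
  using assms by (auto simp: step_def intro: finite_subset[of _ "g ` X \<times> h ` X"])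
 moreover have "{x \<in> X. (g x, h x) = T} \<in> \<A>" for T
 proof -
  have "{x \<in> X. (g x, h x) = T} = {x \<in> X. g x = fst T} \<inter> {x \<in> X. h x = snd T}" by auto
  then show ?thesis using assms by (auto simp: step_def)
 qed
 ultimately show ?thesis using step_finite_range(2)[of "\<lambda>x. (g x, h x)" "\<lambda>(a, b). k a b"] by simp
qed

lemma step_set: "step X \<A> h ==> {x \<in> X. h x \<in> S} \<in> \<A>"
 using step_finite_range(1)[of h] by (simp add: step_def)

lemma step_indicator: "E \<in> \<A> ==> step X \<A> (indicator E)"
proof -
 assume E: "E \<in> \<A>"
 have "{x \<in> X. (x \<in> E) = b} \<in> \<A>" for b
  using E sets_into_space[OF E] by (cases b) (auto simp: Int_absorb1 set_diff_eq[symmetric] Collect_conj_eq[symmetric] Int_def[symmetric])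
 then have "step X \<A> (\<lambda>x. if x \<in> E then 1 else 0)"
  by (intro step_finite_range(2)[of "\<lambda>x. x \<in> E" "\<lambda>b. if b then 1 else 0"]) auto
 moreover have "indicator E = (\<lambda>x. if x \<in> E then 1 else 0 :: real)" by (auto simp: indicator_def)
 ultimately show ?thesis by simp
qed

lemma step_sum: "finite I ==> (!!i. i \<in> I ==> step X \<A> (h i)) ==> step X \<A> (\<lambda>x. \<Sum>i\<in>I. h i x)"
 by (induction I rule: finite_induct) (auto simp: step_const intro: step_combine[where k = "(+)"])

lemma sint_factor:
 assumes "finite (p ` X)" "!!T. T \<in> p ` X ==> {x \<in> X. p x = T} \<in> \<A>"
 shows "sint X \<nu> (\<lambda>x. k (p x)) = (\<Sum>T\<in>p ` X. k T * \<nu> {x \<in> X. p x = T})"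
proof -
 have "\<nu> {x \<in> X. k (p x) = r} = (\<Sum>T\<in>{T \<in> p ` X. k T = r}. \<nu> {x \<in> X. p x = T})" for r
 proof -
  have "{x \<in> X. k (p x) = r} = (\<Union>T\<in>{T \<in> p ` X. k T = r}. {x \<in> X. p x = T})" by auto
  moreover have "\<nu> (\<Union>T\<in>{T \<in> p ` X. k T = r}. {x \<in> X. p x = T})
    = (\<Sum>T\<in>{T \<in> p ` X. k T = r}. \<nu> {x \<in> X. p x = T})"
   by (rule nu_UN) (use assms in \<open>auto simp: disjoint_family_on_def\<close>)
  ultimately show ?thesis by (rule trans[OF arg_cong[where f = \<nu>]])
 qed
 then have "sint X \<nu> (\<lambda>x. k (p x)) =
   (\<Sum>r\<in>k ` p ` X. \<Sum>T\<in>{T \<in> p ` X. k T = r}. k T * \<nu> {x \<in> X. p x = T})"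
  unfolding sint_def image_image by (intro sum.cong) (auto simp: sum_distrib_left)
 also have "\<dots> = (\<Sum>T\<in>p ` X. k T * \<nu> {x \<in> X. p x = T})"
  using assms(1) by (intro sum.image_gen[symmetric])
 finally show ?thesis .
qed

lemma sint_le_const:
 assumes "step X \<A> h" "!!x. x \<in> X ==> h x \<le> c"
 shows "sint X \<nu> h \<le> c"
proof -
 have "sint X \<nu> h \<le> (\<Sum>r\<in>h ` X. c * \<nu> {x \<in> X. h x = r})"
  unfolding sint_def using assms by (intro sum_mono mult_right_mono) (auto simp: step_def nonneg)
 also have "\<dots> = sint X \<nu> (\<lambda>x. c)"
  using sint_factor[of h "\<lambda>_. c"] assms by (simp add: step_def)
 also have "\<dots> = c"
  by (cases "X = {}") (use total nu_empty in \<open>auto simp: sint_def image_constant_conv\<close>)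
 finally show ?thesis .
qed

text \<open>A finitely additive probability is represented exactly, on finitely many sets, by a finitely
 supported one: choose a point in each atom of the algebra that these sets generate.  Choosing the
 points where \<open>f\<close> almost attains its infimum over the atom also makes the mean of \<open>f\<close> at most
 its lower integral, up to an arbitrarily small error.\<close>

lemma sampling:
 assumes G: "finite G" "G \<subseteq> \<A>" and f: "!!x. x \<in> X ==> 0 \<le> f x" and "0 < \<delta>"
  and B: "!!h. step X \<A> h ==> (!!x. x \<in> X ==> h x \<le> f x) ==> sint X \<nu> h \<le> B"
 shows "\<exists>u. finite (set_pmf u) \<and> set_pmf u \<subseteq> X \<and> (\<forall>E\<in>G. measure_pmf.prob u E = \<nu> E) \<and>
  measure_pmf.expectation u f \<le> B + \<delta>"
proof -
 define pat where "pat x = {E \<in> G. x \<in> E}" for x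
 define atom where "atom T = {x \<in> X. pat x = T}" for T
 have finp: "finite (pat ` X)" using G(1)
  by (intro finite_subset[of "pat ` X" "Pow G"]) (auto simp: pat_def)
 have atom: "atom T \<in> \<A>" for T
 proof (cases "T \<subseteq> G")
  case True
  have "atom T = (\<Inter>E\<in>G. if E \<in> T then E else X - E) \<inter> X"
   using True by (auto simp: atom_def pat_def split: if_splits)
  moreover have "(\<Inter>E\<in>F. if E \<in> T then E else X - E) \<inter> X \<in> \<A>" if "finite F" "F \<subseteq> G" for F
   using that
  proof (induction F rule: finite_induct)
   case (insert E F)
   have eq: "(\<Inter>E\<in>insert E F. if E \<in> T then E else X - E) \<inter> X
     = (if E \<in> T then E else X - E) \<inter> ((\<Inter>E\<in>F. if E \<in> T then E else X - E) \<inter> X)" by auto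
   have m: "(if E \<in> T then E else X - E) \<in> \<A>" using insert.prems G(2) compl_sets[of E] by auto
   show ?case unfolding eq by (rule Int[OF m insert.IH]) (use insert.prems in auto)
  qed simp
  ultimately show ?thesis using G(1) by simp
 next
  case False
  then have "atom T = {}" by (auto simp: atom_def pat_def)
  then show ?thesis by simp
 qed
 have "\<exists>x. x \<in> atom T \<and> (\<forall>y\<in>atom T. f x - \<delta> \<le> f y)" if "T \<in> pat ` X" for T
 proof -
  have ne: "f ` atom T \<noteq> {}" using that by (auto simp: atom_def)
  have bdd: "bdd_below (f ` atom T)" by (rule bdd_belowI[of _ 0]) (use f in \<open>auto simp: atom_def\<close>)
  obtain x where "x \<in> atom T" "f x < Inf (f ` atom T) + \<delta>"
   using cInf_lessD[OF ne, of "Inf (f ` atom T) + \<delta>"] \<open>0 < \<delta>\<close> by auto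
  moreover have "Inf (f ` atom T) \<le> f y" if "y \<in> atom T" for y
   using that bdd by (intro cInf_lower) auto
  ultimately show ?thesis by (intro exI[of _ x]) force
 qed
 then obtain pt where pt: "!!T. T \<in> pat ` X ==> pt T \<in> atom T"
  and pt_inf: "!!T y. T \<in> pat ` X ==> y \<in> atom T ==> f (pt T) - \<delta> \<le> f y" by metis
 have nu_decomp: "\<nu> E = (\<Sum>T\<in>{T \<in> pat ` X. E \<in> T}. \<nu> (atom T))" if "E \<in> G" for E
 proof -
  have "E \<subseteq> X" using that G(2) sets_into_space[of E] by blast
  then have "E = {x \<in> X. E \<in> pat x}" using that unfolding pat_def by blast
  also have "\<dots> = (\<Union>T\<in>{T \<in> pat ` X. E \<in> T}. atom T)" unfolding atom_def by blast
  finally have "E = (\<Union>T\<in>{T \<in> pat ` X. E \<in> T}. atom T)" .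
  moreover have "\<nu> (\<Union>T\<in>{T \<in> pat ` X. E \<in> T}. atom T) = (\<Sum>T\<in>{T \<in> pat ` X. E \<in> T}. \<nu> (atom T))"
   using finp atom by (intro nu_UN) (auto simp: disjoint_family_on_def atom_def)
  ultimately show ?thesis by (rule trans[OF arg_cong[where f = \<nu>]])
 qed
 have one: "(\<Sum>T\<in>pat ` X. \<nu> (atom T)) = 1"
 proof -
  have "X = (\<Union>T\<in>pat ` X. atom T)" by (auto simp: atom_def)
  moreover have "\<nu> (\<Union>T\<in>pat ` X. atom T) = (\<Sum>T\<in>pat ` X. \<nu> (atom T))"
   using finp atom by (intro nu_UN) (auto simp: disjoint_family_on_def atom_def)
  ultimately have "\<nu> X = (\<Sum>T\<in>pat ` X. \<nu> (atom T))" by (rule trans[OF arg_cong[where f = \<nu>]])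
  then show ?thesis using total by simp
 qed
 have zero: "\<nu> (atom T) = 0" if "T \<notin> pat ` X" for T
 proof -
  have "atom T = {}" using that by (auto simp: atom_def)
  then show ?thesis by (simp add: nu_empty)
 qed
 define v where "v = embed_pmf (\<lambda>T. \<nu> (atom T))"
 have "(\<integral>\<^sup>+T. ennreal (\<nu> (atom T)) \<partial>count_space UNIV) = (\<Sum>T\<in>pat ` X. ennreal (\<nu> (atom T)))"
  using finp zero by (intro nn_integral_count_space'[where A = "pat ` X"]) auto
 also have "\<dots> = 1" using one nonneg[OF atom] by (simp add: sum_ennreal)
 finally have pmf_v: "pmf v T = \<nu> (atom T)" for T
  unfolding v_def by (intro pmf_embed_pmf) (auto simp: nonneg atom)
 have set_v: "set_pmf v \<subseteq> pat ` X" using zero by (auto simp: set_pmf_eq pmf_v)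
 define u where "u = map_pmf pt v"
 have "measure_pmf.prob u E = \<nu> E" if E: "E \<in> G" for E
 proof -
  have "measure_pmf.prob u E = measure_pmf.prob v (pt -` E)" by (simp add: u_def)
  also have "\<dots> = measure_pmf.prob v {T \<in> pat ` X. E \<in> T}"
  proof (intro measure_eq_AE)
   have "T \<in> pat ` X \<and> (pt T \<in> E \<longleftrightarrow> E \<in> T)" if "T \<in> set_pmf v" for T
   proof -
    have T: "T \<in> pat ` X" using that set_v by blast
    then have "pat (pt T) = T" using pt[OF T] by (simp add: atom_def)
    then show ?thesis using T E by (auto simp: pat_def)
   qed
   then show "AE T in measure_pmf v. (T \<in> pt -` E) = (T \<in> {T \<in> pat ` X. E \<in> T})"
    by (simp add: AE_measure_pmf_iff)
  qed simp_all
  also have "\<dots> = \<nu> E"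
   using finp nu_decomp[OF E] by (simp add: measure_measure_pmf_finite pmf_v)
  finally show ?thesis .
 qed
 moreover have "measure_pmf.expectation u f \<le> B + \<delta>"
 proof -
  have "measure_pmf.expectation u f = (\<Sum>T\<in>pat ` X. f (pt T) * \<nu> (atom T))"
   unfolding u_def integral_map_pmf using finp set_v pmf_v
   by (subst integral_measure_pmf_real[of "pat ` X"]) auto
  also have "\<dots> = (\<Sum>T\<in>pat ` X. (f (pt T) - \<delta>) * \<nu> (atom T)) + \<delta>"
   using one by (simp add: algebra_simps sum.distrib sum_subtractf flip: sum_distrib_left)
  also have "(\<Sum>T\<in>pat ` X. (f (pt T) - \<delta>) * \<nu> (atom T)) = sint X \<nu> (\<lambda>x. f (pt (pat x)) - \<delta>)"
   using sint_factor[of pat "\<lambda>T. f (pt T) - \<delta>"] finp atom by (simp add: atom_def)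
  also have "\<dots> \<le> B"
  proof (rule B)
   show "step X \<A> (\<lambda>x. f (pt (pat x)) - \<delta>)"
    using step_finite_range(2)[of pat "\<lambda>T. f (pt T) - \<delta>"] finp atom by (simp add: atom_def)
  qed (auto intro: pt_inf simp: atom_def)
  finally show ?thesis by simp
 qed
 moreover have "finite (set_pmf u)" using finite_subset[OF set_v finp] by (simp add: u_def)
 moreover have "set_pmf u \<subseteq> X" using set_v pt by (auto simp: u_def atom_def)
 ultimately show ?thesis by blast
qed

lemma sampling':
 assumes "finite G" "G \<subseteq> \<A>"
 shows "\<exists>u. finite (set_pmf u) \<and> set_pmf u \<subseteq> X \<and> (\<forall>E\<in>G. measure_pmf.prob u E = \<nu> E)"
 using sampling[OF assms, of "\<lambda>_. 0" 1 0] sint_le_const by auto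

lemma expectation_step:
 assumes "finite (set_pmf u)" "set_pmf u \<subseteq> X" "step X \<A> h"
  and "!!r. r \<in> h ` X ==> measure_pmf.prob u {x \<in> X. h x = r} = \<nu> {x \<in> X. h x = r}"
 shows "measure_pmf.expectation u h = sint X \<nu> h"
proof -
 have "measure_pmf.expectation u h = measure_pmf.expectation (map_pmf h u) (\<lambda>r. r)" by simp
 also have "\<dots> = (\<Sum>r\<in>h ` X. r * pmf (map_pmf h u) r)"
  using assms by (intro integral_measure_pmf_real) (auto simp: step_def)
 also have "\<dots> = sint X \<nu> h" unfolding sint_def
 proof (rule sum.cong[OF refl])
  fix r assume "r \<in> h ` X"
  have "pmf (map_pmf h u) r = measure_pmf.prob u {x \<in> X. h x = r}"
   unfolding pmf_map using assms(2)
   by (intro measure_eq_AE) (auto simp: AE_measure_pmf_iff)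
  then show "r * pmf (map_pmf h u) r = r * \<nu> {x \<in> X. h x = r}"
   using assms(4) \<open>r \<in> h ` X\<close> by simp
 qed
 finally show ?thesis .
qed

text \<open>Sampling reduces identities between finitely many step integrals to identities between
 expectations.\<close>

lemma sampling_steps:
 assumes "finite H" "!!h. h \<in> H ==> step X \<A> h"
 shows "\<exists>u. finite (set_pmf u) \<and> set_pmf u \<subseteq> X \<and> (\<forall>h\<in>H. measure_pmf.expectation u h = sint X \<nu> h)"
proof -
 let ?G = "\<Union>h\<in>H. (\<lambda>r. {x \<in> X. h x = r}) ` h ` X"
 have "finite ?G" "?G \<subseteq> \<A>" using assms by (auto simp: step_def)
 from sampling'[OF this] obtain u where
  u: "finite (set_pmf u) \<and> set_pmf u \<subseteq> X \<and> (\<forall>E\<in>?G. measure_pmf.prob u E = \<nu> E)" ..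
 have "measure_pmf.expectation u h = sint X \<nu> h" if "h \<in> H" for h
 proof (rule expectation_step)
  fix r assume "r \<in> h ` X"
  then have "{x \<in> X. h x = r} \<in> ?G" using that by blast
  then show "measure_pmf.prob u {x \<in> X. h x = r} = \<nu> {x \<in> X. h x = r}" using u by blast
 qed (use u assms that in auto)
 then show ?thesis using u by (intro exI[of _ u]) simp
qed

lemma sint_mono:
 assumes "step X \<A> g" "step X \<A> h" "!!x. x \<in> X ==> g x \<le> h x"
 shows "sint X \<nu> g \<le> sint X \<nu> h"
proof -
 obtain u where u: "finite (set_pmf u)" "set_pmf u \<subseteq> X"
  "measure_pmf.expectation u g = sint X \<nu> g" "measure_pmf.expectation u h = sint X \<nu> h"
  using sampling_steps[of "{g, h}"] assms by auto
 have "measure_pmf.expectation u g \<le> measure_pmf.expectation u h"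
  using u assms(3)
  by (intro integral_mono_AE) (auto simp: integrable_measure_pmf_finite AE_measure_pmf_iff)
 then show ?thesis using u by simp
qed

lemma sint_linear:
 assumes "step X \<A> g" "step X \<A> h"
 shows "sint X \<nu> (\<lambda>x. a * g x + b * h x) = a * sint X \<nu> g + b * sint X \<nu> h"
proof -
 let ?k = "\<lambda>x. a * g x + b * h x"
 have "step X \<A> ?k" using step_combine[OF assms, of "\<lambda>r s. a * r + b * s"] .
 then obtain u where u: "finite (set_pmf u)" "set_pmf u \<subseteq> X"
  "measure_pmf.expectation u g = sint X \<nu> g" "measure_pmf.expectation u h = sint X \<nu> h"
  "measure_pmf.expectation u ?k = sint X \<nu> ?k"
  using sampling_steps[of "{g, h, ?k}"] assms by auto
 then show ?thesis by (simp add: integrable_measure_pmf_finite)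
qed

lemma sint_const: "sint X \<nu> (\<lambda>_. c) = c"
 by (cases "X = {}") (use total nu_empty in \<open>auto simp: sint_def image_constant_conv\<close>)

lemma sint_indicator:
 assumes E: "E \<in> \<A>"
 shows "sint X \<nu> (indicator E) = \<nu> E"
proof -
 let ?p = "\<lambda>x. x \<in> E" and ?k = "\<lambda>b. if b then 1 else 0 :: real"
 have eq: "{x \<in> X. ?p x = b} = (if b then E else X - E)" for b
  using sets_into_space[OF E] by (cases b) auto
 have "sint X \<nu> (\<lambda>x. ?k (?p x)) = (\<Sum>b\<in>?p ` X. ?k b * \<nu> {x \<in> X. ?p x = b})"
 proof (rule sint_factor)
  show "{x \<in> X. ?p x = b} \<in> \<A>" for b unfolding eq using E compl_sets[OF E] by simp
 qed (rule finite)
 also have "\<dots> = (\<Sum>b\<in>UNIV. ?k b * \<nu> {x \<in> X. ?p x = b})"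
 proof (rule sum.mono_neutral_left)
  show "\<forall>b\<in>UNIV - ?p ` X. ?k b * \<nu> {x \<in> X. ?p x = b} = 0"
  proof
   fix b assume "b \<in> UNIV - ?p ` X"
   then have e: "{x \<in> X. ?p x = b} = {}" by auto
   show "?k b * \<nu> {x \<in> X. ?p x = b} = 0" unfolding e nu_empty by simp
  qed
 qed simp_all
 also have "\<dots> = \<nu> E" unfolding eq by (simp add: UNIV_bool)
 finally have "sint X \<nu> (\<lambda>x. ?k (?p x)) = \<nu> E" .
 moreover have "(indicator E :: 'x => real) = (\<lambda>x. ?k (?p x))" by (rule ext) (simp add: indicator_def)
 ultimately show ?thesis by metis
qed

lemma sint_sum:
 assumes "finite I" "!!i. i \<in> I ==> step X \<A> (h i)"
 shows "sint X \<nu> (\<lambda>x. \<Sum>i\<in>I. c i * h i x) = (\<Sum>i\<in>I. c i * sint X \<nu> (h i))"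
 using assms
proof (induction I rule: finite_induct)
 case (insert i I)
 have "step X \<A> (\<lambda>x. \<Sum>i\<in>I. c i * h i x)"
 proof (rule step_sum[OF insert.hyps(1)])
  fix j assume "j \<in> I"
  then have "step X \<A> (h j)" using insert.prems by blast
  from step_combine[OF this this, of "\<lambda>r _. c j * r"] show "step X \<A> (\<lambda>x. c j * h j x)" .
 qed
 then show ?case
  using sint_linear[of "h i" "\<lambda>x. \<Sum>i\<in>I. c i * h i x" "c i" 1] insert by simp
qed (simp add: sint_const)

lemma lint_upper:
 assumes "step X \<A> h" "!!x. x \<in> X ==> h x \<le> f x" "!!x. x \<in> X ==> f x \<le> c"
 shows "sint X \<nu> h \<le> lint X \<A> \<nu> f"
 unfolding lint_def
proof (rule cSUP_upper)
 show "bdd_above (sint X \<nu> ` {h. step X \<A> h \<and> (\<forall>x\<in>X. h x \<le> f x)})"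
 proof (rule bdd_aboveI2[of _ _ c])
  fix g assume "g \<in> {h. step X \<A> h \<and> (\<forall>x\<in>X. h x \<le> f x)}"
  then show "sint X \<nu> g \<le> c" by (intro sint_le_const order_trans[OF _ assms(3)]) auto
 qed
qed (use assms in auto)

lemma lint_least:
 assumes "!!h. step X \<A> h ==> (!!x. x \<in> X ==> h x \<le> f x) ==> sint X \<nu> h \<le> c"
  and "!!x. x \<in> X ==> b \<le> f x"
 shows "lint X \<A> \<nu> f \<le> c"
 unfolding lint_def
 by (rule cSUP_least) (use assms step_const[of b] in auto)

lemma lint_approx:
 assumes h: "step X \<A> h" "!!x. x \<in> X ==> \<bar>f x - h x\<bar> \<le> eps"
 shows "\<bar>lint X \<A> \<nu> f - sint X \<nu> h\<bar> \<le> eps"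
proof -
 have s: "step X \<A> (\<lambda>x. h x + c)" for c using step_combine[OF h(1) h(1), of "\<lambda>r _. r + c"] .
 have i: "sint X \<nu> (\<lambda>x. h x + c) = sint X \<nu> h + c" for c
  using sint_linear[OF h(1) step_const[of 1], of 1 c] by (simp add: sint_const)
 obtain b where b: "!!x. x \<in> X ==> \<bar>h x\<bar> \<le> b"
 proof -
  have "finite ((\<lambda>x. \<bar>h x\<bar>) ` X)" using h(1) finite_imageI[of "h ` X" abs] by (simp add: step_def image_image)
  then have "\<bar>h x\<bar> \<le> Max ((\<lambda>x. \<bar>h x\<bar>) ` X)" if "x \<in> X" for x using that by auto
  then show ?thesis using that by blast
 qed
 have f: "- b - eps \<le> f x" "f x \<le> b + eps" if "x \<in> X" for x using h(2)[OF that] b[OF that] by linarith+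
 have "sint X \<nu> (\<lambda>x. h x + - eps) \<le> lint X \<A> \<nu> f"
  by (rule lint_upper[OF s, of _ _ "b + eps"]) (use h(2) f in \<open>auto simp: abs_le_iff algebra_simps dest!: h(2)\<close>)
 moreover have "lint X \<A> \<nu> f \<le> sint X \<nu> (\<lambda>x. h x + eps)"
 proof (rule lint_least[of _ _ "- b - eps"])
  fix g assume g: "step X \<A> g" "!!x. x \<in> X ==> g x \<le> f x"
  show "sint X \<nu> g \<le> sint X \<nu> (\<lambda>x. h x + eps)"
   by (rule sint_mono[OF g(1) s]) (use g(2) h(2) in \<open>force simp: abs_le_iff\<close>)
 qed (use f in auto)
 ultimately show ?thesis unfolding i by linarith
qed

lemma lint_step: "step X \<A> h ==> lint X \<A> \<nu> h = sint X \<nu> h"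
 using lint_approx[of h h 0] by simp

lemma tame_step: "step X \<A> h ==> tame X \<A> h"
 unfolding tame_def by (metis abs_zero diff_self less_imp_le)

lemma lint_linear:
 assumes "tame X \<A> f" "tame X \<A> g"
 shows "lint X \<A> \<nu> (\<lambda>x. a * f x + b * g x) = a * lint X \<A> \<nu> f + b * lint X \<A> \<nu> g"
proof (rule ccontr)
 let ?d = "\<bar>lint X \<A> \<nu> (\<lambda>x. a * f x + b * g x) - (a * lint X \<A> \<nu> f + b * lint X \<A> \<nu> g)\<bar>"
 let ?s = "2 * (\<bar>a\<bar> + \<bar>b\<bar>) + 1"
 assume "\<not> ?thesis"
 then have d: "?d > 0" by auto
 define eps where "eps = ?d / ?s"
 have "eps > 0" using d by (simp add: eps_def divide_pos_pos add_nonneg_pos)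
 then obtain h k where h: "step X \<A> h" "!!x. x \<in> X ==> \<bar>f x - h x\<bar> \<le> eps"
  and k: "step X \<A> k" "!!x. x \<in> X ==> \<bar>g x - k x\<bar> \<le> eps"
  using assms unfolding tame_def by meson
 have bound: "\<bar>a * p + b * q\<bar> \<le> (\<bar>a\<bar> + \<bar>b\<bar>) * eps" if "\<bar>p\<bar> \<le> eps" "\<bar>q\<bar> \<le> eps" for p q
 proof -
  have "\<bar>a * p + b * q\<bar> \<le> \<bar>a\<bar> * \<bar>p\<bar> + \<bar>b\<bar> * \<bar>q\<bar>" by (metis abs_mult abs_triangle_ineq)
  also have "\<dots> \<le> \<bar>a\<bar> * eps + \<bar>b\<bar> * eps" by (intro add_mono mult_left_mono that) auto
  finally show ?thesis by (simp add: algebra_simps)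
 qed
 have "\<bar>lint X \<A> \<nu> (\<lambda>x. a * f x + b * g x) - sint X \<nu> (\<lambda>x. a * h x + b * k x)\<bar> \<le> (\<bar>a\<bar> + \<bar>b\<bar>) * eps"
 proof (rule lint_approx)
  show "step X \<A> (\<lambda>x. a * h x + b * k x)" using step_combine[OF h(1) k(1)] .
  fix x assume "x \<in> X"
  then show "\<bar>a * f x + b * g x - (a * h x + b * k x)\<bar> \<le> (\<bar>a\<bar> + \<bar>b\<bar>) * eps"
   using bound[OF h(2) k(2), of x x] by (simp add: algebra_simps)
 qed
 moreover have "\<bar>a * (lint X \<A> \<nu> f - sint X \<nu> h) + b * (lint X \<A> \<nu> g - sint X \<nu> k)\<bar> \<le> (\<bar>a\<bar> + \<bar>b\<bar>) * eps"
  by (intro bound lint_approx h k)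
 ultimately have "?d \<le> 2 * (\<bar>a\<bar> + \<bar>b\<bar>) * eps"
  unfolding sint_linear[OF h(1) k(1)] by (simp add: algebra_simps)
 also have "\<dots> < ?s * eps" using \<open>eps > 0\<close> by (simp add: algebra_simps)
 also have "?s * eps = ?d" by (simp add: eps_def add_nonneg_eq_0_iff)
 finally show False by simp
qed

lemma lint_cong: "(!!x. x \<in> X ==> f x = g x) ==> lint X \<A> \<nu> f = lint X \<A> \<nu> g"
 unfolding lint_def by (intro arg_cong[where f = Sup] arg_cong2[where f = image] refl) auto

lemma lint_compl: "tame X \<A> f ==> lint X \<A> \<nu> (\<lambda>x. 1 - f x) = 1 - lint X \<A> \<nu> f"
 using lint_linear[OF tame_step[OF step_const[of 1]], of f 1 "-1"] lint_step[OF step_const[of 1]]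
 by (simp add: sint_const)

lemma tame_linear:
 assumes "tame X \<A> f" "tame X \<A> g"
 shows "tame X \<A> (\<lambda>x. a * f x + b * g x)"
 unfolding tame_def
proof (intro allI impI)
 fix eps :: real assume "eps > 0"
 define \<delta> where "\<delta> = eps / (\<bar>a\<bar> + \<bar>b\<bar> + 1)"
 have \<delta>: "\<delta> > 0" using \<open>eps > 0\<close> by (simp add: \<delta>_def divide_pos_pos add_nonneg_pos)
 then obtain h k where h: "step X \<A> h" "!!x. x \<in> X ==> \<bar>f x - h x\<bar> \<le> \<delta>"
  and k: "step X \<A> k" "!!x. x \<in> X ==> \<bar>g x - k x\<bar> \<le> \<delta>"
  using assms unfolding tame_def by meson
 have "\<bar>a * f x + b * g x - (a * h x + b * k x)\<bar> \<le> eps" if "x \<in> X" for x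
 proof -
  have "\<bar>a * (f x - h x) + b * (g x - k x)\<bar> \<le> \<bar>a\<bar> * \<bar>f x - h x\<bar> + \<bar>b\<bar> * \<bar>g x - k x\<bar>"
   by (metis abs_mult abs_triangle_ineq)
  also have "\<dots> \<le> \<bar>a\<bar> * \<delta> + \<bar>b\<bar> * \<delta>" by (intro add_mono mult_left_mono h k that) auto
  also have "\<dots> \<le> (\<bar>a\<bar> + \<bar>b\<bar> + 1) * \<delta>" using \<delta> by (simp add: algebra_simps)
  also have "\<dots> = eps" by (simp add: \<delta>_def add_nonneg_eq_0_iff)
  finally show ?thesis by (simp add: algebra_simps)
 qed
 then show "\<exists>h. step X \<A> h \<and> (\<forall>x\<in>X. \<bar>a * f x + b * g x - h x\<bar> \<le> eps)"
  using step_combine[OF h(1) k(1), of "\<lambda>r s. a * r + b * s"] by blast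
qed

end

section \<open>Regular Borel measures on Stone spaces\<close>

text \<open>The Stone space \<open>S\<close> of an algebra of sets, presented by the map \<open>cyl\<close> that sends a set of the
 algebra to the corresponding clopen set.\<close>

locale stone = algebra X \<A> for X :: "'x set" and \<A> +
 fixes S :: "'s set" and cyl :: "'x set => 's set"
 assumes cyl_sub: "D \<in> \<A> ==> cyl D \<subseteq> S"
  and cyl_Int: "D \<in> \<A> ==> E \<in> \<A> ==> cyl (D \<inter> E) = cyl D \<inter> cyl E"
  and cyl_compl: "D \<in> \<A> ==> cyl (X - D) = S - cyl D"
  and cyl_empty_iff: "D \<in> \<A> ==> cyl D = {} \<longleftrightarrow> D = {}"
  and cyl_compact: "\<D> \<subseteq> \<A> ==> S \<subseteq> (\<Union>D\<in>\<D>. cyl D) ==>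
   \<exists>\<D>'\<subseteq>\<D>. finite \<D>' \<and> S \<subseteq> (\<Union>D\<in>\<D>'. cyl D)"
begin

definition T :: "'s topology" where "T = topology_generated_by (cyl ` \<A>)"

lemma cyl_empty: "cyl {} = {}"
 using cyl_empty_iff by simp

lemma cyl_X: "cyl X = S"
 using cyl_compl[of "{}"] cyl_empty by simp

lemma cyl_Un: "D \<in> \<A> ==> E \<in> \<A> ==> cyl (D \<union> E) = cyl D \<union> cyl E"
proof -
 assume *: "D \<in> \<A>" "E \<in> \<A>"
 have "D \<union> E = X - ((X - D) \<inter> (X - E))" using * sets_into_space by auto
 then have "cyl (D \<union> E) = S - ((S - cyl D) \<inter> (S - cyl E))" using * by (simp add: cyl_compl cyl_Int compl_sets Int)
 also have "\<dots> = cyl D \<union> cyl E" using cyl_sub * by auto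
 finally show ?thesis .
qed

lemma cyl_Union: "finite \<D> ==> \<D> \<subseteq> \<A> ==> cyl (\<Union>\<D>) = (\<Union>D\<in>\<D>. cyl D)"
 by (induction \<D> rule: finite_induct) (simp_all add: cyl_empty cyl_Un finite_Union)

lemma cyl_mono_iff:
 assumes "D \<in> \<A>" "E \<in> \<A>"
 shows "cyl D \<subseteq> cyl E \<longleftrightarrow> D \<subseteq> E"
proof -
 have "D \<subseteq> E \<longleftrightarrow> D \<inter> (X - E) = {}" using sets_into_space[OF assms(1)] by blast
 also have "\<dots> \<longleftrightarrow> cyl D \<inter> (S - cyl E) = {}"
  using cyl_empty_iff[of "D \<inter> (X - E)"] assms by (auto simp add: cyl_Int cyl_compl compl_sets)
 also have "\<dots> \<longleftrightarrow> cyl D \<subseteq> cyl E" using cyl_sub[OF assms(1)] by blast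
 finally show ?thesis ..
qed

lemma openin_T: "openin T V \<longleftrightarrow> V \<subseteq> S \<and> (\<forall>p\<in>V. \<exists>D\<in>\<A>. p \<in> cyl D \<and> cyl D \<subseteq> V)"
proof
 assume "openin T V"
 then have "generate_topology_on (cyl ` \<A>) V" by (simp add: T_def openin_topology_generated_by)
 then show "V \<subseteq> S \<and> (\<forall>p\<in>V. \<exists>D\<in>\<A>. p \<in> cyl D \<and> cyl D \<subseteq> V)"
 proof induction
  case (Int V W)
  show ?case
  proof (intro conjI ballI)
   fix p assume p: "p \<in> V \<inter> W"
   then obtain D E where "D \<in> \<A>" "p \<in> cyl D" "cyl D \<subseteq> V" "E \<in> \<A>" "p \<in> cyl E" "cyl E \<subseteq> W"
    using Int by blast
   then show "\<exists>D\<in>\<A>. p \<in> cyl D \<and> cyl D \<subseteq> V \<inter> W"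
    by (intro bexI[of _ "D \<inter> E"]) (auto simp: cyl_Int)
  qed (use Int in blast)
 next
  case (Basis V)
  then show ?case using cyl_sub by blast
 next
  case (UN K)
  show ?case
  proof (intro conjI ballI)
   show "\<Union>K \<subseteq> S" using UN.IH by (simp add: Union_least)
   fix p assume "p \<in> \<Union>K"
   then obtain k where k: "k \<in> K" "p \<in> k" by (rule UnionE)
   then obtain D where "D \<in> \<A>" "p \<in> cyl D" "cyl D \<subseteq> k" using bspec[OF conjunct2[OF UN.IH[OF k(1)]] k(2)] by blast
   then show "\<exists>D\<in>\<A>. p \<in> cyl D \<and> cyl D \<subseteq> \<Union>K" using k(1) by (intro bexI[of _ D]) auto
  qed
 qed simp
next
 assume V: "V \<subseteq> S \<and> (\<forall>p\<in>V. \<exists>D\<in>\<A>. p \<in> cyl D \<and> cyl D \<subseteq> V)"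
 then have eq: "V = (\<Union>D\<in>{D \<in> \<A>. cyl D \<subseteq> V}. cyl D)" by blast
 have "openin T (\<Union>D\<in>{D \<in> \<A>. cyl D \<subseteq> V}. cyl D)"
  by (intro openin_Union) (auto simp: T_def intro: topology_generated_by_Basis)
 then show "openin T V" unfolding eq[symmetric] .
qed

lemma openin_cyl: "D \<in> \<A> ==> openin T (cyl D)"
 unfolding openin_T using cyl_sub by blast

lemma topspace_T: "topspace T = S"
 using cyl_sub cyl_X by (auto simp: T_def)

lemma cyl_compact':
 assumes "D \<in> \<A>" "\<D> \<subseteq> \<A>" "cyl D \<subseteq> (\<Union>E\<in>\<D>. cyl E)"
 shows "\<exists>\<D>'\<subseteq>\<D>. finite \<D>' \<and> D \<subseteq> \<Union>\<D>'"
proof -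
 have "S \<subseteq> (\<Union>E\<in>insert (X - D) \<D>. cyl E)" using assms by (auto simp: cyl_compl)
 then obtain \<D>' where \<D>': "\<D>' \<subseteq> insert (X - D) \<D>" "finite \<D>'" "S \<subseteq> (\<Union>E\<in>\<D>'. cyl E)"
  using cyl_compact[of "insert (X - D) \<D>"] assms by auto
 let ?E = "\<D>' - {X - D}"
 have E: "finite ?E" "?E \<subseteq> \<D>" "?E \<subseteq> \<A>" using \<D>' assms by auto
 have "cyl D \<subseteq> (\<Union>E\<in>?E. cyl E)" using \<D>'(3) cyl_sub[OF assms(1)] cyl_compl[OF assms(1)] by blast
 then have "cyl D \<subseteq> cyl (\<Union>?E)" using cyl_Union[OF E(1,3)] by simp
 then have "D \<subseteq> \<Union>?E" using cyl_mono_iff[OF assms(1) finite_Union[OF E(1,3)]] by blast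
 then show ?thesis using E by blast
qed

lemma closed_inside_open:
 assumes "closedin T K" "openin T V" "K \<subseteq> V"
 shows "\<exists>D\<in>\<A>. K \<subseteq> cyl D \<and> cyl D \<subseteq> V"
proof -
 have K: "K \<subseteq> S" "openin T (S - K)" using assms(1) by (auto simp: closedin_def topspace_T)
 let ?D = "{D \<in> \<A>. cyl D \<subseteq> V} \<union> {D \<in> \<A>. cyl D \<subseteq> S - K}"
 have "S \<subseteq> (\<Union>D\<in>?D. cyl D)"
 proof
  fix p assume "p \<in> S"
  then consider "p \<in> V" | "p \<in> S - K" using assms(3) by blast
  then show "p \<in> (\<Union>D\<in>?D. cyl D)"
   using assms(2) K(2) unfolding openin_T by cases blast+
 qed
 moreover have "?D \<subseteq> \<A>" by blast
 ultimately obtain \<D>' where D': "\<D>' \<subseteq> ?D" "finite \<D>'" "S \<subseteq> (\<Union>D\<in>\<D>'. cyl D)"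
  using cyl_compact[of ?D] by meson
 let ?E = "{D \<in> \<D>'. cyl D \<subseteq> V}"
 have E: "finite ?E" "?E \<subseteq> \<A>" using D' by auto
 have "K \<subseteq> (\<Union>D\<in>?E. cyl D)"
 proof
  fix p assume p: "p \<in> K"
  have "p \<in> (\<Union>D\<in>\<D>'. cyl D)" using subsetD[OF D'(3) subsetD[OF K(1) p]] .
  then obtain D where D: "D \<in> \<D>'" "p \<in> cyl D" by (rule UN_E)
  have "\<not> cyl D \<subseteq> S - K" using p D(2) by (meson DiffD2 subsetD)
  moreover have "D \<in> ?D" using subsetD[OF D'(1) D(1)] .
  ultimately have "D \<in> ?E" using D(1) by simp
  then show "p \<in> (\<Union>D\<in>?E. cyl D)" using D(2) by (rule UN_I)
 qed
 then have "K \<subseteq> cyl (\<Union>?E) \<and> cyl (\<Union>?E) \<subseteq> V" unfolding cyl_Union[OF E] by blast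
 then show ?thesis using finite_Union[OF E] by blast
qed

lemma open_separate:
 assumes "openin T V" "D \<in> \<A>"
 shows "openin T (V - cyl D)"
proof -
 have "V - cyl D = V \<inter> cyl (X - D)"
  using assms openin_subset[OF assms(1)] by (auto simp: cyl_compl topspace_T)
 then show ?thesis using assms openin_cyl[of "X - D"] by (auto intro: openin_Int)
qed

lemma regular_borel_probD:
 assumes "regular_borel_prob T Q"
 shows "openin T V ==> V \<in> sets Q" "sets Q = sigma_sets S {V. openin T V}"
  "A \<in> sets Q ==> emeasure Q A = (SUP K\<in>{K. K \<subseteq> A \<and> closedin T K}. emeasure Q K)"
  "A \<in> sets Q ==> emeasure Q A = (INF V\<in>{V. A \<subseteq> V \<and> openin T V}. emeasure Q V)"
proof -
 have *: "sets Q = sigma_sets S {V. openin T V}" and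
  **: "\<forall>A\<in>sets Q. emeasure Q A = (SUP K\<in>{K. K \<subseteq> A \<and> closedin T K}. emeasure Q K) \<and>
   emeasure Q A = (INF V\<in>{V. A \<subseteq> V \<and> openin T V}. emeasure Q V)"
  using assms unfolding regular_borel_prob_def topspace_T by blast+
 show "openin T V ==> V \<in> sets Q" unfolding * by (rule sigma_sets.Basic) simp
 show "sets Q = sigma_sets S {V. openin T V}" by (rule *)
 show "A \<in> sets Q ==> emeasure Q A = (SUP K\<in>{K. K \<subseteq> A \<and> closedin T K}. emeasure Q K)"
  "A \<in> sets Q ==> emeasure Q A = (INF V\<in>{V. A \<subseteq> V \<and> openin T V}. emeasure Q V)"
  using ** by blast+
qed

text \<open>Regularity and compactness determine a Borel measure from its values on clopen sets.\<close>

lemma regular_measure_open: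
 assumes "regular_borel_prob T P" "openin T V"
 shows "emeasure P V = (SUP D\<in>{D \<in> \<A>. cyl D \<subseteq> V}. emeasure P (cyl D))"
proof -
 have sets: "W \<in> sets P" if "openin T W" for W
  using regular_borel_probD(1)[OF assms(1) that] .
 have "emeasure P V = (SUP K\<in>{K. K \<subseteq> V \<and> closedin T K}. emeasure P K)"
  by (rule regular_borel_probD(3)[OF assms(1) sets[OF assms(2)]])
 also have "\<dots> \<le> (SUP D\<in>{D \<in> \<A>. cyl D \<subseteq> V}. emeasure P (cyl D))"
 proof (rule SUP_least)
  fix K assume "K \<in> {K. K \<subseteq> V \<and> closedin T K}"
  then have K: "K \<subseteq> V" "closedin T K" by simp_all
  obtain D where D: "D \<in> \<A>" "K \<subseteq> cyl D" "cyl D \<subseteq> V"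
   using closed_inside_open[OF K(2) assms(2) K(1)] by (elim bexE conjE)
  have "emeasure P K \<le> emeasure P (cyl D)"
   using D(2) sets[OF openin_cyl[OF D(1)]] by (rule emeasure_mono)
  also have "\<dots> \<le> (SUP D\<in>{D \<in> \<A>. cyl D \<subseteq> V}. emeasure P (cyl D))"
   using D by (intro SUP_upper) simp
  finally show "emeasure P K \<le> (SUP D\<in>{D \<in> \<A>. cyl D \<subseteq> V}. emeasure P (cyl D))" .
 qed
 finally show ?thesis
 proof (rule antisym)
  show "(SUP D\<in>{D \<in> \<A>. cyl D \<subseteq> V}. emeasure P (cyl D)) \<le> emeasure P V"
   by (rule SUP_least, rule emeasure_mono) (simp_all add: sets[OF assms(2)])
 qed
qed

lemma regular_measure_unique:
 assumes "regular_borel_prob T P" "regular_borel_prob T Q"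
  and "!!D. D \<in> \<A> ==> emeasure P (cyl D) = emeasure Q (cyl D)"
 shows "P = Q"
proof (rule measure_eqI)
 show eq: "sets P = sets Q" using regular_borel_probD(2) assms(1,2) by simp
 fix A assume A: "A \<in> sets P"
 have "emeasure P A = (INF V\<in>{V. A \<subseteq> V \<and> openin T V}. emeasure P V)"
  "emeasure Q A = (INF V\<in>{V. A \<subseteq> V \<and> openin T V}. emeasure Q V)"
  using regular_borel_probD(4)[OF assms(1) A] regular_borel_probD(4)[OF assms(2)] A eq by simp_all
 moreover have "emeasure P V = emeasure Q V" if "openin T V" for V
  using that assms by (simp add: regular_measure_open)
 ultimately show "emeasure P A = emeasure Q A" by simp
qed

end

locale stone_charge = stone X \<A> S cyl + charge X \<A> \<nu>
 for X :: "'x set" and \<A> and S :: "'s set" and cyl and \<nu>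
begin

definition lam :: "'s set => ennreal" where
 "lam V = (SUP D\<in>{D \<in> \<A>. cyl D \<subseteq> V}. ennreal (\<nu> D))"

definition outer :: "'s set => ennreal" where
 "outer A = (INF V\<in>{V. openin T V \<and> A \<subseteq> V}. lam V)"

lemma lam_upper: "D \<in> \<A> ==> cyl D \<subseteq> V ==> ennreal (\<nu> D) \<le> lam V"
 unfolding lam_def by (rule SUP_upper) simp

lemma lam_mono: "V \<subseteq> W ==> lam V \<le> lam W"
 unfolding lam_def by (rule SUP_subset_mono) auto

lemma lam_cyl:
 assumes D: "D \<in> \<A>"
 shows "lam (cyl D) = ennreal (\<nu> D)"
proof (rule antisym)
 show "lam (cyl D) \<le> ennreal (\<nu> D)" unfolding lam_def
 proof (rule SUP_least)
  fix E assume "E \<in> {E \<in> \<A>. cyl E \<subseteq> cyl D}"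
  then have "E \<in> \<A>" "E \<subseteq> D" using cyl_mono_iff[OF _ D] by auto
  then show "ennreal (\<nu> E) \<le> ennreal (\<nu> D)" by (intro ennreal_leI nu_mono D)
 qed
qed (simp add: lam_upper D)

lemma lam_S: "lam S = 1"
 using lam_cyl[of X] by (simp add: cyl_X total)

lemma nu_subadditive:
 assumes "finite I" "!!i. i \<in> I ==> D i \<in> \<A>"
 shows "\<nu> (\<Union>i\<in>I. D i) \<le> (\<Sum>i\<in>I. \<nu> (D i))"
 using assms
proof (induction I rule: finite_induct)
 case (insert i I)
 let ?U = "\<Union>i\<in>I. D i"
 have U: "?U \<in> \<A>" "D i \<in> \<A>" using insert by auto
 have "\<nu> (D i \<union> ?U) = \<nu> (D i \<union> (?U - D i))" by (rule arg_cong[where f = \<nu>]) blast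
 also have "\<dots> = \<nu> (D i) + \<nu> (?U - D i)" using U by (intro nu_Un) auto
 also have "\<dots> \<le> \<nu> (D i) + \<nu> ?U" using U by (intro add_left_mono nu_mono) auto
 also have "\<dots> \<le> \<nu> (D i) + (\<Sum>i\<in>I. \<nu> (D i))" using insert by simp
 finally show ?case using insert by simp
qed (simp add: nu_empty)

lemma lam_UN:
 assumes V: "!!i::nat. openin T (V i)"
 shows "lam (\<Union>i. V i) \<le> (\<Sum>i. lam (V i))"
 unfolding lam_def[of "\<Union>i. V i"]
proof (rule SUP_least)
 fix D assume "D \<in> {D \<in> \<A>. cyl D \<subseteq> (\<Union>i. V i)}"
 then have D: "D \<in> \<A>" "cyl D \<subseteq> (\<Union>i. V i)" by auto
 let ?D = "{E \<in> \<A>. \<exists>i. cyl E \<subseteq> V i}"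
 have "cyl D \<subseteq> (\<Union>E\<in>?D. cyl E)"
 proof
  fix p assume "p \<in> cyl D"
  then have "p \<in> (\<Union>i. V i)" by (rule subsetD[OF D(2)])
  then obtain i where "p \<in> V i" by (rule UN_E)
  then obtain E where "E \<in> \<A>" "p \<in> cyl E" "cyl E \<subseteq> V i"
   using V[of i] unfolding openin_T by meson
  then show "p \<in> (\<Union>E\<in>?D. cyl E)" by (intro UN_I[of E]) auto
 qed
 moreover have "?D \<subseteq> \<A>" by simp
 ultimately obtain \<D> where \<D>: "\<D> \<subseteq> ?D" "finite \<D>" "D \<subseteq> \<Union>\<D>" using cyl_compact'[OF D(1)] by meson
 have "\<forall>E\<in>\<D>. \<exists>i. cyl E \<subseteq> V i" using \<D>(1) by (simp add: subset_eq)
 then obtain ix where ix: "!!E. E \<in> \<D> ==> cyl E \<subseteq> V (ix E)" by (meson bchoice)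
 define W where "W i = \<Union>{E \<in> \<D>. ix E = i}" for i
 have W: "W i \<in> \<A>" "cyl (W i) \<subseteq> V i" for i
 proof -
  have *: "finite {E \<in> \<D>. ix E = i}" "{E \<in> \<D>. ix E = i} \<subseteq> \<A>"
   using \<D>(1,2) by (simp_all add: subset_eq)
  show "W i \<in> \<A>" unfolding W_def using finite_Union[OF *] .
  show "cyl (W i) \<subseteq> V i" unfolding W_def cyl_Union[OF *] using ix by (intro UN_least) auto
 qed
 have J: "finite (ix ` \<D>)" using \<D> by simp
 have "\<Union>\<D> \<subseteq> (\<Union>i\<in>ix ` \<D>. W i)" by (intro Union_least) (simp add: W_def Union_upper UN_upper subset_eq; blast)
 then have "D \<subseteq> (\<Union>i\<in>ix ` \<D>. W i)" using \<D>(3) by (rule order_trans[rotated])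
 then have "\<nu> D \<le> \<nu> (\<Union>i\<in>ix ` \<D>. W i)"
  by (rule nu_mono[OF D(1) finite_UN[OF J W(1)]])
 also have "\<dots> \<le> (\<Sum>i\<in>ix ` \<D>. \<nu> (W i))" by (rule nu_subadditive[OF J]) (rule W)
 finally have "ennreal (\<nu> D) \<le> (\<Sum>i\<in>ix ` \<D>. ennreal (\<nu> (W i)))"
  using W by (simp add: sum_ennreal nonneg ennreal_leI)
 also have "\<dots> \<le> (\<Sum>i\<in>ix ` \<D>. lam (V i))" by (intro sum_mono lam_upper W)
 also have "\<dots> \<le> (\<Sum>i. lam (V i))" by (rule sum_le_suminf[OF summableI J]) simp
 finally show "ennreal (\<nu> D) \<le> (\<Sum>i. lam (V i))" .
qed

lemma outer_open: "openin T V ==> outer V = lam V"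
 unfolding outer_def by (rule antisym; (rule INF_lower | rule INF_greatest)) (simp_all add: lam_mono)

lemma outer_mono: "A \<subseteq> B ==> outer A \<le> outer B"
 unfolding outer_def by (rule INF_superset_mono) (simp_all add: Collect_mono order_trans)

lemma outer_le_1: "A \<subseteq> S ==> outer A \<le> 1"
 using outer_mono[of A S] outer_open[of S] openin_topspace[of T] lam_S by (simp add: topspace_T)

lemma outer_approx:
 assumes "A \<subseteq> S" "0 < (e :: real)"
 shows "\<exists>V. openin T V \<and> A \<subseteq> V \<and> lam V \<le> outer A + e"
proof -
 have "outer A < outer A + e"
 proof (cases "outer A" rule: ennreal_cases)
  case (real r)
  then show ?thesis using assms(2) by (simp add: ennreal_less_iff flip: ennreal_plus)
 next
  case top
  then show ?thesis using outer_le_1[OF assms(1)] by (simp add: top_unique)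
 qed
 then obtain V where "openin T V" "A \<subseteq> V" "lam V < outer A + e"
  unfolding outer_def[of A] INF_less_iff by (elim bexE) auto
 then show ?thesis by (intro exI[of _ V]) simp
qed

lemma outer_measure_space: "outer_measure_space (Pow S) outer"
 unfolding outer_measure_space_def
proof (intro conjI)
 show "positive (Pow S) outer"
  using outer_open[of "{}"] lam_cyl[of "{}"] by (simp add: positive_def cyl_empty nu_empty)
 show "increasing (Pow S) outer" by (auto simp: increasing_def intro: outer_mono)
 show "countably_subadditive (Pow S) outer"
  unfolding countably_subadditive_def
 proof (intro allI impI)
  fix A :: "nat => 's set" assume A: "range A \<subseteq> Pow S"
  show "outer (\<Union>i. A i) \<le> (\<Sum>i. outer (A i))"
  proof (rule ennreal_le_epsilon)
   fix e :: real assume "0 < e"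
   then have "\<exists>V. openin T V \<and> A i \<subseteq> V \<and> lam V \<le> outer (A i) + ennreal (e * (1 / 2) ^ Suc i)" for i
    using A by (intro outer_approx) auto
   then obtain V where V: "!!i. openin T (V i)" "!!i. A i \<subseteq> V i"
    "!!i. lam (V i) \<le> outer (A i) + ennreal (e * (1 / 2) ^ Suc i)" by metis
   have "outer (\<Union>i. A i) \<le> lam (\<Union>i. V i)"
    using V by (subst outer_open[symmetric]) (auto intro!: outer_mono)
   also have "\<dots> \<le> (\<Sum>i. lam (V i))" by (rule lam_UN) (rule V)
   also have "\<dots> \<le> (\<Sum>i. outer (A i) + ennreal (e * (1 / 2) ^ Suc i))"
    by (intro suminf_le V) auto
   also have "\<dots> = (\<Sum>i. outer (A i)) + (\<Sum>i. ennreal (e * (1 / 2) ^ Suc i))"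
    by (intro suminf_add[symmetric]) auto
   also have "(\<Sum>i. ennreal (e * (1 / 2) ^ Suc i)) = ennreal e"
    using \<open>0 < e\<close> sums_mult[OF power_half_series, of e]
    by (intro suminf_ennreal_eq) (auto intro: less_imp_le)
   finally show "outer (\<Union>i. A i) \<le> (\<Sum>i. outer (A i)) + ennreal e" .
  qed
 qed
qed

text \<open>Open sets are measurable in the sense of Caratheodory although they need not be countable
 unions of clopen sets: a clopen set inside carries almost all of the content.\<close>

lemma open_lambda:
 assumes V: "openin T V"
 shows "V \<in> lambda_system S (Pow S) outer"
proof -
 interpret Pow: sigma_algebra S "Pow S" by (rule sigma_algebra_Pow)
 have "outer (A \<inter> V) + outer (A - V) = outer A" if A: "A \<subseteq> S" for A
 proof (rule antisym)
  show "outer A \<le> outer (A \<inter> V) + outer (A - V)"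
  proof -
   have "subadditive (Pow S) outer"
    using outer_measure_space by (auto simp: outer_measure_space_def intro!: Pow.countably_subadditive_subadditive)
   then have "outer ((A \<inter> V) \<union> (A - V)) \<le> outer (A \<inter> V) + outer (A - V)"
    by (rule subadditiveD) (use A in auto)
   then show ?thesis by (simp add: Int_Diff_Un)
  qed
  show "outer (A \<inter> V) + outer (A - V) \<le> outer A"
   unfolding outer_def[of A]
  proof (rule INF_greatest)
   fix W assume "W \<in> {W. openin T W \<and> A \<subseteq> W}"
   then have W: "openin T W" "A \<subseteq> W" by auto
   have "lam (W \<inter> V) + outer (A - V) \<le> lam W"
    unfolding lam_def[of "W \<inter> V"]
   proof (subst ennreal_SUP_add_left[symmetric])
    show "{D \<in> \<A>. cyl D \<subseteq> W \<inter> V} \<noteq> {}" using cyl_empty by auto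
    show "(SUP D\<in>{D \<in> \<A>. cyl D \<subseteq> W \<inter> V}. ennreal (\<nu> D) + outer (A - V)) \<le> lam W"
    proof (rule SUP_least)
     fix D assume "D \<in> {D \<in> \<A>. cyl D \<subseteq> W \<inter> V}"
     then have D: "D \<in> \<A>" "cyl D \<subseteq> W" "cyl D \<subseteq> V" by auto
     have "outer (A - V) \<le> outer (W - cyl D)" using W D by (intro outer_mono) auto
     also have "\<dots> = lam (W - cyl D)" using open_separate[OF W(1) D(1)] by (rule outer_open)
     finally have "ennreal (\<nu> D) + outer (A - V) \<le> ennreal (\<nu> D) + lam (W - cyl D)"
      by (rule add_left_mono)
     also have "\<dots> = lam (W - cyl D) + ennreal (\<nu> D)" by (rule add.commute)
     also have "\<dots> \<le> lam W"
      unfolding lam_def[of "W - cyl D"]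
     proof (subst ennreal_SUP_add_left[symmetric])
      show "{E \<in> \<A>. cyl E \<subseteq> W - cyl D} \<noteq> {}" using cyl_empty by auto
      show "(SUP E\<in>{E \<in> \<A>. cyl E \<subseteq> W - cyl D}. ennreal (\<nu> E) + ennreal (\<nu> D)) \<le> lam W"
      proof (rule SUP_least)
       fix E assume "E \<in> {E \<in> \<A>. cyl E \<subseteq> W - cyl D}"
       then have E: "E \<in> \<A>" "cyl E \<subseteq> W" "cyl D \<inter> cyl E = {}" by auto
       then have "D \<inter> E = {}" using D cyl_Int[of D E] cyl_empty_iff[of "D \<inter> E"] by auto
       then have "ennreal (\<nu> E) + ennreal (\<nu> D) = ennreal (\<nu> (D \<union> E))"
        using D E by (simp add: nu_Un nonneg add.commute)
       also have "\<dots> \<le> lam W" using D E by (intro lam_upper) (auto simp: cyl_Un)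
       finally show "ennreal (\<nu> E) + ennreal (\<nu> D) \<le> lam W" .
      qed
     qed
     finally show "ennreal (\<nu> D) + outer (A - V) \<le> lam W" .
    qed
   qed
   moreover have "outer (A \<inter> V) \<le> lam (W \<inter> V)"
    using outer_open[OF openin_Int[OF W(1) V]] outer_mono[of "A \<inter> V" "W \<inter> V"] W(2) by auto
   ultimately show "outer (A \<inter> V) + outer (A - V) \<le> lam W"
    by (meson add_right_mono order_trans)
  qed
 qed
 then show ?thesis
  using V openin_subset[OF V] unfolding Pow.lambda_system_eq by (auto simp: topspace_T)
qed

definition P :: "'s measure" where
 "P = measure_of S {V. openin T V} outer"

lemma
 shows space_P: "space P = S" and sets_P: "sets P = sigma_sets S {V. openin T V}"
  and emeasure_P: "A \<in> sets P ==> emeasure P A = outer A"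
proof -
 interpret Pow: sigma_algebra S "Pow S" by (rule sigma_algebra_Pow)
 have opens: "{V. openin T V} \<subseteq> Pow S" using openin_subset[of T] by (auto simp: topspace_T)
 show "space P = S" "sets P = sigma_sets S {V. openin T V}"
  using opens by (auto simp: P_def space_measure_of_conv sets_measure_of_conv)
 have ms: "measure_space S (lambda_system S (Pow S) outer) outer"
  using Pow.caratheodory_lemma[OF outer_measure_space] .
 have sub: "sigma_sets S {V. openin T V} \<subseteq> lambda_system S (Pow S) outer"
  using ms open_lambda by (intro sigma_algebra.sigma_sets_subset) (auto simp: measure_space_def)
 have "measure_space S (sigma_sets S {V. openin T V}) outer"
  unfolding measure_space_def
 proof (intro conjI)
  show "sigma_algebra S (sigma_sets S {V. openin T V})" by (rule sigma_algebra_sigma_sets[OF opens])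
  show "positive (sigma_sets S {V. openin T V}) outer"
   using ms by (auto simp: measure_space_def positive_def)
  show "countably_additive (sigma_sets S {V. openin T V}) outer"
   using ms sub by (auto simp: measure_space_def countably_additive_def)
 qed
 then show "emeasure P A = outer A" if "A \<in> sets P"
  using that \<open>sets P = _\<close> by (intro emeasure_measure_of[OF P_def opens]) (simp_all add: measure_space_def)
qed

lemma open_sets: "openin T V ==> V \<in> sets P"
 by (auto simp: sets_P)

lemma emeasure_cyl: "D \<in> \<A> ==> emeasure P (cyl D) = ennreal (\<nu> D)"
 by (simp add: emeasure_P open_sets openin_cyl outer_open lam_cyl)

lemma regular_P: "regular_borel_prob T P"
 unfolding regular_borel_prob_def
proof (intro conjI ballI)
 show "space P = topspace T" "sets P = sigma_sets (topspace T) {V. openin T V}"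
  by (simp_all add: space_P sets_P topspace_T)
 show prob: "prob_space P"
  using emeasure_cyl[of X] by (intro prob_spaceI) (simp add: space_P cyl_X total)
 interpret prob_space P by (rule prob)
 fix A assume A: "A \<in> sets P"
 have AS: "A \<subseteq> S" using sets.sets_into_space[OF A] by (simp add: space_P)
 have out: "emeasure P B = (INF V\<in>{V. B \<subseteq> V \<and> openin T V}. emeasure P V)" if "B \<in> sets P" for B
  unfolding emeasure_P[OF that] outer_def
  by (intro INF_cong) (auto simp: emeasure_P open_sets outer_open)
 show "emeasure P A = (INF V\<in>{V. A \<subseteq> V \<and> openin T V}. emeasure P V)" by (rule out[OF A])
 show "emeasure P A = (SUP K\<in>{K. K \<subseteq> A \<and> closedin T K}. emeasure P K)"
 proof (rule antisym)
  have cl: "K \<in> sets P" if "closedin T K" for K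
  proof -
   have "K = space P - (S - K)" using that closedin_subset[OF that] by (auto simp: space_P topspace_T)
   moreover have "S - K \<in> sets P" using that by (intro open_sets) (auto simp: closedin_def topspace_T)
   ultimately show ?thesis by (metis sets.compl_sets)
  qed
  show "emeasure P A \<le> (SUP K\<in>{K. K \<subseteq> A \<and> closedin T K}. emeasure P K)"
  proof (rule ennreal_le_epsilon)
   fix e :: real assume "0 < e"
   have AC: "S - A \<in> sets P" using sets.compl_sets[OF A] by (simp add: space_P)
   from outer_approx[of "S - A" e] \<open>0 < e\<close> obtain V where
    V: "openin T V" "S - A \<subseteq> V" "lam V \<le> outer (S - A) + e" by auto
   have VS: "V \<subseteq> S" using openin_subset[OF V(1)] by (simp add: topspace_T)
   have K: "closedin T (S - V)" "S - V \<subseteq> A" using V AS by (auto simp: topspace_T[symmetric])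
   have "emeasure P V \<le> emeasure P (S - A) + e"
    using V AC by (simp add: emeasure_P open_sets outer_open)
   then have "ennreal (measure P V) \<le> ennreal (measure P (S - A) + e)"
    using \<open>0 < e\<close> by (simp add: emeasure_eq_measure ennreal_plus)
   then have "measure P V \<le> measure P (S - A) + e" using \<open>0 < e\<close> by (subst (asm) ennreal_le_iff) simp_all
   moreover have "measure P (S - A) = 1 - measure P A" using prob_compl[OF A] by (simp add: space_P)
   moreover have "measure P (S - V) = 1 - measure P V"
    using prob_compl[OF open_sets[OF V(1)]] by (simp add: space_P)
   ultimately have "measure P A \<le> measure P (S - V) + e" by linarith
   then have "emeasure P A \<le> emeasure P (S - V) + e"
    using \<open>0 < e\<close> by (simp add: emeasure_eq_measure flip: ennreal_plus)
   also have "emeasure P (S - V) \<le> (SUP K\<in>{K. K \<subseteq> A \<and> closedin T K}. emeasure P K)"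
    using K by (intro SUP_upper) auto
   finally show "emeasure P A \<le> (SUP K\<in>{K. K \<subseteq> A \<and> closedin T K}. emeasure P K) + e"
    by (simp add: add_right_mono)
  qed
  show "(SUP K\<in>{K. K \<subseteq> A \<and> closedin T K}. emeasure P K) \<le> emeasure P A"
   by (intro SUP_least emeasure_mono) (use A in auto)
 qed
qed

theorem stone_regular_borel:
 "\<exists>!P. regular_borel_prob T P \<and> (\<forall>D\<in>\<A>. measure P (cyl D) = \<nu> D)"
proof (rule ex1I[of _ P])
 show "regular_borel_prob T P \<and> (\<forall>D\<in>\<A>. measure P (cyl D) = \<nu> D)"
  using regular_P by (auto simp: measure_def emeasure_cyl nonneg)
 fix Q assume Q: "regular_borel_prob T Q \<and> (\<forall>D\<in>\<A>. measure Q (cyl D) = \<nu> D)"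
 then interpret Q: prob_space Q by (simp add: regular_borel_prob_def)
 show "Q = P"
  using Q by (intro regular_measure_unique[OF _ regular_P])
   (auto simp: emeasure_cyl Q.emeasure_eq_measure)
qed

end

section \<open>Type spaces\<close>

definition tcyl :: "('f, 'r) lang => ('a, 'f, 'r) struct => 'a set => nat => 'a list set
  => (('f, 'r) form \<times> 'a list) set set" where
 "tcyl L U A n D = {p \<in> types L U A n. \<exists>(\<phi>, c)\<in>p. D = defset U n \<phi> c}"

locale base_set =
 fixes L :: "('f, 'r) lang" and U :: "('a, 'f, 'r) struct" and A :: "'a set"
 assumes univ_ne: "univ U \<noteq> {}" and A_univ: "A \<subseteq> univ U"
begin

abbreviation "X n \<equiv> tuples n (univ U)"

lemma algebra_def: "algebra (X n) (definable L U A n)"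
 by (rule definable_algebra[OF univ_ne A_univ])

lemma typesD:
 assumes "p \<in> types L U A n"
 shows "p \<subseteq> param_fms L A n"
  and "F \<subseteq> p ==> finite F ==> \<exists>b\<in>X n. \<forall>(\<phi>, c)\<in>F. holds U \<phi> (b @ c)"
  and "(\<phi>, c) \<in> param_fms L A n ==> (\<phi>, c) \<in> p \<or> (Neg \<phi>, c) \<in> p"
 using assms by (auto simp: types_def)

lemma type_consequence:
 assumes p: "p \<in> types L U A n" and "finite \<D>" "!!D. D \<in> \<D> ==> p \<in> tcyl L U A n D"
  and E: "(\<psi>, d) \<in> param_fms L A n" "X n \<inter> \<Inter>\<D> \<subseteq> defset U n \<psi> d"
 shows "(\<psi>, d) \<in> p"
proof (rule ccontr)
 assume "(\<psi>, d) \<notin> p"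
 then have neg: "(Neg \<psi>, d) \<in> p" using typesD(3)[OF p E(1)] by blast
 have "\<forall>D\<in>\<D>. \<exists>x. x \<in> p \<and> D = defset U n (fst x) (snd x)"
  using assms(3) by (fastforce simp: tcyl_def)
 then obtain f where f: "!!D. D \<in> \<D> ==> f D \<in> p" "!!D. D \<in> \<D> ==> defset U n (fst (f D)) (snd (f D)) = D"
  by metis
 have "insert (Neg \<psi>, d) (f ` \<D>) \<subseteq> p" "finite (insert (Neg \<psi>, d) (f ` \<D>))"
  using f(1) neg assms(2) by auto
 from typesD(2)[OF p this] obtain b where b: "b \<in> X n" "\<not> holds U \<psi> (b @ d)"
  "!!D. D \<in> \<D> ==> holds U (fst (f D)) (b @ snd (f D))" by force
 have "b \<in> D" if "D \<in> \<D>" for D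
  using b(1) b(3)[OF that] f(2)[OF that] unfolding defset_def by blast
 then have "b \<in> defset U n \<psi> d" using E(2) b(1) by blast
 then show False using b(2) by (simp add: defset_def)
qed

lemma tcyl_defset:
 assumes "(\<phi>, c) \<in> param_fms L A n"
 shows "tcyl L U A n (defset U n \<phi> c) = basic_open L U A n (\<phi>, c)"
proof (rule set_eqI)
 fix p
 show "p \<in> tcyl L U A n (defset U n \<phi> c) \<longleftrightarrow> p \<in> basic_open L U A n (\<phi>, c)"
  using type_consequence[of p n "{defset U n \<phi> c}" \<phi> c] assms
  by (auto simp: basic_open_def tcyl_def)
qed

lemma tcyl_consequence:
 assumes "p \<in> types L U A n" "finite \<D>" "!!D. D \<in> \<D> ==> p \<in> tcyl L U A n D"
  and "E \<in> definable L U A n" "X n \<inter> \<Inter>\<D> \<subseteq> E"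
 shows "p \<in> tcyl L U A n E"
 using type_consequence[OF assms(1-3)] assms(1,4,5) unfolding tcyl_def definable_def by force

lemma tcyl_compl:
 assumes p: "p \<in> types L U A n" and D: "D \<in> definable L U A n"
 shows "p \<in> tcyl L U A n (X n - D) \<longleftrightarrow> p \<notin> tcyl L U A n D"
proof
 obtain \<phi> c where \<phi>: "(\<phi>, c) \<in> param_fms L A n" "D = defset U n \<phi> c"
  using D by (auto simp: definable_def)
 have N: "X n - D = defset U n (Neg \<phi>) c" "(Neg \<phi>, c) \<in> param_fms L A n"
  using \<phi> by (auto simp: defset_def param_fms_def fm_Neg)
 show "p \<notin> tcyl L U A n D ==> p \<in> tcyl L U A n (X n - D)"
  using typesD(3)[OF p \<phi>(1)] p N(2)
  unfolding N(1) unfolding \<phi>(2) tcyl_defset[OF \<phi>(1)] tcyl_defset[OF N(2)] basic_open_def by simp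
 assume "p \<in> tcyl L U A n (X n - D)"
 then have "(Neg \<phi>, c) \<in> p" unfolding N(1) tcyl_defset[OF N(2)] by (simp add: basic_open_def)
 moreover have "(\<phi>, c) \<notin> p" if "(Neg \<phi>, c) \<in> p"
  using typesD(2)[OF p, of "{(\<phi>, c), (Neg \<phi>, c)}"] that by auto
 ultimately show "p \<notin> tcyl L U A n D"
  unfolding \<phi>(2) tcyl_defset[OF \<phi>(1)] by (simp add: basic_open_def)
qed

lemma tp_types: "b \<in> X n ==> tp L U A b \<in> types L U A n"
 by (auto simp: types_def tp_def tuplesD param_fms_def fm_Neg intro!: bexI[of _ b])

lemma tp_tcyl:
 assumes "b \<in> X n" "D \<in> definable L U A n"
 shows "tp L U A b \<in> tcyl L U A n D \<longleftrightarrow> b \<in> D"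
proof -
 obtain \<phi> c where \<phi>: "(\<phi>, c) \<in> param_fms L A n" "D = defset U n \<phi> c"
  using assms(2) by (auto simp: definable_def)
 show ?thesis unfolding \<phi>(2) tcyl_defset[OF \<phi>(1)]
  using tp_types[OF assms(1)] assms(1) \<phi>(1) by (auto simp: basic_open_def tp_def defset_def tuplesD)
qed

text \<open>Compactness of the type space: a finitely satisfiable set of formulas extends to a maximal
 one.\<close>

lemma extend_to_type:
 assumes "p0 \<subseteq> param_fms L A n"
  and "!!F. F \<subseteq> p0 ==> finite F ==> \<exists>b\<in>X n. \<forall>(\<phi>, c)\<in>F. holds U \<phi> (b @ c)"
 shows "\<exists>p\<in>types L U A n. p0 \<subseteq> p"
proof -
 let ?fs = "\<lambda>p. \<forall>F\<subseteq>p. finite F --> (\<exists>b\<in>X n. \<forall>(\<phi>, c)\<in>F. holds U \<phi> (b @ c))"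
 let ?Z = "{p. p0 \<subseteq> p \<and> p \<subseteq> param_fms L A n \<and> ?fs p}"
 have "\<exists>p\<in>?Z. \<forall>q\<in>?Z. p \<subseteq> q --> q = p"
 proof (rule subset_Zorn_nonempty)
  show "?Z \<noteq> {}" using assms by blast
  fix \<C> assume C: "\<C> \<noteq> {}" "subset.chain ?Z \<C>"
  have sub: "\<C> \<subseteq> ?Z" using C(2) by (simp add: subset.chain_def)
  have subD: "p0 \<subseteq> q" "q \<subseteq> param_fms L A n" "?fs q" if "q \<in> \<C>" for q
   using subsetD[OF sub that] by simp_all
  have "?fs (\<Union>\<C>)"
  proof (intro allI impI)
   fix F assume F: "F \<subseteq> \<Union>\<C>" "finite F"
   obtain q where q: "q \<in> \<C>" "F \<subseteq> q"
    by (rule finite_subset_Union_chain[OF F(2,1) C(1) C(2)])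
   show "\<exists>b\<in>X n. \<forall>(\<phi>, c)\<in>F. holds U \<phi> (b @ c)"
    by (rule subD(3)[OF q(1), rule_format, OF q(2) F(2)])
  qed
  moreover obtain q where "q \<in> \<C>" using C(1) by (meson ex_in_conv)
  then have "p0 \<subseteq> \<Union>\<C>" using subD(1) by (meson Union_upper order_trans)
  moreover have "\<Union>\<C> \<subseteq> param_fms L A n" by (rule Union_least) (rule subD(2))
  ultimately show "\<Union>\<C> \<in> ?Z" by simp
 qed
 then obtain p where pZ: "p \<in> ?Z" and mx: "\<forall>q\<in>?Z. p \<subseteq> q --> q = p" by (rule bexE)
 have p: "p0 \<subseteq> p" "p \<subseteq> param_fms L A n" "?fs p" using pZ by simp_all
 have max: "q = p" if "q \<in> ?Z" "p \<subseteq> q" for q using mx that by blast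
 have "(\<phi>, c) \<in> p \<or> (Neg \<phi>, c) \<in> p" if \<phi>: "(\<phi>, c) \<in> param_fms L A n" for \<phi> c
 proof (rule ccontr)
  assume no: "\<not> ?thesis"
  have N: "(Neg \<phi>, c) \<in> param_fms L A n" using \<phi> by (auto simp: param_fms_def fm_Neg)
  have bad: "\<exists>F. F \<subseteq> p \<and> finite F \<and>
    (\<forall>b\<in>X n. (\<forall>(\<psi>, d)\<in>F. holds U \<psi> (b @ d)) --> \<not> holds U \<theta> (b @ c))"
   if \<theta>: "(\<theta>, c) \<in> param_fms L A n" "(\<theta>, c) \<notin> p" for \<theta>
  proof (rule ccontr)
   assume *: "\<not> ?thesis"
   have "insert (\<theta>, c) p \<in> ?Z"
   proof (intro CollectI conjI allI impI)
    fix F assume F: "F \<subseteq> insert (\<theta>, c) p" "finite F"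
    define G where "G = F - {(\<theta>, c)}"
    have "G \<subseteq> p" "finite G" using F by (auto simp: G_def)
    with * have "\<not> (\<forall>b\<in>X n. (\<forall>(\<psi>, d)\<in>G. holds U \<psi> (b @ d)) --> \<not> holds U \<theta> (b @ c))"
     by metis
    then obtain b where b: "b \<in> X n" "\<forall>(\<psi>, d)\<in>G. holds U \<psi> (b @ d)" "holds U \<theta> (b @ c)" by blast
    have "case x of (\<psi>, d) => holds U \<psi> (b @ d)" if "x \<in> F" for x
     using b that by (cases "x = (\<theta>, c)") (simp_all add: G_def)
    then show "\<exists>b\<in>X n. \<forall>(\<psi>, d)\<in>F. holds U \<psi> (b @ d)" using b(1) by (intro bexI[of _ b] ballI)
   qed (use p(1,2) \<theta>(1) in auto)
   from max[OF this subset_insertI] show False using \<theta>(2) by (metis insertI1)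
  qed
  from bad[OF \<phi>] no obtain F where F: "F \<subseteq> p" "finite F"
   "!!b. b \<in> X n ==> (\<forall>(\<psi>, d)\<in>F. holds U \<psi> (b @ d)) ==> \<not> holds U \<phi> (b @ c)" by metis
  from bad[OF N] no obtain G where G: "G \<subseteq> p" "finite G"
   "!!b. b \<in> X n ==> (\<forall>(\<psi>, d)\<in>G. holds U \<psi> (b @ d)) ==> \<not> holds U (Neg \<phi>) (b @ c)" by metis
  have "F \<union> G \<subseteq> p" "finite (F \<union> G)" using F(1,2) G(1,2) by simp_all
  from p(3)[rule_format, OF this] obtain b where b: "b \<in> X n" "\<forall>(\<psi>, d)\<in>F \<union> G. holds U \<psi> (b @ d)"
   by (rule bexE)
  have "\<forall>(\<psi>, d)\<in>F. holds U \<psi> (b @ d)" "\<forall>(\<psi>, d)\<in>G. holds U \<psi> (b @ d)"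
   using b(2) by (simp_all add: ball_Un)
  then show False using F(3)[OF b(1)] G(3)[OF b(1)] by simp
 qed
 then have "p \<in> types L U A n" using p(2,3) unfolding types_def mem_Collect_eq by (intro conjI) auto
 then show ?thesis using p(1) by blast
qed

lemma stone_types: "stone (X n) (definable L U A n) (types L U A n) (tcyl L U A n)"
proof -
 interpret algebra "X n" "definable L U A n" by (rule algebra_def)
 have sub: "tcyl L U A n D \<subseteq> types L U A n" for D by (auto simp: tcyl_def)
 show ?thesis
 proof
  fix D assume D: "D \<in> definable L U A n"
  show "tcyl L U A n D \<subseteq> types L U A n" by (rule sub)
  show "tcyl L U A n (X n - D) = types L U A n - tcyl L U A n D"
   using tcyl_compl[OF _ D] sub by blast
  show "tcyl L U A n D = {} \<longleftrightarrow> D = {}"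
  proof
   assume *: "tcyl L U A n D = {}"
   show "D = {}"
   proof (rule ccontr)
    assume "D \<noteq> {}"
    then obtain b where b: "b \<in> D" by blast
    then have "b \<in> X n" using definable_tuples[OF D] by blast
    then show False using tp_tcyl[OF _ D] b * by blast
   qed
  next
   assume *: "D = {}"
   show "tcyl L U A n D = {}"
   proof (rule ccontr)
    assume "tcyl L U A n D \<noteq> {}"
    then obtain p \<phi> c where p: "p \<in> types L U A n" "(\<phi>, c) \<in> p" "D = defset U n \<phi> c"
     by (auto simp: tcyl_def)
    then have "\<exists>b\<in>X n. holds U \<phi> (b @ c)" using typesD(2)[OF p(1), of "{(\<phi>, c)}"] by simp
    then show False using p(3) * by (auto simp: defset_def)
   qed
  qed
  fix E assume E: "E \<in> definable L U A n"
  show "tcyl L U A n (D \<inter> E) = tcyl L U A n D \<inter> tcyl L U A n E"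
  proof (intro equalityI subsetI IntI)
   fix p assume "p \<in> tcyl L U A n (D \<inter> E)"
   then have p: "p \<in> types L U A n" "!!F. F \<in> {D \<inter> E} ==> p \<in> tcyl L U A n F" using sub by auto
   show "p \<in> tcyl L U A n D"
    by (rule tcyl_consequence[where \<D> = "{D \<inter> E}", OF p(1) _ p(2) D]) auto
   show "p \<in> tcyl L U A n E"
    by (rule tcyl_consequence[where \<D> = "{D \<inter> E}", OF p(1) _ p(2) E]) auto
  next
   fix p assume "p \<in> tcyl L U A n D \<inter> tcyl L U A n E"
   then have p: "p \<in> types L U A n" "!!F. F \<in> {D, E} ==> p \<in> tcyl L U A n F" using sub by auto
   show "p \<in> tcyl L U A n (D \<inter> E)" 
    by (rule tcyl_consequence[where \<D> = "{D, E}", OF p(1) _ p(2) Int[OF D E]]) auto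
  qed
 next
  fix \<D> assume \<D>: "\<D> \<subseteq> definable L U A n" and cover: "types L U A n \<subseteq> (\<Union>D\<in>\<D>. tcyl L U A n D)"
  show "\<exists>\<D>'\<subseteq>\<D>. finite \<D>' \<and> types L U A n \<subseteq> (\<Union>D\<in>\<D>'. tcyl L U A n D)"
  proof (rule ccontr)
   assume no: "\<not> ?thesis"
   let ?p0 = "{(\<phi>, c) \<in> param_fms L A n. X n - defset U n \<phi> c \<in> \<D>}"
   have "\<exists>b\<in>X n. \<forall>(\<phi>, c)\<in>F. holds U \<phi> (b @ c)" if F: "F \<subseteq> ?p0" "finite F" for F
   proof -
    let ?D = "(\<lambda>(\<phi>, c). X n - defset U n \<phi> c) ` F"
    have "?D \<subseteq> \<D>" "finite ?D" using F by auto
    then obtain p where p: "p \<in> types L U A n" "!!D. D \<in> ?D ==> p \<notin> tcyl L U A n D"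
     using no by (meson UN_I subsetI)
    have "F \<subseteq> p"
    proof
     fix x assume "x \<in> F"
     moreover obtain \<phi> c where x: "x = (\<phi>, c)" by fastforce
     ultimately have *: "(\<phi>, c) \<in> param_fms L A n" "p \<notin> tcyl L U A n (X n - defset U n \<phi> c)"
      using F(1) p(2)[of "X n - defset U n \<phi> c"] by force+
     then have "p \<in> tcyl L U A n (defset U n \<phi> c)"
      using tcyl_compl[OF p(1)] by (auto simp: definable_def)
     then show "x \<in> p" unfolding tcyl_defset[OF *(1)] x by (simp add: basic_open_def)
    qed
    then show ?thesis using typesD(2)[OF p(1)] F(2) by blast
   qed
   then obtain p where p: "p \<in> types L U A n" "?p0 \<subseteq> p" using extend_to_type[of ?p0 n] by auto
   then obtain D where D: "D \<in> \<D>" "p \<in> tcyl L U A n D" using cover by blast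
   then have "D \<in> definable L U A n" using \<D> by blast
   then obtain \<phi> c where \<phi>: "(\<phi>, c) \<in> param_fms L A n" "D = defset U n \<phi> c"
    by (auto simp: definable_def)
   have N: "X n - defset U n (Neg \<phi>) c = D" "(Neg \<phi>, c) \<in> param_fms L A n"
    using \<phi> by (auto simp: defset_def param_fms_def fm_Neg)
   then have "(Neg \<phi>, c) \<in> p" using p(2) D(1) by auto
   moreover have "(\<phi>, c) \<in> p" using D(2) unfolding \<phi>(2) tcyl_defset[OF \<phi>(1)] by (simp add: basic_open_def)
   ultimately show False using typesD(2)[OF p(1), of "{(\<phi>, c), (Neg \<phi>, c)}"] by auto
  qed
 qed
qed

lemma type_space_T: "type_space L U A n = stone.T (definable L U A n) (tcyl L U A n)"
proof -
 interpret stone "X n" "definable L U A n" "types L U A n" "tcyl L U A n" by (rule stone_types)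
 have "basic_open L U A n ` param_fms L A n = tcyl L U A n ` definable L U A n"
  using tcyl_defset by (force simp: definable_def image_iff)
 then show ?thesis by (simp add: T_def type_space_def)
qed

end

section \<open>Keisler measures and their Morley products\<close>

lemma keisler_charge:
 assumes "keisler L U n \<nu>" "univ U \<noteq> {}" "A \<subseteq> univ U"
 shows "charge (tuples n (univ U)) (definable L U A n) \<nu>"
proof -
 interpret algebra "tuples n (univ U)" "definable L U A n" by (rule definable_algebra[OF assms(2,3)])
 have sub: "D \<in> definable L U (univ U) n" if "D \<in> definable L U A n" for D
  using definable_mono[OF assms(3)] that by blast
 show ?thesis
  by unfold_locales (use assms(1) sub in \<open>auto simp: keisler_def additive_def\<close>)
qed

lemma step_algebra_mono: "step X \<A> h ==> \<A> \<subseteq> \<B> ==> step X \<B> h"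
 by (auto simp: step_def)

lemma lint_algebra_mono:
 assumes "charge X \<A> \<nu>" "charge X \<B> \<nu>" "\<A> \<subseteq> \<B>" "tame X \<A> f"
 shows "lint X \<B> \<nu> f = lint X \<A> \<nu> f"
proof (rule ccontr)
 assume "\<not> ?thesis"
 then have "\<bar>lint X \<B> \<nu> f - lint X \<A> \<nu> f\<bar> / 3 > 0" by simp
 then obtain h where h: "step X \<A> h" "!!x. x \<in> X ==> \<bar>f x - h x\<bar> \<le> \<bar>lint X \<B> \<nu> f - lint X \<A> \<nu> f\<bar> / 3"
  using assms(4) unfolding tame_def by meson
 have "\<bar>lint X \<A> \<nu> f - sint X \<nu> h\<bar> \<le> \<bar>lint X \<B> \<nu> f - lint X \<A> \<nu> f\<bar> / 3"
  by (rule charge.lint_approx[OF assms(1) h(1)]) (rule h(2))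
 moreover have "\<bar>lint X \<B> \<nu> f - sint X \<nu> h\<bar> \<le> \<bar>lint X \<B> \<nu> f - lint X \<A> \<nu> f\<bar> / 3"
  by (rule charge.lint_approx[OF assms(2) step_algebra_mono[OF h(1) assms(3)]]) (rule h(2))
 moreover have "\<bar>lint X \<B> \<nu> f - lint X \<A> \<nu> f\<bar>
   \<le> \<bar>lint X \<A> \<nu> f - sint X \<nu> h\<bar> + \<bar>lint X \<B> \<nu> f - sint X \<nu> h\<bar>" by arith
 moreover have "d \<le> 0" if "p \<le> d / 3" "q \<le> d / 3" "d \<le> p + q" for d p q :: real
  using that by linarith
 ultimately have "\<bar>lint X \<B> \<nu> f - lint X \<A> \<nu> f\<bar> \<le> 0" by metis
 then show False using \<open>_ > 0\<close> by simp
qed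

text \<open>A function squeezed between measurable functions with almost equal integrals is measurable
 for the completed measure.\<close>

lemma sandwich_completion:
 fixes f :: "'q => real"
 assumes "prob_space P"
  and "!!j::nat. \<exists>G H. G \<in> borel_measurable P \<and> H \<in> borel_measurable P \<and>
   (\<forall>q\<in>space P. 0 \<le> G q \<and> G q \<le> f q \<and> f q \<le> H q \<and> H q \<le> 1) \<and>
   integral\<^sup>L P G \<ge> I - 1 / Suc j \<and> integral\<^sup>L P H \<le> I + 1 / Suc j"
 shows "f \<in> borel_measurable (completion P) \<and> integral\<^sup>L (completion P) f = I"
proof -
 interpret prob_space P by (rule assms(1))
 obtain G H where GH[measurable]: "!!j. G j \<in> borel_measurable P" "!!j. H j \<in> borel_measurable P"
  and b: "!!j q. q \<in> space P ==> 0 \<le> G j q \<and> G j q \<le> f q \<and> f q \<le> H j q \<and> H j q \<le> 1"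
  and i: "!!j. integral\<^sup>L P (G j) \<ge> I - 1 / Suc j" "!!j. integral\<^sup>L P (H j) \<le> I + 1 / Suc j"
  using assms(2) by metis
 define A where "A q = (SUP j. G j q)" for q
 define B where "B q = (INF j. H j q)" for q
 have bdd: "bdd_above (range (\<lambda>j. G j q))" "bdd_below (range (\<lambda>j. H j q))" if "q \<in> space P" for q
  using b[OF that] by (auto intro!: bdd_aboveI[of _ "f q"] bdd_belowI[of _ "f q"])
 have A[measurable]: "A \<in> borel_measurable P" unfolding A_def
  by (rule borel_measurable_cSUP) (use bdd in auto)
 have B[measurable]: "B \<in> borel_measurable P" unfolding B_def
  by (rule borel_measurable_cINF) (use bdd in auto)
 have AB: "G j q \<le> A q" "B q \<le> H j q" "A q \<le> f q" "f q \<le> B q" if "q \<in> space P" for j q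
  unfolding A_def B_def using b[OF that] bdd[OF that]
  by (auto intro!: cSUP_upper cINF_lower cSUP_least cINF_greatest)
 have bound: "norm (k q) \<le> 1" if "k = A \<or> k = B \<or> k = G j \<or> k = H j" "q \<in> space P" for k j q
  using that AB(1,2)[OF that(2), of j] AB(3,4)[OF that(2)] b[OF that(2), of j] by auto
 have int: "integrable P A" "integrable P B" "integrable P (G j)" "integrable P (H j)" for j
  by (rule integrable_const_bound[of _ 1], use bound in \<open>auto intro!: AE_I2\<close>)+
 have A_ge: "integral\<^sup>L P A \<ge> I - 1 / Suc j" for j
  using i(1)[of j] integral_mono[OF int(3)[of j] int(1)] AB by fastforce
 have B_le: "integral\<^sup>L P B \<le> I + 1 / Suc j" for j
  using i(2)[of j] integral_mono[OF int(2) int(4)[of j]] AB by fastforce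
 have AB_le: "integral\<^sup>L P A \<le> integral\<^sup>L P B"
  by (rule integral_mono[OF int(1,2)]) (use AB in \<open>force intro: order_trans\<close>)
 have lim: "x \<le> 0" if "!!j. x \<le> 1 / Suc j" for x :: real
 proof (rule field_le_epsilon)
  fix e :: real assume "e > 0"
  then obtain n where "inverse (real (Suc n)) < e" using reals_Archimedean by blast
  then show "x \<le> 0 + e" using that[of n] by (simp add: inverse_eq_divide)
 qed
 have IA: "integral\<^sup>L P A \<ge> I" using lim[of "I - integral\<^sup>L P A"] A_ge by (simp add: algebra_simps)
 have IB: "integral\<^sup>L P B \<le> I" using lim[of "integral\<^sup>L P B - I"] B_le by (simp add: algebra_simps)
 have "integral\<^sup>L P (\<lambda>q. B q - A q) = 0" using IA IB AB_le int by simp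
 moreover have "AE q in P. 0 \<le> B q - A q" using AB by (intro AE_I2) (force intro: order_trans)
 ultimately have "AE q in P. B q - A q = 0"
  using integral_nonneg_eq_0_iff_AE[of P "\<lambda>q. B q - A q"] int by auto
 then have ae: "AE q in P. f q = A q"
  using AE_space by eventually_elim (use AB in force)
 then have aeC: "AE q in completion P. A q = f q" by (auto intro: AE_completion)
 have Am: "A \<in> borel_measurable (completion P)" by (rule measurable_completion) (rule A)
 have f: "f \<in> borel_measurable (completion P)"
 proof (rule measurableI)
  fix S :: "real set" assume S: "S \<in> sets borel"
  have "{q \<in> space (completion P). f q \<in> S} \<in> sets (completion P)"
  proof (rule completion.in_sets_AE)
   show "{q \<in> space (completion P). A q \<in> S} \<in> sets (completion P)"
    using measurable_sets[OF Am S] by (simp add: vimage_def Int_def conj_commute)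
   show "AE q in completion P. (q \<in> {q \<in> space (completion P). A q \<in> S}) =
     (q \<in> {q \<in> space (completion P). f q \<in> S})"
    using aeC by eventually_elim simp
  qed auto
  then show "f -` S \<inter> space (completion P) \<in> sets (completion P)"
   by (simp add: vimage_def Int_def conj_commute)
 qed simp
 have "integral\<^sup>L (completion P) f = integral\<^sup>L (completion P) A"
  using aeC by (intro integral_cong_AE f Am) auto
 also have "\<dots> = integral\<^sup>L P A" by (rule integral_completion[OF A])
 also have "\<dots> = I" using IA IB AB_le by simp
 finally show ?thesis using f by blast
qed

locale monster_model =
 fixes L :: "('f, 'r) lang" and \<kappa> :: "'k rel" and U :: "('a, 'f, 'r) struct" and M :: "'a set"
 assumes countable: "countable_lang L" and monster: "monster L \<kappa> U"
  and M: "small_model L \<kappa> U M"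
begin

abbreviation "X n \<equiv> tuples n (univ U)"
abbreviation "\<D> n \<equiv> definable L U (univ U) n"

lemma univ_ne: "univ U \<noteq> {}" and card_\<kappa>: "uncountable_card \<kappa>"
 using monster by (auto simp: monster_def is_struct_def)

lemma small_model_sub: "small_model L \<kappa> U N ==> N \<subseteq> univ U" "small_model L \<kappa> U N ==> small \<kappa> N"
 by (auto simp: small_model_def elem_sub_def)

lemmas M_sub = small_model_sub[OF M]

lemma base_set: "A \<subseteq> univ U ==> base_set U A"
 using univ_ne by unfold_locales

lemma keisler_charge_univ: "keisler L U n \<nu> ==> charge (X n) (\<D> n) \<nu>"
 by (rule keisler_charge[OF _ univ_ne]) simp_all

lemma saturation:
 assumes "A \<subseteq> univ U" "small \<kappa> A" "q \<in> types L U A n"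
 shows "\<exists>b\<in>X n. tp L U A b = q"
 using monster assms unfolding monster_def by blast

lemma realization:
 assumes "A \<subseteq> univ U" "small \<kappa> A" "q \<in> types L U A n"
 shows "realization L U A n q \<in> X n" "tp L U A (realization L U A n q) = q"
 using someI_ex[of "\<lambda>b. b \<in> X n \<and> tp L U A b = q"] saturation[OF assms]
 by (auto simp: realization_def)

lemma realization_tcyl:
 assumes "A \<subseteq> univ U" "small \<kappa> A" "q \<in> types L U A n" "D \<in> definable L U A n"
 shows "q \<in> tcyl L U A n D \<longleftrightarrow> realization L U A n q \<in> D"
 using base_set.tp_tcyl[OF base_set[OF assms(1)] realization(1)[OF assms(1-3)] assms(4)]
  realization(2)[OF assms(1-3)] by simp

lemma types_eqI:
 assumes "A \<subseteq> univ U" "b \<in> X n" "b' \<in> X n" "tp L U A b \<subseteq> tp L U A b'"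
 shows "tp L U A b = tp L U A b'"
proof (rule antisym[OF assms(4)], rule subsetI)
 fix x assume x: "x \<in> tp L U A b'"
 obtain \<phi> c where xe: "x = (\<phi>, c)" by fastforce
 show "x \<in> tp L U A b"
 proof (rule ccontr)
  assume "x \<notin> tp L U A b"
  then have "(Neg \<phi>, c) \<in> tp L U A b"
   using x assms(2,3) by (auto simp: xe tp_def param_fms_def fm_Neg tuplesD)
  then show False using x assms(4) by (auto simp: xe tp_def)
 qed
qed

text \<open>If every realization of a type over the small set \<open>N\<close> lies in \<open>D\<close>, which may need parameters
 outside \<open>N\<close>, then some \<open>N\<close>-definable set in the type is contained in \<open>D\<close>.\<close>

lemma type_inside:
 assumes N: "N \<subseteq> univ U" "small \<kappa> N" and q: "q \<in> types L U N n" and D: "D \<in> \<D> n"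
  and all: "!!b. b \<in> X n ==> tp L U N b = q ==> b \<in> D"
 shows "\<exists>E\<in>definable L U N n. q \<in> tcyl L U N n E \<and> E \<subseteq> D"
proof (rule ccontr)
 assume no: "\<not> ?thesis"
 interpret N: base_set L U N by (rule base_set[OF N(1)])
 obtain \<phi> d where \<phi>: "fm L (n + length d) \<phi>" "set d \<subseteq> univ U" "D = defset U n \<phi> d"
  using D by (rule definableE)
 let ?A = "N \<union> set d"
 have A: "?A \<subseteq> univ U" "small \<kappa> ?A"
  using N \<phi>(2) small_Un_countable[OF card_\<kappa> N(2) countable_finite[OF finite_set]] by simp_all
 interpret A: base_set L U ?A by (rule base_set[OF A(1)])
 have "\<exists>p\<in>types L U ?A n. insert (Neg \<phi>, d) q \<subseteq> p"
 proof (rule A.extend_to_type)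
  show "insert (Neg \<phi>, d) q \<subseteq> param_fms L ?A n"
   using \<phi>(1) N.typesD(1)[OF q] by (auto simp: param_fms_def fm_Neg)
  fix F assume F: "F \<subseteq> insert (Neg \<phi>, d) q" "finite F"
  let ?G = "F - {(Neg \<phi>, d)}" and ?S = "\<lambda>(\<psi>, c). defset U n \<psi> c"
  have G: "?G \<subseteq> q" "finite ?G" using F by auto
  have S: "?S x \<in> definable L U N n \<and> q \<in> tcyl L U N n (?S x)" if "x \<in> ?G" for x
  proof -
   obtain \<psi> c where x: "x = (\<psi>, c)" by fastforce
   have "(\<psi>, c) \<in> q" "(\<psi>, c) \<in> param_fms L N n" using that G(1) N.typesD(1)[OF q] x by auto
   then show ?thesis using q by (auto simp: x tcyl_def definable_def)
  qed
  interpret algebra "X n" "definable L U N n" by (rule N.algebra_def)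
  have E: "X n \<inter> \<Inter>(?S ` ?G) \<in> definable L U N n"
  proof (cases "?G = {}")
   case False
   have "\<Inter>(?S ` ?G) \<in> definable L U N n" using G(2) False S by (intro finite_INT) auto
   then show ?thesis by (metis Int top)
  next
   case True
   show ?thesis unfolding True by simp
  qed
  have "q \<in> tcyl L U N n (X n \<inter> \<Inter>(?S ` ?G))"
   by (rule N.tcyl_consequence[where \<D> = "?S ` ?G", OF q _ _ E]) (use S G(2) in auto)
  then have "\<not> X n \<inter> \<Inter>(?S ` ?G) \<subseteq> D" using no E by blast
  then obtain b where b: "b \<in> X n" "b \<notin> D" "!!x. x \<in> ?G ==> b \<in> ?S x" by blast
  have "case x of (\<psi>, c) => holds U \<psi> (b @ c)" if "x \<in> F" for x
  proof (cases "x = (Neg \<phi>, d)")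
   case True
   then show ?thesis using b(1,2) by (simp add: \<phi>(3) defset_def)
  next
   case False
   then show ?thesis using b(3)[of x] that by (cases x) (simp add: defset_def)
  qed
  then show "\<exists>b\<in>X n. \<forall>(\<psi>, c)\<in>F. holds U \<psi> (b @ c)" using b(1) by blast
 qed
 then obtain p where p: "p \<in> types L U ?A n" "(Neg \<phi>, d) \<in> p" "q \<subseteq> p" by blast
 obtain b where b: "b \<in> X n" "tp L U ?A b = p" using saturation[OF A p(1)] by blast
 have "q \<subseteq> tp L U N b"
 proof
  fix x assume x: "x \<in> q"
  then have "x \<in> tp L U ?A b" "x \<in> param_fms L N n" using p(3) b(2) N.typesD(1)[OF q] by auto
  then show "x \<in> tp L U N b" using b(1) by (auto simp: tp_def tuplesD)
 qed
 moreover obtain b0 where b0: "b0 \<in> X n" "tp L U N b0 = q" using saturation[OF N q] by blast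
 ultimately have "tp L U N b = q" using types_eqI[OF N(1) b0(1) b(1)] by simp
 then have "b \<in> D" using all b(1) by blast
 moreover have "b \<notin> D" using p(2) b by (auto simp: \<phi>(3) defset_def tp_def)
 ultimately show False by blast
qed

lemma tuples_fibre:
 assumes "D \<in> definable L U A (m + k)" "b \<in> X k"
 shows "{a \<in> X m. a @ b \<in> D} \<in> definable L U (A \<union> set b) m"
proof -
 have "{xs \<in> X m. map (nth (xs @ b)) [0..<m + k] \<in> D} \<in> definable L U (A \<union> set b) m"
  using assms tuplesD[OF assms(2)] by (intro definable_preimage[OF assms(1)]) auto
 moreover have "map (nth (xs @ b)) [0..<m + k] = xs @ b" if "xs \<in> X m" for xs
  using tuplesD[OF that] tuplesD[OF assms(2)] map_nth[of "xs @ b"] by simp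
 ultimately show ?thesis by (auto cong: conj_cong)
qed

lemma fibre_univ: "D \<in> \<D> (m + k) ==> b \<in> X k ==> {a \<in> X m. a @ b \<in> D} \<in> \<D> m"
 using tuples_fibre[of D "univ U" m k b] tuplesD(2)[of b] by (simp add: Un_absorb2)

lemma tuples_cofibre:
 assumes "D \<in> definable L U A (m + k)" "a \<in> X m"
 shows "{b \<in> X k. a @ b \<in> D} \<in> definable L U (A \<union> set a) k"
proof -
 let ?vs = "[k..<k + m] @ [0..<k]"
 have "{xs \<in> X k. map (nth (xs @ a)) ?vs \<in> D} \<in> definable L U (A \<union> set a) k"
  using assms tuplesD[OF assms(2)] by (intro definable_preimage[OF assms(1)]) auto
 moreover have "map (nth (xs @ a)) ?vs = a @ xs" if "xs \<in> X k" for xs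
  using tuplesD[OF that] tuplesD[OF assms(2)] by (auto intro!: nth_equalityI simp: nth_append)
 ultimately show ?thesis by (auto cong: conj_cong)
qed

lemma cofibre_univ: "D \<in> \<D> (m + k) ==> a \<in> X m ==> {b \<in> X k. a @ b \<in> D} \<in> \<D> k"
 using tuples_cofibre[of D "univ U" m k a] tuplesD(2)[of a] by (simp add: Un_absorb2)

lemma swap_blocks_eq:
 assumes "D \<in> \<D> (m + k)"
 shows "swap_blocks m D = {xs \<in> X (k + m). drop k xs @ take k xs \<in> D}"
proof (intro equalityI subsetI)
 fix x assume "x \<in> swap_blocks m D"
 then obtain a b where ab: "x = b @ a" "length a = m" "a @ b \<in> D" by (auto simp: swap_blocks_def)
 then have "a @ b \<in> X (m + k)" using definable_tuples[OF assms] by blast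
 then show "x \<in> {xs \<in> X (k + m). drop k xs @ take k xs \<in> D}" using ab by (auto simp: tuples_def)
next
 fix x assume x: "x \<in> {xs \<in> X (k + m). drop k xs @ take k xs \<in> D}"
 then have "x = take k x @ drop k x" "length (drop k x) = m" "drop k x @ take k x \<in> D"
  by (auto simp: tuples_def)
 then show "x \<in> swap_blocks m D" unfolding swap_blocks_def by blast
qed

lemma swap_blocks_definable:
 assumes "D \<in> definable L U A (m + k)" "A \<subseteq> univ U"
 shows "swap_blocks m D \<in> definable L U A (k + m)"
proof -
 let ?vs = "[k..<k + m] @ [0..<k]"
 have "{xs \<in> X (k + m). map (nth (xs @ [])) ?vs \<in> D} \<in> definable L U (A \<union> set []) (k + m)"
  by (intro definable_preimage[OF assms(1)]) auto
 moreover have "map (nth (xs @ [])) ?vs = drop k xs @ take k xs" if "xs \<in> X (k + m)" for xs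
  using tuplesD[OF that] by (auto intro!: nth_equalityI simp: nth_append)
 moreover have "D \<in> \<D> (m + k)" using definable_mono[OF assms(2)] assms(1) by blast
 from swap_blocks_eq[OF this] have "swap_blocks m D = {xs \<in> X (k + m). drop k xs @ take k xs \<in> D}" .
 ultimately show ?thesis by (simp cong: conj_cong)
qed

subsection \<open>Integrals over type spaces\<close>

lemma borel_restr:
 assumes N: "N \<subseteq> univ U" and \<nu>: "keisler L U n \<nu>"
 shows "regular_borel_prob (type_space L U N n) (borel_restr L U N n \<nu>)"
  and "D \<in> definable L U N n ==> measure (borel_restr L U N n \<nu>) (tcyl L U N n D) = \<nu> D"
proof -
 interpret N: base_set L U N by (rule base_set[OF N])
 interpret stone "X n" "definable L U N n" "types L U N n" "tcyl L U N n" by (rule N.stone_types)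
 interpret charge "X n" "definable L U N n" \<nu> by (rule keisler_charge[OF \<nu> univ_ne N])
 interpret stone_charge "X n" "definable L U N n" "types L U N n" "tcyl L U N n" \<nu> ..
 have eq: "(\<forall>(\<phi>, c)\<in>param_fms L N n. measure P (basic_open L U N n (\<phi>, c)) = \<nu> (defset U n \<phi> c))
   \<longleftrightarrow> (\<forall>D\<in>definable L U N n. measure P (tcyl L U N n D) = \<nu> D)" for P
  using N.tcyl_defset by (fastforce simp: definable_def)
 have *: "regular_borel_prob (type_space L U N n) (borel_restr L U N n \<nu>) \<and>
   (\<forall>D\<in>definable L U N n. measure (borel_restr L U N n \<nu>) (tcyl L U N n D) = \<nu> D)"
  unfolding borel_restr_def eq N.type_space_T by (rule theI'[OF stone_regular_borel])
 show "regular_borel_prob (type_space L U N n) (borel_restr L U N n \<nu>)"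
  "D \<in> definable L U N n ==> measure (borel_restr L U N n \<nu>) (tcyl L U N n D) = \<nu> D"
  using * by blast+
qed

lemma borel_restr_space:
 assumes N: "N \<subseteq> univ U" and \<nu>: "keisler L U n \<nu>"
 shows "prob_space (borel_restr L U N n \<nu>)" "space (borel_restr L U N n \<nu>) = types L U N n"
  "D \<in> definable L U N n ==> tcyl L U N n D \<in> sets (borel_restr L U N n \<nu>)"
proof -
 interpret N: base_set L U N by (rule base_set[OF N])
 interpret stone "X n" "definable L U N n" "types L U N n" "tcyl L U N n" by (rule N.stone_types)
 note r = borel_restr(1)[OF N \<nu>, unfolded N.type_space_T]
 show "prob_space (borel_restr L U N n \<nu>)" "space (borel_restr L U N n \<nu>) = types L U N n"
  using r by (simp_all add: regular_borel_prob_def topspace_T)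
 show "D \<in> definable L U N n ==> tcyl L U N n D \<in> sets (borel_restr L U N n \<nu>)"
  by (rule regular_borel_probD(1)[OF r openin_cyl])
qed

lemma borel_restr_open:
 assumes N: "N \<subseteq> univ U" and \<nu>: "keisler L U n \<nu>" and D: "D \<in> \<D> n"
 defines "W \<equiv> \<Union>E\<in>{E \<in> definable L U N n. E \<subseteq> D}. tcyl L U N n E"
 shows "W \<in> sets (borel_restr L U N n \<nu>)" "measure (borel_restr L U N n \<nu>) W \<le> \<nu> D"
proof -
 interpret N: base_set L U N by (rule base_set[OF N])
 interpret stone "X n" "definable L U N n" "types L U N n" "tcyl L U N n" by (rule N.stone_types)
 interpret UU: charge "X n" "\<D> n" \<nu> by (rule keisler_charge_univ[OF \<nu>])
 note r = borel_restr(1)[OF N \<nu>, unfolded N.type_space_T]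
 interpret P: prob_space "borel_restr L U N n \<nu>" by (rule borel_restr_space[OF N \<nu>])
 have W: "openin T W" unfolding W_def by (intro openin_Union) (auto intro: openin_cyl)
 show "W \<in> sets (borel_restr L U N n \<nu>)" by (rule regular_borel_probD(1)[OF r W])
 have "emeasure (borel_restr L U N n \<nu>) W \<le> ennreal (\<nu> D)"
  unfolding regular_measure_open[OF r W]
 proof (rule SUP_least)
  fix E assume "E \<in> {E \<in> definable L U N n. tcyl L U N n E \<subseteq> W}"
  then have E: "E \<in> definable L U N n" "tcyl L U N n E \<subseteq> W" by auto
  have "\<exists>\<E>\<subseteq>{E \<in> definable L U N n. E \<subseteq> D}. finite \<E> \<and> E \<subseteq> \<Union>\<E>"
   by (rule cyl_compact'[OF E(1)]) (use E(2) in \<open>auto simp: W_def\<close>)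
  then have "E \<subseteq> D" by auto
  moreover have "E \<in> \<D> n" using E(1) definable_mono[OF N] by blast
  ultimately have "\<nu> E \<le> \<nu> D" using D by (intro UU.nu_mono)
  then show "emeasure (borel_restr L U N n \<nu>) (tcyl L U N n E) \<le> ennreal (\<nu> D)"
   using borel_restr(2)[OF N \<nu> E(1)] by (simp add: P.emeasure_eq_measure ennreal_leI)
 qed
 then show "measure (borel_restr L U N n \<nu>) W \<le> \<nu> D"
  using UU.nonneg[OF D] by (simp add: P.emeasure_eq_measure)
qed

lemma integral_step_types:
 assumes N: "N \<subseteq> univ U" "small \<kappa> N" and \<nu>: "keisler L U n \<nu>" and h: "step (X n) (definable L U N n) h"
 defines "P \<equiv> borel_restr L U N n \<nu>"
 shows "(\<lambda>q. h (realization L U N n q)) \<in> borel_measurable P"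
  "integral\<^sup>L P (\<lambda>q. h (realization L U N n q)) = sint (X n) \<nu> h"
proof -
 interpret P: prob_space P unfolding P_def by (rule borel_restr_space[OF N(1) \<nu>])
 let ?E = "\<lambda>r. {x \<in> X n. h x = r}"
 let ?s = "\<lambda>q. \<Sum>r\<in>h ` X n. r * indicator (tcyl L U N n (?E r)) q"
 have E: "?E r \<in> definable L U N n" for r using h by (simp add: step_def)
 have fin: "finite (h ` X n)" using h by (simp add: step_def)
 have sets: "tcyl L U N n (?E r) \<in> sets P" for r
  unfolding P_def by (rule borel_restr_space(3)[OF N(1) \<nu> E])
 have eq: "h (realization L U N n q) = ?s q" if "q \<in> space P" for q
 proof -
  have q: "q \<in> types L U N n" using that borel_restr_space(2)[OF N(1) \<nu>] by (simp add: P_def)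
  note b = realization(1)[OF N q]
  have "?s q = (\<Sum>r\<in>h ` X n. if r = h (realization L U N n q) then r else 0)"
   using realization_tcyl[OF N q E] b by (intro sum.cong) (auto simp: indicator_def)
  also have "\<dots> = h (realization L U N n q)" using fin b by (simp add: sum.delta)
  finally show ?thesis by simp
 qed
 have "?s \<in> borel_measurable P" using sets by measurable
 then show "(\<lambda>q. h (realization L U N n q)) \<in> borel_measurable P"
  using eq by (subst measurable_cong[where g = ?s]) auto
 have "integral\<^sup>L P (\<lambda>q. h (realization L U N n q)) = integral\<^sup>L P ?s"
  using eq by (intro Bochner_Integration.integral_cong) auto
 also have "\<dots> = (\<Sum>r\<in>h ` X n. r * measure P (tcyl L U N n (?E r)))"
  using sets by (subst Bochner_Integration.integral_sum) (auto simp: P.emeasure_eq_measure)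
 also have "\<dots> = sint (X n) \<nu> h"
  unfolding sint_def P_def by (intro sum.cong refl arg_cong2[where f = "(*)"] borel_restr(2)[OF N(1) \<nu> E])
 finally show "integral\<^sup>L P (\<lambda>q. h (realization L U N n q)) = sint (X n) \<nu> h" .
qed

lemma integral_tame_types:
 assumes N: "N \<subseteq> univ U" "small \<kappa> N" and \<nu>: "keisler L U n \<nu>" and f: "tame (X n) (definable L U N n) f"
 defines "P \<equiv> borel_restr L U N n \<nu>"
 shows "(\<lambda>q. f (realization L U N n q)) \<in> borel_measurable P"
  "integral\<^sup>L P (\<lambda>q. f (realization L U N n q)) = lint (X n) (definable L U N n) \<nu> f"
proof -
 interpret P: prob_space P unfolding P_def by (rule borel_restr_space[OF N(1) \<nu>])
 interpret charge "X n" "definable L U N n" \<nu> by (rule keisler_charge[OF \<nu> univ_ne N(1)])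
 let ?f = "\<lambda>q. f (realization L U N n q)"
 have sp: "realization L U N n q \<in> X n" if "q \<in> space P" for q
  using that borel_restr_space(2)[OF N(1) \<nu>] realization(1)[OF N] by (simp add: P_def)
 have "\<exists>h. step (X n) (definable L U N n) h \<and> (\<forall>x\<in>X n. \<bar>f x - h x\<bar> \<le> inverse (real (Suc j)))" for j
  using f by (simp add: tame_def)
 then obtain h where h: "!!j. step (X n) (definable L U N n) (h j)"
  "!!j x. x \<in> X n ==> \<bar>f x - h j x\<bar> \<le> inverse (real (Suc j))" by metis
 note hm = integral_step_types[OF N \<nu> h(1), folded P_def]
 show m: "?f \<in> borel_measurable P"
 proof (rule borel_measurable_LIMSEQ_real)
  fix q assume "q \<in> space P"
  then have "\<bar>h j (realization L U N n q) - ?f q\<bar> \<le> inverse (real (Suc j))" for j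
   using h(2)[OF sp] by (simp add: abs_minus_commute)
  then have "(\<lambda>j. h j (realization L U N n q) - ?f q) \<longlonglongrightarrow> 0"
   by (intro Lim_null_comparison[OF _ LIMSEQ_inverse_real_of_nat]) simp
  then show "(\<lambda>j. h j (realization L U N n q)) \<longlonglongrightarrow> ?f q" by (rule LIM_zero_cancel)
 qed (rule hm(1))
 have bounded: "integrable P (\<lambda>q. g (realization L U N n q))"
  if g: "(\<lambda>q. g (realization L U N n q)) \<in> borel_measurable P" and b: "!!x. x \<in> X n ==> \<bar>g x\<bar> \<le> B" for g and B :: real
  by (rule P.integrable_const_bound[where B = B, OF _ g]) (use b sp in \<open>auto intro!: AE_I2\<close>)
 obtain B where B: "!!x. x \<in> X n ==> \<bar>h 0 x\<bar> \<le> B"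
 proof -
  have "finite ((\<lambda>x. \<bar>h 0 x\<bar>) ` X n)"
   using h(1)[of 0] finite_imageI[of "h 0 ` X n" abs] by (simp add: step_def image_image)
  then have "\<bar>h 0 x\<bar> \<le> Max ((\<lambda>x. \<bar>h 0 x\<bar>) ` X n)" if "x \<in> X n" for x using that by auto
  then show ?thesis using that by blast
 qed
 have fB: "\<bar>f x\<bar> \<le> B + 1" if "x \<in> X n" for x using B[OF that] h(2)[OF that, of 0] by simp
 have inv1: "inverse (real (Suc j)) \<le> 1" for j by (simp add: inverse_eq_divide)
 have hB: "\<bar>h j x\<bar> \<le> B + 2" if "x \<in> X n" for j x
  using fB[OF that] h(2)[OF that, of j] inv1[of j] by linarith
 have "\<bar>integral\<^sup>L P ?f - lint (X n) (definable L U N n) \<nu> f\<bar> \<le> 2 * inverse (real (Suc j))" for j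
 proof -
  have i: "integrable P ?f" "integrable P (\<lambda>q. h j (realization L U N n q))"
   using bounded[OF m fB] bounded[OF hm(1) hB] by auto
  have "\<bar>integral\<^sup>L P ?f - integral\<^sup>L P (\<lambda>q. h j (realization L U N n q))\<bar>
    = \<bar>integral\<^sup>L P (\<lambda>q. ?f q - h j (realization L U N n q))\<bar>" using i by simp
  also have "\<dots> \<le> integral\<^sup>L P (\<lambda>q. \<bar>?f q - h j (realization L U N n q)\<bar>)"
   using integral_norm_bound[of P "\<lambda>q. ?f q - h j (realization L U N n q)"] by simp
  also have "\<dots> \<le> integral\<^sup>L P (\<lambda>q. inverse (real (Suc j)))"
   using i h(2) sp by (intro integral_mono) auto
  also have "\<dots> = inverse (real (Suc j))" using P.prob_space by simp
  finally show ?thesis using lint_approx[OF h(1)[of j] h(2)[of _ j]] by (simp add: hm(2))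
 qed
 then have "\<bar>integral\<^sup>L P ?f - lint (X n) (definable L U N n) \<nu> f\<bar> \<le> 0"
  by (intro LIMSEQ_le_const[OF tendsto_mult_right_zero[OF LIMSEQ_inverse_real_of_nat, of 2]]) auto
 then show "integral\<^sup>L P ?f = lint (X n) (definable L U N n) \<nu> f" by simp
qed


end

context monster_model
begin

subsection \<open>Definable measures\<close>

lemma definable_measure_tame:
 assumes \<mu>: "definable_measure L U M m \<mu>" and \<phi>: "fm L (m + k) \<phi>"
 shows "tame (X k) (definable L U M k) (\<lambda>b. \<mu> (defset U m \<phi> b))"
 unfolding tame_def
proof (intro allI impI)
 fix eps :: real assume eps: "eps > 0"
 interpret M: base_set L U M by (rule base_set[OF M_sub(1)])
 interpret stone "X k" "definable L U M k" "types L U M k" "tcyl L U M k" by (rule M.stone_types)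
 let ?F = "\<lambda>b. \<mu> (defset U m \<phi> b)"
 let ?G = "\<lambda>q. ?F (realization L U M k q)"
 have cont: "continuous_map T euclideanreal ?G"
  using \<mu> \<phi> unfolding definable_measure_def M.type_space_T by blast
 have FG: "?F b = ?G (tp L U M b)" if "b \<in> X k" for b
  using \<mu> \<phi> that realization[OF M_sub M.tp_types[OF that]]
  unfolding definable_measure_def invariant_measure_def by metis
 let ?C = "{D \<in> definable L U M k. \<exists>r. \<forall>q\<in>tcyl L U M k D. \<bar>?G q - r\<bar> \<le> eps}"
 have "types L U M k \<subseteq> (\<Union>D\<in>?C. tcyl L U M k D)"
 proof
  fix q assume q: "q \<in> types L U M k"
  have "openin T {p \<in> topspace T. ?G p \<in> ball (?G q) eps}"
   by (rule openin_continuous_map_preimage[OF cont]) simp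
  moreover have "q \<in> {p \<in> topspace T. ?G p \<in> ball (?G q) eps}" using q eps by (simp add: topspace_T)
  ultimately obtain D where D: "D \<in> definable L U M k" "q \<in> tcyl L U M k D"
   "tcyl L U M k D \<subseteq> {p \<in> topspace T. ?G p \<in> ball (?G q) eps}" unfolding openin_T by meson
  have "\<bar>?G p - ?G q\<bar> \<le> eps" if "p \<in> tcyl L U M k D" for p
   using subsetD[OF D(3) that] by (simp add: dist_real_def abs_minus_commute)
  then show "q \<in> (\<Union>D\<in>?C. tcyl L U M k D)" using D(1,2) by (intro UN_I[of D]) auto
 qed
 moreover have "?C \<subseteq> definable L U M k" by simp
 ultimately obtain \<F> where \<F>: "\<F> \<subseteq> ?C" "finite \<F>" "types L U M k \<subseteq> (\<Union>D\<in>\<F>. tcyl L U M k D)"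
  using cyl_compact[of ?C] by meson
 have "\<exists>h. step (X k) (definable L U M k) h \<and> (\<forall>b\<in>X k. b \<in> \<Union>\<E> --> \<bar>?F b - h b\<bar> \<le> eps)"
  if "finite \<E>" "\<E> \<subseteq> ?C" for \<E>
  using that
 proof (induction \<E> rule: finite_induct)
  case empty
  have "{x \<in> X k. 0 = (r::real)} \<in> definable L U M k" for r
   by (cases "r = 0") (use top empty_sets in auto)
  then have "step (X k) (definable L U M k) (\<lambda>_. 0)"
   by (auto simp: step_def intro: finite_subset[of _ "{0}"])
  then show ?case by auto
 next
  case (insert D \<E>)
  have sub: "\<E> \<subseteq> ?C" "D \<in> ?C" using insert.prems by simp_all
  from insert.IH[OF sub(1)] obtain h where
   h': "step (X k) (definable L U M k) h \<and> (\<forall>b\<in>X k. b \<in> \<Union>\<E> --> \<bar>?F b - h b\<bar> \<le> eps)" ..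
  have h: "step (X k) (definable L U M k) h"
   "!!b. b \<in> X k ==> b \<in> \<Union>\<E> ==> \<bar>?F b - h b\<bar> \<le> eps" using h' by simp_all
  have D: "D \<in> definable L U M k" and "\<exists>r. \<forall>q\<in>tcyl L U M k D. \<bar>?G q - r\<bar> \<le> eps" using sub(2) by simp_all
  then obtain r where r: "!!q. q \<in> tcyl L U M k D ==> \<bar>?G q - r\<bar> \<le> eps" by meson
  let ?h = "\<lambda>b. if b \<in> D then r else h b"
  have "step (X k) (definable L U M k) ?h"
   unfolding step_def
  proof (intro conjI allI)
   show "finite (?h ` X k)"
    by (rule finite_subset[of _ "insert r (h ` X k)"]) (use h(1) in \<open>auto simp: step_def\<close>)
   fix s
   have hs: "{x \<in> X k. h x = s} \<in> definable L U M k" using h(1) by (simp add: step_def)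
   show "{x \<in> X k. ?h x = s} \<in> definable L U M k"
   proof (cases "s = r")
    case True
    have "{x \<in> X k. ?h x = s} = D \<union> {x \<in> X k. h x = s}"
     using definable_tuples[OF D] True by auto
    then show ?thesis using Un[OF D hs] by simp
   next
    case False
    then have "{x \<in> X k. ?h x = s} = {x \<in> X k. h x = s} - D" by auto
    then show ?thesis using Diff[OF hs D] by simp
   qed
  qed
  moreover have "\<bar>?F b - ?h b\<bar> \<le> eps" if "b \<in> X k" "b \<in> \<Union>(insert D \<E>)" for b
  proof (cases "b \<in> D")
   case True
   then show ?thesis using r[of "tp L U M b"] M.tp_tcyl[OF that(1) D] FG[OF that(1)] by simp
  next
   case False
   then show ?thesis using h(2)[OF that(1)] that(2) by simp
  qed
  ultimately show ?case by (intro exI[of _ ?h] conjI ballI impI)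
 qed
 from this[OF \<F>(2,1)] obtain h where
  h': "step (X k) (definable L U M k) h \<and> (\<forall>b\<in>X k. b \<in> \<Union>\<F> --> \<bar>?F b - h b\<bar> \<le> eps)" ..
 have "b \<in> \<Union>\<F>" if b: "b \<in> X k" for b
 proof -
  obtain D where D: "D \<in> \<F>" "tp L U M b \<in> tcyl L U M k D"
   using subsetD[OF \<F>(3) M.tp_types[OF b]] by (rule UN_E)
  have "D \<in> definable L U M k" using subsetD[OF \<F>(1) D(1)] by simp
  then have "b \<in> D" using M.tp_tcyl[OF b] D(2) by simp
  then show ?thesis using D(1) by (rule UnionI[rotated])
 qed
 then show "\<exists>h. step (X k) (definable L U M k) h \<and> (\<forall>b\<in>X k. \<bar>?F b - h b\<bar> \<le> eps)"
  using h' by (intro exI[of _ h]) simp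
qed

lemma step_fibre:
 assumes "step (X (k + length c)) (definable L U A (k + length c)) h" "set c \<subseteq> univ U"
 shows "step (X k) (definable L U (A \<union> set c) k) (\<lambda>b. h (b @ c))"
 unfolding step_def
proof (intro conjI allI)
 have c: "c \<in> X (length c)" using assms(2) by (simp add: tuples_def)
 have sub: "b @ c \<in> X (k + length c)" if "b \<in> X k" for b using tuples_append[OF that c] .
 show "finite ((\<lambda>b. h (b @ c)) ` X k)"
  by (rule finite_subset[of _ "h ` X (k + length c)"]) (use sub assms(1) in \<open>auto simp: step_def\<close>)
 fix r
 have "{x \<in> X (k + length c). h x = r} \<in> definable L U A (k + length c)"
  using assms(1) by (simp add: step_def)
 from tuples_fibre[OF this c] show "{b \<in> X k. h (b @ c) = r} \<in> definable L U (A \<union> set c) k"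
  using sub by (simp cong: conj_cong)
qed

lemma defset_fibre:
 assumes "b \<in> X k"
 shows "{a \<in> X m. a @ b \<in> defset U (m + k) \<phi> c} = defset U m \<phi> (b @ c)"
 using tuples_append[OF _ assms] by (auto simp: defset_def)

lemma definable_fibre_tame:
 assumes \<mu>: "definable_measure L U M m \<mu>" and D: "D \<in> definable L U A (m + k)"
  and A: "M \<subseteq> A" "A \<subseteq> univ U"
 shows "tame (X k) (definable L U A k) (\<lambda>b. \<mu> {a \<in> X m. a @ b \<in> D})"
 unfolding tame_def
proof (intro allI impI)
 fix eps :: real assume eps: "eps > 0"
 obtain \<phi> c where \<phi>: "fm L (m + k + length c) \<phi>" "set c \<subseteq> A" "D = defset U (m + k) \<phi> c"
  using D by (rule definableE)
 have "fm L (m + (k + length c)) \<phi>" using \<phi>(1) by (simp add: add.assoc)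
 from definable_measure_tame[OF \<mu> this] eps obtain h where
  h: "step (X (k + length c)) (definable L U M (k + length c)) h"
   "!!b. b \<in> X (k + length c) ==> \<bar>\<mu> (defset U m \<phi> b) - h b\<bar> \<le> eps"
  unfolding tame_def by meson
 have cU: "set c \<subseteq> univ U" using \<phi>(2) A by blast
 have "step (X k) (definable L U A k) (\<lambda>b. h (b @ c))"
  by (rule step_algebra_mono[OF step_fibre[OF h(1) cU] definable_mono]) (use \<phi>(2) A in simp)
 moreover have "\<bar>\<mu> {a \<in> X m. a @ b \<in> D} - h (b @ c)\<bar> \<le> eps" if "b \<in> X k" for b
  unfolding \<phi>(3) defset_fibre[OF that]
  by (rule h(2)) (use that cU in \<open>auto simp: tuples_def\<close>)
 ultimately show "\<exists>h. step (X k) (definable L U A k) h \<and>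
   (\<forall>b\<in>X k. \<bar>\<mu> {a \<in> X m. a @ b \<in> D} - h b\<bar> \<le> eps)"
  by (intro exI[of _ "\<lambda>b. h (b @ c)"] conjI ballI)
qed

lemma exists_model_for:
 assumes "D \<in> \<D> n"
 shows "\<exists>N. small_model L \<kappa> U N \<and> M \<subseteq> N \<and> D \<in> definable L U N n"
proof -
 obtain \<phi> d where \<phi>: "fm L (n + length d) \<phi>" "set d \<subseteq> univ U" "D = defset U n \<phi> d"
  using assms by (rule definableE)
 from exists_small_model[OF countable monster M \<phi>(2)] obtain N where
  "small_model L \<kappa> U N" "M \<subseteq> N" "set d \<subseteq> N" by blast
 then show ?thesis using definableI[OF \<phi>(1)] \<phi>(3) by blast
qed

text \<open>The Morley product with a definable measure on the left is an iterated integral that does not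
 refer to type spaces.\<close>

lemma morley_lint:
 assumes \<mu>: "definable_measure L U M m \<mu>" and \<nu>: "keisler L U k \<nu>" and D: "D \<in> \<D> (m + k)"
 shows "morley L \<kappa> U M m k \<mu> \<nu> D = lint (X k) (\<D> k) \<nu> (\<lambda>b. \<mu> {a \<in> X m. a @ b \<in> D})"
proof -
 define N where "N = (SOME N. small_model L \<kappa> U N \<and> M \<subseteq> N \<and> D \<in> definable L U N (m + k))"
 have N: "small_model L \<kappa> U N" "M \<subseteq> N" "D \<in> definable L U N (m + k)"
  using someI_ex[OF exists_model_for[OF D]] by (auto simp: N_def)
 note NU = small_model_sub[OF N(1)]
 note t = definable_fibre_tame[OF \<mu> N(3,2) NU(1)]
 note i = integral_tame_types[OF NU \<nu> t]
 have "morley L \<kappa> U M m k \<mu> \<nu> D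
   = integral\<^sup>L (completion (borel_restr L U N k \<nu>)) (fibre_measure L U N m k \<mu> D)"
  by (simp add: morley_def N_def Let_def)
 also have "\<dots> = lint (X k) (definable L U N k) \<nu> (\<lambda>b. \<mu> {a \<in> X m. a @ b \<in> D})"
  unfolding fibre_measure_def[abs_def] using i by (simp add: integral_completion)
 also have "\<dots> = lint (X k) (\<D> k) \<nu> (\<lambda>b. \<mu> {a \<in> X m. a @ b \<in> D})"
  by (rule lint_algebra_mono[OF keisler_charge[OF \<nu> univ_ne NU(1)] keisler_charge_univ[OF \<nu>]
     definable_mono[OF NU(1)] t, symmetric])
 finally show ?thesis .
qed

subsection \<open>Invariant measures\<close>

text \<open>Let \<open>h \<le> g\<close> be a step function with parameters anywhere in the monster model.  Although \<open>h\<close> is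
 no function on the types over \<open>N\<close>, its maximum over all realizations of a type is one.  This
 maximum is upper semicontinuous, stays below \<open>g\<close> by invariance, and its integral is at least that
 of \<open>h\<close>.  Rounding to multiples of \<open>1 / j\<close> makes it a finite sum of indicators of closed sets.\<close>

lemma lower_function:
 assumes N: "small_model L \<kappa> U N" and \<mu>: "keisler L U n \<mu>"
  and g: "!!a. a \<in> X n ==> 0 \<le> g a \<and> g a \<le> 1"
  and inv: "!!a a'. a \<in> X n ==> a' \<in> X n ==> tp L U N a = tp L U N a' ==> g a = g a'"
  and h: "step (X n) (\<D> n) h" "!!a. a \<in> X n ==> h a \<le> g a" and j: "0 < (j :: nat)"
 defines "P \<equiv> borel_restr L U N n \<mu>"
 shows "\<exists>G. G \<in> borel_measurable P \<and>
  (\<forall>q\<in>space P. 0 \<le> G q \<and> G q \<le> g (realization L U N n q)) \<and> integral\<^sup>L P G \<ge> sint (X n) \<mu> h - 1 / j"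
proof -
 note NU = small_model_sub[OF N]
 interpret P: prob_space P unfolding P_def by (rule borel_restr_space[OF NU(1) \<mu>])
 interpret charge "X n" "\<D> n" \<mu> by (rule keisler_charge_univ[OF \<mu>])
 have sp: "space P = types L U N n" unfolding P_def by (rule borel_restr_space[OF NU(1) \<mu>])
 let ?D = "\<lambda>i::nat. {x \<in> X n. h x \<in> {..<i / j}}"
 define W where "W i = (\<Union>E\<in>{E \<in> definable L U N n. E \<subseteq> ?D i}. tcyl L U N n E)" for i
 have D: "?D i \<in> \<D> n" for i by (rule step_set[OF h(1)])
 have W: "W i \<in> sets P" "measure P (W i) \<le> \<mu> (?D i)" for i
  using borel_restr_open[OF NU(1) \<mu> D] unfolding P_def W_def by simp_all
 define G where "G q = (\<Sum>i=1..j. indicator (space P - W i) q) / real j" for q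
 have meas: "G \<in> borel_measurable P" unfolding G_def using W(1) by measurable
 have "0 \<le> G q \<and> G q \<le> g (realization L U N n q)" if "q \<in> space P" for q
 proof -
  have q: "q \<in> types L U N n" using that sp by simp
  let ?a = "realization L U N n q"
  note a = realization[OF NU q]
  have gi: "real i / j \<le> g ?a" if "q \<notin> W i" for i
  proof -
   have "\<not> (\<forall>b\<in>X n. tp L U N b = q --> b \<in> ?D i)"
   proof
    assume "\<forall>b\<in>X n. tp L U N b = q --> b \<in> ?D i"
    then obtain E where "E \<in> definable L U N n" "q \<in> tcyl L U N n E" "E \<subseteq> ?D i"
     using type_inside[OF NU q D[of i]] by meson
    then have "q \<in> W i" unfolding W_def by (intro UN_I[of E]) simp_all
    then show False using that by simp
   qed
   then obtain b where b: "b \<in> X n" "tp L U N b = q" "b \<notin> ?D i" by blast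
   then have "real i / j \<le> h b" by simp
   also have "\<dots> \<le> g b" by (rule h(2)[OF b(1)])
   also have "\<dots> = g ?a" by (rule inv[OF b(1) a(1)]) (simp add: b(2) a(2))
   finally show ?thesis .
  qed
  have ga: "0 \<le> g ?a" using g[OF a(1)] by simp
  have "(\<Sum>i=1..j. indicator (space P - W i) q :: real) = real (card {i \<in> {1..j}. q \<notin> W i})"
   using that by (simp add: indicator_def sum.If_cases Int_def)
  also have "card {i \<in> {1..j}. q \<notin> W i} \<le> card {1..nat \<lfloor>j * g ?a\<rfloor>}"
  proof (rule card_mono[OF finite_atLeastAtMost], rule subsetI)
   fix i assume i: "i \<in> {i \<in> {1..j}. q \<notin> W i}"
   then have "real i \<le> j * g ?a" using gi[of i] j by (simp add: field_simps)
   then show "i \<in> {1..nat \<lfloor>j * g ?a\<rfloor>}" using i by (simp add: le_nat_floor)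
  qed
  also have "real (card {1..nat \<lfloor>j * g ?a\<rfloor>}) \<le> j * g ?a" using ga by simp
  finally have "(\<Sum>i=1..j. indicator (space P - W i) q :: real) \<le> j * g ?a" by simp
  then show ?thesis using j by (simp add: G_def field_simps sum_nonneg)
 qed
 moreover have "integral\<^sup>L P G \<ge> sint (X n) \<mu> h - 1 / j"
 proof -
  let ?C = "\<lambda>i::nat. {x \<in> X n. h x \<in> {i / j..}}"
  have C: "?C i \<in> \<D> n" for i by (rule step_set[OF h(1)])
  let ?s = "\<lambda>x. \<Sum>i=1..j. 1 / j * indicator (?C i) x"
  have s: "step (X n) (\<D> n) ?s"
  proof (rule step_sum)
   fix i
   from step_combine[OF step_indicator[OF C] step_const[of "1 / j"], of "\<lambda>r s. s * r" i]
   show "step (X n) (\<D> n) (\<lambda>x. 1 / j * indicator (?C i) x)" .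
  qed simp
  have "sint (X n) \<mu> h \<le> sint (X n) \<mu> (\<lambda>x. 1 * ?s x + 1 * (1 / j))"
  proof (rule sint_mono[OF h(1)])
   show "step (X n) (\<D> n) (\<lambda>x. 1 * ?s x + 1 * (1 / j))"
    by (rule step_combine[OF s step_const, of "\<lambda>r s. 1 * r + 1 * s"])
   fix x assume x: "x \<in> X n"
   have hx: "h x \<le> 1" using h(2)[OF x] g[OF x] by simp
   have "?s x = real (card {i \<in> {1..j}. real i / j \<le> h x}) / j"
    using x by (simp add: indicator_def sum.If_cases Int_def flip: sum_divide_distrib)
   moreover have "j * h x - 1 \<le> real (card {i \<in> {1..j}. real i / j \<le> h x})"
   proof (cases "h x < 0")
    case True
    then have "j * h x \<le> 0" by (simp add: mult_nonneg_nonpos)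
    then show ?thesis by simp
   next
    case False
    define t where "t = nat \<lfloor>j * h x\<rfloor>"
    have t: "real t \<le> j * h x" "j * h x < t + 1" using False by (simp_all add: t_def) linarith
    have "t \<le> j" using t(1) mult_left_mono[OF hx, of "real j"] by simp
    have "{1..t} \<subseteq> {i \<in> {1..j}. real i / j \<le> h x}"
    proof
     fix i assume i: "i \<in> {1..t}"
     then have "real i \<le> j * h x" using t(1) by simp
     then show "i \<in> {i \<in> {1..j}. real i / j \<le> h x}" using i \<open>t \<le> j\<close> j by (simp add: field_simps)
    qed
    from card_mono[OF _ this] have "t \<le> card {i \<in> {1..j}. real i / j \<le> h x}" by simp
    then show ?thesis using t(2) by linarith
   qed
   ultimately show "h x \<le> 1 * ?s x + 1 * (1 / j)" using j by (simp add: field_simps)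
  qed
  also have "\<dots> = 1 * sint (X n) \<mu> ?s + 1 * (1 / j)"
   using sint_linear[OF s step_const[of "1 / j"], of 1 1] by (simp add: sint_const)
  also have "sint (X n) \<mu> ?s = (\<Sum>i=1..j. 1 / j * \<mu> (?C i))"
   unfolding sint_indicator[OF C, symmetric]
   by (rule sint_sum[OF finite_atLeastAtMost]) (rule step_indicator[OF C])
  also have "\<dots> \<le> (\<Sum>i=1..j. 1 / j * (1 - measure P (W i)))"
  proof (rule sum_mono)
   fix i
   have "?C i = X n - ?D i" by (rule set_eqI) (auto simp: not_less)
   then have "\<mu> (?C i) = 1 - \<mu> (?D i)" using nu_compl[OF D, of i] by simp
   then show "1 / j * \<mu> (?C i) \<le> 1 / j * (1 - measure P (W i))"
    using W(2)[of i] by (intro mult_left_mono) simp_all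
  qed
  also have "\<dots> = integral\<^sup>L P G"
  proof -
   have sets: "space P - W i \<in> sets P" for i using W(1) by (rule sets.compl_sets)
   have "integrable P (indicator (space P - W i) :: _ => real)" for i
    using sets by (rule integrable_real_indicator) (simp add: P.emeasure_eq_measure)
   then have "integral\<^sup>L P G = (\<Sum>i=1..j. integral\<^sup>L P (indicator (space P - W i))) / j"
    unfolding G_def integral_divide_zero by (subst Bochner_Integration.integral_sum) simp_all
   also have "\<dots> = (\<Sum>i=1..j. measure P (space P - W i)) / j"
    using sets.sets_into_space[OF sets] by (simp add: Int_absorb2)
   also have "\<dots> = (\<Sum>i=1..j. 1 / j * (1 - measure P (W i)))"
    using W(1) by (simp add: P.prob_compl flip: sum_divide_distrib)
   finally show ?thesis by simp
  qed
  finally show ?thesis by simp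
 qed
 ultimately show ?thesis using meas by blast
qed

lemma invariant_integral:
 assumes N: "small_model L \<kappa> U N" and \<mu>: "keisler L U n \<mu>"
  and f: "!!a. a \<in> X n ==> 0 \<le> f a \<and> f a \<le> 1"
  and inv: "!!a a'. a \<in> X n ==> a' \<in> X n ==> tp L U N a = tp L U N a' ==> f a = f a'"
  and I: "I \<le> lint (X n) (\<D> n) \<mu> f" "1 - I \<le> lint (X n) (\<D> n) \<mu> (\<lambda>a. 1 - f a)"
 defines "P \<equiv> borel_restr L U N n \<mu>"
 shows "(\<lambda>q. f (realization L U N n q)) \<in> borel_measurable (completion P) \<and>
  integral\<^sup>L (completion P) (\<lambda>q. f (realization L U N n q)) = I"
proof -
 note NU = small_model_sub[OF N]
 interpret P: prob_space P unfolding P_def by (rule borel_restr_space[OF NU(1) \<mu>])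
 interpret charge "X n" "\<D> n" \<mu> by (rule keisler_charge_univ[OF \<mu>])
 have sp: "realization L U N n q \<in> X n" if "q \<in> space P" for q
  using that borel_restr_space(2)[OF NU(1) \<mu>] realization(1)[OF NU] by (simp add: P_def)
 have lower: "\<exists>G. G \<in> borel_measurable P \<and>
   (\<forall>q\<in>space P. 0 \<le> G q \<and> G q \<le> g (realization L U N n q)) \<and> integral\<^sup>L P G \<ge> J - 1 / Suc j"
  if g: "!!a. a \<in> X n ==> 0 \<le> g a \<and> g a \<le> 1"
   and ginv: "!!a a'. a \<in> X n ==> a' \<in> X n ==> tp L U N a = tp L U N a' ==> g a = g a'"
   and J: "J \<le> lint (X n) (\<D> n) \<mu> g" for g J j
 proof -
  define eps where "eps = 1 / real (2 * Suc j)"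
  have eps: "eps > 0" "eps + eps = 1 / Suc j" by (simp_all add: eps_def field_simps)
  have "\<exists>h. step (X n) (\<D> n) h \<and> (\<forall>a\<in>X n. h a \<le> g a) \<and> sint (X n) \<mu> h \<ge> J - eps"
  proof (rule ccontr)
   assume "\<not> ?thesis"
   then have no: "\<not> (step (X n) (\<D> n) h \<and> (\<forall>a\<in>X n. h a \<le> g a) \<and> sint (X n) \<mu> h \<ge> J - eps)" for h
    by simp
   have "lint (X n) (\<D> n) \<mu> g \<le> J - eps"
   proof (rule lint_least[of _ _ 0])
    fix h assume "step (X n) (\<D> n) h" "!!x. x \<in> X n ==> h x \<le> g x"
    then show "sint (X n) \<mu> h \<le> J - eps" using no[of h] by simp
   qed (simp add: g)
   then show False using J eps(1) by simp
  qed
  then obtain h where h: "step (X n) (\<D> n) h" "\<forall>a\<in>X n. h a \<le> g a" "sint (X n) \<mu> h \<ge> J - eps"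
   by (elim exE conjE)
  have "\<exists>G. G \<in> borel_measurable P \<and> (\<forall>q\<in>space P. 0 \<le> G q \<and> G q \<le> g (realization L U N n q)) \<and>
    integral\<^sup>L P G \<ge> sint (X n) \<mu> h - 1 / real (2 * Suc j)"
   unfolding P_def
  proof (rule lower_function[OF N \<mu> _ _ h(1)])
   show "tp L U N a = tp L U N a' ==> a \<in> X n ==> a' \<in> X n ==> g a = g a'" for a a' by (rule ginv)
  qed (simp_all add: g h(2))
  then obtain G where G: "G \<in> borel_measurable P" "\<forall>q\<in>space P. 0 \<le> G q \<and> G q \<le> g (realization L U N n q)"
   "integral\<^sup>L P G \<ge> sint (X n) \<mu> h - eps" unfolding eps_def by (elim exE conjE)
  have "J - 1 / Suc j = J - eps - eps" using eps(2) by simp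
  also have "\<dots> \<le> integral\<^sup>L P G" using G(3) h(3) by simp
  finally show ?thesis using G(1,2) by (intro exI[of _ G] conjI)
 qed
 show ?thesis
 proof (rule sandwich_completion)
  show "prob_space P" by (rule P.prob_space_axioms)
  fix j
  have "\<exists>G. G \<in> borel_measurable P \<and>
   (\<forall>q\<in>space P. 0 \<le> G q \<and> G q \<le> f (realization L U N n q)) \<and> integral\<^sup>L P G \<ge> I - 1 / Suc j"
   by (rule lower[OF f inv I(1)])
  then obtain G where G: "G \<in> borel_measurable P" "integral\<^sup>L P G \<ge> I - 1 / Suc j"
   "!!q. q \<in> space P ==> 0 \<le> G q \<and> G q \<le> f (realization L U N n q)" by meson
  have f': "0 \<le> 1 - f a \<and> 1 - f a \<le> 1" if "a \<in> X n" for a using f[OF that] by simp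
  have inv': "1 - f a = 1 - f a'" if "a \<in> X n" "a' \<in> X n" "tp L U N a = tp L U N a'" for a a'
   using inv[OF that] by simp
  have "\<exists>K. K \<in> borel_measurable P \<and>
   (\<forall>q\<in>space P. 0 \<le> K q \<and> K q \<le> 1 - f (realization L U N n q)) \<and> integral\<^sup>L P K \<ge> 1 - I - 1 / Suc j"
   by (rule lower[OF f' inv' I(2)])
  then obtain K where K: "K \<in> borel_measurable P" "integral\<^sup>L P K \<ge> 1 - I - 1 / Suc j"
   "!!q. q \<in> space P ==> 0 \<le> K q \<and> K q \<le> 1 - f (realization L U N n q)" by meson
  have K1: "0 \<le> K q \<and> K q \<le> 1" if "q \<in> space P" for q
   using K(3)[OF that] f[OF sp[OF that]] by simp
  have "integrable P K"
   by (rule P.integrable_const_bound[where B = 1, OF _ K(1)]) (simp add: K1 AE_I2)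
  then have KI: "integral\<^sup>L P (\<lambda>q. 1 - K q) \<le> I + 1 / Suc j" using K(2) P.prob_space by simp
  show "\<exists>G H. G \<in> borel_measurable P \<and> H \<in> borel_measurable P \<and>
   (\<forall>q\<in>space P. 0 \<le> G q \<and> G q \<le> f (realization L U N n q) \<and> f (realization L U N n q) \<le> H q \<and> H q \<le> 1) \<and>
   integral\<^sup>L P G \<ge> I - 1 / Suc j \<and> integral\<^sup>L P H \<le> I + 1 / Suc j"
  proof (rule exI[of _ G], rule exI[of _ "\<lambda>q. 1 - K q"], intro conjI ballI)
   show "(\<lambda>q. 1 - K q) \<in> borel_measurable P" using K(1) by measurable
   fix q assume q: "q \<in> space P"
   show "0 \<le> G q" "G q \<le> f (realization L U N n q)" using G(3)[OF q] by simp_all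
   show "f (realization L U N n q) \<le> 1 - K q" "1 - K q \<le> 1" using K(3)[OF q] by simp_all
  qed (rule G(1), rule G(2), rule KI)
 qed
qed

lemma fin_sat_invariant:
 assumes \<nu>: "keisler L U k \<nu>" "fin_sat_measure L U M k \<nu>" and N: "M \<subseteq> N" "N \<subseteq> univ U"
  and D: "D \<in> definable L U N (m + k)" and a: "a \<in> X m" "a' \<in> X m" "tp L U N a = tp L U N a'"
 shows "\<nu> {b \<in> X k. a @ b \<in> D} = \<nu> {b \<in> X k. a' @ b \<in> D}"
proof -
 interpret N: base_set L U N by (rule base_set[OF N(2)])
 interpret charge "X k" "\<D> k" \<nu> by (rule keisler_charge_univ[OF \<nu>(1)])
 have DU: "D \<in> \<D> (m + k)" using definable_mono[OF N(2)] D by blast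
 have le: "\<nu> {b \<in> X k. a @ b \<in> D} \<le> \<nu> {b \<in> X k. a' @ b \<in> D}"
  if a: "a \<in> X m" "a' \<in> X m" "tp L U N a = tp L U N a'" for a a'
 proof (rule ccontr)
  let ?E = "\<lambda>a. {b \<in> X k. a @ b \<in> D}"
  assume "\<not> ?thesis"
  have E: "?E a \<in> \<D> k" "?E a' \<in> \<D> k" using cofibre_univ[OF DU] a by auto
  then have E': "?E a - ?E a' \<in> \<D> k" "?E a \<inter> ?E a' \<in> \<D> k" by auto
  have "\<nu> (?E a) = \<nu> ((?E a - ?E a') \<union> (?E a \<inter> ?E a'))" by (rule arg_cong[where f = \<nu>]) blast
  also have "\<dots> = \<nu> (?E a - ?E a') + \<nu> (?E a \<inter> ?E a')" using E' by (intro nu_Un) auto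
  also have "\<nu> (?E a \<inter> ?E a') \<le> \<nu> (?E a')" using E E' by (intro nu_mono) auto
  finally have "\<nu> (?E a - ?E a') > 0" using \<open>\<not> _\<close> by simp
  then obtain b where b: "b \<in> tuples k M" "b \<in> ?E a - ?E a'"
   using \<nu>(2) E'(1) unfolding fin_sat_measure_def by meson
  have bN: "set b \<subseteq> N" "b \<in> X k" using b(1) N by (auto simp: tuples_def)
  then have F: "{x \<in> X m. x @ b \<in> D} \<in> definable L U N m"
   using tuples_fibre[OF D bN(2)] by (simp add: Un_absorb2)
  have "a \<in> {x \<in> X m. x @ b \<in> D}" using b(2) a(1) by blast
  then have "a' \<in> {x \<in> X m. x @ b \<in> D}" using N.tp_tcyl[OF a(1) F] N.tp_tcyl[OF a(2) F] a(3) by simp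
  then show False using b(2) bN(2) by blast
 qed
 show ?thesis using le[OF a] le[OF a(2,1) a(3)[symmetric]] by simp
qed

lemma swap_mem:
 assumes "length a = m"
 shows "b @ a \<in> swap_blocks m D \<longleftrightarrow> a @ b \<in> D"
 using assms by (auto simp: swap_blocks_def)

text \<open>Applied to \<open>D\<close> and to its complement, the inequality \<open>core\<close> squeezes the lower and the upper
 integral of \<open>a \<mapsto> \<nu>(D_a)\<close> together.  As this function is invariant over small models, it is then
 measurable for the completed measure, which is what makes the other product well-defined.\<close>

lemma commuting_products:
 assumes \<mu>: "keisler L U m \<mu>" "definable_measure L U M m \<mu>"
  and \<nu>: "keisler L U k \<nu>" "fin_sat_measure L U M k \<nu>"
  and core: "!!D. D \<in> \<D> (m + k) ==> lint (X k) (\<D> k) \<nu> (\<lambda>b. \<mu> {a \<in> X m. a @ b \<in> D})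
   \<le> lint (X m) (\<D> m) \<mu> (\<lambda>a. \<nu> {b \<in> X k. a @ b \<in> D})"
 shows "morley_wd L \<kappa> U M k m \<nu> \<mu>"
  and "D \<in> \<D> (m + k) ==> morley L \<kappa> U M m k \<mu> \<nu> D = morley L \<kappa> U M k m \<nu> \<mu> (swap_blocks m D)"
proof -
 interpret \<mu>: charge "X m" "\<D> m" \<mu> by (rule keisler_charge_univ[OF \<mu>(1)])
 interpret \<nu>: charge "X k" "\<D> k" \<nu> by (rule keisler_charge_univ[OF \<nu>(1)])
 let ?F = "\<lambda>D b. \<mu> {a \<in> X m. a @ b \<in> D}" and ?f = "\<lambda>D a. \<nu> {b \<in> X k. a @ b \<in> D}"
 have key: "fibre_measure L U N k m \<nu> E \<in> borel_measurable (completion (borel_restr L U N m \<mu>)) \<and>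
   integral\<^sup>L (completion (borel_restr L U N m \<mu>)) (fibre_measure L U N k m \<nu> E) = lint (X k) (\<D> k) \<nu> (?F D)"
  if N: "small_model L \<kappa> U N" "M \<subseteq> N" and E: "E \<in> definable L U N (k + m)"
   and D: "D = swap_blocks k E" for N D E
 proof -
  note NU = small_model_sub[OF N(1)]
  have DN: "D \<in> definable L U N (m + k)" unfolding D by (rule swap_blocks_definable[OF E NU(1)])
  then have DU: "D \<in> \<D> (m + k)" using definable_mono[OF NU(1)] by blast
  have C: "X (m + k) - D \<in> \<D> (m + k)"
   using algebra.compl_sets[OF definable_algebra[OF univ_ne] DU] by simp
  have "1 - lint (X k) (\<D> k) \<nu> (?F D) = lint (X k) (\<D> k) \<nu> (\<lambda>b. 1 - ?F D b)"
   using \<nu>.lint_compl[OF definable_fibre_tame[OF \<mu>(2) DU M_sub(1)]] by simp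
  also have "\<dots> = lint (X k) (\<D> k) \<nu> (?F (X (m + k) - D))"
  proof (rule \<nu>.lint_cong)
   fix b assume b: "b \<in> X k"
   have "{a \<in> X m. a @ b \<in> X (m + k) - D} = X m - {a \<in> X m. a @ b \<in> D}"
    using tuples_append[OF _ b] by auto
   then show "1 - ?F D b = ?F (X (m + k) - D) b" using \<mu>.nu_compl[OF fibre_univ[OF DU b]] by simp
  qed
  also have "\<dots> \<le> lint (X m) (\<D> m) \<mu> (?f (X (m + k) - D))" by (rule core[OF C])
  also have "\<dots> = lint (X m) (\<D> m) \<mu> (\<lambda>a. 1 - ?f D a)"
  proof (rule \<mu>.lint_cong)
   fix a assume a: "a \<in> X m"
   have "{b \<in> X k. a @ b \<in> X (m + k) - D} = X k - {b \<in> X k. a @ b \<in> D}"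
    using tuples_append[OF a] by auto
   then show "?f (X (m + k) - D) a = 1 - ?f D a" using \<nu>.nu_compl[OF cofibre_univ[OF DU a]] by simp
  qed
  finally have upper: "1 - lint (X k) (\<D> k) \<nu> (?F D) \<le> lint (X m) (\<D> m) \<mu> (\<lambda>a. 1 - ?f D a)" .
  have "fibre_measure L U N k m \<nu> E = (\<lambda>q. \<nu> {b \<in> X k. b @ realization L U N m q \<in> E})"
   by (simp add: fibre_measure_def[abs_def])
  also have "\<dots> = (\<lambda>q. ?f D (realization L U N m q))"
   unfolding D by (intro ext arg_cong[where f = \<nu>] Collect_cong conj_cong refl) (simp add: swap_mem tuplesD)
  finally have eq: "fibre_measure L U N k m \<nu> E = (\<lambda>q. ?f D (realization L U N m q))" .
  show ?thesis unfolding eq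
  proof (rule invariant_integral[OF N(1) \<mu>(1) _ _ core[OF DU] upper])
   show "0 \<le> ?f D a \<and> ?f D a \<le> 1" if "a \<in> X m" for a
    using \<nu>.nonneg[OF cofibre_univ[OF DU that]] \<nu>.nu_le_1[OF cofibre_univ[OF DU that]] by simp
  qed (rule fin_sat_invariant[OF \<nu> N(2) NU(1) DN])
 qed
 show "morley_wd L \<kappa> U M k m \<nu> \<mu>"
  unfolding morley_wd_def using key by simp
 assume D: "D \<in> \<D> (m + k)"
 define E where "E = swap_blocks m D"
 have E: "E \<in> \<D> (k + m)" unfolding E_def by (rule swap_blocks_definable[OF D]) simp
 have DE: "D = swap_blocks k E"
 proof (intro equalityI subsetI)
  fix x assume "x \<in> D"
  then have "x \<in> X (m + k)" using definable_tuples[OF D] by blast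
  then obtain a b where "x = a @ b" "a \<in> X m" "b \<in> X k" by (rule tuples_splitE)
  then show "x \<in> swap_blocks k E" using \<open>x \<in> D\<close> by (simp add: E_def swap_mem tuplesD)
 next
  fix x assume "x \<in> swap_blocks k E"
  then obtain a b where ab: "x = a @ b" "length b = k" "b @ a \<in> E" by (auto simp: swap_blocks_def)
  then have "b @ a \<in> X (k + m)" using definable_tuples[OF E] by blast
  then have "length a = m" using ab(2) by (simp add: tuples_def)
  then show "x \<in> D" using ab by (simp add: E_def swap_mem)
 qed
 define N where "N = (SOME N. small_model L \<kappa> U N \<and> M \<subseteq> N \<and> E \<in> definable L U N (k + m))"
 have N: "small_model L \<kappa> U N" "M \<subseteq> N" "E \<in> definable L U N (k + m)"
  using someI_ex[OF exists_model_for[OF E]] by (auto simp: N_def)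
 have "morley L \<kappa> U M k m \<nu> \<mu> E
   = integral\<^sup>L (completion (borel_restr L U N m \<mu>)) (fibre_measure L U N k m \<nu> E)"
  by (simp add: morley_def N_def Let_def)
 then show "morley L \<kappa> U M m k \<mu> \<nu> D = morley L \<kappa> U M k m \<nu> \<mu> (swap_blocks m D)"
  using key[OF N DE] morley_lint[OF \<mu>(2) \<nu>(1) D] by (simp add: E_def)
qed

end

section \<open>Continuous formulas\<close>

lemma SUP_diff_le:
 fixes f :: "'x => real" and g :: "'y => real"
 assumes A: "A \<noteq> {}" "B \<noteq> {}" and f: "!!x. x \<in> A ==> f x \<in> {0..1}" and g: "!!y. y \<in> B ==> g y \<in> {0..1}"
  and fg: "!!x. x \<in> A ==> \<exists>y\<in>B. \<bar>f x - g y\<bar> \<le> eps" and gf: "!!y. y \<in> B ==> \<exists>x\<in>A. \<bar>f x - g y\<bar> \<le> eps"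
 shows "\<bar>(SUP x\<in>A. f x) - (SUP y\<in>B. g y)\<bar> \<le> eps" "\<bar>(INF x\<in>A. f x) - (INF y\<in>B. g y)\<bar> \<le> eps"
proof -
 have bdd: "bdd_above (f ` A)" "bdd_above (g ` B)" "bdd_below (f ` A)" "bdd_below (g ` B)"
  using f g by (auto intro!: bdd_aboveI2[of _ _ 1] bdd_belowI2[of _ 0])
 have "(SUP x\<in>A. f x) \<le> (SUP y\<in>B. g y) + eps"
 proof (rule cSUP_least[OF A(1)])
  fix x assume "x \<in> A"
  then obtain y where y: "y \<in> B" "\<bar>f x - g y\<bar> \<le> eps" using fg by blast
  have "g y \<le> (SUP y\<in>B. g y)" by (rule cSUP_upper[OF y(1) bdd(2)])
  then show "f x \<le> (SUP y\<in>B. g y) + eps" using y(2) by simp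
 qed
 moreover have "(SUP y\<in>B. g y) \<le> (SUP x\<in>A. f x) + eps"
 proof (rule cSUP_least[OF A(2)])
  fix y assume "y \<in> B"
  then obtain x where x: "x \<in> A" "\<bar>f x - g y\<bar> \<le> eps" using gf by blast
  have "f x \<le> (SUP x\<in>A. f x)" by (rule cSUP_upper[OF x(1) bdd(1)])
  then show "g y \<le> (SUP x\<in>A. f x) + eps" using x(2) by simp
 qed
 ultimately show "\<bar>(SUP x\<in>A. f x) - (SUP y\<in>B. g y)\<bar> \<le> eps" by simp
 have "(INF y\<in>B. g y) - eps \<le> (INF x\<in>A. f x)"
 proof (rule cINF_greatest[OF A(1)])
  fix x assume "x \<in> A"
  then obtain y where y: "y \<in> B" "\<bar>f x - g y\<bar> \<le> eps" using fg by blast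
  have "(INF y\<in>B. g y) \<le> g y" by (rule cINF_lower[OF bdd(4) y(1)])
  then show "(INF y\<in>B. g y) - eps \<le> f x" using y(2) by simp
 qed
 moreover have "(INF x\<in>A. f x) - eps \<le> (INF y\<in>B. g y)"
 proof (rule cINF_greatest[OF A(2)])
  fix y assume "y \<in> B"
  then obtain x where x: "x \<in> A" "\<bar>f x - g y\<bar> \<le> eps" using gf by blast
  have "(INF x\<in>A. f x) \<le> f x" by (rule cINF_lower[OF bdd(3) x(1)])
  then show "(INF x\<in>A. f x) - eps \<le> g y" using x(2) by simp
 qed
 ultimately show "\<bar>(INF x\<in>A. f x) - (INF y\<in>B. g y)\<bar> \<le> eps" by simp
qed

lemma cval_env_CConn:
 "cval_env C (CConn u \<psi>s) e = u (\<lambda>i. if i < length \<psi>s then cval_env C (\<psi>s ! i) e else 0)"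
proof -
 have "(\<lambda>i. if i < length \<psi>s then (map (cval_env C) \<psi>s ! i) e else 0)
   = (\<lambda>i. if i < length \<psi>s then cval_env C (\<psi>s ! i) e else 0)" by (rule ext) simp
 then show ?thesis by (simp only: cval_env.simps Let_def)
qed

lemma wf_CConn: "wf_cform L (CConn u \<psi>s) \<longleftrightarrow>
  continuous_on unit_cube u \<and> u ` unit_cube \<subseteq> {0..1} \<and> (\<forall>\<psi>\<in>set \<psi>s. wf_cform L \<psi>)"
 by (auto simp: list_all_iff)

lemma cval_env_cong:
 "(!!i. i \<in> cfvars \<psi> ==> e i = e' i) ==> cval_env C \<psi> e = cval_env C \<psi> e'"
proof (induction \<psi> arbitrary: e e')
 case (CDist i j)
 then show ?case by simp
next
 case (CProb \<phi> vs)
 then have "map e vs = map e' vs" by simp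
 then show ?case by (simp only: cval_env.simps)
next
 case (CConn u \<psi>s)
 have "cval_env C (\<psi>s ! i) e = cval_env C (\<psi>s ! i) e'" if "i < length \<psi>s" for i
 proof (rule CConn.IH[OF nth_mem[OF that]])
  fix j assume "j \<in> cfvars (\<psi>s ! i)"
  then have "j \<in> cfvars (CConn u \<psi>s)" using nth_mem[OF that] by auto
  then show "e j = e' j" by (rule CConn.prems)
 qed
 then have "(\<lambda>i. if i < length \<psi>s then cval_env C (\<psi>s ! i) e else 0)
   = (\<lambda>i. if i < length \<psi>s then cval_env C (\<psi>s ! i) e' else 0)" by (intro ext) simp
 then show ?case unfolding cval_env_CConn by (rule arg_cong)
next
 case (CSup i \<psi>)
 have "cval_env C \<psi> (e(i := x)) = cval_env C \<psi> (e'(i := x))" for x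
  by (rule CSup.IH) (use CSup.prems in auto)
 then show ?case by simp
next
 case (CInf i \<psi>)
 have "cval_env C \<psi> (e(i := x)) = cval_env C \<psi> (e'(i := x))" for x
  by (rule CInf.IH) (use CInf.prems in auto)
 then show ?case by simp
qed

primrec crename :: "(nat => nat) => ('f, 'r) cform => ('f, 'r) cform" where
 "crename \<pi> (CDist i j) = CDist (\<pi> i) (\<pi> j)"
| "crename \<pi> (CProb \<phi> vs) = CProb \<phi> (map \<pi> vs)"
| "crename \<pi> (CConn u \<psi>s) = CConn u (map (crename \<pi>) \<psi>s)"
| "crename \<pi> (CSup i \<psi>) = CSup (\<pi> i) (crename \<pi> \<psi>)"
| "crename \<pi> (CInf i \<psi>) = CInf (\<pi> i) (crename \<pi> \<psi>)"

lemma wf_crename: "wf_cform L (crename \<pi> \<psi>) = wf_cform L \<psi>"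
proof (induction \<psi>)
 case (CConn u \<psi>s)
 then show ?case unfolding crename.simps wf_CConn by simp
qed simp_all

lemma cfvars_crename: "inj \<pi> ==> cfvars (crename \<pi> \<psi>) = \<pi> ` cfvars \<psi>"
 by (induction \<psi>) (auto simp: image_set_diff inj_eq)

lemma cval_crename: "inj \<pi> ==> cval_env C (crename \<pi> \<psi>) e = cval_env C \<psi> (\<lambda>i. e (\<pi> i))"
proof (induction \<psi> arbitrary: e)
 case (CConn u \<psi>s)
 have "cval_env C (map (crename \<pi>) \<psi>s ! i) e = cval_env C (\<psi>s ! i) (\<lambda>i. e (\<pi> i))" if "i < length \<psi>s" for i
  using CConn.IH[OF nth_mem[OF that] CConn.prems] that by simp
 then have "(\<lambda>i. if i < length \<psi>s then cval_env C (map (crename \<pi>) \<psi>s ! i) e else 0)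
   = (\<lambda>i. if i < length \<psi>s then cval_env C (\<psi>s ! i) (\<lambda>i. e (\<pi> i)) else 0)" by (intro ext) simp
 then show ?case unfolding cval_env_CConn crename.simps length_map by (rule arg_cong)
next
 case (CSup i \<psi>)
 have "(\<lambda>j. (e(\<pi> i := x)) (\<pi> j)) = (\<lambda>j. e (\<pi> j))(i := x)" for x
  using CSup.prems by (auto simp: inj_eq)
 then show ?case using CSup by simp
next
 case (CInf i \<psi>)
 have "(\<lambda>j. (e(\<pi> i := x)) (\<pi> j)) = (\<lambda>j. e (\<pi> j))(i := x)" for x
  using CInf.prems by (auto simp: inj_eq)
 then show ?case using CInf by simp
qed (simp_all add: comp_def)

lemma cstructD:
 assumes "is_cstruct L C"
 shows "cuniv C \<noteq> {}" "Metric_space (cuniv C) (cdist C)"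
  "x \<in> cuniv C ==> y \<in> cuniv C ==> cdist C x y \<le> 1"
  "fm L n \<phi> ==> xs \<in> tuples n (cuniv C) ==> cprob C \<phi> xs \<in> {0..1}"
  "fm L n \<phi> ==> xs \<in> tuples n (cuniv C) ==> ys \<in> tuples n (cuniv C) ==>
   \<bar>cprob C \<phi> xs - cprob C \<phi> ys\<bar> \<le> (\<Sum>i<n. cdist C (xs ! i) (ys ! i))"
 using assms unfolding is_cstruct_def by blast+

lemma map_tuples: "(!!i. e i \<in> S) ==> map e vs \<in> tuples (length vs) S"
 by (auto simp: tuples_def)

lemma cval_bounds:
 assumes C: "is_cstruct L C"
 shows "wf_cform L \<psi> ==> (!!i. e i \<in> cuniv C) ==> cval_env C \<psi> e \<in> {0..1}"
proof (induction \<psi> arbitrary: e)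
 case (CDist i j)
 interpret Metric_space "cuniv C" "cdist C" by (rule cstructD(2)[OF C])
 show ?case using cstructD(3)[OF C CDist(2) CDist(2)] nonneg by simp
next
 case (CProb \<phi> vs)
 then show ?case using cstructD(4)[OF C _ map_tuples[of e "cuniv C" vs]] by simp
next
 case (CConn u \<psi>s)
 have "(\<lambda>i. if i < length \<psi>s then cval_env C (\<psi>s ! i) e else 0) \<in> unit_cube"
  unfolding unit_cube_def
 proof (intro CollectI allI)
  fix i
  have "cval_env C (\<psi>s ! i) e \<in> {0..1}" if "i < length \<psi>s"
   using CConn.IH[OF nth_mem[OF that] _ CConn.prems(2)] CConn.prems(1) that unfolding wf_CConn by simp
  then show "(if i < length \<psi>s then cval_env C (\<psi>s ! i) e else 0) \<in> {0..1::real}" by simp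
 qed
 then show ?case using CConn.prems(1) unfolding wf_CConn cval_env_CConn by blast
next
 case (CSup i \<psi>)
 have *: "cval_env C \<psi> (e(i := x)) \<in> {0..1}" if "x \<in> cuniv C" for x
  by (rule CSup.IH) (use CSup.prems that in auto)
 obtain x where x: "x \<in> cuniv C" using cstructD(1)[OF C] by blast
 have "bdd_above ((\<lambda>x. cval_env C \<psi> (e(i := x))) ` cuniv C)"
  using * by (intro bdd_aboveI2[of _ _ 1]) simp
 then have "cval_env C \<psi> (e(i := x)) \<le> (SUP x\<in>cuniv C. cval_env C \<psi> (e(i := x)))"
  by (rule cSUP_upper[OF x])
 moreover have "(SUP x\<in>cuniv C. cval_env C \<psi> (e(i := x))) \<le> 1"
  using * cstructD(1)[OF C] by (intro cSUP_least) simp_all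
 ultimately show ?case using *[OF x] by simp
next
 case (CInf i \<psi>)
 have *: "cval_env C \<psi> (e(i := x)) \<in> {0..1}" if "x \<in> cuniv C" for x
  by (rule CInf.IH) (use CInf.prems that in auto)
 obtain x where x: "x \<in> cuniv C" using cstructD(1)[OF C] by blast
 have "bdd_below ((\<lambda>x. cval_env C \<psi> (e(i := x))) ` cuniv C)"
  using * by (intro bdd_belowI2[of _ 0]) simp
 then have "(INF x\<in>cuniv C. cval_env C \<psi> (e(i := x))) \<le> cval_env C \<psi> (e(i := x))"
  by (rule cINF_lower[OF _ x])
 moreover have "0 \<le> (INF x\<in>cuniv C. cval_env C \<psi> (e(i := x)))"
  using * cstructD(1)[OF C] by (intro cINF_greatest) simp_all
 ultimately show ?case using *[OF x] by simp
qed

text \<open>The unit cube is compact, so connectives are uniformly continuous, uniformly over all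
 coordinates.\<close>

lemma connective_uniform:
 assumes "continuous_on unit_cube u" "0 < eps"
 shows "\<exists>\<eta>>0. \<forall>v\<in>unit_cube. \<forall>w\<in>unit_cube. (\<forall>i. \<bar>v i - w i\<bar> \<le> \<eta>) --> \<bar>u v - u w :: real\<bar> \<le> eps"
proof -
 have "unit_cube = (\<Pi>\<^sub>E i\<in>UNIV. {0..1::real})" by (auto simp: unit_cube_def PiE_def Pi_def)
 moreover have "compactin (product_topology (\<lambda>i. euclidean) UNIV) (\<Pi>\<^sub>E i\<in>(UNIV :: nat set). {0..1::real})"
  by (subst compactin_PiE) simp
 ultimately have "compact unit_cube"
  by (simp add: euclidean_product_topology)
 then have "uniformly_continuous_on unit_cube u" using assms(1) by (rule compact_uniformly_continuous[rotated])
 then obtain d where d: "d > 0" "!!v w. v \<in> unit_cube ==> w \<in> unit_cube ==> dist v w < d ==> dist (u v) (u w) < eps"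
  using assms(2) unfolding uniformly_continuous_on_def by metis
 obtain N where N: "(1 / 2 :: real) ^ N < d / 2" using d(1) real_arch_pow_inv[of "d / 2" "1 / 2"] by auto
 have "dist v w < d" if "!!i. \<bar>v i - w i\<bar> \<le> d / 8" for v w :: "nat => real"
 proof -
  have "dist v w \<le> 2 * Max {dist (v (from_nat n)) (w (from_nat n)) |n. n \<le> N} + (1 / 2) ^ N"
   by (rule dist_fun_le_dist_first_terms)
  also have "Max {dist (v (from_nat n)) (w (from_nat n)) |n. n \<le> N} \<le> d / 8"
   using that by (subst Max_le_iff) (auto simp: dist_real_def)
  finally show ?thesis using N d(1) by simp
 qed
 then have "\<forall>v\<in>unit_cube. \<forall>w\<in>unit_cube. (\<forall>i. \<bar>v i - w i\<bar> \<le> d / 8) --> \<bar>u v - u w\<bar> \<le> eps"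
  using d(2) by (fastforce simp: dist_real_def)
 then show ?thesis using d(1) by (intro exI[of _ "d / 8"]) simp
qed

lemma common_delta:
 assumes "finite I" "!!i. i \<in> I ==> \<exists>\<delta>>0::real. P i \<delta>"
  and "!!i \<delta> \<delta>'. P i \<delta> ==> 0 < \<delta>' ==> \<delta>' \<le> \<delta> ==> P i \<delta>'"
 shows "\<exists>\<delta>>0. \<forall>i\<in>I. P i \<delta>"
 using assms(1,2)
proof (induction I rule: finite_induct)
 case empty
 show ?case by (rule exI[of _ 1]) simp
next
 case (insert j I)
 obtain \<delta> where \<delta>: "\<delta> > 0" "\<forall>i\<in>I. P i \<delta>" using insert by auto
 obtain \<delta>' where \<delta>': "\<delta>' > 0" "P j \<delta>'" using insert.prems by auto
 have "P i (min \<delta> \<delta>')" if "i \<in> insert j I" for i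
  using that \<delta> \<delta>' assms(3)[of j \<delta>' "min \<delta> \<delta>'"] assms(3)[of i \<delta> "min \<delta> \<delta>'"] by auto
 then show ?case using \<delta>(1) \<delta>'(1) by (intro exI[of _ "min \<delta> \<delta>'"]) simp
qed

lemma cval_uniform:
 fixes C :: "('c, 'f, 'r) cstruct"
 assumes C: "is_cstruct L C"
 shows "wf_cform L \<psi> ==> 0 < eps ==> \<exists>\<delta>>0. \<forall>e e'. (\<forall>i. e i \<in> cuniv C \<and> e' i \<in> cuniv C \<and> cdist C (e i) (e' i) \<le> \<delta>)
  --> \<bar>cval_env C \<psi> e - cval_env C \<psi> e'\<bar> \<le> eps"
proof (induction \<psi> arbitrary: eps)
 interpret Metric_space "cuniv C" "cdist C" by (rule cstructD(2)[OF C])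
 case (CDist i j)
 have "\<bar>cdist C (e i) (e j) - cdist C (e' i) (e' j)\<bar> \<le> eps"
  if e: "!!i. e i \<in> cuniv C \<and> e' i \<in> cuniv C \<and> cdist C (e i) (e' i) \<le> eps / 2" for e e' :: "nat => 'c"
 proof -
  have "cdist C (e i) (e j) \<le> cdist C (e i) (e' i) + cdist C (e' i) (e j)"
   "cdist C (e' i) (e j) \<le> cdist C (e' i) (e' j) + cdist C (e' j) (e j)"
   "cdist C (e' i) (e' j) \<le> cdist C (e' i) (e i) + cdist C (e i) (e' j)"
   "cdist C (e i) (e' j) \<le> cdist C (e i) (e j) + cdist C (e j) (e' j)"
   using e by (intro triangle; simp)+
  then show ?thesis using e[of i] e[of j] commute[of "e' i" "e i"] commute[of "e' j" "e j"]
   by linarith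
 qed
 then show ?case using CDist.prems(2) by (intro exI[of _ "eps / 2"]) simp
next
 interpret Metric_space "cuniv C" "cdist C" by (rule cstructD(2)[OF C])
 case (CProb \<phi> vs)
 define \<delta> where "\<delta> = eps / (length vs + 1)"
 have \<delta>: "\<delta> > 0" "length vs * \<delta> \<le> eps" using CProb.prems(2) by (simp_all add: \<delta>_def field_simps)
 have "\<bar>cprob C \<phi> (map e vs) - cprob C \<phi> (map e' vs)\<bar> \<le> eps"
  if e: "!!i. e i \<in> cuniv C \<and> e' i \<in> cuniv C \<and> cdist C (e i) (e' i) \<le> \<delta>" for e e' :: "nat => 'c"
 proof -
  have fm: "fm L (length vs) \<phi>" using CProb.prems(1) by simp
  have "\<bar>cprob C \<phi> (map e vs) - cprob C \<phi> (map e' vs)\<bar>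
    \<le> (\<Sum>i<length vs. cdist C (map e vs ! i) (map e' vs ! i))"
   by (rule cstructD(5)[OF C fm map_tuples map_tuples]) (use e in auto)
  also have "\<dots> \<le> (\<Sum>i<length vs. \<delta>)" using e by (intro sum_mono) simp
  also have "\<dots> \<le> eps" using \<delta>(2) by simp
  finally show ?thesis .
 qed
 then show ?case using \<delta>(1) by (intro exI[of _ \<delta>]) simp
next
 case (CConn u \<psi>s)
 have u: "continuous_on unit_cube u" and wf: "!!\<psi>. \<psi> \<in> set \<psi>s ==> wf_cform L \<psi>"
  using CConn.prems(1) unfolding wf_CConn by blast+
 obtain \<eta> where \<eta>: "\<eta> > 0" "!!v w. v \<in> unit_cube ==> w \<in> unit_cube ==> (\<forall>i. \<bar>v i - w i\<bar> \<le> \<eta>) ==> \<bar>u v - u w\<bar> \<le> eps"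
  using connective_uniform[OF u CConn.prems(2)] by metis
 let ?Q = "\<lambda>\<psi> \<delta>. \<forall>e e'. (\<forall>i. e i \<in> cuniv C \<and> e' i \<in> cuniv C \<and> cdist C (e i) (e' i) \<le> \<delta>)
   --> \<bar>cval_env C \<psi> e - cval_env C \<psi> e'\<bar> \<le> \<eta>"
 have "\<exists>\<delta>>0. \<forall>\<psi>\<in>set \<psi>s. ?Q \<psi> \<delta>"
 proof (rule common_delta)
  show "\<exists>\<delta>>0. ?Q \<psi> \<delta>" if "\<psi> \<in> set \<psi>s" for \<psi> by (rule CConn.IH[OF that wf[OF that] \<eta>(1)])
  show "?Q \<psi> \<delta>'" if "?Q \<psi> \<delta>" "0 < \<delta>'" "\<delta>' \<le> \<delta>" for \<psi> \<delta> \<delta>'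
   using that(1,3) by (meson order_trans)
 qed simp
 then obtain \<delta> where \<delta>: "\<delta> > 0" "!!\<psi>. \<psi> \<in> set \<psi>s ==> ?Q \<psi> \<delta>" by blast
 have "\<bar>cval_env C (CConn u \<psi>s) e - cval_env C (CConn u \<psi>s) e'\<bar> \<le> eps"
  if e: "\<forall>i. e i \<in> cuniv C \<and> e' i \<in> cuniv C \<and> cdist C (e i) (e' i) \<le> \<delta>" for e e'
  unfolding cval_env_CConn
 proof (rule \<eta>(2))
  have cube: "(\<lambda>i. if i < length \<psi>s then cval_env C (\<psi>s ! i) e else 0) \<in> unit_cube"
   if "!!i. e i \<in> cuniv C" for e
   unfolding unit_cube_def using cval_bounds[OF C wf[OF nth_mem], of _ e] that by auto
  show "(\<lambda>i. if i < length \<psi>s then cval_env C (\<psi>s ! i) e else 0) \<in> unit_cube"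
   "(\<lambda>i. if i < length \<psi>s then cval_env C (\<psi>s ! i) e' else 0) \<in> unit_cube"
   by (rule cube, simp add: e)+
  show "\<forall>i. \<bar>(if i < length \<psi>s then cval_env C (\<psi>s ! i) e else 0)
    - (if i < length \<psi>s then cval_env C (\<psi>s ! i) e' else 0)\<bar> \<le> \<eta>"
   using \<delta>(2)[OF nth_mem, rule_format, OF _ e[rule_format]] \<eta>(1) by auto
 qed
 then show ?case using \<delta>(1) by blast
next
 interpret Metric_space "cuniv C" "cdist C" by (rule cstructD(2)[OF C])
 case (CSup i \<psi>)
 have wf: "wf_cform L \<psi>" using CSup.prems(1) by simp
 obtain \<delta> where \<delta>: "\<delta> > 0" "!!e e'. (\<forall>i. e i \<in> cuniv C \<and> e' i \<in> cuniv C \<and> cdist C (e i) (e' i) \<le> \<delta>)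
   ==> \<bar>cval_env C \<psi> e - cval_env C \<psi> e'\<bar> \<le> eps" using CSup.IH[OF wf CSup.prems(2)] by blast
 have "\<bar>cval_env C (CSup i \<psi>) e - cval_env C (CSup i \<psi>) e'\<bar> \<le> eps"
  if e: "\<forall>i. e i \<in> cuniv C \<and> e' i \<in> cuniv C \<and> cdist C (e i) (e' i) \<le> \<delta>" for e e'
 proof -
  have *: "\<bar>cval_env C \<psi> (e(i := x)) - cval_env C \<psi> (e'(i := x))\<bar> \<le> eps" if "x \<in> cuniv C" for x
   by (rule \<delta>(2)) (use e that \<delta>(1) in auto)
  show ?thesis unfolding cval_env.simps
   by (rule SUP_diff_le(1)[OF cstructD(1)[OF C] cstructD(1)[OF C]])
    (use * cval_bounds[OF C wf] e in auto)
 qed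
 then show ?case using \<delta>(1) by blast
next
 interpret Metric_space "cuniv C" "cdist C" by (rule cstructD(2)[OF C])
 case (CInf i \<psi>)
 have wf: "wf_cform L \<psi>" using CInf.prems(1) by simp
 obtain \<delta> where \<delta>: "\<delta> > 0" "!!e e'. (\<forall>i. e i \<in> cuniv C \<and> e' i \<in> cuniv C \<and> cdist C (e i) (e' i) \<le> \<delta>)
   ==> \<bar>cval_env C \<psi> e - cval_env C \<psi> e'\<bar> \<le> eps" using CInf.IH[OF wf CInf.prems(2)] by blast
 have "\<bar>cval_env C (CInf i \<psi>) e - cval_env C (CInf i \<psi>) e'\<bar> \<le> eps"
  if e: "\<forall>i. e i \<in> cuniv C \<and> e' i \<in> cuniv C \<and> cdist C (e i) (e' i) \<le> \<delta>" for e e'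
 proof -
  have *: "\<bar>cval_env C \<psi> (e(i := x)) - cval_env C \<psi> (e'(i := x))\<bar> \<le> eps" if "x \<in> cuniv C" for x
   by (rule \<delta>(2)) (use e that \<delta>(1) in auto)
  show ?thesis unfolding cval_env.simps
   by (rule SUP_diff_le(2)[OF cstructD(1)[OF C] cstructD(1)[OF C]])
    (use * cval_bounds[OF C wf] e in auto)
 qed
 then show ?case using \<delta>(1) by blast
qed

primrec CInfs :: "nat => ('f, 'r) cform => ('f, 'r) cform" where
 "CInfs 0 \<psi> = \<psi>"
| "CInfs (Suc n) \<psi> = CInfs n (CInf n \<psi>)"

lemma wf_CInfs: "wf_cform L (CInfs n \<psi>) = wf_cform L \<psi>"
 by (induction n arbitrary: \<psi>) simp_all

lemma cfvars_CInfs: "cfvars (CInfs n \<psi>) = cfvars \<psi> - {..<n}"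
 by (induction n arbitrary: \<psi>) (auto simp: lessThan_Suc)

lemma CInfs_lower:
 assumes C: "is_cstruct L C"
 shows "wf_cform L \<psi> ==> (!!i. e i \<in> cuniv C) ==> (!!i. b i \<in> cuniv C) ==>
  cval_env C (CInfs n \<psi>) e \<le> cval_env C \<psi> (\<lambda>i. if i < n then b i else e i)"
proof (induction n arbitrary: \<psi>)
 case (Suc n)
 let ?e = "\<lambda>i. if i < n then b i else e i"
 have "cval_env C (CInfs (Suc n) \<psi>) e \<le> cval_env C (CInf n \<psi>) ?e"
  unfolding CInfs.simps by (rule Suc.IH) (use Suc.prems in auto)
 also have "\<dots> \<le> cval_env C \<psi> (?e(n := b n))"
  unfolding cval_env.simps
 proof (rule cINF_lower)
  show "bdd_below ((\<lambda>x. cval_env C \<psi> (?e(n := x))) ` cuniv C)"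
  proof (rule bdd_belowI2[of _ 0])
   fix x assume "x \<in> cuniv C"
   then have "cval_env C \<psi> (?e(n := x)) \<in> {0..1}"
    using Suc.prems by (intro cval_bounds[OF C]) simp_all
   then show "0 \<le> cval_env C \<psi> (?e(n := x))" by simp
  qed
 qed (rule Suc.prems)
 also have "?e(n := b n) = (\<lambda>i. if i < Suc n then b i else e i)" by (auto simp: less_Suc_eq)
 finally show ?case .
qed simp

lemma CInfs_attained:
 assumes C: "is_cstruct L C"
 shows "wf_cform L \<psi> ==> (!!i. e i \<in> cuniv C) ==> 0 < \<delta> ==>
  \<exists>b. (\<forall>i. b i \<in> cuniv C) \<and> cval_env C \<psi> (\<lambda>i. if i < n then b i else e i) \<le> cval_env C (CInfs n \<psi>) e + \<delta>"
proof (induction n arbitrary: \<psi> \<delta>)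
 case 0
 then show ?case by (intro exI[of _ e]) simp
next
 case (Suc n)
 have wf: "wf_cform L (CInf n \<psi>)" using Suc.prems(1) by simp
 obtain b where b: "!!i. b i \<in> cuniv C"
  "cval_env C (CInf n \<psi>) (\<lambda>i. if i < n then b i else e i) \<le> cval_env C (CInfs (Suc n) \<psi>) e + \<delta> / 2"
  using Suc.IH[OF wf Suc.prems(2), of "\<delta> / 2"] Suc.prems(3) unfolding CInfs.simps by auto
 let ?e = "\<lambda>i. if i < n then b i else e i"
 have "(INF x\<in>cuniv C. cval_env C \<psi> (?e(n := x))) < cval_env C (CInf n \<psi>) ?e + \<delta> / 2"
  using Suc.prems(3) by simp
 from cInf_lessD[OF _ this] obtain x where x: "x \<in> cuniv C"
  "cval_env C \<psi> (?e(n := x)) < cval_env C (CInf n \<psi>) ?e + \<delta> / 2"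
  using cstructD(1)[OF C] by blast
 have "?e(n := x) = (\<lambda>i. if i < Suc n then (b(n := x)) i else e i)" by (auto simp: less_Suc_eq)
 then have "cval_env C \<psi> (\<lambda>i. if i < Suc n then (b(n := x)) i else e i) \<le> cval_env C (CInfs (Suc n) \<psi>) e + \<delta>"
  using x(2) b(2) by simp
 then show ?case using b(1) x(1) by (intro exI[of _ "b(n := x)"]) simp
qed

text \<open>The formula \<open>Near n \<psi>s lo hi\<close> measures how far the values of the formulas \<open>\<psi>s\<close> can be
 brought, by choosing the first \<open>n\<close> variables, into the prescribed intervals.  Its vanishing is
 what elementarity transports between structures.\<close>

definition dev_conn :: "real list => real list => (nat => real) => real" where
 "dev_conn lo hi v = min 1 (\<Sum>i<length lo. max 0 (v i - hi ! i) + max 0 (lo ! i - v i))"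

definition Near :: "nat => ('f, 'r) cform list => real list => real list => ('f, 'r) cform" where
 "Near n \<psi>s lo hi = CInfs n (CConn (dev_conn lo hi) \<psi>s)"

lemma dev_conn_wf: "continuous_on unit_cube (dev_conn lo hi)" "dev_conn lo hi ` unit_cube \<subseteq> {0..1}"
proof -
 have c: "continuous_on unit_cube (\<lambda>v. v i)" for i :: nat
  by (rule continuous_on_subset[OF continuous_on_product_coordinates]) simp
 show "continuous_on unit_cube (dev_conn lo hi)"
  unfolding dev_conn_def by (intro continuous_intros c)
 show "dev_conn lo hi ` unit_cube \<subseteq> {0..1}" by (auto simp: dev_conn_def intro!: sum_nonneg)
qed

lemma wf_Near: "wf_cform L (Near n \<psi>s lo hi) \<longleftrightarrow> (\<forall>\<psi>\<in>set \<psi>s. wf_cform L \<psi>)"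
 unfolding Near_def wf_CInfs wf_CConn using dev_conn_wf by blast

lemma cfvars_Near: "cfvars (Near n \<psi>s lo hi) = (\<Union>\<psi>\<in>set \<psi>s. cfvars \<psi>) - {..<n}"
 by (simp add: Near_def cfvars_CInfs)

lemma Near_upper:
 assumes C: "is_cstruct L C" and \<psi>s: "!!\<psi>. \<psi> \<in> set \<psi>s ==> wf_cform L \<psi>" "length lo = length \<psi>s"
  and e: "!!i. e i \<in> cuniv C" "!!i. b i \<in> cuniv C"
  and val: "!!i. i < length \<psi>s ==> lo ! i \<le> cval_env C (\<psi>s ! i) (\<lambda>i. if i < n then b i else e i)"
   "!!i. i < length \<psi>s ==> cval_env C (\<psi>s ! i) (\<lambda>i. if i < n then b i else e i) \<le> hi ! i"
 shows "cval_env C (Near n \<psi>s lo hi) e \<le> 0"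
proof -
 have "cval_env C (Near n \<psi>s lo hi) e \<le> cval_env C (CConn (dev_conn lo hi) \<psi>s) (\<lambda>i. if i < n then b i else e i)"
  unfolding Near_def by (rule CInfs_lower[OF C _ e]) (use \<psi>s dev_conn_wf in \<open>simp add: wf_CConn del: wf_cform.simps\<close>)
 also have "\<dots> \<le> 0" unfolding cval_env_CConn dev_conn_def
 proof (intro min.coboundedI2 sum_nonpos)
  fix i assume "i \<in> {..<length lo}"
  then have i: "i < length \<psi>s" using \<psi>s(2) by simp
  show "max 0 ((if i < length \<psi>s then cval_env C (\<psi>s ! i) (\<lambda>i. if i < n then b i else e i) else 0) - hi ! i) +
    max 0 (lo ! i - (if i < length \<psi>s then cval_env C (\<psi>s ! i) (\<lambda>i. if i < n then b i else e i) else 0)) \<le> 0"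
   using i val(1)[OF i] val(2)[OF i] by simp
 qed
 finally show ?thesis .
qed

lemma Near_attained:
 assumes C: "is_cstruct L C" and \<psi>s: "!!\<psi>. \<psi> \<in> set \<psi>s ==> wf_cform L \<psi>" "length lo = length \<psi>s"
  and e: "!!i. e i \<in> cuniv C" and val: "cval_env C (Near n \<psi>s lo hi) e \<le> r" and r: "r < s" "s < 1"
 shows "\<exists>b. (\<forall>i. b i \<in> cuniv C) \<and> (\<forall>i<length \<psi>s.
  lo ! i - s \<le> cval_env C (\<psi>s ! i) (\<lambda>i. if i < n then b i else e i) \<and>
  cval_env C (\<psi>s ! i) (\<lambda>i. if i < n then b i else e i) \<le> hi ! i + s)"
proof -
 have wf: "wf_cform L (CConn (dev_conn lo hi) \<psi>s)" using \<psi>s dev_conn_wf by (simp add: wf_CConn del: wf_cform.simps)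
 have sr: "s - r > 0" using r by simp
 have "\<exists>b. (\<forall>i. b i \<in> cuniv C) \<and> cval_env C (CConn (dev_conn lo hi) \<psi>s) (\<lambda>i. if i < n then b i else e i)
   \<le> cval_env C (CInfs n (CConn (dev_conn lo hi) \<psi>s)) e + (s - r)"
  by (rule CInfs_attained[OF C wf e sr])
 then obtain b where b: "!!i. b i \<in> cuniv C"
  "cval_env C (CConn (dev_conn lo hi) \<psi>s) (\<lambda>i. if i < n then b i else e i) \<le> cval_env C (Near n \<psi>s lo hi) e + (s - r)"
  unfolding Near_def by blast
 let ?v = "\<lambda>i. cval_env C (\<psi>s ! i) (\<lambda>i. if i < n then b i else e i)"
 let ?t = "\<lambda>i. max 0 (?v i - hi ! i) + max 0 (lo ! i - ?v i)"
 have "dev_conn lo hi (\<lambda>i. if i < length \<psi>s then ?v i else 0) \<le> s"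
  using b(2) val unfolding cval_env_CConn by simp
 then have "(\<Sum>i<length \<psi>s. ?t i) \<le> s" using r(2) \<psi>s(2) by (simp add: dev_conn_def min_le_iff_disj)
 moreover have "?t i \<le> (\<Sum>i<length \<psi>s. ?t i)" if "i < length \<psi>s" for i
  using that by (intro member_le_sum) simp_all
 ultimately have "?t i \<le> s" if "i < length \<psi>s" for i using that by (meson order_trans)
 then have "lo ! i - s \<le> ?v i \<and> ?v i \<le> hi ! i + s" if "i < length \<psi>s" for i
  using that by (smt (verit) max.cobounded1 max.cobounded2)
 then show ?thesis using b(1) by blast
qed

section \<open>Simple random variables in the randomization\<close>

lemma finite_cfvars: "finite (cfvars \<psi>)"
 by (induction \<psi>) auto

lemma simple_rvsD:
 assumes "f \<in> simple_rvs \<Omega> B"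
 shows "simple_function \<Omega> f" "\<omega> \<in> space \<Omega> ==> f \<omega> \<in> B"
 using assms by (auto simp: simple_rvs_def)

lemma simple_rvs_mono: "A \<subseteq> B ==> simple_rvs \<Omega> A \<subseteq> simple_rvs \<Omega> B"
 by (auto simp: simple_rvs_def)

lemma const_simple_rvs: "a \<in> B ==> (\<lambda>_. a) \<in> simple_rvs \<Omega> B"
 by (auto simp: simple_rvs_def)

lemma simple_restrict:
 assumes "finite V" "!!j. j \<in> V ==> simple_function \<Omega> (f j)"
 shows "simple_function \<Omega> (\<lambda>\<omega>. restrict (\<lambda>j. f j \<omega>) V)"
 using assms
proof (induction V rule: finite_induct)
 case empty
 show ?case by (simp add: restrict_def)
next
 case (insert j V)
 have "simple_function \<Omega> (\<lambda>\<omega>. (restrict (\<lambda>j. f j \<omega>) V, f j \<omega>))"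
  by (rule simple_function_Pair[OF insert.IH]) (simp_all add: insert.prems)
 from simple_function_compose[OF this, of "\<lambda>(g, y). g(j := y)"]
 have "simple_function \<Omega> (\<lambda>\<omega>. (restrict (\<lambda>j. f j \<omega>) V)(j := f j \<omega>))" by (simp add: comp_def)
 moreover have eq: "(restrict (\<lambda>j. f j \<omega>) V)(j := f j \<omega>) = restrict (\<lambda>j. f j \<omega>) (insert j V)" for \<omega>
  by (auto simp: restrict_def)
 ultimately show ?case unfolding eq by blast
qed

lemma simple_at_point:
 assumes "!!f. f \<in> set fs ==> simple_function \<Omega> f"
 shows "simple_function \<Omega> (at_point fs)"
 using assms
proof (induction fs)
 case (Cons f fs)
 have "simple_function \<Omega> (\<lambda>\<omega>. (f \<omega>, at_point fs \<omega>))"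
  using Cons by (intro simple_function_Pair) simp_all
 from simple_function_compose[OF this, of "\<lambda>(y, ys). y # ys"] show ?case by (simp add: comp_def)
qed simp

lemma simple_sets:
 assumes "simple_function \<Omega> G"
 shows "{\<omega> \<in> space \<Omega>. Q (G \<omega>)} \<in> sets \<Omega>"
proof -
 have "{\<omega> \<in> space \<Omega>. Q (G \<omega>)} = G -` {v. Q v} \<inter> space \<Omega>" by blast
 then show ?thesis using simple_functionD(2)[OF assms, of "{v. Q v}"] by simp
qed

lemma (in prob_space) prob_simple:
 assumes G: "simple_function M G"
 shows "prob {\<omega> \<in> space M. Q (G \<omega>)} = (\<Sum>v\<in>G ` space M. prob {\<omega> \<in> space M. G \<omega> = v} * of_bool (Q v))"
proof -
 have fin: "finite (G ` space M)" using G by (rule simple_functionD(1))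
 let ?V = "{v \<in> G ` space M. Q v}"
 have "{\<omega> \<in> space M. Q (G \<omega>)} = (\<Union>v\<in>?V. {\<omega> \<in> space M. G \<omega> = v})" by auto
 also have "prob \<dots> = (\<Sum>v\<in>?V. prob {\<omega> \<in> space M. G \<omega> = v})"
 proof (rule finite_measure_finite_Union)
  show "(\<lambda>v. {\<omega> \<in> space M. G \<omega> = v}) ` ?V \<subseteq> sets M"
  proof
   fix A assume "A \<in> (\<lambda>v. {\<omega> \<in> space M. G \<omega> = v}) ` ?V"
   then obtain v where "A = {\<omega> \<in> space M. G \<omega> = v}" by blast
   then show "A \<in> sets M" using simple_sets[OF G, of "\<lambda>w. w = v"] by simp
  qed
  show "disjoint_family_on (\<lambda>v. {\<omega> \<in> space M. G \<omega> = v}) ?V" by (auto simp: disjoint_family_on_def)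
 qed (use fin in simp)
 also have "\<dots> = (\<Sum>v\<in>G ` space M. prob {\<omega> \<in> space M. G \<omega> = v} * of_bool (Q v))"
  using fin by (intro sum.mono_neutral_cong_left) auto
 finally show ?thesis .
qed

definition mix :: "nat list => (nat => 'x) => (nat => 'x) => nat => 'x" where
 "mix is x e j = (if j \<in> set is then x j else e j)"

lemma sat_Exs:
 "sat U (foldr Ex is \<theta>) e \<longleftrightarrow> (\<exists>y. (\<forall>j\<in>set is. y j \<in> univ U) \<and> sat U \<theta> (mix is y e))"
proof (induction "is" arbitrary: e)
 case Nil
 show ?case by (simp add: mix_def)
next
 case (Cons i "is")
 show ?case
 proof
  assume "sat U (foldr Ex (i # is) \<theta>) e"
  then obtain x where x: "x \<in> univ U" "sat U (foldr Ex is \<theta>) (e(i := x))" by auto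
  then obtain y where y: "\<forall>j\<in>set is. y j \<in> univ U" "sat U \<theta> (mix is y (e(i := x)))" using Cons by blast
  have "mix is y (e(i := x)) = mix (i # is) (if i \<in> set is then y else y(i := x)) e"
   by (auto simp: mix_def)
  then show "\<exists>y. (\<forall>j\<in>set (i # is). y j \<in> univ U) \<and> sat U \<theta> (mix (i # is) y e)"
   using x(1) y by (intro exI[of _ "if i \<in> set is then y else y(i := x)"]) auto
 next
  assume "\<exists>y. (\<forall>j\<in>set (i # is). y j \<in> univ U) \<and> sat U \<theta> (mix (i # is) y e)"
  then obtain y where y: "\<forall>j\<in>set (i # is). y j \<in> univ U" "sat U \<theta> (mix (i # is) y e)" by blast
  have "mix (i # is) y e = mix is y (e(i := y i))" by (auto simp: mix_def)
  then have "sat U (foldr Ex is \<theta>) (e(i := y i))"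
   unfolding Cons using y by (intro exI[of _ y]) (simp del: fun_upd_apply)
  then show "sat U (foldr Ex (i # is) \<theta>) e" using y(1) by auto
 qed
qed

lemma wf_Exs: "wf_form L (foldr Ex is \<theta>) = wf_form L \<theta>"
 by (induction "is") auto

lemma elem_sub_env:
 fixes U :: "('a, 'f, 'r) struct"
 assumes N: "elem_sub L U N" and \<phi>: "wf_form L \<phi>" and e: "!!i. e i \<in> N"
 shows "sat (U\<lparr>univ := N\<rparr>) \<phi> e = sat U \<phi> e"
proof -
 obtain K where K: "fvars \<phi> \<subseteq> {..<K}" using finite_nat_iff_bounded finite_fvars by blast
 have eq: "sat V \<phi> e = holds V \<phi> (map e [0..<K])" for V :: "('a, 'f, 'r) struct"
  by (rule sat_cong) (use K in auto)
 have "fm L (length (map e [0..<K])) \<phi>" using \<phi> K by (simp add: fm_def)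
 moreover have "set (map e [0..<K]) \<subseteq> N" using e by auto
 ultimately have "holds (U\<lparr>univ := N\<rparr>) \<phi> (map e [0..<K]) = holds U \<phi> (map e [0..<K])"
  using N unfolding elem_sub_def by blast
 then show ?thesis using eq[of U] eq[of "U\<lparr>univ := N\<rparr>"] by simp
qed

definition agree :: "('a, 'f, 'r) struct => 'w measure => ('f, 'r) form list => (nat => 'w => 'a)
  => (nat => 'w => 'a) => bool" where
 "agree U \<Omega> \<theta>s e e' \<longleftrightarrow>
  (\<forall>\<omega>\<in>space \<Omega>. \<forall>\<theta>\<in>set \<theta>s. sat U \<theta> (\<lambda>i. e i \<omega>) = sat U \<theta> (\<lambda>i. e' i \<omega>))"

text \<open>\<open>Lifts is \<theta>s\<close> lists the formulas saying that the variables \<open>is\<close> can be chosen so that exactly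
 a given subset of \<open>\<theta>s\<close> holds.\<close>

definition Lifts :: "nat list => ('f, 'r) form list => ('f, 'r) form list" where
 "Lifts is \<theta>s = map (\<lambda>S. foldr Ex is (Conjs (map (\<lambda>\<theta>. if \<theta> \<in> set S then \<theta> else Neg \<theta>) \<theta>s))) (List.subseqs \<theta>s)"

lemma wf_Conjs: "wf_form L (Conjs \<phi>s) \<longleftrightarrow> (\<forall>\<phi>\<in>set \<phi>s. wf_form L \<phi>)"
 by (induction \<phi>s) (auto simp: Conjs_def Truth_def)

lemma wf_Lifts: "(!!\<theta>. \<theta> \<in> set \<theta>s ==> wf_form L \<theta>) ==> \<theta> \<in> set (Lifts is \<theta>s) ==> wf_form L \<theta>"
 unfolding Lifts_def by (auto simp: wf_Exs wf_Conjs)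

text \<open>The back-and-forth step.  It works pointwise on the sample space and therefore needs no
 property of the probability space; finitely many values are involved, so the new random
 variables are again simple.\<close>

lemma back_and_forth:
 assumes B: "elem_sub L U B" and ne: "univ U \<noteq> {}" and \<theta>s: "!!\<theta>. \<theta> \<in> set \<theta>s ==> wf_form L \<theta>"
  and e: "!!i. e i \<in> simple_rvs \<Omega> (univ U)" "!!i. x i \<in> simple_rvs \<Omega> (univ U)" "!!i. e' i \<in> simple_rvs \<Omega> B"
  and agr: "agree U \<Omega> (Lifts is \<theta>s) e e'"
 shows "\<exists>x'. (\<forall>i. x' i \<in> simple_rvs \<Omega> B) \<and> agree U \<Omega> \<theta>s (mix is x e) (mix is x' e')"
proof -
 have B_ne: "B \<noteq> {}" and BU: "B \<subseteq> univ U" using B by (auto simp: elem_sub_def is_struct_def)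
 define V where "V = (\<Union>\<theta>\<in>set \<theta>s. fvars \<theta>)"
 have V: "finite V" by (simp add: V_def finite_fvars)
 define pat where "pat S = Conjs (map (\<lambda>\<theta>. if \<theta> \<in> S then \<theta> else Neg \<theta>) \<theta>s)" for S
 have sat_pat: "sat U (pat S) f \<longleftrightarrow> (\<forall>\<theta>\<in>set \<theta>s. sat U \<theta> f \<longleftrightarrow> \<theta> \<in> S)" for S f
 proof -
  have *: "sat U (if \<theta> \<in> S then \<theta> else Neg \<theta>) f \<longleftrightarrow> (sat U \<theta> f \<longleftrightarrow> \<theta> \<in> S)" for \<theta> by (cases "\<theta> \<in> S") simp_all
  show ?thesis unfolding pat_def sat_Conjs[OF ne] set_map Ball_image_comp comp_def * ..
 qed
 have wf_pat: "wf_form L (pat S)" for S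
 proof -
  have "wf_form L (if \<theta> \<in> S then \<theta> else Neg \<theta>)" if "\<theta> \<in> set \<theta>s" for \<theta> using \<theta>s[OF that] by simp
  then show ?thesis unfolding pat_def wf_Conjs set_map by (simp only: Ball_image_comp comp_def) blast
 qed
 define Sat where "Sat f = {\<theta> \<in> set \<theta>s. sat U \<theta> f}" for f
 have Sat_V: "Sat f = Sat g" if "!!j. j \<in> V ==> f j = g j" for f g
  unfolding Sat_def by (intro Collect_cong conj_cong refl sat_cong that) (auto simp: V_def)
 define F where "F \<omega> = (Sat (\<lambda>j. mix is x e j \<omega>), restrict (\<lambda>j. e' j \<omega>) V)" for \<omega>
 define Y where "Y v = (SOME y. (\<forall>j. y j \<in> B) \<and> Sat (mix is y (snd v)) = fst v)" for v
 have Y: "(\<forall>j. Y (F \<omega>) j \<in> B) \<and> Sat (mix is (Y (F \<omega>)) (\<lambda>j. e' j \<omega>)) = Sat (\<lambda>j. mix is x e j \<omega>)"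
  if \<omega>: "\<omega> \<in> space \<Omega>" for \<omega>
 proof -
  let ?S = "Sat (\<lambda>j. mix is x e j \<omega>)"
  let ?ex = "foldr Ex is (pat ?S)"
  have "?S \<in> set ` set (List.subseqs \<theta>s)"
   unfolding List.subseqs_powset Sat_def by (rule PowI) (rule subsetI, drule CollectD, erule conjunct1)
  then obtain T where T: "?S = set T" "T \<in> set (List.subseqs \<theta>s)" by (rule imageE)
  have ex: "?ex \<in> set (Lifts is \<theta>s)"
   unfolding Lifts_def set_map pat_def T(1) by (rule imageI[OF T(2)])
  have "sat U ?ex (\<lambda>j. e j \<omega>)"
   unfolding sat_Exs
  proof (intro exI conjI ballI)
   show "x j \<omega> \<in> univ U" for j using simple_rvsD(2)[OF e(2) \<omega>] .
   have "mix is (\<lambda>j. x j \<omega>) (\<lambda>j. e j \<omega>) = (\<lambda>j. mix is x e j \<omega>)" by (auto simp: mix_def)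
   then show "sat U (pat ?S) (mix is (\<lambda>j. x j \<omega>) (\<lambda>j. e j \<omega>))" by (simp add: sat_pat Sat_def)
  qed
  then have "sat U ?ex (\<lambda>j. e' j \<omega>)" using agr[unfolded agree_def, rule_format, OF \<omega> ex] by simp
  moreover have eB: "e' j \<omega> \<in> B" for j using simple_rvsD(2)[OF e(3) \<omega>] .
  ultimately have "sat (U\<lparr>univ := B\<rparr>) ?ex (\<lambda>j. e' j \<omega>)"
   using elem_sub_env[OF B, of ?ex] wf_pat by (simp add: wf_Exs)
  then obtain y where y: "\<forall>j\<in>set is. y j \<in> B" "sat (U\<lparr>univ := B\<rparr>) (pat ?S) (mix is y (\<lambda>j. e' j \<omega>))"
   unfolding sat_Exs by auto
  have "mix is y (\<lambda>j. e' j \<omega>) j \<in> B" for j using y(1) eB by (simp add: mix_def)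
  then have "sat U (pat ?S) (mix is y (\<lambda>j. e' j \<omega>))" using elem_sub_env[OF B wf_pat] y(2) by simp
  then have yS: "Sat (mix is y (\<lambda>j. e' j \<omega>)) = ?S" unfolding sat_pat by (auto simp: Sat_def)
  obtain b where b: "b \<in> B" using B_ne by blast
  define y' where "y' j = (if j \<in> set is then y j else b)" for j
  have "mix is y' f = mix is y f" for f by (auto simp: mix_def y'_def)
  then have y': "\<forall>j. y' j \<in> B" "Sat (mix is y' (\<lambda>j. e' j \<omega>)) = ?S"
   using y(1) b yS by (simp_all add: y'_def)
  have res: "Sat (mix is z (snd (F \<omega>))) = Sat (mix is z (\<lambda>j. e' j \<omega>))" for z
   by (rule Sat_V) (simp add: F_def mix_def)
  have fstF: "fst (F \<omega>) = ?S" by (simp add: F_def)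
  have "\<exists>y. (\<forall>j. y j \<in> B) \<and> Sat (mix is y (snd (F \<omega>))) = fst (F \<omega>)"
   using y' unfolding res fstF by blast
  then have "(\<forall>j. Y (F \<omega>) j \<in> B) \<and> Sat (mix is (Y (F \<omega>)) (snd (F \<omega>))) = fst (F \<omega>)"
   unfolding Y_def by (rule someI_ex)
  then show ?thesis unfolding res fstF .
 qed
 have simpF: "simple_function \<Omega> F"
 proof -
  have "simple_function \<Omega> (\<lambda>\<omega>. restrict (\<lambda>j. mix is x e j \<omega>) V)"
   by (rule simple_restrict[OF V]) (use simple_rvsD(1)[OF e(1)] simple_rvsD(1)[OF e(2)] in \<open>simp add: mix_def\<close>)
  from simple_function_compose[OF this, of Sat]
  have "simple_function \<Omega> (\<lambda>\<omega>. Sat (restrict (\<lambda>j. mix is x e j \<omega>) V))" by (simp add: comp_def)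
  also have "(\<lambda>\<omega>. Sat (restrict (\<lambda>j. mix is x e j \<omega>) V)) = (\<lambda>\<omega>. Sat (\<lambda>j. mix is x e j \<omega>))"
   by (intro ext Sat_V) simp
  finally show ?thesis unfolding F_def
   by (intro simple_function_Pair simple_restrict[OF V] simple_rvsD(1)[OF e(3)])
 qed
 define x' where "x' j \<omega> = Y (F \<omega>) j" for j \<omega>
 have "x' j \<in> simple_rvs \<Omega> B" for j
 proof -
  have "x' j = (\<lambda>v. Y v j) \<circ> F" by (simp add: x'_def fun_eq_iff)
  then have "simple_function \<Omega> (x' j)" using simple_function_compose[OF simpF] by simp
  moreover have "x' j \<omega> \<in> B" if "\<omega> \<in> space \<Omega>" for \<omega> using Y[OF that] by (simp add: x'_def)
  ultimately show ?thesis by (auto simp: simple_rvs_def)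
 qed
 moreover have "agree U \<Omega> \<theta>s (mix is x e) (mix is x' e')"
  unfolding agree_def
 proof (intro ballI)
  fix \<omega> \<theta> assume \<omega>: "\<omega> \<in> space \<Omega>" and \<theta>: "\<theta> \<in> set \<theta>s"
  have "(\<lambda>j. mix is x' e' j \<omega>) = mix is (Y (F \<omega>)) (\<lambda>j. e' j \<omega>)" by (auto simp: mix_def x'_def)
  then have "Sat (\<lambda>j. mix is x' e' j \<omega>) = Sat (\<lambda>j. mix is x e j \<omega>)"
   using conjunct2[OF Y[OF \<omega>]] by (simp only:)
  then show "sat U \<theta> (\<lambda>j. mix is x e j \<omega>) = sat U \<theta> (\<lambda>j. mix is x' e' j \<omega>)"
   using \<theta> unfolding Sat_def by blast
 qed
 ultimately show ?thesis by blast
qed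

locale random_model = monster_model L \<kappa> U M
 for L :: "('f, 'r) lang" and \<kappa> :: "'k rel" and U :: "('a, 'f, 'r) struct" and M :: "'a set" +
 fixes \<Omega> :: "'w measure" and \<kappa>' :: "'l rel" and C :: "('c, 'f, 'r) cstruct" and \<iota> :: "('w => 'a) => 'c"
 assumes atomless: "atomless_prob_space \<Omega>" and random_monster: "random_monster L U M \<Omega> \<kappa>' C \<iota>"
begin

sublocale \<Omega>: prob_space \<Omega>
 using atomless by (simp add: atomless_prob_space_def)

abbreviation "SR B \<equiv> simple_rvs \<Omega> B"
abbreviation "CU \<equiv> C\<lparr>cuniv := randomize C \<iota> \<Omega> (univ U)\<rparr>"
abbreviation "cst \<equiv> map (\<lambda>a (_::'w). a)"

lemma cmonster: "cmonster L \<kappa>' C"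
 and dist_\<iota>: "f \<in> SR (univ U) ==> g \<in> SR (univ U) ==> cdist C (\<iota> f) (\<iota> g) = \<Omega>.prob {\<omega> \<in> space \<Omega>. f \<omega> \<noteq> g \<omega>}"
 and prob_\<iota>: "fm L n \<phi> ==> fs \<in> tuples n (SR (univ U)) ==> cprob C \<phi> (map \<iota> fs) = prob_of U \<Omega> \<phi> fs"
 and celem: "celem_sub L C (randomize C \<iota> \<Omega> (univ U))"
 and small_rand: "small \<kappa>' (randomize C \<iota> \<Omega> M)"
 and \<iota>_C: "f \<in> SR (univ U) ==> \<iota> f \<in> cuniv C"
 using random_monster unfolding random_monster_def by blast+

lemma struct_C: "is_cstruct L C" using cmonster by (simp add: cmonster_def)

lemma struct_CU: "is_cstruct L CU" and CU_sub: "cuniv CU \<subseteq> cuniv C"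
 using celem by (simp_all add: celem_sub_def)

lemma \<iota>_randomize:
 assumes "B \<subseteq> univ U" "f \<in> SR B"
 shows "\<iota> f \<in> randomize C \<iota> \<Omega> B"
proof -
 interpret Metric_space "cuniv C" "cdist C" by (rule cstructD(2)[OF struct_C])
 have "\<iota> ` SR B \<subseteq> topspace mtopology" using \<iota>_C simple_rvs_mono[OF assms(1)] by auto
 from closure_of_subset[OF this] show ?thesis using assms(2) by (auto simp: randomize_def)
qed

lemma \<iota>_CU: "f \<in> SR (univ U) ==> \<iota> f \<in> cuniv CU"
 using \<iota>_randomize[of "univ U" f] by simp

lemma dense_CU:
 assumes "x \<in> cuniv CU" "0 < \<delta>"
 shows "\<exists>f\<in>SR (univ U). cdist C x (\<iota> f) \<le> \<delta>"
proof -
 interpret Metric_space "cuniv C" "cdist C" by (rule cstructD(2)[OF struct_C])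
 have "x \<in> mtopology closure_of (\<iota> ` SR (univ U))" using assms(1) by (simp add: randomize_def)
 then have "\<exists>y\<in>\<iota> ` SR (univ U). y \<in> mball x \<delta>" using assms(2) unfolding metric_closure_of by blast
 then show ?thesis by (auto intro: less_imp_le)
qed

lemma elem_env:
 assumes "wf_cform L \<psi>" "!!i. e i \<in> cuniv CU"
 shows "cval_env CU \<psi> e = cval_env C \<psi> e"
proof -
 obtain K where K: "cfvars \<psi> \<subseteq> {..<K}" using finite_nat_iff_bounded finite_cfvars by blast
 have eq: "cval_env D \<psi> e = cval D \<psi> (map e [0..<K])" for D :: "('c, 'f, 'r) cstruct"
  by (rule cval_env_cong) (use K in auto)
 have "cfm L (length (map e [0..<K])) \<psi>" using assms(1) K by (simp add: cfm_def)
 moreover have "set (map e [0..<K]) \<subseteq> randomize C \<iota> \<Omega> (univ U)" using assms(2) by auto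
 ultimately have "cval CU \<psi> (map e [0..<K]) = cval C \<psi> (map e [0..<K])"
  using celem unfolding celem_sub_def by blast
 then show ?thesis using eq[of CU] eq[of C] by simp
qed

lemma univ_elem: "elem_sub L U (univ U)"
 using monster by (auto simp: elem_sub_def monster_def)

lemma M_elem: "elem_sub L U M"
 using M by (simp add: small_model_def)

lemma quantifier_step:
 assumes wf: "wf_cform L \<psi>" and eps: "0 < eps"
  and IH: "\<exists>\<theta>s. (\<forall>\<theta>\<in>set \<theta>s. wf_form L \<theta>) \<and>
   (\<forall>e e'. (\<forall>i. e i \<in> SR (univ U) \<and> e' i \<in> SR (univ U)) --> agree U \<Omega> \<theta>s e e' -->
    \<bar>cval_env CU \<psi> (\<lambda>i. \<iota> (e i)) - cval_env CU \<psi> (\<lambda>i. \<iota> (e' i))\<bar> \<le> eps / 2)"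
 shows "\<exists>\<theta>s. (\<forall>\<theta>\<in>set \<theta>s. wf_form L \<theta>) \<and>
  (\<forall>e e'. (\<forall>i. e i \<in> SR (univ U) \<and> e' i \<in> SR (univ U)) --> agree U \<Omega> \<theta>s e e' -->
   \<bar>(SUP x\<in>cuniv CU. cval_env CU \<psi> ((\<lambda>i. \<iota> (e i))(i := x))) - (SUP x\<in>cuniv CU. cval_env CU \<psi> ((\<lambda>i. \<iota> (e' i))(i := x)))\<bar> \<le> eps \<and>
   \<bar>(INF x\<in>cuniv CU. cval_env CU \<psi> ((\<lambda>i. \<iota> (e i))(i := x))) - (INF x\<in>cuniv CU. cval_env CU \<psi> ((\<lambda>i. \<iota> (e' i))(i := x)))\<bar> \<le> eps)"
proof -
 interpret Metric_space "cuniv C" "cdist C" by (rule cstructD(2)[OF struct_C])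
 obtain \<theta>s where \<theta>s: "!!\<theta>. \<theta> \<in> set \<theta>s ==> wf_form L \<theta>"
  and near: "!!e e'. (\<forall>i. e i \<in> SR (univ U) \<and> e' i \<in> SR (univ U)) ==> agree U \<Omega> \<theta>s e e' ==>
    \<bar>cval_env CU \<psi> (\<lambda>i. \<iota> (e i)) - cval_env CU \<psi> (\<lambda>i. \<iota> (e' i))\<bar> \<le> eps / 2" using IH by blast
 obtain \<delta> where \<delta>: "\<delta> > 0" "!!e e'. (\<forall>i. e i \<in> cuniv CU \<and> e' i \<in> cuniv CU \<and> cdist CU (e i) (e' i) \<le> \<delta>)
   ==> \<bar>cval_env CU \<psi> e - cval_env CU \<psi> e'\<bar> \<le> eps / 2"
  using cval_uniform[OF struct_CU wf, of "eps / 2"] eps by auto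
 have step: "\<exists>y\<in>cuniv CU. \<bar>cval_env CU \<psi> ((\<lambda>i. \<iota> (e i))(i := x)) - cval_env CU \<psi> ((\<lambda>i. \<iota> (e' i))(i := y))\<bar> \<le> eps"
  if e: "!!i. e i \<in> SR (univ U)" "!!i. e' i \<in> SR (univ U)" and agr: "agree U \<Omega> (Lifts [i] \<theta>s) e e'"
   and x: "x \<in> cuniv CU" for e e' x
 proof -
  obtain f where f: "f \<in> SR (univ U)" "cdist C x (\<iota> f) \<le> \<delta>" using dense_CU[OF x \<delta>(1)] by blast
  have "\<exists>x'. (\<forall>i. x' i \<in> SR (univ U)) \<and> agree U \<Omega> \<theta>s (mix [i] (\<lambda>_. f) e) (mix [i] x' e')"
   by (rule back_and_forth[OF univ_elem univ_ne \<theta>s e(1) f(1) e(2) agr])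
  then obtain x' where x': "!!i. x' i \<in> SR (univ U)" "agree U \<Omega> \<theta>s (mix [i] (\<lambda>_. f) e) (mix [i] x' e')" by blast
  have eqs: "(\<lambda>j. \<iota> (mix [i] (\<lambda>_. f) e j)) = (\<lambda>j. \<iota> (e j))(i := \<iota> f)"
   "(\<lambda>j. \<iota> (mix [i] x' e' j)) = (\<lambda>j. \<iota> (e' j))(i := \<iota> (x' i))" by (auto simp: mix_def)
  have "\<bar>cval_env CU \<psi> ((\<lambda>i. \<iota> (e i))(i := x)) - cval_env CU \<psi> ((\<lambda>i. \<iota> (e i))(i := \<iota> f))\<bar> \<le> eps / 2"
  proof (rule \<delta>(2), intro allI conjI)
   fix j
   show "((\<lambda>i. \<iota> (e i))(i := x)) j \<in> cuniv CU" using \<iota>_CU[OF e(1)] x by simp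
   show "((\<lambda>i. \<iota> (e i))(i := \<iota> f)) j \<in> cuniv CU" using \<iota>_CU[OF e(1)] \<iota>_CU[OF f(1)] by simp
   show "cdist CU (((\<lambda>i. \<iota> (e i))(i := x)) j) (((\<lambda>i. \<iota> (e i))(i := \<iota> f)) j) \<le> \<delta>"
    using f(2) \<delta>(1) \<iota>_C[OF e(1)] by simp
  qed
  moreover have "\<bar>cval_env CU \<psi> ((\<lambda>i. \<iota> (e i))(i := \<iota> f)) - cval_env CU \<psi> ((\<lambda>i. \<iota> (e' i))(i := \<iota> (x' i)))\<bar> \<le> eps / 2"
   unfolding eqs[symmetric] by (rule near[OF _ x'(2)]) (use e f(1) x'(1) in \<open>auto simp: mix_def\<close>)
  ultimately have "\<bar>cval_env CU \<psi> ((\<lambda>i. \<iota> (e i))(i := x)) - cval_env CU \<psi> ((\<lambda>i. \<iota> (e' i))(i := \<iota> (x' i)))\<bar> \<le> eps"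
   by linarith
  then show ?thesis using \<iota>_CU[OF x'(1)] by (rule bexI)
 qed
 have bounds: "cval_env CU \<psi> ((\<lambda>i. \<iota> (e i))(i := x)) \<in> {0..1}"
  if "!!i. e i \<in> SR (univ U)" "x \<in> cuniv CU" for e x
  by (rule cval_bounds[OF struct_CU wf]) (use \<iota>_CU[OF that(1)] that(2) in simp)
 have sym: "agree U \<Omega> ts e' e" if "agree U \<Omega> ts e e'" for ts and e e' :: "nat => 'w => 'a"
  using that by (simp add: agree_def)
 have "\<bar>(SUP x\<in>cuniv CU. cval_env CU \<psi> ((\<lambda>i. \<iota> (e i))(i := x))) - (SUP x\<in>cuniv CU. cval_env CU \<psi> ((\<lambda>i. \<iota> (e' i))(i := x)))\<bar> \<le> eps
  \<and> \<bar>(INF x\<in>cuniv CU. cval_env CU \<psi> ((\<lambda>i. \<iota> (e i))(i := x))) - (INF x\<in>cuniv CU. cval_env CU \<psi> ((\<lambda>i. \<iota> (e' i))(i := x)))\<bar> \<le> eps"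
  if e: "\<forall>i. e i \<in> SR (univ U) \<and> e' i \<in> SR (univ U)" and agr: "agree U \<Omega> (Lifts [i] \<theta>s) e e'" for e e'
 proof -
  have e1: "!!i. e i \<in> SR (univ U)" and e2: "!!i. e' i \<in> SR (univ U)" using e by simp_all
  have bwd: "\<exists>x\<in>cuniv CU. \<bar>cval_env CU \<psi> ((\<lambda>i. \<iota> (e i))(i := x)) - cval_env CU \<psi> ((\<lambda>i. \<iota> (e' i))(i := y))\<bar> \<le> eps"
   if "y \<in> cuniv CU" for y
   using step[OF e2 e1 sym[OF agr] that] by (simp add: abs_minus_commute)
  show ?thesis
   using SUP_diff_le[OF cstructD(1)[OF struct_CU] cstructD(1)[OF struct_CU] bounds[OF e1] bounds[OF e2] step[OF e1 e2 agr] bwd]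
   by blast
 qed
 then show ?thesis using wf_Lifts[OF \<theta>s] by (intro exI[of _ "Lifts [i] \<theta>s"]) blast
qed

text \<open>An approximate form of quantifier elimination on simple random variables.  Only a pointwise
 comparison of tuples is needed, so quantifiers reduce to the back-and-forth step.\<close>

lemma simple_QE:
 "wf_cform L \<psi> ==> 0 < eps ==> \<exists>\<theta>s. (\<forall>\<theta>\<in>set \<theta>s. wf_form L \<theta>) \<and>
  (\<forall>e e'. (\<forall>i. e i \<in> SR (univ U) \<and> e' i \<in> SR (univ U)) --> agree U \<Omega> \<theta>s e e' -->
   \<bar>cval_env CU \<psi> (\<lambda>i. \<iota> (e i)) - cval_env CU \<psi> (\<lambda>i. \<iota> (e' i))\<bar> \<le> eps)"
proof (induction \<psi> arbitrary: eps)
 case (CDist i j)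
 have "cdist C (\<iota> (e i)) (\<iota> (e j)) = cdist C (\<iota> (e' i)) (\<iota> (e' j))"
  if e: "\<forall>i. e i \<in> SR (univ U) \<and> e' i \<in> SR (univ U)" and agr: "agree U \<Omega> [Eq (Var i) (Var j)] e e'" for e e'
 proof -
  have "{\<omega> \<in> space \<Omega>. e i \<omega> \<noteq> e j \<omega>} = {\<omega> \<in> space \<Omega>. e' i \<omega> \<noteq> e' j \<omega>}"
   using agr by (auto simp: agree_def)
  then show ?thesis using dist_\<iota> e by simp
 qed
 note eq = this
 have "\<bar>cval_env CU (CDist i j) (\<lambda>i. \<iota> (e i)) - cval_env CU (CDist i j) (\<lambda>i. \<iota> (e' i))\<bar> \<le> eps"
  if "\<forall>i. e i \<in> SR (univ U) \<and> e' i \<in> SR (univ U)" "agree U \<Omega> [Eq (Var i) (Var j)] e e'" for e e'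
  using CDist.prems(2) eq[OF that] by simp
 moreover have "\<forall>\<theta>\<in>set [Eq (Var i) (Var j)]. wf_form L \<theta>" by simp
 ultimately show ?case by blast
next
 case (CProb \<phi> vs)
 have fm: "fm L (length vs) \<phi>" using CProb.prems(1) by simp
 obtain K where K: "set vs \<subseteq> {..<K}" using finite_nat_iff_bounded by blast
 obtain \<phi>' where \<phi>': "fm L K \<phi>'" "!!e. sat U \<phi>' e = holds U \<phi> (map e vs)"
  using fm_subst[OF fm refl K, of U] by blast
 have "cprob C \<phi> (map (\<lambda>i. \<iota> (e i)) vs) = cprob C \<phi> (map (\<lambda>i. \<iota> (e' i)) vs)"
  if e: "\<forall>i. e i \<in> SR (univ U) \<and> e' i \<in> SR (univ U)" and agr: "agree U \<Omega> [\<phi>'] e e'" for e e'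
 proof -
  have pr: "cprob C \<phi> (map (\<lambda>i. \<iota> (e i)) vs) = \<Omega>.prob {\<omega> \<in> space \<Omega>. sat U \<phi>' (\<lambda>i. e i \<omega>)}"
   if "!!i. e i \<in> SR (univ U)" for e
   using prob_\<iota>[OF fm map_tuples[of e, OF that]] by (simp add: comp_def prob_of_def \<phi>'(2))
  have "{\<omega> \<in> space \<Omega>. sat U \<phi>' (\<lambda>i. e i \<omega>)} = {\<omega> \<in> space \<Omega>. sat U \<phi>' (\<lambda>i. e' i \<omega>)}"
   using agr by (auto simp: agree_def)
  then show ?thesis using pr e by simp
 qed
 note eq = this
 have "\<bar>cval_env CU (CProb \<phi> vs) (\<lambda>i. \<iota> (e i)) - cval_env CU (CProb \<phi> vs) (\<lambda>i. \<iota> (e' i))\<bar> \<le> eps"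
  if "\<forall>i. e i \<in> SR (univ U) \<and> e' i \<in> SR (univ U)" "agree U \<Omega> [\<phi>'] e e'" for e e'
  using CProb.prems(2) eq[OF that] by simp
 moreover have "\<forall>\<theta>\<in>set [\<phi>']. wf_form L \<theta>" using \<phi>'(1) by (simp add: fm_def)
 ultimately show ?case by blast
next
 case (CConn u \<psi>s)
 have u: "continuous_on unit_cube u" and wf: "!!\<psi>. \<psi> \<in> set \<psi>s ==> wf_cform L \<psi>"
  using CConn.prems(1) unfolding wf_CConn by blast+
 obtain \<eta> where \<eta>: "\<eta> > 0" "!!v w. v \<in> unit_cube ==> w \<in> unit_cube ==> (\<forall>i. \<bar>v i - w i\<bar> \<le> \<eta>) ==> \<bar>u v - u w\<bar> \<le> eps"
  using connective_uniform[OF u CConn.prems(2)] by metis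
 have "\<forall>\<psi>\<in>set \<psi>s. \<exists>\<theta>s. (\<forall>\<theta>\<in>set \<theta>s. wf_form L \<theta>) \<and>
  (\<forall>e e'. (\<forall>i. e i \<in> SR (univ U) \<and> e' i \<in> SR (univ U)) --> agree U \<Omega> \<theta>s e e' -->
   \<bar>cval_env CU \<psi> (\<lambda>i. \<iota> (e i)) - cval_env CU \<psi> (\<lambda>i. \<iota> (e' i))\<bar> \<le> \<eta>)"
  using CConn.IH wf \<eta>(1) by blast
 then obtain T where T: "\<forall>\<psi>\<in>set \<psi>s. (\<forall>\<theta>\<in>set (T \<psi>). wf_form L \<theta>) \<and>
  (\<forall>e e'. (\<forall>i. e i \<in> SR (univ U) \<and> e' i \<in> SR (univ U)) --> agree U \<Omega> (T \<psi>) e e' -->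
   \<bar>cval_env CU \<psi> (\<lambda>i. \<iota> (e i)) - cval_env CU \<psi> (\<lambda>i. \<iota> (e' i))\<bar> \<le> \<eta>)"
  unfolding bchoice_iff by blast
 let ?T = "concat (map T \<psi>s)"
 have "\<bar>cval_env CU (CConn u \<psi>s) (\<lambda>i. \<iota> (e i)) - cval_env CU (CConn u \<psi>s) (\<lambda>i. \<iota> (e' i))\<bar> \<le> eps"
  if e: "\<forall>i. e i \<in> SR (univ U) \<and> e' i \<in> SR (univ U)" and agr: "agree U \<Omega> ?T e e'" for e e'
  unfolding cval_env_CConn
 proof (rule \<eta>(2))
  have cube: "(\<lambda>i. if i < length \<psi>s then cval_env CU (\<psi>s ! i) (\<lambda>i. \<iota> (e i)) else 0) \<in> unit_cube"
   if "!!i. e i \<in> SR (univ U)" for e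
   unfolding unit_cube_def using cval_bounds[OF struct_CU wf[OF nth_mem] \<iota>_CU[OF that]] by auto
  show "(\<lambda>i. if i < length \<psi>s then cval_env CU (\<psi>s ! i) (\<lambda>i. \<iota> (e i)) else 0) \<in> unit_cube"
   "(\<lambda>i. if i < length \<psi>s then cval_env CU (\<psi>s ! i) (\<lambda>i. \<iota> (e' i)) else 0) \<in> unit_cube"
   by (rule cube, simp add: e)+
  have "\<bar>cval_env CU (\<psi>s ! i) (\<lambda>i. \<iota> (e i)) - cval_env CU (\<psi>s ! i) (\<lambda>i. \<iota> (e' i))\<bar> \<le> \<eta>" if "i < length \<psi>s" for i
  proof -
   have mem: "\<psi>s ! i \<in> set \<psi>s" using that by simp
   then have "agree U \<Omega> (T (\<psi>s ! i)) e e'" using agr by (auto simp: agree_def)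
   then show ?thesis using T mem e by blast
  qed
  then show "\<forall>i. \<bar>(if i < length \<psi>s then cval_env CU (\<psi>s ! i) (\<lambda>i. \<iota> (e i)) else 0)
    - (if i < length \<psi>s then cval_env CU (\<psi>s ! i) (\<lambda>i. \<iota> (e' i)) else 0)\<bar> \<le> \<eta>"
   using \<eta>(1) by auto
 qed
 then show ?case using T by (intro exI[of _ ?T]) auto
next
 case (CSup i \<psi>)
 have wf: "wf_cform L \<psi>" and eps2: "eps / 2 > 0" using CSup.prems by simp_all
 have "\<exists>\<theta>s. (\<forall>\<theta>\<in>set \<theta>s. wf_form L \<theta>) \<and>
  (\<forall>e e'. (\<forall>i. e i \<in> SR (univ U) \<and> e' i \<in> SR (univ U)) --> agree U \<Omega> \<theta>s e e' -->
   \<bar>(SUP x\<in>cuniv CU. cval_env CU \<psi> ((\<lambda>i. \<iota> (e i))(i := x))) - (SUP x\<in>cuniv CU. cval_env CU \<psi> ((\<lambda>i. \<iota> (e' i))(i := x)))\<bar> \<le> eps \<and>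
   \<bar>(INF x\<in>cuniv CU. cval_env CU \<psi> ((\<lambda>i. \<iota> (e i))(i := x))) - (INF x\<in>cuniv CU. cval_env CU \<psi> ((\<lambda>i. \<iota> (e' i))(i := x)))\<bar> \<le> eps)"
  by (rule quantifier_step[OF wf CSup.prems(2) CSup.IH[OF wf eps2]])
 then show ?case unfolding cval_env.simps by blast
next
 case (CInf i \<psi>)
 have wf: "wf_cform L \<psi>" and eps2: "eps / 2 > 0" using CInf.prems by simp_all
 have "\<exists>\<theta>s. (\<forall>\<theta>\<in>set \<theta>s. wf_form L \<theta>) \<and>
  (\<forall>e e'. (\<forall>i. e i \<in> SR (univ U) \<and> e' i \<in> SR (univ U)) --> agree U \<Omega> \<theta>s e e' -->
   \<bar>(SUP x\<in>cuniv CU. cval_env CU \<psi> ((\<lambda>i. \<iota> (e i))(i := x))) - (SUP x\<in>cuniv CU. cval_env CU \<psi> ((\<lambda>i. \<iota> (e' i))(i := x)))\<bar> \<le> eps \<and>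
   \<bar>(INF x\<in>cuniv CU. cval_env CU \<psi> ((\<lambda>i. \<iota> (e i))(i := x))) - (INF x\<in>cuniv CU. cval_env CU \<psi> ((\<lambda>i. \<iota> (e' i))(i := x)))\<bar> \<le> eps)"
  by (rule quantifier_step[OF wf CInf.prems(2) CInf.IH[OF wf eps2]])
 then show ?case unfolding cval_env.simps by blast
qed

end

context random_model
begin

lemma univ_ne_SR: "\<exists>z. z \<in> SR (univ U)"
proof -
 obtain a where "a \<in> univ U" using univ_ne by (meson ex_in_conv)
 then show ?thesis by (intro exI[of _ "\<lambda>_. a"] const_simple_rvs)
qed

lemma M_ne: "\<exists>z. z \<in> SR M"
proof -
 have "M \<noteq> {}" using M_elem by (simp add: elem_sub_def is_struct_def)
 then obtain a where "a \<in> M" by (meson ex_in_conv)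
 then show ?thesis by (intro exI[of _ "\<lambda>_. a"] const_simple_rvs)
qed

definition blk :: "nat => (nat => 'x) => 'x list => 'x => nat => 'x" where
 "blk n x c z i = (if i < n then x i else if i < n + length c then c ! (i - n) else z)"

lemma blk_range: "(!!i. x i \<in> S) ==> set c \<subseteq> S ==> z \<in> S ==> blk n x c z i \<in> S"
 by (auto simp: blk_def intro!: subsetD[of "set c" S])

lemma blk_map: "f (blk n x c z i) = blk n (\<lambda>i. f (x i)) (map f c) (f z) i"
 by (auto simp: blk_def)

lemma cval_blk:
 assumes "cfm L (n + length c) \<psi>"
 shows "cval_env D \<psi> (blk n x c z) = cval D \<psi> (map x [0..<n] @ c)"
 by (rule cval_env_cong) (use assms in \<open>auto simp: cfm_def blk_def nth_append\<close>)

lemma blk_upd: "(\<lambda>i. if i < n then b i else blk n x c z i) = blk n b c z"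
 by (auto simp: blk_def)

text \<open>Every tuple of the monster model is approximated, in finitely many formulas, by simple random
 variables, because \<open>U\<close>-valued random variables form an elementary substructure.\<close>

lemma approx_simple:
 assumes a: "a \<in> tuples n (cuniv C)" and c: "set c \<subseteq> SR (univ U)"
  and \<Psi>: "!!\<psi>. \<psi> \<in> set \<Psi> ==> cfm L (n + length c) \<psi>" and eps: "0 < eps"
 shows "\<exists>x. (\<forall>i. x i \<in> SR (univ U)) \<and> (\<forall>\<psi>\<in>set \<Psi>.
  \<bar>cval C \<psi> (map \<iota> (map x [0..<n]) @ map \<iota> c) - cval C \<psi> (a @ map \<iota> c)\<bar> \<le> eps)"
proof -
 obtain z where z: "z \<in> SR (univ U)" using univ_ne_SR by blast
 let ?ic = "map \<iota> c" and ?E = "\<lambda>b. blk n b (map \<iota> c) (\<iota> z)"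
 have icCU: "set ?ic \<subseteq> cuniv CU" "\<iota> z \<in> cuniv CU" using c z \<iota>_CU by auto
 then have icC: "set ?ic \<subseteq> cuniv C" "\<iota> z \<in> cuniv C" using CU_sub by blast+
 have wf: "!!\<psi>. \<psi> \<in> set \<Psi> ==> wf_cform L \<psi>" using \<Psi> by (simp add: cfm_def)
 have cfm: "cfm L (n + length ?ic) \<psi>" if "\<psi> \<in> set \<Psi>" for \<psi> using \<Psi>[OF that] by simp
 define s where "s = map (\<lambda>\<psi>. cval C \<psi> (a @ ?ic)) \<Psi>"
 have len: "length s = length \<Psi>" by (simp add: s_def)
 define a' where "a' i = (if i < n then a ! i else \<iota> z)" for i
 have a'C: "a' i \<in> cuniv C" for i
  using a icC(2) nth_mem[of i a] by (auto simp: a'_def tuples_def)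
 have a'a: "map a' [0..<n] = a" using a by (intro nth_equalityI) (auto simp: a'_def tuples_def)
 have EC: "?E (\<lambda>_. \<iota> z) i \<in> cuniv C" "?E (\<lambda>_. \<iota> z) i \<in> cuniv CU" for i
  using icC icCU by (auto intro!: blk_range simp del: select_convs update_convs)
 have val: "cval_env C (\<Psi> ! i) (\<lambda>i. if i < n then a' i else ?E (\<lambda>_. \<iota> z) i) = s ! i" if "i < length \<Psi>" for i
  unfolding blk_upd cval_blk[OF cfm[OF nth_mem[OF that]]] a'a using that by (simp add: s_def)
 have "cval_env C (Near n \<Psi> s s) (?E (\<lambda>_. \<iota> z)) \<le> 0"
  by (rule Near_upper[OF struct_C wf len, where b = a']) (simp_all add: EC a'C val del: select_convs update_convs)
 moreover have wfN: "wf_cform L (Near n \<Psi> s s)" using wf by (simp add: wf_Near)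
 ultimately have zero: "cval_env CU (Near n \<Psi> s s) (?E (\<lambda>_. \<iota> z)) \<le> 0"
  using elem_env[OF wfN EC(2)] by simp
 define \<eta> where "\<eta> = min (eps / 2) (1 / 2)"
 have \<eta>: "0 < \<eta>" "\<eta> < 1" "\<eta> \<le> eps / 2" using eps by (auto simp: \<eta>_def)
 from Near_attained[OF struct_CU wf len EC(2) zero \<eta>(1,2)] obtain b where b: "!!i. b i \<in> cuniv CU"
  "!!i. i < length \<Psi> ==> s ! i - \<eta> \<le> cval_env CU (\<Psi> ! i) (?E b) \<and> cval_env CU (\<Psi> ! i) (?E b) \<le> s ! i + \<eta>"
  unfolding blk_upd by blast
 let ?Q = "\<lambda>\<psi> \<delta>. \<forall>e e'. (\<forall>i. e i \<in> cuniv CU \<and> e' i \<in> cuniv CU \<and> cdist CU (e i) (e' i) \<le> \<delta>)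
  --> \<bar>cval_env CU \<psi> e - cval_env CU \<psi> e'\<bar> \<le> eps / 2"
 have "\<exists>\<delta>>0. \<forall>\<psi>\<in>set \<Psi>. ?Q \<psi> \<delta>"
 proof (rule common_delta)
  show "\<exists>\<delta>>0. ?Q \<psi> \<delta>" if "\<psi> \<in> set \<Psi>" for \<psi>
   by (rule cval_uniform[OF struct_CU wf[OF that]]) (use eps in simp)
  show "?Q \<psi> \<delta>'" if "?Q \<psi> \<delta>" "0 < \<delta>'" "\<delta>' \<le> \<delta>" for \<psi> \<delta> \<delta>'
   using that(1,3) by (meson order_trans)
 qed simp
 then obtain \<delta> where \<delta>: "\<delta> > 0" "!!\<psi>. \<psi> \<in> set \<Psi> ==> ?Q \<psi> \<delta>" by blast
 have "\<forall>i. \<exists>f. f \<in> SR (univ U) \<and> cdist C (b i) (\<iota> f) \<le> \<delta>" using dense_CU[OF b(1) \<delta>(1)] by blast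
 then obtain x where x: "!!i. x i \<in> SR (univ U)" "!!i. cdist C (b i) (\<iota> (x i)) \<le> \<delta>" by metis
 interpret Metric_space "cuniv C" "cdist C" by (rule cstructD(2)[OF struct_C])
 have xCU: "?E (\<lambda>i. \<iota> (x i)) i \<in> cuniv CU" "?E b i \<in> cuniv CU" for i
  using icCU b(1) \<iota>_CU[OF x(1)] by (auto intro!: blk_range simp del: select_convs update_convs)
 have "\<bar>cval C (\<Psi> ! i) (map \<iota> (map x [0..<n]) @ ?ic) - cval C (\<Psi> ! i) (a @ ?ic)\<bar> \<le> eps" if i: "i < length \<Psi>" for i
 proof -
  have mem: "\<Psi> ! i \<in> set \<Psi>" using i by simp
  have "cdist C (?E b j) (?E (\<lambda>i. \<iota> (x i)) j) \<le> \<delta>" for j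
  proof (cases "j < n")
   case True
   then show ?thesis using x(2) by (simp add: blk_def)
  next
   case False
   then have "?E b j = ?E (\<lambda>i. \<iota> (x i)) j" by (simp add: blk_def)
   moreover have "?E b j \<in> cuniv C" using xCU(2) CU_sub by blast
   ultimately show ?thesis using \<delta>(1) by simp
  qed
  then have "\<bar>cval_env CU (\<Psi> ! i) (?E b) - cval_env CU (\<Psi> ! i) (?E (\<lambda>i. \<iota> (x i)))\<bar> \<le> eps / 2"
   using \<delta>(2)[OF mem, rule_format, of "?E b" "?E (\<lambda>i. \<iota> (x i))"] xCU by (simp del: update_convs)
  moreover have "cval_env CU (\<Psi> ! i) (?E (\<lambda>i. \<iota> (x i))) = cval C (\<Psi> ! i) (map \<iota> (map x [0..<n]) @ ?ic)"
  proof -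
   have "cval_env CU (\<Psi> ! i) (?E (\<lambda>i. \<iota> (x i))) = cval_env C (\<Psi> ! i) (?E (\<lambda>i. \<iota> (x i)))"
    by (rule elem_env[OF wf[OF mem] xCU(1)])
   also have "\<dots> = cval C (\<Psi> ! i) (map (\<lambda>i. \<iota> (x i)) [0..<n] @ ?ic)" by (rule cval_blk[OF cfm[OF mem]])
   also have "map (\<lambda>i. \<iota> (x i)) [0..<n] = map \<iota> (map x [0..<n])" by simp
   finally show ?thesis .
  qed
  moreover have "s ! i = cval C (\<Psi> ! i) (a @ ?ic)" using i by (simp add: s_def)
  ultimately show ?thesis using b(2)[OF i] \<eta>(3) by linarith
 qed
 note near = this
 show ?thesis
 proof (intro exI[of _ x] conjI allI ballI)
  fix \<psi> assume "\<psi> \<in> set \<Psi>"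
  then obtain i where "i < length \<Psi>" "\<psi> = \<Psi> ! i" by (metis in_set_conv_nth)
  then show "\<bar>cval C \<psi> (map \<iota> (map x [0..<n]) @ ?ic) - cval C \<psi> (a @ ?ic)\<bar> \<le> eps" using near by simp
 qed (rule x(1))
qed

lemma approx_simple_M:
 assumes a: "a \<in> tuples n (cuniv C)" and c: "set c \<subseteq> SR M"
  and \<Psi>: "!!\<psi>. \<psi> \<in> set \<Psi> ==> cfm L (n + length c) \<psi>" and eps: "0 < eps"
 shows "\<exists>x\<in>tuples n (SR M). \<forall>\<psi>\<in>set \<Psi>.
  \<bar>cval C \<psi> (map \<iota> x @ map \<iota> c) - cval C \<psi> (a @ map \<iota> c)\<bar> \<le> eps"
proof -
 obtain z where z: "z \<in> SR M" using M_ne by blast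
 have MU: "SR M \<subseteq> SR (univ U)" by (rule simple_rvs_mono[OF M_sub(1)])
 have eps2: "eps / 2 > 0" using eps by simp
 have cU: "set c \<subseteq> SR (univ U)" using c MU by (rule order_trans)
 obtain x where x: "!!i. x i \<in> SR (univ U)" "!!\<psi>. \<psi> \<in> set \<Psi> ==>
   \<bar>cval C \<psi> (map \<iota> (map x [0..<n]) @ map \<iota> c) - cval C \<psi> (a @ map \<iota> c)\<bar> \<le> eps / 2"
  using approx_simple[OF a cU \<Psi> eps2] by blast
 have wf: "!!\<psi>. \<psi> \<in> set \<Psi> ==> wf_cform L \<psi>" using \<Psi> by (simp add: cfm_def)
 have "\<forall>\<psi>\<in>set \<Psi>. \<exists>\<theta>s. (\<forall>\<theta>\<in>set \<theta>s. wf_form L \<theta>) \<and>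
  (\<forall>e e'. (\<forall>i. e i \<in> SR (univ U) \<and> e' i \<in> SR (univ U)) --> agree U \<Omega> \<theta>s e e' -->
   \<bar>cval_env CU \<psi> (\<lambda>i. \<iota> (e i)) - cval_env CU \<psi> (\<lambda>i. \<iota> (e' i))\<bar> \<le> eps / 2)"
  using simple_QE[OF wf eps2] by blast
 then obtain T where T: "\<forall>\<psi>\<in>set \<Psi>. (\<forall>\<theta>\<in>set (T \<psi>). wf_form L \<theta>) \<and>
  (\<forall>e e'. (\<forall>i. e i \<in> SR (univ U) \<and> e' i \<in> SR (univ U)) --> agree U \<Omega> (T \<psi>) e e' -->
   \<bar>cval_env CU \<psi> (\<lambda>i. \<iota> (e i)) - cval_env CU \<psi> (\<lambda>i. \<iota> (e' i))\<bar> \<le> eps / 2)"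
  unfolding bchoice_iff by blast
 let ?T = "concat (map T \<Psi>)"
 let ?e = "blk n (\<lambda>_. z) c z"
 have eM: "?e i \<in> SR M" for i using c z by (intro blk_range)
 then have eU: "?e i \<in> SR (univ U)" for i using MU by blast
 have "\<exists>x'. (\<forall>i. x' i \<in> SR M) \<and> agree U \<Omega> ?T (mix [0..<n] x ?e) (mix [0..<n] x' ?e)"
 proof (rule back_and_forth[OF M_elem univ_ne _ eU x(1) eM])
  show "wf_form L \<theta>" if "\<theta> \<in> set ?T" for \<theta> using that T by auto
  show "agree U \<Omega> (Lifts [0..<n] ?T) ?e ?e" by (simp add: agree_def)
 qed
 then obtain x' where x': "!!i. x' i \<in> SR M" "agree U \<Omega> ?T (mix [0..<n] x ?e) (mix [0..<n] x' ?e)" by blast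
 have mb: "mix [0..<n] y ?e = blk n y c z" for y by (auto simp: mix_def blk_def)
 have "\<bar>cval C \<psi> (map \<iota> (map x' [0..<n]) @ map \<iota> c) - cval C \<psi> (a @ map \<iota> c)\<bar> \<le> eps"
  if mem: "\<psi> \<in> set \<Psi>" for \<psi>
 proof -
  have rng: "blk n x c z i \<in> SR (univ U)" "blk n x' c z i \<in> SR (univ U)" for i
   using x(1) x'(1) cU z MU by (auto intro!: blk_range)
  have "agree U \<Omega> (T \<psi>) (blk n x c z) (blk n x' c z)"
   using x'(2) mem unfolding mb agree_def by auto
  then have "\<bar>cval_env CU \<psi> (\<lambda>i. \<iota> (blk n x c z i)) - cval_env CU \<psi> (\<lambda>i. \<iota> (blk n x' c z i))\<bar> \<le> eps / 2"
   using T mem rng by blast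
  moreover have "cval_env CU \<psi> (\<lambda>i. \<iota> (blk n y c z i)) = cval C \<psi> (map \<iota> (map y [0..<n]) @ map \<iota> c)"
   if "!!i. blk n y c z i \<in> SR (univ U)" for y
  proof -
   have "cval_env CU \<psi> (\<lambda>i. \<iota> (blk n y c z i)) = cval_env C \<psi> (\<lambda>i. \<iota> (blk n y c z i))"
    by (rule elem_env[OF wf[OF mem] \<iota>_CU[OF that]])
   also have "\<dots> = cval_env C \<psi> (blk n (\<lambda>i. \<iota> (y i)) (map \<iota> c) (\<iota> z))" by (simp only: blk_map)
   also have "\<dots> = cval C \<psi> (map (\<lambda>i. \<iota> (y i)) [0..<n] @ map \<iota> c)"
    by (rule cval_blk) (use \<Psi>[OF mem] in simp)
   finally show ?thesis by (simp add: comp_def)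
  qed
  ultimately have "\<bar>cval C \<psi> (map \<iota> (map x [0..<n]) @ map \<iota> c) - cval C \<psi> (map \<iota> (map x' [0..<n]) @ map \<iota> c)\<bar> \<le> eps / 2"
   using rng by simp
  then show ?thesis using x(2)[OF mem] by linarith
 qed
 moreover have "map x' [0..<n] \<in> tuples n (SR M)" using x'(1) by (auto simp: tuples_def)
 ultimately show ?thesis by blast
qed

lemma common_cparameters:
 assumes "finite Z" "Z \<subseteq> param_cfms L (\<iota> ` SR M) k"
 shows "\<exists>d \<Psi>. set d \<subseteq> SR M \<and> (\<forall>(\<psi>, c)\<in>Z. cfm L (k + length d) (\<Psi> (\<psi>, c)) \<and>
  (\<forall>g. length g = k --> cval C (\<Psi> (\<psi>, c)) (g @ map \<iota> d) = cval C \<psi> (g @ c)))"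
 using assms
proof (induction Z rule: finite_induct)
 case empty
 show ?case by (rule exI[of _ "[]"]) simp
next
 case (insert p Z)
 have "Z \<subseteq> param_cfms L (\<iota> ` SR M) k" using insert.prems by simp
 from insert.IH[OF this] obtain d \<Psi> where
  IH: "set d \<subseteq> SR M \<and> (\<forall>(\<psi>, c)\<in>Z. cfm L (k + length d) (\<Psi> (\<psi>, c)) \<and>
   (\<forall>g. length g = k --> cval C (\<Psi> (\<psi>, c)) (g @ map \<iota> d) = cval C \<psi> (g @ c)))" by (elim exE)
 have d: "set d \<subseteq> SR M" by (rule conjunct1[OF IH])
 have \<Psi>: "cfm L (k + length d) (\<Psi> (\<psi>, c))"
  "length g = k ==> cval C (\<Psi> (\<psi>, c)) (g @ map \<iota> d) = cval C \<psi> (g @ c)" if "(\<psi>, c) \<in> Z" for \<psi> c g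
  using bspec[OF conjunct2[OF IH] that] by simp_all
 obtain \<psi>0 c0 where p: "p = (\<psi>0, c0)" by fastforce
 have p0: "cfm L (k + length c0) \<psi>0" "set c0 \<subseteq> \<iota> ` SR M" using insert.prems by (auto simp: param_cfms_def p)
 obtain d0 where d0: "set d0 \<subseteq> SR M" "map \<iota> d0 = c0"
 proof -
  have "c0 \<in> lists (\<iota> ` SR M)" using p0(2) by auto
  then have "c0 \<in> map \<iota> ` lists (SR M)" by (simp add: lists_image)
  then show ?thesis using that by auto
 qed
 define \<pi> where "\<pi> i = (if i < k then i else i + length d)" for i
 have inj: "inj \<pi>" by (auto simp: inj_def \<pi>_def split: if_splits)
 define \<Psi>' where "\<Psi>' = \<Psi>(p := crename \<pi> \<psi>0)"
 have len0: "length d0 = length c0" using arg_cong[OF d0(2), of length] by simp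
 have "cfm L (k + length (d @ d0)) (\<Psi>' (\<psi>, c)) \<and>
  (\<forall>g. length g = k --> cval C (\<Psi>' (\<psi>, c)) (g @ map \<iota> (d @ d0)) = cval C \<psi> (g @ c))"
  if mem: "(\<psi>, c) \<in> insert p Z" for \<psi> c
 proof (cases "(\<psi>, c) = p")
  case True
  then have eq: "\<psi> = \<psi>0" "c = c0" by (simp_all add: p)
  have eq': "\<Psi>' (\<psi>0, c0) = crename \<pi> \<psi>0" unfolding \<Psi>'_def p by simp
  have "cfm L (k + length (d @ d0)) (crename \<pi> \<psi>0)"
   using p0(1) len0 by (auto simp: cfm_def wf_crename cfvars_crename[OF inj] \<pi>_def)
  moreover have "cval C (crename \<pi> \<psi>0) (g @ map \<iota> (d @ d0)) = cval C \<psi>0 (g @ c0)" if "length g = k" for g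
   unfolding cval_crename[OF inj]
  proof (rule cval_env_cong)
   fix i
   show "(g @ map \<iota> (d @ d0)) ! \<pi> i = (g @ c0) ! i"
   proof (cases "i < k")
    case True
    then show ?thesis using that by (simp add: \<pi>_def nth_append)
   next
    case False
    then obtain t where t: "i = k + t" using le_Suc_ex by (metis not_less)
    have e1: "(g @ c0) ! i = c0 ! t" unfolding t that[symmetric] by (rule nth_append_length_plus)
    have "\<pi> i = length g + (length (map \<iota> d) + t)" using False that by (simp add: \<pi>_def t)
    then have "(g @ map \<iota> (d @ d0)) ! \<pi> i = (map \<iota> d @ map \<iota> d0) ! (length (map \<iota> d) + t)"
     by (simp only: nth_append_length_plus map_append)
    also have "\<dots> = c0 ! t" unfolding nth_append_length_plus d0(2) ..
    finally show ?thesis using e1 by simp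
   qed
  qed
  ultimately show ?thesis unfolding eq eq' by (intro conjI allI impI)
 next
  case False
  have Z: "(\<psi>, c) \<in> Z" "\<Psi>' (\<psi>, c) = \<Psi> (\<psi>, c)"
   using mem False unfolding \<Psi>'_def by simp_all
  have "cval C (\<Psi> (\<psi>, c)) (g @ map \<iota> (d @ d0)) = cval C (\<Psi> (\<psi>, c)) (g @ map \<iota> d)" if "length g = k" for g
   by (rule cval_env_cong) (use \<Psi>(1)[OF Z(1)] that in \<open>auto simp: cfm_def nth_append\<close>)
  moreover have "cfm L (k + length (d @ d0)) (\<Psi> (\<psi>, c))"
   using \<Psi>(1)[OF Z(1)] unfolding cfm_def by (auto intro: order.trans)
  ultimately show ?thesis unfolding Z(2) using \<Psi>(2)[OF Z(1)] by (intro conjI allI impI) simp_all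
 qed
 note props = this
 have "\<forall>(\<psi>, c)\<in>insert p Z. cfm L (k + length (d @ d0)) (\<Psi>' (\<psi>, c)) \<and>
   (\<forall>g. length g = k --> cval C (\<Psi>' (\<psi>, c)) (g @ map \<iota> (d @ d0)) = cval C \<psi> (g @ c))"
 proof (intro ballI case_prodI2)
  fix x \<psi> c assume "x \<in> insert p Z" "x = (\<psi>, c)"
  then show "cfm L (k + length (d @ d0)) (\<Psi>' (\<psi>, c)) \<and>
   (\<forall>g. length g = k --> cval C (\<Psi>' (\<psi>, c)) (g @ map \<iota> (d @ d0)) = cval C \<psi> (g @ c))"
   by (intro props) simp
 qed
 moreover have "set (d @ d0) \<subseteq> SR M" unfolding set_append by (rule Un_least[OF d d0(1)])
 ultimately show ?case by (intro exI[of _ "d @ d0"] exI[of _ \<Psi>'] conjI)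
qed

lemma types_tendsto_ex:
 assumes h: "h \<in> tuples k (cuniv C)"
 shows "\<exists>F. F \<noteq> bot \<and> eventually (\<lambda>g. g \<in> tuples k (SR M)) F \<and> types_tendsto L M \<Omega> C \<iota> h F"
proof -
 let ?P = "param_cfms L (\<iota> ` SR M) k"
 define A where "A = (\<lambda>((\<psi>, c), j::nat). {g \<in> tuples k (SR M).
  \<bar>cval C \<psi> (map \<iota> g @ c) - cval C \<psi> (h @ c)\<bar> \<le> inverse (real (Suc j))})"
 define F where "F = (INF t\<in>?P \<times> UNIV. principal (A t))"
 have "F \<noteq> bot" unfolding F_def
 proof (rule INF_filter_not_bot)
  fix X assume X: "X \<subseteq> ?P \<times> (UNIV :: nat set)" "finite X"
  have "finite (fst ` X)" "fst ` X \<subseteq> ?P" using X by auto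
  from common_cparameters[OF this] obtain d \<Psi> where
   IH: "set d \<subseteq> SR M \<and> (\<forall>(\<psi>, c)\<in>fst ` X. cfm L (k + length d) (\<Psi> (\<psi>, c)) \<and>
    (\<forall>g. length g = k --> cval C (\<Psi> (\<psi>, c)) (g @ map \<iota> d) = cval C \<psi> (g @ c)))" by (elim exE)
  have d: "set d \<subseteq> SR M" by (rule conjunct1[OF IH])
  have \<Psi>: "cfm L (k + length d) (\<Psi> (\<psi>, c)) \<and>
    (\<forall>g. length g = k --> cval C (\<Psi> (\<psi>, c)) (g @ map \<iota> d) = cval C \<psi> (g @ c))"
   if "(\<psi>, c) \<in> fst ` X" for \<psi> c
   using bspec[OF conjunct2[OF IH] that] by simp
  obtain J where J: "\<forall>j\<in>snd ` X. j \<le> J" using finite_nat_set_iff_bounded_le[of "snd ` X"] X(2) by auto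
  obtain \<Psi>s where \<Psi>s: "set \<Psi>s = \<Psi> ` fst ` X" using X(2) finite_list[of "\<Psi> ` fst ` X"] by auto
  have "\<exists>x\<in>tuples k (SR M). \<forall>\<psi>\<in>set \<Psi>s.
   \<bar>cval C \<psi> (map \<iota> x @ map \<iota> d) - cval C \<psi> (h @ map \<iota> d)\<bar> \<le> inverse (real (Suc J))"
  proof (rule approx_simple_M[OF h d])
   show "cfm L (k + length d) \<psi>" if "\<psi> \<in> set \<Psi>s" for \<psi>
    using that \<Psi> unfolding \<Psi>s by force
  qed simp
  then obtain x where x: "x \<in> tuples k (SR M)" "!!\<psi>. \<psi> \<in> set \<Psi>s ==>
   \<bar>cval C \<psi> (map \<iota> x @ map \<iota> d) - cval C \<psi> (h @ map \<iota> d)\<bar> \<le> inverse (real (Suc J))" by blast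
  have "x \<in> A t" if t: "t \<in> X" for t
  proof -
   obtain \<psi> c j where t': "t = ((\<psi>, c), j)" by (metis prod.collapse)
   have mem: "(\<psi>, c) \<in> fst ` X" and "j \<le> J" using t J by (force simp: t')+
   have "\<bar>cval C \<psi> (map \<iota> x @ c) - cval C \<psi> (h @ c)\<bar> \<le> inverse (real (Suc J))"
    using x(2)[of "\<Psi> (\<psi>, c)"] \<Psi>[OF mem] mem tuplesD(1)[OF x(1)] tuplesD(1)[OF h] by (auto simp: \<Psi>s)
   also have "\<dots> \<le> inverse (real (Suc j))" using \<open>j \<le> J\<close> by (intro le_imp_inverse_le) simp_all
   finally show ?thesis using x(1) by (simp add: A_def t')
  qed
  then have "principal {x} \<le> (INF t\<in>X. principal (A t))" by (intro INF_greatest) simp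
  moreover have "principal {x} \<noteq> bot" by (simp add: principal_eq_bot_iff)
  ultimately show "(INF t\<in>X. principal (A t)) \<noteq> bot" by (metis bot_unique)
 qed
 moreover have ev: "eventually (\<lambda>g. g \<in> A t) F" if "t \<in> ?P \<times> UNIV" for t
 proof -
  have "F \<le> principal (A t)" unfolding F_def using that by (rule INF_lower)
  then show ?thesis by (simp add: le_principal)
 qed
 moreover have "eventually (\<lambda>g. g \<in> tuples k (SR M)) F"
 proof -
  have "((CProb Truth [], []), 0) \<in> ?P \<times> (UNIV :: nat set)" by (simp add: param_cfms_def cfm_def fm_Truth)
  from ev[OF this] show ?thesis by (rule eventually_mono) (simp add: A_def)
 qed
 moreover have "types_tendsto L M \<Omega> C \<iota> h F"
  unfolding types_tendsto_def
 proof (intro ballI, clarify)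
  fix \<psi> c assume mem: "(\<psi>, c) \<in> param_cfms L (\<iota> ` SR M) (length h)"
  then have P: "(\<psi>, c) \<in> ?P" using tuplesD(1)[OF h] by simp
  show "((\<lambda>g. cval C \<psi> (map \<iota> g @ c)) \<longlongrightarrow> cval C \<psi> (h @ c)) F"
  proof (rule tendstoI)
   fix e :: real assume "e > 0"
   then obtain j where j: "inverse (real (Suc j)) < e" using reals_Archimedean by blast
   have "eventually (\<lambda>g. g \<in> A ((\<psi>, c), j)) F" by (rule ev) (use P in simp)
   then show "eventually (\<lambda>g. dist (cval C \<psi> (map \<iota> g @ c)) (cval C \<psi> (h @ c)) < e) F"
    by (rule eventually_mono) (use j in \<open>auto simp: A_def dist_real_def\<close>)
  qed
 qed
 ultimately show ?thesis by blast
qed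

lemma set_cst:
 assumes "set a \<subseteq> B"
 shows "set (cst a) \<subseteq> SR B"
 unfolding set_map by (rule image_subsetI, rule const_simple_rvs) (rule subsetD[OF assms])

lemma at_point_cst: "at_point (gs @ cst c) \<omega> = at_point gs \<omega> @ c"
 by (simp add: comp_def)

text \<open>The type \<open>r_\<mu>\<close> integrates the function \<open>b \<mapsto> \<mu>(\<phi>(x, b))\<close> against the law of the parameter:
 by definability this function is, up to \<open>eps\<close>, a finite combination of \<open>M\<close>-definable indicators.\<close>

lemma type_prob_approx:
 assumes p: "is_r L U M m \<mu> \<Omega> C \<iota> p" and \<phi>: "fm L (m + k) \<phi>"
  and c: "set c \<subseteq> M" and R: "finite R" and \<theta>: "!!r. r \<in> R ==> fm L (k + length c) (\<theta> r)"
  and near: "!!b. b \<in> X k ==> \<bar>\<mu> (defset U m \<phi> b) - (\<Sum>r\<in>R. r * of_bool (holds U (\<theta> r) (b @ c)))\<bar> \<le> eps"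
  and h: "h \<in> tuples k (cuniv C)"
 shows "\<bar>type_prob m p \<phi> h - (\<Sum>r\<in>R. r * cprob C (\<theta> r) (h @ map \<iota> (cst c)))\<bar> \<le> eps"
proof -
 obtain F where F: "F \<noteq> bot" "eventually (\<lambda>g. g \<in> tuples k (SR M)) F" "types_tendsto L M \<Omega> C \<iota> h F"
  using types_tendsto_ex[OF h] by blast
 let ?c = "cst c"
 have cM: "set ?c \<subseteq> SR M" by (rule set_cst[OF c])
 have MU: "SR M \<subseteq> SR (univ U)" by (rule simple_rvs_mono[OF M_sub(1)])
 have lim1: "(r_simple U \<Omega> m \<mu> \<phi> \<longlongrightarrow> type_prob m p \<phi> h) F"
  using p \<phi> h F unfolding is_r_def by blast
 have cv: "cval C (CProb (\<theta> r) [0..<k + length c]) (g @ map \<iota> ?c) = cprob C (\<theta> r) (g @ map \<iota> ?c)"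
  if "length g = k" for g r
  using map_nth[of "g @ map \<iota> ?c"] that by simp
 have lim2: "((\<lambda>g. \<Sum>r\<in>R. r * cprob C (\<theta> r) (map \<iota> g @ map \<iota> ?c)) \<longlongrightarrow>
   (\<Sum>r\<in>R. r * cprob C (\<theta> r) (h @ map \<iota> ?c))) F"
 proof (intro tendsto_sum tendsto_mult tendsto_const)
  fix r assume "r \<in> R"
  then have "(CProb (\<theta> r) [0..<k + length c], map \<iota> ?c) \<in> param_cfms L (\<iota> ` SR M) (length h)"
   using \<theta> cM tuplesD(1)[OF h] by (auto simp: param_cfms_def cfm_def)
  with F(3) have "((\<lambda>g. cval C (CProb (\<theta> r) [0..<k + length c]) (map \<iota> g @ map \<iota> ?c)) \<longlongrightarrow>
    cval C (CProb (\<theta> r) [0..<k + length c]) (h @ map \<iota> ?c)) F"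
   unfolding types_tendsto_def by blast
  then have "((\<lambda>g. cval C (CProb (\<theta> r) [0..<k + length c]) (map \<iota> g @ map \<iota> ?c)) \<longlongrightarrow>
    cprob C (\<theta> r) (h @ map \<iota> ?c)) F" unfolding cv[OF tuplesD(1)[OF h]] .
  then show "((\<lambda>g. cprob C (\<theta> r) (map \<iota> g @ map \<iota> ?c)) \<longlongrightarrow> cprob C (\<theta> r) (h @ map \<iota> ?c)) F"
   by (rule Lim_transform_eventually)
    (use F(2) in \<open>eventually_elim, subst cv, simp_all add: tuples_def\<close>)
 qed
 have "\<bar>r_simple U \<Omega> m \<mu> \<phi> g - (\<Sum>r\<in>R. r * cprob C (\<theta> r) (map \<iota> g @ map \<iota> ?c))\<bar> \<le> eps"
  if g: "g \<in> tuples k (SR M)" for g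
 proof -
  let ?G = "at_point g" and ?P = "\<lambda>a. \<Omega>.prob {\<omega> \<in> space \<Omega>. at_point g \<omega> = a}"
  have G: "simple_function \<Omega> ?G" using g by (intro simple_at_point) (auto simp: tuples_def simple_rvs_def)
  have GX: "?G \<omega> \<in> X k" if "\<omega> \<in> space \<Omega>" for \<omega>
  proof -
   have "f \<omega> \<in> univ U" if "f \<in> set g" for f
   proof -
    have "f \<in> SR (univ U)" using that g MU by (auto simp: tuples_def)
    then show ?thesis using \<open>\<omega> \<in> space \<Omega>\<close> by (rule simple_rvsD(2))
   qed
   then show ?thesis using g by (auto simp: tuples_def)
  qed
  have gc: "g @ ?c \<in> tuples (k + length c) (SR (univ U))" using g cM MU by (auto simp: tuples_def)
  have "cprob C (\<theta> r) (map \<iota> g @ map \<iota> ?c) = (\<Sum>a\<in>?G ` space \<Omega>. ?P a * of_bool (holds U (\<theta> r) (a @ c)))"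
   if r: "r \<in> R" for r
  proof -
   have "cprob C (\<theta> r) (map \<iota> (g @ ?c)) = prob_of U \<Omega> (\<theta> r) (g @ ?c)" by (rule prob_\<iota>[OF \<theta>[OF r] gc])
   also have "\<dots> = \<Omega>.prob {\<omega> \<in> space \<Omega>. holds U (\<theta> r) (?G \<omega> @ c)}"
    unfolding prob_of_def at_point_cst ..
   also have "\<dots> = (\<Sum>a\<in>?G ` space \<Omega>. ?P a * of_bool (holds U (\<theta> r) (a @ c)))"
    by (rule \<Omega>.prob_simple[OF G])
   finally show ?thesis by simp
  qed
  then have "(\<Sum>r\<in>R. r * cprob C (\<theta> r) (map \<iota> g @ map \<iota> ?c))
    = (\<Sum>r\<in>R. \<Sum>a\<in>?G ` space \<Omega>. ?P a * (r * of_bool (holds U (\<theta> r) (a @ c))))"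
   by (intro sum.cong) (simp_all add: sum_distrib_left algebra_simps)
  also have "\<dots> = (\<Sum>a\<in>?G ` space \<Omega>. ?P a * (\<Sum>r\<in>R. r * of_bool (holds U (\<theta> r) (a @ c))))"
   by (subst sum.swap) (simp add: sum_distrib_left)
  finally have "\<bar>r_simple U \<Omega> m \<mu> \<phi> g - (\<Sum>r\<in>R. r * cprob C (\<theta> r) (map \<iota> g @ map \<iota> ?c))\<bar>
    = \<bar>\<Sum>a\<in>?G ` space \<Omega>. ?P a * (\<mu> (defset U m \<phi> a) - (\<Sum>r\<in>R. r * of_bool (holds U (\<theta> r) (a @ c))))\<bar>"
   by (simp add: r_simple_def sum_subtractf right_diff_distrib)
  also have "\<dots> \<le> (\<Sum>a\<in>?G ` space \<Omega>. \<bar>?P a * (\<mu> (defset U m \<phi> a) - (\<Sum>r\<in>R. r * of_bool (holds U (\<theta> r) (a @ c))))\<bar>)"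
   by (rule sum_abs)
  also have "\<dots> \<le> (\<Sum>a\<in>?G ` space \<Omega>. ?P a * eps)"
  proof (rule sum_mono)
   fix a assume "a \<in> ?G ` space \<Omega>"
   then have "a \<in> X k" using GX by blast
   from near[OF this] show "\<bar>?P a * (\<mu> (defset U m \<phi> a) - (\<Sum>r\<in>R. r * of_bool (holds U (\<theta> r) (a @ c))))\<bar> \<le> ?P a * eps"
    by (simp add: abs_mult mult_left_mono)
  qed
  also have "\<dots> = eps"
   using \<Omega>.prob_simple[OF G, of "\<lambda>_. True"] \<Omega>.prob_space by (simp flip: sum_distrib_right)
  finally show ?thesis .
 qed
 then have "eventually (\<lambda>g. \<bar>r_simple U \<Omega> m \<mu> \<phi> g - (\<Sum>r\<in>R. r * cprob C (\<theta> r) (map \<iota> g @ map \<iota> ?c))\<bar> \<le> eps) F"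
  using F(2) by (rule eventually_mono[rotated])
 from tendsto_upperbound[OF tendsto_rabs[OF tendsto_diff[OF lim1 lim2]] this F(1)] show ?thesis .
qed

text \<open>Common parameters put the approximations of finitely many formulas into one list of variables, so
 that a single tuple in the monster model of the randomization can be tested against all of them.\<close>

lemma definable_approx:
 assumes \<mu>: "definable_measure L U M m \<mu>" and \<Phi>: "finite \<Phi>" "!!\<phi>. \<phi> \<in> \<Phi> ==> fm L (m + k) \<phi>" and eps: "0 < eps"
 shows "\<exists>c R \<theta>. set c \<subseteq> M \<and> (\<forall>\<phi>\<in>\<Phi>. finite (R \<phi>) \<and> (\<forall>r\<in>R \<phi>. fm L (k + length c) (\<theta> \<phi> r)) \<and>
  (\<forall>b\<in>X k. \<bar>\<mu> (defset U m \<phi> b) - (\<Sum>r\<in>R \<phi>. r * of_bool (holds U (\<theta> \<phi> r) (b @ c)))\<bar> \<le> eps))"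
proof -
 have "\<forall>\<phi>\<in>\<Phi>. \<exists>h. step (X k) (definable L U M k) h \<and> (\<forall>b\<in>X k. \<bar>\<mu> (defset U m \<phi> b) - h b\<bar> \<le> eps)"
  using definable_measure_tame[OF \<mu> \<Phi>(2)] eps unfolding tame_def by blast
 then obtain h where h: "!!\<phi>. \<phi> \<in> \<Phi> ==> step (X k) (definable L U M k) (h \<phi>)"
  "!!\<phi> b. \<phi> \<in> \<Phi> ==> b \<in> X k ==> \<bar>\<mu> (defset U m \<phi> b) - h \<phi> b\<bar> \<le> eps" by metis
 let ?R = "\<lambda>\<phi>. h \<phi> ` X k" and ?E = "\<lambda>\<phi> r. {b \<in> X k. h \<phi> b = r}"
 let ?D = "\<Union>\<phi>\<in>\<Phi>. ?E \<phi> ` ?R \<phi>"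
 have "finite ?D"
 proof (rule finite_UN_I[OF \<Phi>(1)])
  show "finite (?E \<phi> ` ?R \<phi>)" if "\<phi> \<in> \<Phi>" for \<phi>
   by (rule finite_imageI) (use h(1)[OF that] in \<open>simp add: step_def\<close>)
 qed
 moreover have "?D \<subseteq> definable L U M k"
 proof (intro UN_least image_subsetI)
  show "?E \<phi> r \<in> definable L U M k" if "\<phi> \<in> \<Phi>" "r \<in> ?R \<phi>" for \<phi> r
   using h(1)[OF that(1)] that(2) by (simp add: step_def)
 qed
 ultimately have fin: "finite ?D" "?D \<subseteq> definable L U M k" by simp_all
 from definable_common[OF fin] obtain c \<theta> where c\<theta>: "set c \<subseteq> M \<and>
  (\<forall>D\<in>?D. fm L (k + length c) (\<theta> D) \<and> D = defset U k (\<theta> D) c)" by (elim exE)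
 have c: "set c \<subseteq> M" by (rule conjunct1[OF c\<theta>])
 have \<theta>: "fm L (k + length c) (\<theta> D)" "D = defset U k (\<theta> D) c" if "D \<in> ?D" for D
  using bspec[OF conjunct2[OF c\<theta>] that] by (rule conjunct1, rule conjunct2)
 have "(\<Sum>r\<in>?R \<phi>. r * of_bool (holds U (\<theta> (?E \<phi> r)) (b @ c))) = h \<phi> b" if "\<phi> \<in> \<Phi>" "b \<in> X k" for \<phi> b
 proof -
  have "holds U (\<theta> (?E \<phi> r)) (b @ c) \<longleftrightarrow> h \<phi> b = r" if "r \<in> ?R \<phi>" for r
  proof -
   have "?E \<phi> r \<in> ?D" by (rule UN_I[OF \<open>\<phi> \<in> \<Phi>\<close>]) (rule imageI[OF that])
   from \<theta>(2)[OF this] have "b \<in> ?E \<phi> r \<longleftrightarrow> b \<in> defset U k (\<theta> (?E \<phi> r)) c" by (rule arg_cong)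
   then show ?thesis using \<open>b \<in> X k\<close> by (simp add: defset_def)
  qed
  then have "(\<Sum>r\<in>?R \<phi>. r * of_bool (holds U (\<theta> (?E \<phi> r)) (b @ c))) = (\<Sum>r\<in>?R \<phi>. if r = h \<phi> b then r else 0)"
   by (intro sum.cong) auto
  also have "\<dots> = h \<phi> b" using h(1)[OF that(1)] that(2) by (simp add: step_def)
  finally show ?thesis .
 qed
 note sum_eq = this
 show ?thesis
 proof (intro exI conjI ballI)
  show "set c \<subseteq> M" by (rule c)
  show "finite (?R \<phi>)" if "\<phi> \<in> \<Phi>" for \<phi> using h(1)[OF that] by (simp add: step_def)
  show "fm L (k + length c) (\<theta> (?E \<phi> r))" if "\<phi> \<in> \<Phi>" "r \<in> ?R \<phi>" for \<phi> r
  proof (rule \<theta>(1))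
   show "?E \<phi> r \<in> ?D" by (rule UN_I[OF that(1)]) (rule imageI[OF that(2)])
  qed
  show "\<bar>\<mu> (defset U m \<phi> b) - (\<Sum>r\<in>?R \<phi>. r * of_bool (holds U (\<theta> (?E \<phi> r)) (b @ c)))\<bar> \<le> eps"
   if "\<phi> \<in> \<Phi>" "b \<in> X k" for \<phi> b
   unfolding sum_eq[OF that] by (rule h(2)[OF that])
 qed
qed

end

section \<open>Independent randomness in atomless spaces\<close>

lemma expectation_finite:
 fixes h :: "'x => real"
 assumes "finite (set_pmf w)"
 shows "measure_pmf.expectation w h = (\<Sum>x\<in>set_pmf w. pmf w x * h x)"
 using integral_measure_pmf_real[of "set_pmf w" w h] assms by (simp add: mult.commute)

lemma prob_expectation:
 assumes "finite (set_pmf w)"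
 shows "measure_pmf.prob w {x. Q x} = measure_pmf.expectation w (\<lambda>x. of_bool (Q x))"
proof -
 have "measure_pmf.expectation w (\<lambda>x. of_bool (Q x)) = measure_pmf.expectation w (indicator {x. Q x})"
  by (intro arg_cong[where f = "measure_pmf.expectation w"] ext) (simp add: indicator_def)
 then show ?thesis unfolding \<open>measure_pmf.expectation w (\<lambda>x. of_bool (Q x)) = _\<close> by simp
qed

lemma expectation_le:
 fixes h :: "'x => real"
 assumes "finite (set_pmf w)" "!!x. x \<in> set_pmf w ==> g x \<le> h x + b"
 shows "measure_pmf.expectation w g \<le> measure_pmf.expectation w h + b"
proof -
 have "(\<Sum>x\<in>set_pmf w. pmf w x * g x) \<le> (\<Sum>x\<in>set_pmf w. pmf w x * (h x + b))"
  by (intro sum_mono mult_left_mono assms(2)) simp_all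
 also have "\<dots> = (\<Sum>x\<in>set_pmf w. pmf w x * h x) + (\<Sum>x\<in>set_pmf w. pmf w x) * b"
  by (simp add: distrib_left sum.distrib sum_distrib_right)
 also have "(\<Sum>x\<in>set_pmf w. pmf w x) = 1" by (rule sum_pmf_eq_1[OF assms(1)]) simp
 finally show ?thesis by (simp add: expectation_finite[OF assms(1)])
qed

lemma expectation_close:
 fixes h :: "'x => real"
 assumes "finite (set_pmf w)" "!!x. x \<in> set_pmf w ==> \<bar>g x - h x\<bar> \<le> b"
 shows "\<bar>measure_pmf.expectation w g - measure_pmf.expectation w h\<bar> \<le> b"
proof -
 have "measure_pmf.expectation w g \<le> measure_pmf.expectation w h + b"
  by (rule expectation_le[OF assms(1)]) (use assms(2) in \<open>simp add: abs_le_iff\<close>, force)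
 moreover have "measure_pmf.expectation w h \<le> measure_pmf.expectation w g + b"
  by (rule expectation_le[OF assms(1)]) (use assms(2) in \<open>simp add: abs_le_iff\<close>, force)
 ultimately show ?thesis by simp
qed

lemma expectation_bind_map:
 fixes h :: "'y => real"
 assumes w: "finite (set_pmf w)" and u: "!!x. x \<in> set_pmf w ==> finite (set_pmf (u x))"
 shows "measure_pmf.expectation (bind_pmf w (\<lambda>x. map_pmf (g x) (u x))) h
  = measure_pmf.expectation w (\<lambda>x. measure_pmf.expectation (u x) (\<lambda>y. h (g x y)))"
proof -
 have "measure_pmf.expectation (bind_pmf w (\<lambda>x. map_pmf (g x) (u x))) h
  = (\<Sum>x\<in>set_pmf w. pmf w x *\<^sub>R measure_pmf.expectation (map_pmf (g x) (u x)) h)"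
  by (rule pmf_expectation_bind[OF w _ order.refl]) (use u in simp)
 then show ?thesis by (simp add: expectation_finite[OF w])
qed

lemma nearly_largest:
 fixes S :: "real set"
 assumes "x0 \<in> S" "!!x. x \<in> S ==> 0 \<le> x" "!!x. x \<in> S ==> x \<le> b"
 shows "\<exists>x\<in>S. \<forall>y\<in>S. y \<le> 2 * x"
proof (cases "Sup S \<le> 0")
 case bdd: True
 have "y \<le> Sup S" if "y \<in> S" for y
  by (rule cSup_upper[OF that]) (use assms(3) in \<open>auto simp: bdd_above_def\<close>)
 then have "y \<le> 2 * x0" if "y \<in> S" for y using bdd that assms(1,2) by (meson order.trans mult_nonneg_nonneg zero_le_numeral)
 then show ?thesis using assms(1) by blast
next
 case False
 then have "Sup S / 2 < Sup S" by simp
 then obtain x where x: "x \<in> S" "Sup S / 2 < x" using less_cSupE[of "Sup S / 2" S] assms(1) by blast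
 have "y \<le> 2 * x" if "y \<in> S" for y
 proof -
  have "y \<le> Sup S" by (rule cSup_upper[OF that]) (use assms(3) in \<open>auto simp: bdd_above_def\<close>)
  then show ?thesis using x(2) by simp
 qed
 then show ?thesis using x(1) by blast
qed

lemma atomless_small_subset:
 assumes \<Omega>: "atomless_prob_space \<Omega>" and A: "A \<in> sets \<Omega>" "0 < measure \<Omega> A" and eps: "0 < eps"
 shows "\<exists>B\<in>sets \<Omega>. B \<subseteq> A \<and> 0 < measure \<Omega> B \<and> measure \<Omega> B \<le> eps"
proof -
 interpret prob_space \<Omega> using \<Omega> by (simp add: atomless_prob_space_def)
 have "\<exists>B\<in>sets \<Omega>. B \<subseteq> A \<and> 0 < prob B \<and> prob B \<le> (1 / 2) ^ n" for n
 proof (induction n)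
  case 0
  then show ?case using A by (intro bexI[of _ A]) auto
 next
  case (Suc n)
  then obtain B where B: "B \<in> sets \<Omega>" "B \<subseteq> A" "0 < prob B" "prob B \<le> (1 / 2) ^ n" by blast
  then obtain D where D: "D \<in> sets \<Omega>" "D \<subseteq> B" "0 < prob D" "prob D < prob B"
   using \<Omega> unfolding atomless_prob_space_def by blast
  have eq: "prob (B - D) = prob B - prob D" by (rule finite_measure_Diff[OF B(1) D(1,2)])
  show ?case
  proof (cases "prob D \<le> prob B / 2")
   case True
   then show ?thesis using B D by (intro bexI[of _ D]) auto
  next
   case False
   then show ?thesis using B D eq by (intro bexI[of _ "B - D"]) auto
  qed
 qed
 moreover obtain n where "(1 / 2 :: real) ^ n < eps" using real_arch_pow_inv[OF eps, of "1 / 2"] by auto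
 ultimately show ?thesis by (meson order.strict_implies_order order.trans)
qed

text \<open>A greedy exhaustion: each step adds a piece of at least half the largest admissible size.  If
 the union missed the prescribed measure, a fixed small piece would remain admissible forever, and
 the sizes of the added pieces would not tend to \<open>0\<close>.\<close>

lemma atomless_subset_of_measure:
 assumes \<Omega>: "atomless_prob_space \<Omega>" and A: "A \<in> sets \<Omega>" and t: "0 \<le> t" "t \<le> measure \<Omega> A"
 shows "\<exists>B\<in>sets \<Omega>. B \<subseteq> A \<and> measure \<Omega> B = t"
proof -
 interpret prob_space \<Omega> using \<Omega> by (simp add: atomless_prob_space_def)
 let ?adm = "\<lambda>B E. E \<in> sets \<Omega> \<and> E \<subseteq> A - B \<and> prob B + prob E \<le> t"
 have "\<exists>B. \<forall>n. (B n \<in> sets \<Omega> \<and> B n \<subseteq> A \<and> prob (B n) \<le> t) \<and>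
  (B n \<subseteq> B (Suc n) \<and> (\<forall>E. ?adm (B n) E --> prob E \<le> 2 * (prob (B (Suc n)) - prob (B n))))"
 proof (rule dependent_nat_choice)
  show "\<exists>B. B \<in> sets \<Omega> \<and> B \<subseteq> A \<and> prob B \<le> t" using t by (intro exI[of _ "{}"]) simp
 next
  fix B n assume B: "B \<in> sets \<Omega> \<and> B \<subseteq> A \<and> prob B \<le> t"
  have "\<exists>x\<in>{prob E | E. ?adm B E}. \<forall>y\<in>{prob E | E. ?adm B E}. y \<le> 2 * x"
  proof (rule nearly_largest)
   show "prob {} \<in> {prob E | E. ?adm B E}" using B by (intro CollectI exI[of _ "{}"]) simp
  qed auto
  then obtain E where E: "?adm B E" "!!E'. ?adm B E' ==> prob E' \<le> 2 * prob E" by blast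
  have "prob (B \<union> E) = prob B + prob E" using B E(1) by (intro finite_measure_Union) auto
  then show "\<exists>B'. (B' \<in> sets \<Omega> \<and> B' \<subseteq> A \<and> prob B' \<le> t) \<and>
   (B \<subseteq> B' \<and> (\<forall>E. ?adm B E --> prob E \<le> 2 * (prob B' - prob B)))"
   using B E by (intro exI[of _ "B \<union> E"]) auto
 qed
 then obtain B where B: "!!n. B n \<in> sets \<Omega>" "!!n. B n \<subseteq> A" "!!n. prob (B n) \<le> t"
  "!!n. B n \<subseteq> B (Suc n)" "!!n E. ?adm (B n) E ==> prob E \<le> 2 * (prob (B (Suc n)) - prob (B n))" by metis
 let ?B = "\<Union>n. B n"
 have lim: "(\<lambda>n. prob (B n)) \<longlonglongrightarrow> prob ?B"
  by (rule finite_Lim_measure_incseq) (use B(1,4) in \<open>auto intro: incseq_SucI\<close>)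
 have meas: "?B \<in> sets \<Omega>" using B(1) by auto
 have sub: "?B \<subseteq> A" using B(2) by blast
 have le: "prob ?B \<le> t" by (rule LIMSEQ_le_const2[OF lim]) (use B(3) in blast)
 have "prob ?B = t"
 proof (rule ccontr)
  assume "prob ?B \<noteq> t"
  then have less: "prob ?B < t" using le by simp
  have "prob (A - ?B) = prob A - prob ?B" by (rule finite_measure_Diff[OF A meas sub])
  then have "0 < prob (A - ?B)" using less t by simp
  from atomless_small_subset[OF \<Omega> _ this, of "t - prob ?B"] A meas less
  obtain E where E: "E \<in> sets \<Omega>" "E \<subseteq> A - ?B" "0 < prob E" "prob E \<le> t - prob ?B" by auto
  have "prob E \<le> 2 * (prob (B (Suc n)) - prob (B n))" for n
  proof (rule B(5))
   have "prob (B n) \<le> prob ?B" by (rule finite_measure_mono) (use meas in auto)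
   then show "?adm (B n) E" using E by auto
  qed
  moreover have "(\<lambda>n. 2 * (prob (B (Suc n)) - prob (B n))) \<longlonglongrightarrow> 2 * (prob ?B - prob ?B)"
   by (intro tendsto_intros lim LIMSEQ_Suc[OF lim])
  ultimately have "prob E \<le> 2 * (prob ?B - prob ?B)" by (intro LIMSEQ_le_const) blast+
  then show False using E(3) by simp
 qed
 then show ?thesis using meas sub by blast
qed

lemma atomless_partition:
 assumes \<Omega>: "atomless_prob_space \<Omega>" and V: "finite V" "V \<noteq> {}"
 shows "A \<in> sets \<Omega> ==> (!!y. y \<in> V ==> 0 \<le> c y) ==> sum c V = measure \<Omega> A ==>
  \<exists>Y. \<forall>y. {\<omega> \<in> A. Y \<omega> = y} \<in> sets \<Omega> \<and> (if y \<in> V then measure \<Omega> {\<omega> \<in> A. Y \<omega> = y} = c y else {\<omega> \<in> A. Y \<omega> = y} = {})"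
 using V
proof (induction V arbitrary: A rule: finite_ne_induct)
 case (singleton v)
 then have "{\<omega> \<in> A. v = y} = (if y = v then A else {})" for y by auto
 then show ?case using singleton by (intro exI[of _ "\<lambda>_. v"]) auto
next
 case (insert v V)
 interpret prob_space \<Omega> using \<Omega> by (simp add: atomless_prob_space_def)
 have "c v \<le> sum c (insert v V)" using insert by (intro member_le_sum) auto
 then obtain B where B: "B \<in> sets \<Omega>" "B \<subseteq> A" "prob B = c v"
  using atomless_subset_of_measure[OF \<Omega> insert.prems(1), of "c v"] insert by auto
 have "sum c V = prob (A - B)"
  using insert finite_measure_Diff[OF insert.prems(1) B(1,2)] B(3) by simp
 with insert.IH[of "A - B"] insert.prems B obtain Y where
  Y: "!!y. {\<omega> \<in> A - B. Y \<omega> = y} \<in> sets \<Omega>"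
   "!!y. if y \<in> V then prob {\<omega> \<in> A - B. Y \<omega> = y} = c y else {\<omega> \<in> A - B. Y \<omega> = y} = {}" by auto
 let ?Y = "\<lambda>\<omega>. if \<omega> \<in> B then v else Y \<omega>"
 have eq: "{\<omega> \<in> A. ?Y \<omega> = y} = (if y = v then B else {\<omega> \<in> A - B. Y \<omega> = y})" for y
 proof -
  have "{\<omega> \<in> A - B. Y \<omega> = v} = {}" using Y(2)[of v] insert.hyps by simp
  then show ?thesis using B(2) by auto
 qed
 show ?case
 proof (intro exI[of _ ?Y] allI)
  fix y
  show "{\<omega> \<in> A. ?Y \<omega> = y} \<in> sets \<Omega> \<and>
   (if y \<in> insert v V then prob {\<omega> \<in> A. ?Y \<omega> = y} = c y else {\<omega> \<in> A. ?Y \<omega> = y} = {})"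
   unfolding eq using Y(1)[of y] Y(2)[of y] B by (simp split: if_splits)
 qed
qed

text \<open>Over an atomless space every finitely supported transition kernel is realized by a new simple
 random variable.\<close>

lemma kernel_realization:
 assumes \<Omega>: "atomless_prob_space \<Omega>" and Z: "simple_function \<Omega> Z"
  and K: "!!z. z \<in> Z ` space \<Omega> ==> finite (set_pmf (K z))"
 shows "\<exists>Y. simple_function \<Omega> Y \<and> (\<forall>\<omega>\<in>space \<Omega>. Y \<omega> \<in> set_pmf (K (Z \<omega>))) \<and>
  (\<forall>z\<in>Z ` space \<Omega>. \<forall>y. measure \<Omega> {\<omega> \<in> space \<Omega>. Z \<omega> = z \<and> Y \<omega> = y}
   = measure \<Omega> {\<omega> \<in> space \<Omega>. Z \<omega> = z} * pmf (K z) y)"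
proof -
 interpret prob_space \<Omega> using \<Omega> by (simp add: atomless_prob_space_def)
 let ?A = "\<lambda>z. {\<omega> \<in> space \<Omega>. Z \<omega> = z}"
 have A: "?A z \<in> sets \<Omega>" for z by (rule simple_sets[OF Z])
 have "\<forall>z\<in>Z ` space \<Omega>. \<exists>Y. \<forall>y. {\<omega> \<in> ?A z. Y \<omega> = y} \<in> sets \<Omega> \<and> (if y \<in> set_pmf (K z)
  then prob {\<omega> \<in> ?A z. Y \<omega> = y} = prob (?A z) * pmf (K z) y else {\<omega> \<in> ?A z. Y \<omega> = y} = {})"
 proof
  fix z assume z: "z \<in> Z ` space \<Omega>"
  show "\<exists>Y. \<forall>y. {\<omega> \<in> ?A z. Y \<omega> = y} \<in> sets \<Omega> \<and> (if y \<in> set_pmf (K z)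
   then prob {\<omega> \<in> ?A z. Y \<omega> = y} = prob (?A z) * pmf (K z) y else {\<omega> \<in> ?A z. Y \<omega> = y} = {})"
  proof (rule atomless_partition[OF \<Omega> K[OF z] set_pmf_not_empty A])
   show "(\<Sum>y\<in>set_pmf (K z). prob (?A z) * pmf (K z) y) = prob (?A z)"
    using sum_pmf_eq_1[OF K[OF z] order.refl] by (simp flip: sum_distrib_left)
  qed simp
 qed
 from bchoice[OF this] obtain Y where Y: "\<forall>z\<in>Z ` space \<Omega>. \<forall>y. {\<omega> \<in> ?A z. Y z \<omega> = y} \<in> sets \<Omega> \<and>
  (if y \<in> set_pmf (K z) then prob {\<omega> \<in> ?A z. Y z \<omega> = y} = prob (?A z) * pmf (K z) y
   else {\<omega> \<in> ?A z. Y z \<omega> = y} = {})" by (elim exE)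
 note Y' = spec[OF bspec[OF Y]]
 have Y1: "{\<omega> \<in> ?A z. Y z \<omega> = y} \<in> sets \<Omega>" if "z \<in> Z ` space \<Omega>" for z y
  by (rule conjunct1[OF Y'[OF that]])
 have Y2: "prob {\<omega> \<in> ?A z. Y z \<omega> = y} = prob (?A z) * pmf (K z) y" if "z \<in> Z ` space \<Omega>" for z y
 proof (cases "y \<in> set_pmf (K z)")
  case True
  then show ?thesis using conjunct2[OF Y'[OF that]] by (simp only: if_True)
 next
  case False
  then have "{\<omega> \<in> ?A z. Y z \<omega> = y} = {}" "pmf (K z) y = 0"
   using conjunct2[OF Y'[OF that, of y]] by (simp_all only: if_False set_pmf_iff simp_thms)
  then show ?thesis by (simp only: measure_empty mult_zero_right)
 qed
 let ?Y = "\<lambda>\<omega>. Y (Z \<omega>) \<omega>"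
 have mem: "?Y \<omega> \<in> set_pmf (K (Z \<omega>))" if "\<omega> \<in> space \<Omega>" for \<omega>
 proof (rule ccontr)
  assume "?Y \<omega> \<notin> set_pmf (K (Z \<omega>))"
  then have "{\<omega>' \<in> ?A (Z \<omega>). Y (Z \<omega>) \<omega>' = ?Y \<omega>} = {}"
   using conjunct2[OF Y'[OF imageI[OF that], of "?Y \<omega>"]] by (simp only: if_False)
  then show False using that by blast
 qed
 have fin: "finite (Z ` space \<Omega>)" using Z by (simp add: simple_function_def)
 have "simple_function \<Omega> ?Y"
  unfolding simple_function_def
 proof (intro conjI ballI)
  have "?Y ` space \<Omega> \<subseteq> (\<Union>z\<in>Z ` space \<Omega>. set_pmf (K z))" using mem by blast
  moreover have "finite (\<Union>z\<in>Z ` space \<Omega>. set_pmf (K z))" using fin K by (rule finite_UN_I)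
  ultimately show "finite (?Y ` space \<Omega>)" by (rule finite_subset)
 next
  fix y
  have "?Y -` {y} \<inter> space \<Omega> = (\<Union>z\<in>Z ` space \<Omega>. {\<omega> \<in> ?A z. Y z \<omega> = y})" by auto
  moreover have "(\<Union>z\<in>Z ` space \<Omega>. {\<omega> \<in> ?A z. Y z \<omega> = y}) \<in> sets \<Omega>" by (rule sets.finite_UN[OF fin Y1])
  ultimately show "?Y -` {y} \<inter> space \<Omega> \<in> sets \<Omega>" by simp
 qed
 moreover have "prob {\<omega> \<in> space \<Omega>. Z \<omega> = z \<and> ?Y \<omega> = y} = prob (?A z) * pmf (K z) y"
  if "z \<in> Z ` space \<Omega>" for z y
 proof -
  have "{\<omega> \<in> space \<Omega>. Z \<omega> = z \<and> ?Y \<omega> = y} = {\<omega> \<in> ?A z. Y z \<omega> = y}" by auto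
  then show ?thesis using Y2[OF that] by simp
 qed
 ultimately show ?thesis using mem by (intro exI[of _ ?Y]) blast
qed

text \<open>Expectations of functions of the pair, computed through the kernel.\<close>

text \<open>The law of the pair \<open>(Z, Y)\<close> is determined by the kernel, so events about it are computed as in a
two-stage experiment.\<close>

lemma kernel_prob:
 assumes \<Omega>: "prob_space \<Omega>" and Z: "simple_function \<Omega> Z" and Y: "simple_function \<Omega> Y"
  and mem: "!!\<omega>. \<omega> \<in> space \<Omega> ==> Y \<omega> \<in> set_pmf (K (Z \<omega>))"
  and K: "!!z. z \<in> Z ` space \<Omega> ==> finite (set_pmf (K z))"
  and eq: "!!z y. z \<in> Z ` space \<Omega> ==> measure \<Omega> {\<omega> \<in> space \<Omega>. Z \<omega> = z \<and> Y \<omega> = y}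
   = measure \<Omega> {\<omega> \<in> space \<Omega>. Z \<omega> = z} * pmf (K z) y"
 shows "measure \<Omega> {\<omega> \<in> space \<Omega>. Q (Z \<omega>) (Y \<omega>)}
  = (\<Sum>z\<in>Z ` space \<Omega>. measure \<Omega> {\<omega> \<in> space \<Omega>. Z \<omega> = z} * measure_pmf.prob (K z) {y. Q z y})"
proof -
 interpret prob_space \<Omega> by (rule \<Omega>)
 have fin: "finite (Z ` space \<Omega>)" using Z by (simp add: simple_function_def)
 let ?S = "\<lambda>z. {y \<in> set_pmf (K z). Q z y}"
 have m: "{\<omega> \<in> space \<Omega>. Z \<omega> = z \<and> Y \<omega> = y} \<in> sets \<Omega>" for z y
 proof -
  have "{\<omega> \<in> space \<Omega>. Z \<omega> = z \<and> Y \<omega> = y} = {\<omega> \<in> space \<Omega>. Z \<omega> = z} \<inter> {\<omega> \<in> space \<Omega>. Y \<omega> = y}" by auto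
  then show ?thesis using simple_sets[OF Z] simple_sets[OF Y] by simp
 qed
 have "{\<omega> \<in> space \<Omega>. Q (Z \<omega>) (Y \<omega>)}
   = (\<Union>(z, y)\<in>(SIGMA z:Z ` space \<Omega>. ?S z). {\<omega> \<in> space \<Omega>. Z \<omega> = z \<and> Y \<omega> = y})"
  using mem by auto
 also have "prob \<dots> = (\<Sum>(z, y)\<in>(SIGMA z:Z ` space \<Omega>. ?S z). prob {\<omega> \<in> space \<Omega>. Z \<omega> = z \<and> Y \<omega> = y})"
  unfolding split_def
  by (rule finite_measure_finite_Union)
   (use fin K m in \<open>auto simp: disjoint_family_on_def intro!: finite_SigmaI\<close>)
 also have "\<dots> = (\<Sum>z\<in>Z ` space \<Omega>. \<Sum>y\<in>?S z. prob {\<omega> \<in> space \<Omega>. Z \<omega> = z \<and> Y \<omega> = y})"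
  by (rule sum.Sigma[symmetric]) (use fin K in auto)
 also have "\<dots> = (\<Sum>z\<in>Z ` space \<Omega>. prob {\<omega> \<in> space \<Omega>. Z \<omega> = z} * measure_pmf.prob (K z) {y. Q z y})"
 proof (rule sum.cong[OF refl])
  fix z assume z: "z \<in> Z ` space \<Omega>"
  have "measure_pmf.prob (K z) {y. Q z y} = measure_pmf.prob (K z) (?S z)"
   by (rule measure_pmf.finite_measure_eq_AE) (simp_all add: AE_measure_pmf_iff)
  also have "\<dots> = (\<Sum>y\<in>?S z. pmf (K z) y)" by (rule measure_measure_pmf_finite) (use K[OF z] in simp)
  finally show "(\<Sum>y\<in>?S z. prob {\<omega> \<in> space \<Omega>. Z \<omega> = z \<and> Y \<omega> = y})
    = prob {\<omega> \<in> space \<Omega>. Z \<omega> = z} * measure_pmf.prob (K z) {y. Q z y}"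
   by (simp add: eq[OF z] sum_distrib_left)
 qed
 finally show ?thesis .
qed

text \<open>If a simple random variable \<open>Y0\<close> and a law \<open>w\<close> nearly agree on the finitely many events that a
 pattern \<open>pat\<close> distinguishes, then \<open>Y0\<close> can be resampled from \<open>w\<close> conditioned on the pattern of
 \<open>Y0\<close>: this leaves the pattern unchanged at each point, and the new law is nearly below \<open>w\<close>.\<close>

lemma pattern_coupling:
 assumes \<Omega>: "atomless_prob_space \<Omega>" and Y0: "simple_function \<Omega> Y0" and w: "finite (set_pmf w)"
  and P: "finite P" "!!y. pat y \<in> P" and "0 \<le> \<delta>"
  and near: "!!S. S \<in> P ==>
   measure \<Omega> {\<omega> \<in> space \<Omega>. pat (Y0 \<omega>) = S} \<le> measure_pmf.prob w {y. pat y = S} + \<delta>"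
 shows "\<exists>Y. simple_function \<Omega> Y \<and>
  (\<forall>\<omega>\<in>space \<Omega>. pat (Y \<omega>) = pat (Y0 \<omega>) \<and> (Y \<omega> = Y0 \<omega> \<or> Y \<omega> \<in> set_pmf w)) \<and>
  (\<forall>f. (\<forall>y\<in>Y0 ` space \<Omega> \<union> set_pmf w. 0 \<le> f y \<and> f y \<le> 1) -->
   (\<Sum>y\<in>Y ` space \<Omega>. measure \<Omega> {\<omega> \<in> space \<Omega>. Y \<omega> = y} * f y)
    \<le> measure_pmf.expectation w f + \<delta> * card P)"
proof -
 interpret prob_space \<Omega> using \<Omega> by (simp add: atomless_prob_space_def)
 let ?W = "\<lambda>S. {y. pat y = S}"
 define K where "K y = (if set_pmf w \<inter> ?W (pat y) = {} then return_pmf y else cond_pmf w (?W (pat y)))" for y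
 have K: "finite (set_pmf (K y))" "y' \<in> set_pmf (K y) ==> pat y' = pat y \<and> (y' = y \<or> y' \<in> set_pmf w)" for y y'
  using w by (auto simp: K_def set_cond_pmf split: if_splits)
 obtain Y where Y: "simple_function \<Omega> Y" "!!\<omega>. \<omega> \<in> space \<Omega> ==> Y \<omega> \<in> set_pmf (K (Y0 \<omega>))"
  "!!z y. z \<in> Y0 ` space \<Omega> ==> prob {\<omega> \<in> space \<Omega>. Y0 \<omega> = z \<and> Y \<omega> = y}
   = prob {\<omega> \<in> space \<Omega>. Y0 \<omega> = z} * pmf (K z) y"
  using kernel_realization[OF \<Omega> Y0 K(1)] by meson
 have fin: "finite (Y ` space \<Omega>)" "finite (Y0 ` space \<Omega>)" using Y(1) Y0 by (simp_all add: simple_function_def)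
 let ?P0 = "\<lambda>z. prob {\<omega> \<in> space \<Omega>. Y0 \<omega> = z}"
 have "(\<Sum>y\<in>Y ` space \<Omega>. prob {\<omega> \<in> space \<Omega>. Y \<omega> = y} * f y) \<le> measure_pmf.expectation w f + \<delta> * card P"
  if f: "!!y. y \<in> Y0 ` space \<Omega> \<union> set_pmf w ==> 0 \<le> f y \<and> f y \<le> 1" for f
 proof -
  define Q where "Q S = (if set_pmf w \<inter> ?W S = {} then 1 else measure_pmf.expectation (cond_pmf w (?W S)) f)" for S
  have fin_cond: "finite (set_pmf (cond_pmf w (?W S)))" "set_pmf (cond_pmf w (?W S)) \<subseteq> set_pmf w"
   if "set_pmf w \<inter> ?W S \<noteq> {}" for S
   using w that by (auto simp: set_cond_pmf)
  have Q01: "0 \<le> Q S \<and> Q S \<le> 1" for S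
  proof (cases "set_pmf w \<inter> ?W S = {}")
   case False
   note fc = fin_cond[OF False]
   have "measure_pmf.expectation (cond_pmf w (?W S)) (\<lambda>_. 0)
     \<le> measure_pmf.expectation (cond_pmf w (?W S)) f + 0"
    by (rule expectation_le[OF fc(1)]) (use f fc(2) in auto)
   moreover have "measure_pmf.expectation (cond_pmf w (?W S)) f
     \<le> measure_pmf.expectation (cond_pmf w (?W S)) (\<lambda>_. 0) + 1"
    by (rule expectation_le[OF fc(1)]) (use f fc(2) in auto)
   ultimately show ?thesis using False by (simp add: Q_def)
  qed (simp add: Q_def)
  have EK: "measure_pmf.expectation (K z) f \<le> Q (pat z)" if "z \<in> Y0 ` space \<Omega>" for z
   using f that by (simp add: K_def Q_def)
  have PY: "prob {\<omega> \<in> space \<Omega>. Y \<omega> = y} = (\<Sum>z\<in>Y0 ` space \<Omega>. ?P0 z * pmf (K z) y)" for y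
   using kernel_prob[OF prob_space_axioms Y0 Y(1,2) K(1) Y(3), of "\<lambda>_ y'. y' = y"]
   by (simp add: pmf.rep_eq)
  have Pcomb: "(\<Sum>z\<in>Y0 ` space \<Omega>. ?P0 z * G (pat z))
    = (\<Sum>S\<in>P. prob {\<omega> \<in> space \<Omega>. pat (Y0 \<omega>) = S} * G S)" for G :: "_ => real"
  proof -
   have "(\<Sum>S\<in>P. prob {\<omega> \<in> space \<Omega>. pat (Y0 \<omega>) = S} * G S)
     = (\<Sum>S\<in>P. \<Sum>z\<in>Y0 ` space \<Omega>. ?P0 z * of_bool (pat z = S) * G S)"
    unfolding prob_simple[OF Y0, of "\<lambda>z. pat z = _"] by (simp add: sum_distrib_right)
   also have "\<dots> = (\<Sum>z\<in>Y0 ` space \<Omega>. \<Sum>S\<in>P. ?P0 z * of_bool (pat z = S) * G S)" by (rule sum.swap)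
   also have "\<dots> = (\<Sum>z\<in>Y0 ` space \<Omega>. ?P0 z * G (pat z))"
   proof (rule sum.cong[OF refl])
    fix z
    have "(\<Sum>S\<in>P. ?P0 z * of_bool (pat z = S) * G S) = (\<Sum>S\<in>P. if pat z = S then ?P0 z * G S else 0)"
     by (rule sum.cong) auto
    then show "(\<Sum>S\<in>P. ?P0 z * of_bool (pat z = S) * G S) = ?P0 z * G (pat z)"
     using P by simp
   qed
   finally show ?thesis by simp
  qed
  have "(\<Sum>y\<in>Y ` space \<Omega>. prob {\<omega> \<in> space \<Omega>. Y \<omega> = y} * f y)
    = (\<Sum>y\<in>Y ` space \<Omega>. \<Sum>z\<in>Y0 ` space \<Omega>. ?P0 z * (pmf (K z) y * f y))"
   unfolding PY by (simp add: sum_distrib_right mult.assoc)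
  also have "\<dots> = (\<Sum>z\<in>Y0 ` space \<Omega>. ?P0 z * (\<Sum>y\<in>Y ` space \<Omega>. pmf (K z) y * f y))"
   by (subst sum.swap) (simp add: sum_distrib_left)
  also have "\<dots> \<le> (\<Sum>z\<in>Y0 ` space \<Omega>. ?P0 z * Q (pat z))"
  proof (intro sum_mono mult_left_mono measure_nonneg)
   fix z assume z: "z \<in> Y0 ` space \<Omega>"
   have "(\<Sum>y\<in>Y ` space \<Omega>. pmf (K z) y * f y) = (\<Sum>y\<in>Y ` space \<Omega> \<inter> set_pmf (K z). pmf (K z) y * f y)"
    by (rule sum.mono_neutral_right[OF fin(1)]) (auto simp: set_pmf_iff)
   also have "\<dots> \<le> (\<Sum>y\<in>set_pmf (K z). pmf (K z) y * f y)"
   proof (rule sum_mono2[OF K(1)])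
    fix y assume "y \<in> set_pmf (K z) - Y ` space \<Omega> \<inter> set_pmf (K z)"
    then have "y \<in> Y0 ` space \<Omega> \<union> set_pmf w" using K(2)[of y z] z by blast
    then show "0 \<le> pmf (K z) y * f y" using f by simp
   qed simp
   also have "\<dots> = measure_pmf.expectation (K z) f" by (rule expectation_finite[OF K(1), symmetric])
   also have "\<dots> \<le> Q (pat z)" by (rule EK[OF z])
   finally show "(\<Sum>y\<in>Y ` space \<Omega>. pmf (K z) y * f y) \<le> Q (pat z)" .
  qed
  also have "\<dots> = (\<Sum>S\<in>P. prob {\<omega> \<in> space \<Omega>. pat (Y0 \<omega>) = S} * Q S)" by (rule Pcomb)
  also have "\<dots> \<le> (\<Sum>S\<in>P. measure_pmf.expectation w (\<lambda>y. of_bool (pat y = S) * f y) + \<delta>)"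
  proof (rule sum_mono)
   fix S assume S: "S \<in> P"
   have "prob {\<omega> \<in> space \<Omega>. pat (Y0 \<omega>) = S} * Q S \<le> (measure_pmf.prob w (?W S) + \<delta>) * Q S"
    by (rule mult_right_mono[OF near[OF S]]) (use Q01 in simp)
   also have "\<dots> \<le> measure_pmf.prob w (?W S) * Q S + \<delta>"
    using mult_left_mono[of "Q S" 1 \<delta>] Q01[of S] \<open>0 \<le> \<delta>\<close> by (simp add: distrib_right)
   also have "measure_pmf.prob w (?W S) * Q S = measure_pmf.expectation w (\<lambda>y. of_bool (pat y = S) * f y)"
   proof (cases "set_pmf w \<inter> ?W S = {}")
    case True
    have "measure_pmf.prob w (?W S) = 0" using True by (simp add: measure_pmf_zero_iff)
    moreover have "measure_pmf.expectation w (\<lambda>y. of_bool (pat y = S) * f y) = 0"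
     unfolding expectation_finite[OF w] using True by (intro sum.neutral) auto
    ultimately show ?thesis by simp
   next
    case False
    have pos: "measure_pmf.prob w (?W S) \<noteq> 0" using False by (simp add: measure_pmf_zero_iff)
    have "measure_pmf.prob w (?W S) * Q S
      = (\<Sum>y\<in>set_pmf w \<inter> ?W S. measure_pmf.prob w (?W S) * (pmf (cond_pmf w (?W S)) y * f y))"
     using False by (simp add: Q_def expectation_finite[OF fin_cond(1)[OF False]] set_cond_pmf[OF False] sum_distrib_left)
    also have "\<dots> = (\<Sum>y\<in>set_pmf w \<inter> ?W S. pmf w y * f y)"
     by (rule sum.cong) (use pos in \<open>auto simp: pmf_cond[OF False]\<close>)
    also have "\<dots> = (\<Sum>y\<in>set_pmf w. pmf w y * (of_bool (pat y = S) * f y))"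
     by (rule sum.mono_neutral_cong_left[OF w]) auto
    finally show ?thesis by (simp add: expectation_finite[OF w])
   qed
   finally show "prob {\<omega> \<in> space \<Omega>. pat (Y0 \<omega>) = S} * Q S
     \<le> measure_pmf.expectation w (\<lambda>y. of_bool (pat y = S) * f y) + \<delta>" by simp
  qed
  also have "\<dots> = (\<Sum>S\<in>P. \<Sum>y\<in>set_pmf w. pmf w y * (of_bool (pat y = S) * f y)) + \<delta> * card P"
   by (simp add: sum.distrib expectation_finite[OF w] mult.commute)
  also have "(\<Sum>S\<in>P. \<Sum>y\<in>set_pmf w. pmf w y * (of_bool (pat y = S) * f y))
    = (\<Sum>y\<in>set_pmf w. \<Sum>S\<in>P. pmf w y * (of_bool (pat y = S) * f y))" by (rule sum.swap)
  also have "\<dots> = (\<Sum>y\<in>set_pmf w. pmf w y * f y)"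
  proof (rule sum.cong[OF refl])
   fix y
   have "(\<Sum>S\<in>P. pmf w y * (of_bool (pat y = S) * f y)) = (\<Sum>S\<in>P. if pat y = S then pmf w y * f y else 0)"
    by (rule sum.cong) auto
   then show "(\<Sum>S\<in>P. pmf w y * (of_bool (pat y = S) * f y)) = pmf w y * f y" using P by simp
  qed
  finally show ?thesis by (simp add: expectation_finite[OF w])
 qed
 moreover have "pat (Y \<omega>) = pat (Y0 \<omega>) \<and> (Y \<omega> = Y0 \<omega> \<or> Y \<omega> \<in> set_pmf w)" if "\<omega> \<in> space \<Omega>" for \<omega>
  by (rule K(2)[OF Y(2)[OF that]])
 ultimately show ?thesis using Y(1) by (intro exI[of _ Y]) blast
qed

section \<open>Laws of finite Morley sequences\<close>

lemma concat_tuples: "set xs \<subseteq> tuples m S ==> concat xs \<in> tuples (length xs * m) S"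
 by (induction xs) (auto simp: tuples_def)

text \<open>A finite Morley sequence, the most recent tuple first, so that it grows by \<open>Cons\<close>.\<close>

primrec morley_list :: "('f, 'r) lang => ('c, 'f, 'r) cstruct => 'c set => nat
  => (('f, 'r) cform => 'c list => real) => 'c list list => bool" where
 "morley_list L C A m p [] \<longleftrightarrow> True"
| "morley_list L C A m p (a # as) \<longleftrightarrow>
   crealizes L C (A \<union> set (concat as)) m p a \<and> morley_list L C A m p as"

lemma morley_list_tuples: "morley_list L C A m p as ==> set as \<subseteq> tuples m (cuniv C)"
 by (induction as) (auto simp: crealizes_def)

lemma cval_CProb:
 assumes "length xs = n"
 shows "cval C (CProb \<phi> [0..<n]) xs = cprob C \<phi> xs"
 using map_nth[of xs] assms by simp

context random_model
begin

lemma \<iota>_tuples: "fs \<in> tuples n (SR (univ U)) ==> map \<iota> fs \<in> tuples n (cuniv C)"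
 unfolding tuples_def using \<iota>_C by auto

lemma cst_tuples: "e \<in> tuples n B ==> cst e \<in> tuples n (SR B)"
 using set_cst[of e B] by (simp add: tuples_def)

lemma cprob_cst:
 assumes "fm L (length e) \<theta>" "set e \<subseteq> univ U"
 shows "cprob C \<theta> (map \<iota> (cst e)) = of_bool (holds U \<theta> e)"
proof -
 have "cst e \<in> tuples (length e) (SR (univ U))" by (rule cst_tuples) (use assms(2) in \<open>simp add: tuples_def\<close>)
 from prob_\<iota>[OF assms(1) this] have "cprob C \<theta> (map \<iota> (cst e)) = \<Omega>.prob {\<omega> \<in> space \<Omega>. holds U \<theta> e}"
  by (simp add: prob_of_def comp_def)
 then show ?thesis by (simp add: \<Omega>.prob_space)
qed

text \<open>The tuples \<open>as\<close> live in the monster model of the randomization, where \<open>f\<close> cannot be evaluated.  The law is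
built from the oldest tuple on: given the law of the older ones, the distribution of \<open>a\<close> over them is \<open>\<mu>\<close>
by the description of \<open>r_\<mu>\<close>, and each fibre of \<open>\<mu>\<close> is replaced by a finite sample for which the mean of
\<open>f\<close> does not exceed the lower integral by much.  The induction needs the law of the older tuples only
for the formulas that approximate \<open>\<mu>\<close>, whose parameters \<open>c\<close> lie in \<open>M\<close>.\<close>

lemma law_of_morley_list:
 assumes \<mu>: "keisler L U m \<mu>" "definable_measure L U M m \<mu>" and p: "is_r L U M m \<mu> \<Omega> C \<iota> p"
  and f: "!!x. x \<in> X m ==> 0 \<le> f x"
  and B: "!!h. step (X m) (\<D> m) h ==> (!!x. x \<in> X m ==> h x \<le> f x) ==> sint (X m) \<mu> h \<le> B"
  and A: "\<iota> ` SR M \<subseteq> A"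
 shows "morley_list L C A m p as ==> set e \<subseteq> univ U ==> set (map \<iota> (cst e)) \<subseteq> A ==> finite \<Theta> ==>
  (!!\<theta>. \<theta> \<in> \<Theta> ==> fm L (length as * m + length e) \<theta>) ==> 0 < \<delta> ==>
  \<exists>w. finite (set_pmf w) \<and> (\<forall>xs\<in>set_pmf w. length xs = length as \<and> set xs \<subseteq> X m) \<and>
   (\<forall>\<theta>\<in>\<Theta>. \<bar>measure_pmf.prob w {xs. holds U \<theta> (concat xs @ e)}
    - cprob C \<theta> (concat as @ map \<iota> (cst e))\<bar> \<le> \<delta>) \<and>
   (\<forall>i<length as. measure_pmf.expectation w (\<lambda>xs. f (xs ! i)) \<le> B + \<delta>)"
proof (induction as arbitrary: e \<Theta> \<delta>)
 case Nil
 have "cprob C \<theta> (map \<iota> (cst e)) = of_bool (holds U \<theta> e)" if "\<theta> \<in> \<Theta>" for \<theta>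
  by (rule cprob_cst[OF _ Nil.prems(2)]) (use Nil.prems(5)[OF that] in simp)
 then show ?case using Nil.prems(6)
  by (intro exI[of _ "return_pmf []"]) (simp add: indicator_def)
next
 case (Cons a as)
 note prems = Cons.prems
 interpret \<mu>: charge "X m" "\<D> m" \<mu> by (rule keisler_charge_univ[OF \<mu>(1)])
 define k where "k = length as * m + length e"
 have a: "crealizes L C (A \<union> set (concat as)) m p a" and as: "morley_list L C A m p as"
  using prems(1) by simp_all
 have \<Theta>: "fm L (m + k) \<theta>" if "\<theta> \<in> \<Theta>" for \<theta> using prems(5)[OF that] by (simp add: k_def add.assoc)
 have eps: "0 < \<delta> / 4" using prems(6) by simp
 obtain c R \<eta> where
  ca: "set c \<subseteq> M \<and> (\<forall>\<theta>\<in>\<Theta>. finite (R \<theta>) \<and> (\<forall>r\<in>R \<theta>. fm L (k + length c) (\<eta> \<theta> r)) \<and>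
   (\<forall>b\<in>X k. \<bar>\<mu> (defset U m \<theta> b) - (\<Sum>r\<in>R \<theta>. r * of_bool (holds U (\<eta> \<theta> r) (b @ c)))\<bar> \<le> \<delta> / 4))"
  by (atomize_elim, rule definable_approx[OF \<mu>(2) prems(4) \<Theta> eps])
 have c: "set c \<subseteq> M" by (rule conjunct1[OF ca])
 note ca' = bspec[OF conjunct2[OF ca]]
 have R: "finite (R \<theta>)" if "\<theta> \<in> \<Theta>" for \<theta> by (rule conjunct1[OF ca'[OF that]])
 have \<eta>: "fm L (k + length c) (\<eta> \<theta> r)" if "\<theta> \<in> \<Theta>" "r \<in> R \<theta>" for \<theta> r
  by (rule bspec[OF conjunct1[OF conjunct2[OF ca'[OF that(1)]]] that(2)])
 have near: "\<bar>\<mu> (defset U m \<theta> b) - (\<Sum>r\<in>R \<theta>. r * of_bool (holds U (\<eta> \<theta> r) (b @ c)))\<bar> \<le> \<delta> / 4"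
  if "\<theta> \<in> \<Theta>" "b \<in> X k" for \<theta> b
  by (rule bspec[OF conjunct2[OF conjunct2[OF ca'[OF that(1)]]] that(2)])
 define S where "S = (\<Sum>\<theta>\<in>\<Theta>. \<Sum>r\<in>R \<theta>. \<bar>r\<bar>)"
 have S: "0 \<le> S" "\<theta> \<in> \<Theta> ==> (\<Sum>r\<in>R \<theta>. \<bar>r\<bar>) \<le> S" for \<theta>
  unfolding S_def by (auto intro!: sum_nonneg member_le_sum[OF _ _ prems(4)])
 define \<delta>' where "\<delta>' = min \<delta> (\<delta> / (4 * (1 + S)))"
 have \<delta>': "0 < \<delta>'" "\<delta>' \<le> \<delta>" using prems(6) S(1) by (auto simp: \<delta>'_def)
 have \<delta>'S: "S * \<delta>' \<le> \<delta> / 4"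
 proof -
  have "S * \<delta>' \<le> S * (\<delta> / (4 * (1 + S)))" by (rule mult_left_mono[OF _ S(1)]) (simp add: \<delta>'_def)
  also have "\<dots> = \<delta> / 4 * (S / (1 + S))" using S(1) by (simp add: field_simps)
  also have "\<dots> \<le> \<delta> / 4 * 1" by (rule mult_left_mono) (use S(1) prems(6) in \<open>simp_all add: field_simps\<close>)
  finally show ?thesis by simp
 qed
 let ?\<Theta>' = "\<Union>\<theta>\<in>\<Theta>. \<eta> \<theta> ` R \<theta>"
 have ec: "set (e @ c) \<subseteq> univ U" "set (map \<iota> (cst (e @ c))) \<subseteq> A"
 proof -
  show "set (e @ c) \<subseteq> univ U" unfolding set_append by (rule Un_least[OF prems(2) order.trans[OF c M_sub(1)]])
  have "set (map \<iota> (cst c)) \<subseteq> \<iota> ` SR M" unfolding set_map[of \<iota>] by (rule image_mono[OF set_cst[OF c]])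
  then have "set (map \<iota> (cst c)) \<subseteq> A" by (rule order.trans[OF _ A])
  then show "set (map \<iota> (cst (e @ c))) \<subseteq> A" unfolding map_append set_append by (rule Un_least[OF prems(3)])
 qed
 have fin': "finite ?\<Theta>'" by (rule finite_UN_I[OF prems(4)]) (rule finite_imageI[OF R])
 have fm': "fm L (length as * m + length (e @ c)) \<theta>'" if "\<theta>' \<in> ?\<Theta>'" for \<theta>'
 proof -
  from that obtain \<theta> r where "\<theta> \<in> \<Theta>" "r \<in> R \<theta>" "\<theta>' = \<eta> \<theta> r" by (elim UN_E imageE)
  then show ?thesis using \<eta>[of \<theta> r] by (simp add: k_def add.assoc)
 qed
 obtain w where
  w: "finite (set_pmf w) \<and> (\<forall>xs\<in>set_pmf w. length xs = length as \<and> set xs \<subseteq> X m) \<and>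
   (\<forall>\<theta>'\<in>?\<Theta>'. \<bar>measure_pmf.prob w {xs. holds U \<theta>' (concat xs @ e @ c)}
    - cprob C \<theta>' (concat as @ map \<iota> (cst (e @ c)))\<bar> \<le> \<delta>') \<and>
   (\<forall>i<length as. measure_pmf.expectation w (\<lambda>xs. f (xs ! i)) \<le> B + \<delta>')"
  by (atomize_elim, rule Cons.IH[OF as ec fin' fm' \<delta>'(1), unfolded append_assoc])
 note wfin = conjunct1[OF w] and wX = bspec[OF conjunct1[OF conjunct2[OF w]]]
  and wp = bspec[OF conjunct1[OF conjunct2[OF conjunct2[OF w]]]]
  and wf = spec[OF conjunct2[OF conjunct2[OF conjunct2[OF w]]], THEN mp]
 have we: "concat xs @ e \<in> X k" if "xs \<in> set_pmf w" for xs
 proof -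
  have "concat xs \<in> X (length as * m)" using concat_tuples[of xs m "univ U"] wX[OF that] by simp
  then show ?thesis unfolding k_def by (rule tuples_append) (use prems(2) in \<open>simp add: tuples_def\<close>)
 qed
 let ?G = "\<lambda>xs. (\<lambda>\<theta>. defset U m \<theta> (concat xs @ e)) ` \<Theta>"
 have "\<exists>u. \<forall>xs\<in>set_pmf w. finite (set_pmf (u xs)) \<and> set_pmf (u xs) \<subseteq> X m \<and>
  (\<forall>E\<in>?G xs. measure_pmf.prob (u xs) E = \<mu> E) \<and> measure_pmf.expectation (u xs) f \<le> B + \<delta>"
 proof (rule bchoice, rule ballI)
  fix xs assume xs: "xs \<in> set_pmf w"
  show "\<exists>u. finite (set_pmf u) \<and> set_pmf u \<subseteq> X m \<and>
   (\<forall>E\<in>?G xs. measure_pmf.prob u E = \<mu> E) \<and> measure_pmf.expectation u f \<le> B + \<delta>"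
  proof (rule \<mu>.sampling[OF _ _ f prems(6) B])
   show "finite (?G xs)" using prems(4) by simp
   show "?G xs \<subseteq> \<D> m"
   proof (rule image_subsetI, rule definableI)
    show "fm L (m + length (concat xs @ e)) \<theta>" if "\<theta> \<in> \<Theta>" for \<theta>
     using \<Theta>[OF that] tuplesD(1)[OF we[OF xs]] by simp
    show "set (concat xs @ e) \<subseteq> univ U" by (rule tuplesD(2)[OF we[OF xs]])
   qed
  qed
 qed
 then obtain u where u: "\<forall>xs\<in>set_pmf w. finite (set_pmf (u xs)) \<and> set_pmf (u xs) \<subseteq> X m \<and>
  (\<forall>E\<in>?G xs. measure_pmf.prob (u xs) E = \<mu> E) \<and> measure_pmf.expectation (u xs) f \<le> B + \<delta>" by (elim exE)
 have ufin: "finite (set_pmf (u xs))" and uX: "set_pmf (u xs) \<subseteq> X m"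
  and uE: "\<theta> \<in> \<Theta> ==> measure_pmf.prob (u xs) (defset U m \<theta> (concat xs @ e)) = \<mu> (defset U m \<theta> (concat xs @ e))"
  and uf: "measure_pmf.expectation (u xs) f \<le> B + \<delta>" if "xs \<in> set_pmf w" for xs \<theta>
  using bspec[OF u that] by simp_all
 define v where "v = bind_pmf w (\<lambda>xs. map_pmf (\<lambda>x. x # xs) (u xs))"
 have Ev: "measure_pmf.expectation v h = measure_pmf.expectation w (\<lambda>xs. measure_pmf.expectation (u xs) (\<lambda>x. h (x # xs)))"
  for h :: "_ => real" unfolding v_def by (rule expectation_bind_map[OF wfin ufin])
 have vset: "set_pmf v = (\<Union>xs\<in>set_pmf w. (\<lambda>x. x # xs) ` set_pmf (u xs))" by (simp add: v_def)
 have vfin: "finite (set_pmf v)" unfolding vset by (rule finite_UN_I[OF wfin]) (rule finite_imageI[OF ufin])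
 show ?case
 proof (intro exI conjI ballI allI impI)
  show "finite (set_pmf v)" by (rule vfin)
  show "length ys = length (a # as)" "set ys \<subseteq> X m" if "ys \<in> set_pmf v" for ys
  proof -
   from that obtain xs x where x: "xs \<in> set_pmf w" "x \<in> set_pmf (u xs)" "ys = x # xs"
    unfolding vset by (elim UN_E imageE)
   show "length ys = length (a # as)" using wX[OF x(1)] x(3) by simp
   have "x \<in> X m" by (rule subsetD[OF uX[OF x(1)] x(2)])
   then show "set ys \<subseteq> X m" using wX[OF x(1)] x(3) by simp
  qed
 next
  fix i assume i: "i < length (a # as)"
  show "measure_pmf.expectation v (\<lambda>ys. f (ys ! i)) \<le> B + \<delta>"
  proof (cases i)
   case 0
   have "measure_pmf.expectation w (\<lambda>xs. measure_pmf.expectation (u xs) f)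
     \<le> measure_pmf.expectation w (\<lambda>_. 0) + (B + \<delta>)"
    by (rule expectation_le[OF wfin]) (use uf in simp)
   then show ?thesis unfolding Ev using 0 by simp
  next
   case (Suc j)
   then show ?thesis unfolding Ev using wf[of j] i \<delta>'(2) by simp
  qed
 next
  fix \<theta> assume \<theta>: "\<theta> \<in> \<Theta>"
  let ?q = "\<lambda>r. measure_pmf.prob w {xs. holds U (\<eta> \<theta> r) (concat xs @ e @ c)}"
  let ?h = "concat as @ map \<iota> (cst e)"
  let ?c = "\<lambda>r. cprob C (\<eta> \<theta> r) (?h @ map \<iota> (cst c))"
  have "measure_pmf.prob v {ys. holds U \<theta> (concat ys @ e)}
    = measure_pmf.expectation w (\<lambda>xs. measure_pmf.expectation (u xs) (\<lambda>x. of_bool (holds U \<theta> (x @ concat xs @ e))))"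
   unfolding prob_expectation[OF vfin] Ev by simp
  also have "\<dots> = measure_pmf.expectation w (\<lambda>xs. \<mu> (defset U m \<theta> (concat xs @ e)))"
   unfolding expectation_finite[OF wfin]
  proof (rule sum.cong[OF refl])
   fix xs assume xs: "xs \<in> set_pmf w"
   have "measure_pmf.expectation (u xs) (\<lambda>x. of_bool (holds U \<theta> (x @ concat xs @ e)))
     = measure_pmf.prob (u xs) {x. holds U \<theta> (x @ concat xs @ e)}"
    by (rule prob_expectation[OF ufin[OF xs], symmetric])
   also have "\<dots> = measure_pmf.prob (u xs) (defset U m \<theta> (concat xs @ e))"
    by (rule measure_pmf.finite_measure_eq_AE)
     (use subsetD[OF uX[OF xs]] in \<open>simp_all add: AE_measure_pmf_iff defset_def\<close>)
   finally show "pmf w xs * measure_pmf.expectation (u xs) (\<lambda>x. of_bool (holds U \<theta> (x @ concat xs @ e)))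
     = pmf w xs * \<mu> (defset U m \<theta> (concat xs @ e))" by (simp add: uE[OF xs \<theta>])
  qed
  finally have e1: "measure_pmf.prob v {ys. holds U \<theta> (concat ys @ e)}
    = measure_pmf.expectation w (\<lambda>xs. \<mu> (defset U m \<theta> (concat xs @ e)))" .
  have "\<bar>measure_pmf.expectation w (\<lambda>xs. \<mu> (defset U m \<theta> (concat xs @ e)))
   - measure_pmf.expectation w (\<lambda>xs. \<Sum>r\<in>R \<theta>. r * of_bool (holds U (\<eta> \<theta> r) ((concat xs @ e) @ c)))\<bar> \<le> \<delta> / 4"
   by (rule expectation_close[OF wfin]) (rule near[OF \<theta> we])
  moreover have "measure_pmf.expectation w (\<lambda>xs. \<Sum>r\<in>R \<theta>. r * of_bool (holds U (\<eta> \<theta> r) ((concat xs @ e) @ c)))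
    = (\<Sum>r\<in>R \<theta>. r * ?q r)"
   unfolding prob_expectation[OF wfin] expectation_finite[OF wfin]
   by (simp add: sum_distrib_left mult.left_commute, subst sum.swap) simp
  ultimately have e2: "\<bar>measure_pmf.expectation w (\<lambda>xs. \<mu> (defset U m \<theta> (concat xs @ e))) - (\<Sum>r\<in>R \<theta>. r * ?q r)\<bar> \<le> \<delta> / 4"
   by simp
  have "\<bar>(\<Sum>r\<in>R \<theta>. r * ?q r) - (\<Sum>r\<in>R \<theta>. r * ?c r)\<bar> = \<bar>\<Sum>r\<in>R \<theta>. r * (?q r - ?c r)\<bar>"
   by (simp add: sum_subtractf right_diff_distrib)
  also have "\<dots> \<le> (\<Sum>r\<in>R \<theta>. \<bar>r * (?q r - ?c r)\<bar>)" by (rule sum_abs)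
  also have "\<dots> \<le> (\<Sum>r\<in>R \<theta>. \<bar>r\<bar> * \<delta>')"
  proof (rule sum_mono)
   fix r assume r: "r \<in> R \<theta>"
   have "\<eta> \<theta> r \<in> ?\<Theta>'" by (rule UN_I[OF \<theta>]) (rule imageI[OF r])
   from wp[OF this] have "\<bar>?q r - ?c r\<bar> \<le> \<delta>'" by simp
   then show "\<bar>r * (?q r - ?c r)\<bar> \<le> \<bar>r\<bar> * \<delta>'" unfolding abs_mult by (rule mult_left_mono) simp
  qed
  also have "\<dots> = (\<Sum>r\<in>R \<theta>. \<bar>r\<bar>) * \<delta>'" by (simp add: sum_distrib_right)
  also have "\<dots> \<le> S * \<delta>'" by (rule mult_right_mono[OF S(2)[OF \<theta>]]) (use \<delta>' in simp)
  finally have e3: "\<bar>(\<Sum>r\<in>R \<theta>. r * ?q r) - (\<Sum>r\<in>R \<theta>. r * ?c r)\<bar> \<le> \<delta> / 4" using \<delta>'S by linarith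
  have hk: "?h \<in> tuples k (cuniv C)"
   unfolding k_def
  proof (rule tuples_append)
   show "concat as \<in> tuples (length as * m) (cuniv C)" by (rule concat_tuples[OF morley_list_tuples[OF as]])
   show "map \<iota> (cst e) \<in> tuples (length e) (cuniv C)"
    by (intro \<iota>_tuples cst_tuples) (use prems(2) in \<open>simp add: tuples_def\<close>)
  qed
  have e4: "\<bar>type_prob m p \<theta> ?h - (\<Sum>r\<in>R \<theta>. r * ?c r)\<bar> \<le> \<delta> / 4"
   by (rule type_prob_approx[OF p \<Theta>[OF \<theta>] c R[OF \<theta>] \<eta>[OF \<theta>] near[OF \<theta>] hk])
  have "(CProb \<theta> [0..<m + k], ?h) \<in> param_cfms L (A \<union> set (concat as)) m"
   using \<Theta>[OF \<theta>] tuplesD(1)[OF hk] prems(3) unfolding param_cfms_def cfm_def by (auto simp del: set_concat)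
  then have "cval C (CProb \<theta> [0..<m + k]) (a @ ?h) = p (CProb \<theta> [0..<m + k]) ?h"
   using a unfolding crealizes_def by (meson case_prodD)
  moreover have "length (a @ ?h) = m + k" using a tuplesD(1)[OF hk] by (simp add: crealizes_def tuples_def)
  ultimately have e5: "cprob C \<theta> (a @ ?h) = type_prob m p \<theta> ?h"
   using cval_CProb[of "a @ ?h" "m + k" C \<theta>] tuplesD(1)[OF hk] by (simp add: type_prob_def)
  then show "\<bar>measure_pmf.prob v {ys. holds U \<theta> (concat ys @ e)} - cprob C \<theta> (concat (a # as) @ map \<iota> (cst e))\<bar> \<le> \<delta>"
   unfolding concat.simps append_assoc e1 using e2 e3 e4 e5 prems(6) by linarith
 qed
qed

end

section \<open>One step of the construction\<close>

text \<open>The inverse of \<open>concat\<close> on lists of \<open>N\<close> tuples of length \<open>m\<close>.\<close>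

definition blocks :: "nat => nat => 'x list => 'x list list" where
 "blocks m N l = map (\<lambda>j. map (\<lambda>i. l ! (j * m + i)) [0..<m]) [0..<N]"

lemma concat_blocks: "length l = N * m ==> concat (blocks m N l) = l"
proof -
 have "concat (blocks m N l) = map (nth l) [0..<N * m]"
 proof (induction N)
  case (Suc N)
  have "[0..<Suc N * m] = [0..<N * m] @ map (\<lambda>i. i + N * m) [0..<m]"
   unfolding map_add_upt using upt_add_eq_append[of 0 "N * m" m] by (simp add: add.commute)
  moreover have "concat (blocks m (Suc N) l) = concat (blocks m N l) @ map (\<lambda>i. l ! (N * m + i)) [0..<m]"
   by (simp add: blocks_def)
  ultimately show ?case using Suc.IH by (simp add: comp_def add.commute)
 qed (simp add: blocks_def)
 then show "length l = N * m ==> concat (blocks m N l) = l" using map_nth[of l] by simp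
qed

lemma blocks_tuples:
 assumes "l \<in> tuples (N * m) S"
 shows "length (blocks m N l) = N" "set (blocks m N l) \<subseteq> tuples m S"
proof -
 have "l ! (j * m + i) \<in> S" if "j < N" "i < m" for i j
 proof -
  have "j * m + i < Suc j * m" using that by simp
  also have "\<dots> \<le> N * m" using that by (intro mult_le_mono1) simp
  finally have "l ! (j * m + i) \<in> set l" using tuplesD(1)[OF assms] by simp
  then show ?thesis using tuplesD(2)[OF assms] by (rule subsetD[rotated])
 qed
 then show "set (blocks m N l) \<subseteq> tuples m S" by (auto simp: blocks_def tuples_def)
qed (simp add: blocks_def)

lemma nth_concat_block:
 assumes "set xs \<subseteq> tuples m S" "i < length xs" "j < m"
 shows "concat xs ! (i * m + j) = xs ! i ! j"
 using assms
proof (induction xs arbitrary: i)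
 case (Cons x xs)
 have x: "length x = m" "set xs \<subseteq> tuples m S" using Cons.prems(1) by (auto simp: tuples_def)
 show ?case
 proof (cases i)
  case 0
  then show ?thesis using Cons.prems(3) x(1) by (simp add: nth_append)
 next
  case (Suc i')
  have "concat (x # xs) ! (i * m + j) = (x @ concat xs) ! (length x + (i' * m + j))"
   using Suc x(1) by (simp add: add.assoc)
  also have "\<dots> = concat xs ! (i' * m + j)" by (rule nth_append_length_plus)
  also have "\<dots> = xs ! i' ! j" using Cons.IH[OF x(2)] Cons.prems Suc by simp
  finally show ?thesis using Suc by simp
 qed
qed simp

text \<open>The variables of the formulas below are arranged as \<open>(y, x_0, \<dots>, x_(N-1), z)\<close>.\<close>

lemma block_env:
 assumes xs: "set xs \<subseteq> tuples m S" "length xs = N" and y: "length y = k"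
  and E: "!!j. j < k ==> E j = y ! j" "!!t. t < N * m ==> E (k + t) = concat xs ! t"
   "!!j. j < length z ==> E (k + N * m + j) = z ! j"
 shows "i < N ==> map E (map (\<lambda>j. k + (i * m + j)) [0..<m] @ [0..<k] @ map (\<lambda>j. k + N * m + j) [0..<length z])
   = xs ! i @ y @ z"
  and "map E ([0..<k] @ map (\<lambda>j. k + N * m + j) [0..<length z]) = y @ z"
proof -
 have 1: "map E [0..<k] = y" using y by (intro nth_equalityI) (simp_all add: E(1))
 have 2: "map E (map (\<lambda>j. k + N * m + j) [0..<length z]) = z" by (intro nth_equalityI) (simp_all add: E(3))
 show "map E ([0..<k] @ map (\<lambda>j. k + N * m + j) [0..<length z]) = y @ z"
  unfolding map_append 1 2 ..
 assume i: "i < N"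
 have len: "length (xs ! i) = m"
 proof -
  have "xs ! i \<in> set xs" using i xs(2) by simp
  from subsetD[OF xs(1) this] show ?thesis by (rule tuplesD(1))
 qed
 have 3: "map E (map (\<lambda>j. k + (i * m + j)) [0..<m]) = xs ! i"
 proof (rule nth_equalityI)
  fix j assume "j < length (map E (map (\<lambda>j. k + (i * m + j)) [0..<m]))"
  then have j: "j < m" by simp
  have "i * m + j < Suc i * m" using j by simp
  also have "\<dots> \<le> N * m" using i by (intro mult_le_mono1) simp
  finally have "E (k + (i * m + j)) = concat xs ! (i * m + j)" by (rule E(2))
  also have "\<dots> = xs ! i ! j" by (rule nth_concat_block[OF xs(1) _ j]) (simp add: i xs(2))
  finally show "map E (map (\<lambda>j. k + (i * m + j)) [0..<m]) ! j = xs ! i ! j" using j by simp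
 qed (simp add: len)
 show "map E (map (\<lambda>j. k + (i * m + j)) [0..<m] @ [0..<k] @ map (\<lambda>j. k + N * m + j) [0..<length z]) = xs ! i @ y @ z"
  unfolding map_append[of E] 1 2 3 ..
qed

lemma map_nth_suffix: "length xs = k ==> length ys = n ==> map (nth (xs @ ys)) [k..<k + n] = ys"
 using nth_append_length_plus[of xs ys] by (intro nth_equalityI) simp_all

lemma prob_on_support:
 assumes "set_pmf u \<subseteq> X"
 shows "measure_pmf.prob u {b. Q b} = measure_pmf.prob u {b \<in> X. Q b}"
 by (rule measure_pmf.finite_measure_eq_AE) (use subsetD[OF assms] in \<open>simp_all add: AE_measure_pmf_iff\<close>)

context random_model
begin

text \<open>That a suitable \<open>g\<close> exists is, up to a small error, the vanishing of a formula \<open>\<tau>\<close> of the form \<open>Near\<close> at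
the given tuples.  These are first approximated by simple random variables \<open>Y0\<close>.  By quantifier
elimination the value of \<open>\<tau>\<close> there depends only on a finite pattern, so \<open>Y0\<close> may be resampled from the
law of the Morley sequence without changing this value.  For the resampled \<open>Y\<close> a tuple can be written
down: over each value of \<open>Y\<close> it is distributed like a finite sample of \<open>\<nu>\<close>, so the probability of
\<open>\<phi>\<close> is the mean of \<open>f\<close>.\<close>

lemma witness_exists:
 assumes \<mu>: "keisler L U m \<mu>" "definable_measure L U M m \<mu>" and p: "is_r L U M m \<mu> \<Omega> C \<iota> p"
  and \<nu>: "keisler L U k \<nu>" and A: "\<iota> ` SR M \<subseteq> A" and as: "morley_list L C A m p as"
  and \<phi>: "fm L (m + k + length d) \<phi>" and dc: "set (d @ c) \<subseteq> univ U" "set (map \<iota> (cst (d @ c))) \<subseteq> A"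
  and \<theta>s: "!!\<theta>. \<theta> \<in> set \<theta>s ==> fm L (k + length (d @ c)) \<theta>"
  and B: "!!h. step (X m) (\<D> m) h ==> (!!x. x \<in> X m ==> h x \<le> \<nu> {b \<in> X k. holds U \<phi> (x @ b @ d)}) ==>
   sint (X m) \<mu> h \<le> B"
  and eps: "0 < eps"
 shows "\<exists>g\<in>tuples k (cuniv C). (\<forall>a\<in>set as. cprob C \<phi> (a @ g @ map \<iota> (cst d)) \<le> B + eps) \<and>
  (\<forall>\<theta>\<in>set \<theta>s. \<bar>cprob C \<theta> (g @ map \<iota> (cst (d @ c))) - \<nu> {b \<in> X k. holds U \<theta> (b @ d @ c)}\<bar> \<le> eps)"
proof -
 interpret \<nu>: charge "X k" "\<D> k" \<nu> by (rule keisler_charge_univ[OF \<nu>])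
 define f where "f x = \<nu> {b \<in> X k. holds U \<phi> (x @ b @ d)}" for x
 have d: "set d \<subseteq> univ U" using dc(1) by simp
 have f_def': "{b \<in> X k. holds U \<phi> (x @ b @ d)} \<in> \<D> k" if x: "x \<in> X m" for x
 proof -
  have "{b \<in> X k. x @ b \<in> defset U (m + k) \<phi> d} \<in> \<D> k"
   by (rule cofibre_univ[OF definableI[OF \<phi> d] x])
  moreover have "{b \<in> X k. x @ b \<in> defset U (m + k) \<phi> d} = {b \<in> X k. holds U \<phi> (x @ b @ d)}"
   using tuples_append[OF x] by (auto simp: defset_def)
  ultimately show ?thesis by simp
 qed
 have f01: "0 \<le> f x \<and> f x \<le> 1" if "x \<in> X m" for x
  using \<nu>.nonneg[OF f_def'[OF that]] \<nu>.nu_le_1[OF f_def'[OF that]] by (simp add: f_def)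
 have \<theta>D: "{b \<in> X k. holds U \<theta> (b @ d @ c)} \<in> \<D> k" if "\<theta> \<in> set \<theta>s" for \<theta>
  using definableI[OF \<theta>s[OF that] dc(1)] by (simp add: defset_def)
 define N where "N = length as"
 define e where "e = d @ c"
 define n where "n = k + N * m"
 obtain z where z: "z \<in> M" using M_elem by (auto simp: elem_sub_def is_struct_def)
 define e' where "e' = e @ [z]"
 have zU: "z \<in> univ U" by (rule subsetD[OF M_sub(1) z])
 have e'U: "set e' \<subseteq> univ U" using dc(1) zU by (simp add: e'_def e_def)
 have e'A: "set (map \<iota> (cst e')) \<subseteq> A"
 proof -
  have "\<iota> (\<lambda>_. z) \<in> A" by (rule subsetD[OF A]) (intro imageI const_simple_rvs z)
  then show ?thesis using dc(2) by (simp add: e'_def e_def)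
 qed
 have cstU: "set (cst e') \<subseteq> SR (univ U)" by (rule set_cst[OF e'U])
 \<comment> \<open>The condition on the new tuple, as a formula \<open>\<tau>\<close> about the given ones.\<close>
 define \<eta> where "\<eta> = min eps 1 / 8"
 have \<eta>: "0 < \<eta>" "8 * \<eta> \<le> eps" "8 * \<eta> \<le> 1" using eps by (simp_all add: \<eta>_def)
 let ?zs = "\<lambda>l. map (\<lambda>j. k + N * m + j) [0..<length l]"
 let ?v\<phi> = "\<lambda>i. map (\<lambda>j. k + (i * m + j)) [0..<m] @ [0..<k] @ ?zs d"
 define \<psi>s where "\<psi>s = map (\<lambda>i. CProb \<phi> (?v\<phi> i)) [0..<N] @ map (\<lambda>\<theta>. CProb \<theta> ([0..<k] @ ?zs e)) \<theta>s"
 define vals where "vals = map (\<lambda>\<theta>. \<nu> {b \<in> X k. holds U \<theta> (b @ d @ c)}) \<theta>s"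
 define lo hi where "lo = replicate N 0 @ vals" and "hi = replicate N (B + 2 * \<eta>) @ vals"
 define \<tau> where "\<tau> = Near k \<psi>s lo hi"
 have wf\<psi>: "wf_cform L \<psi>" if "\<psi> \<in> set \<psi>s" for \<psi>
  using that \<phi> \<theta>s by (auto simp: \<psi>s_def e_def add.assoc)
 have len: "length lo = length \<psi>s" "length vals = length \<theta>s" "length \<psi>s = N + length \<theta>s"
  by (simp_all add: lo_def \<psi>s_def vals_def)
 have \<psi>1: "\<psi>s ! i = CProb \<phi> (?v\<phi> i)" "lo ! i = 0" "hi ! i = B + 2 * \<eta>" if "i < N" for i
  using that by (simp_all add: \<psi>s_def lo_def hi_def nth_append)
 have \<psi>2: "\<psi>s ! (N + i) = CProb (\<theta>s ! i) ([0..<k] @ ?zs e)"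
  "lo ! (N + i) = \<nu> {b \<in> X k. holds U (\<theta>s ! i) (b @ d @ c)}"
  "hi ! (N + i) = \<nu> {b \<in> X k. holds U (\<theta>s ! i) (b @ d @ c)}" if "i < length \<theta>s" for i
  using that by (simp_all add: \<psi>s_def lo_def hi_def vals_def nth_append)
 have wf\<tau>: "wf_cform L \<tau>" using wf\<psi> by (simp add: \<tau>_def wf_Near)
 have bound_im: "i * m + j < N * m" if "i < N" "j < m" for i j
 proof -
  have "i * m + j < Suc i * m" using that by simp
  also have "\<dots> \<le> N * m" using that by (intro mult_le_mono1) simp
  finally show ?thesis .
 qed
 have fv\<tau>: "cfvars \<tau> \<subseteq> {k..<n + length e}"
 proof
  fix v assume "v \<in> cfvars \<tau>"
  then obtain \<psi> where v: "\<psi> \<in> set \<psi>s" "v \<in> cfvars \<psi>" "k \<le> v" by (auto simp: \<tau>_def cfvars_Near)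
  have "v < n + length e" using v trans_less_add1[OF bound_im] by (auto simp: \<psi>s_def n_def e_def)
  then show "v \<in> {k..<n + length e}" using v(3) by simp
 qed
 obtain \<Theta> where \<Theta>: "!!\<theta>. \<theta> \<in> set \<Theta> ==> wf_form L \<theta>"
  "!!E E'. (!!i. E i \<in> SR (univ U) \<and> E' i \<in> SR (univ U)) ==> agree U \<Omega> \<Theta> E E' ==>
   \<bar>cval_env CU \<tau> (\<lambda>i. \<iota> (E i)) - cval_env CU \<tau> (\<lambda>i. \<iota> (E' i))\<bar> \<le> \<eta>"
  using simple_QE[OF wf\<tau> \<eta>(1)] by blast
 \<comment> \<open>The patterns of the given tuples with respect to \<open>\<Theta>\<close>; variables that do not occur in \<open>\<tau>\<close> are
  replaced by the constant \<open>z\<close>.\<close>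
 define \<sigma> where "\<sigma> i = (if k \<le> i \<and> i < n + length e then i - k else N * m + length e)" for i
 define n' where "n' = N * m + length e'"
 have \<sigma>: "\<sigma> i < n'" for i by (auto simp: \<sigma>_def n'_def n_def e'_def)
 have "\<forall>\<theta>\<in>set \<Theta>. \<exists>\<theta>'. fm L n' \<theta>' \<and> (\<forall>E. sat U \<theta>' E = sat U \<theta> (\<lambda>i. E (\<sigma> i)))"
 proof
  fix \<theta> assume \<theta>: "\<theta> \<in> set \<Theta>"
  obtain \<theta>' where t: "wf_form L \<theta> --> wf_form L \<theta>'" "fvars \<theta>' \<subseteq> \<sigma> ` fvars \<theta>"
   "\<forall>E. sat U \<theta>' E = sat U \<theta> (\<lambda>i. E (\<sigma> i))" using form_subst[of L \<theta> \<sigma> U] by (elim exE conjE)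
  have "fvars \<theta>' \<subseteq> {..<n'}" using t(2) \<sigma> by auto
  then show "\<exists>\<theta>'. fm L n' \<theta>' \<and> (\<forall>E. sat U \<theta>' E = sat U \<theta> (\<lambda>i. E (\<sigma> i)))"
   using t \<Theta>(1)[OF \<theta>] by (intro exI[of _ \<theta>']) (simp add: fm_def)
 qed
 from bchoice[OF this] obtain tr where
  tr: "\<forall>\<theta>\<in>set \<Theta>. fm L n' (tr \<theta>) \<and> (\<forall>E. sat U (tr \<theta>) E = sat U \<theta> (\<lambda>i. E (\<sigma> i)))" by (elim exE)
 have tr1: "fm L n' (tr \<theta>)" and tr2: "sat U (tr \<theta>) E = sat U \<theta> (\<lambda>i. E (\<sigma> i))" if "\<theta> \<in> set \<Theta>" for \<theta> E
  using bspec[OF tr that] by simp_all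
 define pat where "pat xs = {\<theta> \<in> set \<Theta>. holds U (tr \<theta>) (concat xs @ e')}" for xs
 define \<Delta> where "\<Delta> S = Conjs (map (\<lambda>\<theta>. if \<theta> \<in> S then tr \<theta> else Neg (tr \<theta>)) \<Theta>)" for S
 let ?P = "Pow (set \<Theta>)"
 have pat: "pat xs \<in> ?P" for xs by (auto simp: pat_def)
 have \<Delta>fm: "fm L n' (\<Delta> S)" for S using tr1 by (auto simp: \<Delta>_def fm_Conjs fm_Neg)
 have \<Delta>: "holds U (\<Delta> S) (concat xs @ e') \<longleftrightarrow> pat xs = S" if "S \<in> ?P" for S xs
 proof -
  have "holds U (\<Delta> S) (concat xs @ e')
    \<longleftrightarrow> (\<forall>\<theta>\<in>set \<Theta>. holds U (if \<theta> \<in> S then tr \<theta> else Neg (tr \<theta>)) (concat xs @ e'))"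
   unfolding \<Delta>_def sat_Conjs[OF univ_ne] set_map by blast
  also have "\<dots> \<longleftrightarrow> (\<forall>\<theta>\<in>set \<Theta>. \<theta> \<in> S \<longleftrightarrow> holds U (tr \<theta>) (concat xs @ e'))"
   by (intro ball_cong refl) simp
  also have "\<dots> \<longleftrightarrow> pat xs = S" using that by (auto simp: pat_def)
  finally show ?thesis .
 qed
 \<comment> \<open>A law for the given tuples.\<close>
 define \<delta> where "\<delta> = \<eta> / (1 + card ?P)"
 have \<delta>: "0 < \<delta>" "\<delta> + 2 * \<delta> * card ?P \<le> 2 * \<eta>"
 proof -
  show "0 < \<delta>" using \<eta>(1) by (simp add: \<delta>_def)
  have "\<delta> * (1 + real (card ?P)) = \<eta>" by (simp add: \<delta>_def)
  then show "\<delta> + 2 * \<delta> * card ?P \<le> 2 * \<eta>" using \<open>0 < \<delta>\<close> by (simp add: distrib_left)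
 qed
 have lawB: "sint (X m) \<mu> h \<le> B" if "step (X m) (\<D> m) h" "!!x. x \<in> X m ==> h x \<le> f x" for h
  by (rule B[OF that(1)]) (use that(2) in \<open>simp add: f_def\<close>)
 have "\<exists>w. finite (set_pmf w) \<and> (\<forall>xs\<in>set_pmf w. length xs = length as \<and> set xs \<subseteq> X m) \<and>
   (\<forall>\<theta>\<in>\<Delta> ` ?P. \<bar>measure_pmf.prob w {xs. holds U \<theta> (concat xs @ e')}
    - cprob C \<theta> (concat as @ map \<iota> (cst e'))\<bar> \<le> \<delta>) \<and>
   (\<forall>i<length as. measure_pmf.expectation w (\<lambda>xs. f (xs ! i)) \<le> B + \<delta>)"
 proof (rule law_of_morley_list[OF \<mu> p _ lawB A as e'U e'A _ _ \<delta>(1)])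
  show "fm L (length as * m + length e') \<theta>" if "\<theta> \<in> \<Delta> ` ?P" for \<theta>
   using that \<Delta>fm unfolding n'_def N_def by blast
 qed (use f01 in auto)
 then obtain w where w: "finite (set_pmf w) \<and> (\<forall>xs\<in>set_pmf w. length xs = length as \<and> set xs \<subseteq> X m) \<and>
   (\<forall>\<theta>\<in>\<Delta> ` ?P. \<bar>measure_pmf.prob w {xs. holds U \<theta> (concat xs @ e')}
    - cprob C \<theta> (concat as @ map \<iota> (cst e'))\<bar> \<le> \<delta>) \<and>
   (\<forall>i<length as. measure_pmf.expectation w (\<lambda>xs. f (xs ! i)) \<le> B + \<delta>)" by (elim exE)
 note wfin = conjunct1[OF w] and wX = bspec[OF conjunct1[OF conjunct2[OF w]], folded N_def]
  and wp = bspec[OF conjunct1[OF conjunct2[OF conjunct2[OF w]]], OF imageI]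
  and wf = spec[OF conjunct2[OF conjunct2[OF conjunct2[OF w]]], THEN mp, folded N_def]
 \<comment> \<open>Simple random variables approximating the given tuples.\<close>
 define z0 where "z0 = \<iota> (\<lambda>_. z)"
 have z0: "z0 \<in> cuniv C" unfolding z0_def by (intro \<iota>_C const_simple_rvs zU)
 define a' where "a' = replicate k z0 @ concat as"
 have concat_as: "concat as \<in> tuples (N * m) (cuniv C)"
  unfolding N_def by (rule concat_tuples[OF morley_list_tuples[OF as]])
 have a': "a' \<in> tuples n (cuniv C)" unfolding a'_def n_def
  by (rule tuples_append[OF _ concat_as]) (use z0 in \<open>auto simp: tuples_def\<close>)
 obtain Ps where Ps: "set Ps = ?P" using finite_list[of ?P] by auto
 let ?\<Psi> = "\<tau> # map (\<lambda>S. CProb (\<Delta> S) [k..<k + n']) Ps"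
 have \<Psi>: "cfm L (n + length (cst e')) \<psi>" if mem: "\<psi> \<in> set ?\<Psi>" for \<psi>
 proof -
  consider "\<psi> = \<tau>" | S where "\<psi> = CProb (\<Delta> S) [k..<k + n']" using mem by auto
  then show ?thesis
  proof cases
   case 1
   have "cfvars \<tau> \<subseteq> {..<n + length (cst e')}" by (rule order.trans[OF fv\<tau>]) (auto simp: e'_def)
   then show ?thesis using wf\<tau> 1 by (simp add: cfm_def)
  next
   case 2
   then show ?thesis using \<Delta>fm by (auto simp: cfm_def n'_def n_def)
  qed
 qed
 have m\<delta>: "0 < min \<eta> \<delta>" using \<eta> \<delta> by simp
 obtain x where x: "!!i. x i \<in> SR (univ U)" "!!\<psi>. \<psi> \<in> set ?\<Psi> ==>
  \<bar>cval C \<psi> (map \<iota> (map x [0..<n]) @ map \<iota> (cst e')) - cval C \<psi> (a' @ map \<iota> (cst e'))\<bar> \<le> min \<eta> \<delta>"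
 proof -
  have "\<exists>x. (\<forall>i. x i \<in> SR (univ U)) \<and> (\<forall>\<psi>\<in>set ?\<Psi>.
   \<bar>cval C \<psi> (map \<iota> (map x [0..<n]) @ map \<iota> (cst e')) - cval C \<psi> (a' @ map \<iota> (cst e'))\<bar> \<le> min \<eta> \<delta>)"
   by (rule approx_simple[OF a' cstU \<Psi> m\<delta>])
  then show ?thesis using that by blast
 qed
 define \<xi> where "\<xi> = map (\<lambda>t. x (k + t)) [0..<N * m]"
 have \<xi>: "\<xi> \<in> tuples (N * m) (SR (univ U))" using x(1) by (auto simp: \<xi>_def tuples_def)
 define Y0 where "Y0 \<omega> = blocks m N (at_point \<xi> \<omega>)" for \<omega>
 have \<xi>\<omega>: "length (at_point \<xi> \<omega>) = N * m" for \<omega> using tuplesD(1)[OF \<xi>] by simp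
 have cY0: "concat (Y0 \<omega>) = at_point \<xi> \<omega>" for \<omega> unfolding Y0_def by (rule concat_blocks[OF \<xi>\<omega>])
 have Y0s: "simple_function \<Omega> Y0" unfolding Y0_def[abs_def]
 proof (rule simple_function_compose1[OF simple_at_point])
  show "simple_function \<Omega> h" if "h \<in> set \<xi>" for h
   by (rule simple_rvsD(1)[OF subsetD[OF tuplesD(2)[OF \<xi>] that]])
 qed
 have Y0X: "length (Y0 \<omega>) = N \<and> set (Y0 \<omega>) \<subseteq> X m" if "\<omega> \<in> space \<Omega>" for \<omega>
 proof -
  have "h \<omega> \<in> univ U" if "h \<in> set \<xi>" for h
   by (rule simple_rvsD(2)[OF subsetD[OF tuplesD(2)[OF \<xi>] that] \<open>\<omega> \<in> space \<Omega>\<close>])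
  then have "at_point \<xi> \<omega> \<in> X (N * m)" using \<xi>\<omega>[of \<omega>] by (auto simp: tuples_def)
  then show ?thesis unfolding Y0_def using blocks_tuples by blast
 qed
 have near0: "\<Omega>.prob {\<omega> \<in> space \<Omega>. pat (Y0 \<omega>) = S} \<le> measure_pmf.prob w {xs. pat xs = S} + 2 * \<delta>"
  if S: "S \<in> ?P" for S
 proof -
  let ?\<psi> = "CProb (\<Delta> S) [k..<k + n']"
  have "cval C ?\<psi> (a' @ map \<iota> (cst e')) = cprob C (\<Delta> S) (concat as @ map \<iota> (cst e'))"
  proof -
   have "map (nth (replicate k z0 @ (concat as @ map \<iota> (cst e')))) [k..<k + n'] = concat as @ map \<iota> (cst e')"
    by (rule map_nth_suffix) (simp_all add: n'_def tuplesD(1)[OF concat_as] del: length_concat)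
   then show ?thesis by (simp add: a'_def del: map_append)
  qed
  moreover have "cval C ?\<psi> (map \<iota> (map x [0..<n]) @ map \<iota> (cst e')) = cprob C (\<Delta> S) (map \<iota> (\<xi> @ cst e'))"
  proof -
   have split: "map x [0..<n] = map x [0..<k] @ \<xi>"
    unfolding n_def \<xi>_def upt_add_eq_append[OF le0] map_append
    by (intro arg_cong2[where f = append] refl nth_equalityI) simp_all
   have "map (nth (map \<iota> (map x [0..<k]) @ map \<iota> (\<xi> @ cst e'))) [k..<k + n'] = map \<iota> (\<xi> @ cst e')"
    by (rule map_nth_suffix) (simp_all add: n'_def tuplesD(1)[OF \<xi>])
   then show ?thesis by (simp add: split)
  qed
  moreover have "cprob C (\<Delta> S) (map \<iota> (\<xi> @ cst e')) = \<Omega>.prob {\<omega> \<in> space \<Omega>. pat (Y0 \<omega>) = S}"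
  proof -
   have "\<xi> @ cst e' \<in> tuples n' (SR (univ U))"
    unfolding n'_def by (rule tuples_append[OF \<xi>]) (use cstU in \<open>simp add: tuples_def\<close>)
   from prob_\<iota>[OF \<Delta>fm this] have "cprob C (\<Delta> S) (map \<iota> (\<xi> @ cst e'))
     = \<Omega>.prob {\<omega> \<in> space \<Omega>. holds U (\<Delta> S) (concat (Y0 \<omega>) @ e')}"
    unfolding prob_of_def at_point_cst cY0 .
   then show ?thesis unfolding \<Delta>[OF S] .
  qed
  moreover have "\<bar>cval C ?\<psi> (map \<iota> (map x [0..<n]) @ map \<iota> (cst e')) - cval C ?\<psi> (a' @ map \<iota> (cst e'))\<bar> \<le> min \<eta> \<delta>"
   by (rule x(2)) (use S Ps in simp)
  moreover have "\<bar>measure_pmf.prob w {xs. pat xs = S} - cprob C (\<Delta> S) (concat as @ map \<iota> (cst e'))\<bar> \<le> \<delta>"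
   using wp[OF S] unfolding \<Delta>[OF S] .
  ultimately show ?thesis by linarith
 qed
 \<comment> \<open>Resample from the law, and then choose the new tuple.\<close>
 obtain Y where Y: "simple_function \<Omega> Y"
  "\<forall>\<omega>\<in>space \<Omega>. pat (Y \<omega>) = pat (Y0 \<omega>) \<and> (Y \<omega> = Y0 \<omega> \<or> Y \<omega> \<in> set_pmf w)"
  "\<forall>h. (\<forall>y\<in>Y0 ` space \<Omega> \<union> set_pmf w. 0 \<le> h y \<and> h y \<le> 1) -->
   (\<Sum>y\<in>Y ` space \<Omega>. \<Omega>.prob {\<omega> \<in> space \<Omega>. Y \<omega> = y} * h y)
    \<le> measure_pmf.expectation w h + 2 * \<delta> * card ?P"
 proof -
  have "finite ?P" "0 \<le> 2 * \<delta>" using \<delta>(1) by simp_all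
  from pattern_coupling[OF atomless Y0s wfin this(1) pat this(2) near0] show ?thesis using that by blast
 qed
 have YX: "length (Y \<omega>) = N \<and> set (Y \<omega>) \<subseteq> X m" if "\<omega> \<in> space \<Omega>" for \<omega>
  using bspec[OF Y(2) that] Y0X[OF that] wX[of "Y \<omega>"] by auto
 have Ef: "(\<Sum>y\<in>Y ` space \<Omega>. \<Omega>.prob {\<omega> \<in> space \<Omega>. Y \<omega> = y} * f (y ! i)) \<le> B + 2 * \<eta>" if i: "i < N" for i
 proof -
  have "0 \<le> f (y ! i) \<and> f (y ! i) \<le> 1" if "y \<in> Y0 ` space \<Omega> \<union> set_pmf w" for y
  proof (rule f01)
   have y: "length y = N \<and> set y \<subseteq> X m" using that Y0X wX by blast
   then have "y ! i \<in> set y" using i by simp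
   then show "y ! i \<in> X m" using y by blast
  qed
  then have "(\<Sum>y\<in>Y ` space \<Omega>. \<Omega>.prob {\<omega> \<in> space \<Omega>. Y \<omega> = y} * f (y ! i))
    \<le> measure_pmf.expectation w (\<lambda>y. f (y ! i)) + 2 * \<delta> * card ?P"
   using spec[OF Y(3), of "\<lambda>y. f (y ! i)"] by simp
  then show ?thesis using wf[OF i] \<delta>(2) by linarith
 qed
 let ?F = "\<lambda>y. (\<lambda>i. {b \<in> X k. holds U \<phi> (y ! i @ b @ d)}) ` {..<N} \<union> (\<lambda>\<theta>. {b \<in> X k. holds U \<theta> (b @ d @ c)}) ` set \<theta>s"
 have "\<forall>y\<in>Y ` space \<Omega>. \<exists>u. finite (set_pmf u) \<and> set_pmf u \<subseteq> X k \<and> (\<forall>E\<in>?F y. measure_pmf.prob u E = \<nu> E)"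
 proof
  fix y assume y: "y \<in> Y ` space \<Omega>"
  show "\<exists>u. finite (set_pmf u) \<and> set_pmf u \<subseteq> X k \<and> (\<forall>E\<in>?F y. measure_pmf.prob u E = \<nu> E)"
  proof (rule \<nu>.sampling')
   show "?F y \<subseteq> \<D> k"
   proof (intro Un_least image_subsetI)
    fix i assume "i \<in> {..<N}"
    moreover have "length y = N \<and> set y \<subseteq> X m" using y YX by blast
    ultimately have "y ! i \<in> X m" using nth_mem[of i y] by blast
    then show "{b \<in> X k. holds U \<phi> (y ! i @ b @ d)} \<in> \<D> k" by (rule f_def')
   qed (rule \<theta>D)
  qed simp
 qed
 from bchoice[OF this] obtain u where
  u: "\<forall>y\<in>Y ` space \<Omega>. finite (set_pmf (u y)) \<and> set_pmf (u y) \<subseteq> X k \<and> (\<forall>E\<in>?F y. measure_pmf.prob (u y) E = \<nu> E)"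
  by (elim exE)
 have ufin: "finite (set_pmf (u y))" and uX: "set_pmf (u y) \<subseteq> X k"
  and uE: "E \<in> ?F y ==> measure_pmf.prob (u y) E = \<nu> E" if "y \<in> Y ` space \<Omega>" for y E
  using bspec[OF u that] by simp_all
 obtain G where G: "simple_function \<Omega> G" "\<forall>\<omega>\<in>space \<Omega>. G \<omega> \<in> set_pmf (u (Y \<omega>))"
  "\<forall>y\<in>Y ` space \<Omega>. \<forall>b. \<Omega>.prob {\<omega> \<in> space \<Omega>. Y \<omega> = y \<and> G \<omega> = b}
   = \<Omega>.prob {\<omega> \<in> space \<Omega>. Y \<omega> = y} * pmf (u y) b"
  by (atomize_elim, rule kernel_realization[OF atomless Y(1) ufin])
 have GX: "G \<omega> \<in> X k" if "\<omega> \<in> space \<Omega>" for \<omega>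
  by (rule subsetD[OF uX[OF imageI[OF that]] bspec[OF G(2) that]])
 have probG: "\<Omega>.prob {\<omega> \<in> space \<Omega>. Q (Y \<omega>) (G \<omega>)}
   = (\<Sum>y\<in>Y ` space \<Omega>. \<Omega>.prob {\<omega> \<in> space \<Omega>. Y \<omega> = y} * measure_pmf.prob (u y) {b \<in> X k. Q y b})" for Q
 proof -
  have "\<Omega>.prob {\<omega> \<in> space \<Omega>. Q (Y \<omega>) (G \<omega>)}
   = (\<Sum>y\<in>Y ` space \<Omega>. \<Omega>.prob {\<omega> \<in> space \<Omega>. Y \<omega> = y} * measure_pmf.prob (u y) {b. Q y b})"
   by (rule kernel_prob[OF \<Omega>.prob_space_axioms Y(1) G(1) bspec[OF G(2)] ufin spec[OF bspec[OF G(3)]]])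
  also have "\<dots> = (\<Sum>y\<in>Y ` space \<Omega>. \<Omega>.prob {\<omega> \<in> space \<Omega>. Y \<omega> = y} * measure_pmf.prob (u y) {b \<in> X k. Q y b})"
   by (rule sum.cong[OF refl]) (rule arg_cong2[where f = "(*)", OF refl prob_on_support[OF uX]])
  finally show ?thesis .
 qed
 \<comment> \<open>The environments of \<open>\<tau>\<close> given by \<open>Y\<close> and \<open>Y0\<close>.\<close>
 define E where "E W i \<omega> = (concat (W \<omega>) @ e') ! \<sigma> i" for W :: "'w => 'a list list" and i \<omega>
 have cW: "concat xs @ e' \<in> X n'" "length (concat xs) = N * m" if "length xs = N \<and> set xs \<subseteq> X m" for xs
 proof -
  have "concat xs \<in> X (N * m)" using concat_tuples[of xs m "univ U"] that by simp
  then show "concat xs @ e' \<in> X n'" "length (concat xs) = N * m" unfolding n'_def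
   by (rule tuples_append, use e'U in \<open>simp add: tuples_def\<close>) (rule tuplesD(1)[OF \<open>concat xs \<in> X (N * m)\<close>])
 qed
 have E_SR: "E W i \<in> SR (univ U)" if W: "simple_function \<Omega> W" "!!\<omega>. \<omega> \<in> space \<Omega> ==> length (W \<omega>) = N \<and> set (W \<omega>) \<subseteq> X m" for W i
 proof -
  have "simple_function \<Omega> (E W i)" unfolding E_def[abs_def] by (rule simple_function_compose1[OF W(1)])
  moreover have "E W i \<omega> \<in> univ U" if "\<omega> \<in> space \<Omega>" for \<omega>
  proof -
   note c = cW(1)[OF W(2)[OF that]]
   have "E W i \<omega> \<in> set (concat (W \<omega>) @ e')" unfolding E_def by (rule nth_mem) (use \<sigma>[of i] tuplesD(1)[OF c] in simp)
   then show ?thesis by (rule subsetD[OF tuplesD(2)[OF c]])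
  qed
  ultimately show ?thesis by (auto simp: simple_rvs_def)
 qed
 have EY: "E Y i \<in> SR (univ U)" for i by (rule E_SR[OF Y(1) YX])
 have EY0: "E Y0 i \<in> SR (univ U)" for i by (rule E_SR[OF Y0s Y0X])
 have CU_C: "cval_env CU \<tau> (\<lambda>i. \<iota> (E Y i)) = cval_env C \<tau> (\<lambda>i. \<iota> (E Y i))"
  "cval_env CU \<tau> (\<lambda>i. \<iota> (E Y0 i)) = cval_env C \<tau> (\<lambda>i. \<iota> (E Y0 i))"
  by (rule elem_env[OF wf\<tau> \<iota>_CU[OF EY]]) (rule elem_env[OF wf\<tau> \<iota>_CU[OF EY0]])
 have "agree U \<Omega> \<Theta> (E Y) (E Y0)"
  unfolding agree_def
 proof (intro ballI)
  fix \<omega> \<theta> assume \<omega>: "\<omega> \<in> space \<Omega>" and \<theta>: "\<theta> \<in> set \<Theta>"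
  have "sat U \<theta> (\<lambda>i. E W i \<omega>) \<longleftrightarrow> \<theta> \<in> pat (W \<omega>)" for W
   using \<theta> tr2[OF \<theta>, of "nth (concat (W \<omega>) @ e')"] by (simp add: E_def pat_def)
  then show "sat U \<theta> (\<lambda>i. E Y i \<omega>) = sat U \<theta> (\<lambda>i. E Y0 i \<omega>)" using bspec[OF Y(2) \<omega>] by simp
 qed
 then have "\<bar>cval_env CU \<tau> (\<lambda>i. \<iota> (E Y i)) - cval_env CU \<tau> (\<lambda>i. \<iota> (E Y0 i))\<bar> \<le> \<eta>"
  by (rule \<Theta>(2)[rotated]) (intro conjI EY EY0)
 then have qe: "\<bar>cval_env C \<tau> (\<lambda>i. \<iota> (E Y i)) - cval_env C \<tau> (\<lambda>i. \<iota> (E Y0 i))\<bar> \<le> \<eta>"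
  unfolding CU_C .
 have "cval C \<tau> (map \<iota> (map x [0..<n]) @ map \<iota> (cst e')) = cval_env C \<tau> (\<lambda>i. \<iota> (E Y0 i))"
 proof (rule cval_env_cong)
  fix i assume "i \<in> cfvars \<tau>"
  then have i: "k \<le> i" "i < n + length e" using fv\<tau> by auto
  then have si: "\<sigma> i = i - k" by (simp add: \<sigma>_def)
  show "(map \<iota> (map x [0..<n]) @ map \<iota> (cst e')) ! i = \<iota> (E Y0 i)"
  proof (cases "i < n")
   case True
   have "E Y0 i = x i"
   proof
    fix \<omega>
    have lt: "i - k < N * m" using True i(1) by (simp add: n_def)
    then have "E Y0 i \<omega> = at_point \<xi> \<omega> ! (i - k)" using \<xi>\<omega>[of \<omega>] by (simp add: E_def cY0 si nth_append)
    also have "\<dots> = x i \<omega>" using lt i(1) by (simp add: \<xi>_def)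
    finally show "E Y0 i \<omega> = x i \<omega>" .
   qed
   then show ?thesis using True by (simp add: nth_append)
  next
   case False
   define j where "j = i - n"
   have j: "i = n + j" "j < length e'" "i - k = N * m + j" using False i by (simp_all add: j_def e'_def n_def)
   have "E Y0 i = (\<lambda>_. e' ! j)"
   proof
    fix \<omega>
    show "E Y0 i \<omega> = e' ! j"
     unfolding E_def cY0 si j(3) \<xi>\<omega>[of \<omega>, symmetric] by (rule nth_append_length_plus)
   qed
   then show ?thesis using j(2) nth_append_length_plus[of "map \<iota> (map x [0..<n])" "map \<iota> (cst e')" j]
    by (simp add: j(1))
  qed
 qed
 moreover have "\<bar>cval C \<tau> (map \<iota> (map x [0..<n]) @ map \<iota> (cst e')) - cval C \<tau> (a' @ map \<iota> (cst e'))\<bar> \<le> min \<eta> \<delta>"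
  by (rule x(2)) simp
 ultimately have approx: "cval C \<tau> (a' @ map \<iota> (cst e')) \<le> cval_env C \<tau> (\<lambda>i. \<iota> (E Y i)) + 2 * \<eta>"
  using qe by linarith
 define H where "H i = (if i < k then (\<lambda>\<omega>. G \<omega> ! i) else E Y i)" for i
 have H: "H i \<in> SR (univ U)" for i
 proof (cases "i < k")
  case True
  have "simple_function \<Omega> (\<lambda>\<omega>. G \<omega> ! i)" by (rule simple_function_compose1[OF G(1)])
  moreover have "G \<omega> ! i \<in> univ U" if "\<omega> \<in> space \<Omega>" for \<omega>
  proof -
   have "G \<omega> ! i \<in> set (G \<omega>)" by (rule nth_mem) (use True tuplesD(1)[OF GX[OF that]] in simp)
   then show ?thesis by (rule subsetD[OF tuplesD(2)[OF GX[OF that]]])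
  qed
  ultimately show ?thesis using True by (auto simp: H_def simple_rvs_def)
 next
  case False
  then show ?thesis using EY by (simp add: H_def)
 qed
 have H_z: "H (k + N * m + j) \<omega> = e' ! j" if "\<omega> \<in> space \<Omega>" "j < length e" for j \<omega>
 proof -
  have "H (k + N * m + j) \<omega> = (concat (Y \<omega>) @ e') ! (N * m + j)"
   using that(2) by (simp add: H_def E_def \<sigma>_def n_def)
  then show ?thesis using nth_append_length_plus[of "concat (Y \<omega>)" e' j] cW(2)[OF YX[OF that(1)]] by simp
 qed
 have H_x: "H (k + t) \<omega> = concat (Y \<omega>) ! t" if "\<omega> \<in> space \<Omega>" "t < N * m" for t \<omega>
  using that(2) cW(2)[OF YX[OF that(1)]] by (simp add: H_def E_def \<sigma>_def n_def nth_append)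
 have H_y: "H j \<omega> = G \<omega> ! j" if "j < k" for j \<omega> using that by (simp add: H_def)
 have e'_nth: "j < length e ==> e' ! j = e ! j" "j < length d ==> e' ! j = d ! j" for j
  by (simp add: e'_def nth_append) (simp add: e'_def e_def nth_append)
 have de: "length d \<le> length e" by (simp add: e_def)
 have H1: "map (\<lambda>v. H v \<omega>) (?v\<phi> i) = Y \<omega> ! i @ G \<omega> @ d" if "\<omega> \<in> space \<Omega>" "i < N" for \<omega> i
  by (rule block_env(1)[OF conjunct2[OF YX[OF that(1)]] conjunct1[OF YX[OF that(1)]] tuplesD(1)[OF GX[OF that(1)]]
    H_y H_x[OF that(1)] _ that(2)]) (use H_z[OF that(1)] de e'_nth(2) in simp_all)
 have H2: "map (\<lambda>v. H v \<omega>) ([0..<k] @ ?zs e) = G \<omega> @ e" if "\<omega> \<in> space \<Omega>" for \<omega>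
  by (rule block_env(2)[OF conjunct2[OF YX[OF that]] conjunct1[OF YX[OF that]] tuplesD(1)[OF GX[OF that]]
    H_y H_x[OF that]]) (use H_z[OF that] e'_nth(1) in simp_all)
 have cvalH: "cval_env C (CProb \<theta> vs) (\<lambda>i. \<iota> (H i)) = \<Omega>.prob {\<omega> \<in> space \<Omega>. holds U \<theta> (map (\<lambda>v. H v \<omega>) vs)}"
  if "fm L (length vs) \<theta>" for \<theta> vs
 proof -
  have "map H vs \<in> tuples (length vs) (SR (univ U))" using H by (auto simp: tuples_def)
  from prob_\<iota>[OF that this] show ?thesis by (simp add: prob_of_def comp_def)
 qed
 have val1: "0 \<le> cval_env C (\<psi>s ! i) (\<lambda>i. \<iota> (H i)) \<and> cval_env C (\<psi>s ! i) (\<lambda>i. \<iota> (H i)) \<le> B + 2 * \<eta>" if i: "i < N" for i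
 proof -
  have "cval_env C (\<psi>s ! i) (\<lambda>i. \<iota> (H i)) = \<Omega>.prob {\<omega> \<in> space \<Omega>. holds U \<phi> (map (\<lambda>v. H v \<omega>) (?v\<phi> i))}"
   unfolding \<psi>1(1)[OF i] by (rule cvalH) (use \<phi> in \<open>simp add: add.assoc\<close>)
  also have "{\<omega> \<in> space \<Omega>. holds U \<phi> (map (\<lambda>v. H v \<omega>) (?v\<phi> i))} = {\<omega> \<in> space \<Omega>. holds U \<phi> (Y \<omega> ! i @ G \<omega> @ d)}"
   by (intro Collect_cong conj_cong refl) (simp only: H1[OF _ i])
  also have "\<Omega>.prob \<dots> = (\<Sum>y\<in>Y ` space \<Omega>. \<Omega>.prob {\<omega> \<in> space \<Omega>. Y \<omega> = y} * measure_pmf.prob (u y) {b \<in> X k. holds U \<phi> (y ! i @ b @ d)})"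
   by (rule probG)
  also have "\<dots> = (\<Sum>y\<in>Y ` space \<Omega>. \<Omega>.prob {\<omega> \<in> space \<Omega>. Y \<omega> = y} * f (y ! i))"
  proof (rule sum.cong[OF refl])
   fix y assume y: "y \<in> Y ` space \<Omega>"
   have "{b \<in> X k. holds U \<phi> (y ! i @ b @ d)} \<in> ?F y" by (rule UnI1) (use i in \<open>intro image_eqI[of _ _ i], simp_all\<close>)
   from uE[OF y this] show "\<Omega>.prob {\<omega> \<in> space \<Omega>. Y \<omega> = y} * measure_pmf.prob (u y) {b \<in> X k. holds U \<phi> (y ! i @ b @ d)}
    = \<Omega>.prob {\<omega> \<in> space \<Omega>. Y \<omega> = y} * f (y ! i)" by (simp add: f_def)
  qed
  also have "\<dots> \<le> B + 2 * \<eta>" by (rule Ef[OF i])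
  finally have "cval_env C (\<psi>s ! i) (\<lambda>i. \<iota> (H i)) \<le> B + 2 * \<eta>" .
  moreover have "0 \<le> cval_env C (\<psi>s ! i) (\<lambda>i. \<iota> (H i))"
   unfolding \<psi>1(1)[OF i] by (subst cvalH) (use \<phi> in \<open>simp_all add: add.assoc\<close>)
  ultimately show ?thesis by simp
 qed
 have val2: "cval_env C (\<psi>s ! (N + i)) (\<lambda>i. \<iota> (H i)) = \<nu> {b \<in> X k. holds U (\<theta>s ! i) (b @ d @ c)}" if i: "i < length \<theta>s" for i
 proof -
  have mem: "\<theta>s ! i \<in> set \<theta>s" using i by simp
  have "cval_env C (\<psi>s ! (N + i)) (\<lambda>i. \<iota> (H i)) = \<Omega>.prob {\<omega> \<in> space \<Omega>. holds U (\<theta>s ! i) (map (\<lambda>v. H v \<omega>) ([0..<k] @ ?zs e))}"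
   unfolding \<psi>2(1)[OF i] by (rule cvalH) (use \<theta>s[OF mem] in \<open>simp add: e_def\<close>)
  also have "{\<omega> \<in> space \<Omega>. holds U (\<theta>s ! i) (map (\<lambda>v. H v \<omega>) ([0..<k] @ ?zs e))}
    = {\<omega> \<in> space \<Omega>. holds U (\<theta>s ! i) (G \<omega> @ d @ c)}"
   by (intro Collect_cong conj_cong refl) (subst H2, assumption, unfold e_def, rule refl)
  also have "\<Omega>.prob \<dots> = (\<Sum>y\<in>Y ` space \<Omega>. \<Omega>.prob {\<omega> \<in> space \<Omega>. Y \<omega> = y} * measure_pmf.prob (u y) {b \<in> X k. holds U (\<theta>s ! i) (b @ d @ c)})"
   by (rule probG)
  also have "\<dots> = (\<Sum>y\<in>Y ` space \<Omega>. \<Omega>.prob {\<omega> \<in> space \<Omega>. Y \<omega> = y} * \<nu> {b \<in> X k. holds U (\<theta>s ! i) (b @ d @ c)})"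
  proof (rule sum.cong[OF refl])
   fix y assume y: "y \<in> Y ` space \<Omega>"
   have "{b \<in> X k. holds U (\<theta>s ! i) (b @ d @ c)} \<in> ?F y" by (rule UnI2) (use mem in \<open>intro image_eqI[of _ _ "\<theta>s ! i"], simp_all\<close>)
   from uE[OF y this] show "\<Omega>.prob {\<omega> \<in> space \<Omega>. Y \<omega> = y} * measure_pmf.prob (u y) {b \<in> X k. holds U (\<theta>s ! i) (b @ d @ c)}
    = \<Omega>.prob {\<omega> \<in> space \<Omega>. Y \<omega> = y} * \<nu> {b \<in> X k. holds U (\<theta>s ! i) (b @ d @ c)}" by (simp only:)
  qed
  also have "\<dots> = \<nu> {b \<in> X k. holds U (\<theta>s ! i) (b @ d @ c)}"
   using \<Omega>.prob_simple[OF Y(1), of "\<lambda>_. True"] \<Omega>.prob_space by (simp flip: sum_distrib_right)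
  finally show ?thesis .
 qed
 have "cval_env C \<tau> (\<lambda>i. \<iota> (E Y i)) \<le> 0"
  unfolding \<tau>_def
 proof (rule Near_upper[OF struct_C wf\<psi> len(1)])
  have eq: "(\<lambda>i. if i < k then \<iota> (H i) else \<iota> (E Y i)) = (\<lambda>i. \<iota> (H i))" by (auto simp: H_def)
  have val: "lo ! i \<le> cval_env C (\<psi>s ! i) (\<lambda>i. \<iota> (H i)) \<and> cval_env C (\<psi>s ! i) (\<lambda>i. \<iota> (H i)) \<le> hi ! i"
   if i: "i < length \<psi>s" for i
  proof (cases "i < N")
   case True
   then show ?thesis using val1 \<psi>1(2,3) by simp
  next
   case False
   then obtain t where t: "i = N + t" "t < length \<theta>s" using i len(3) by (intro that[of "i - N"]) simp_all
   show ?thesis unfolding t(1) val2[OF t(2)] \<psi>2(2,3)[OF t(2)] by simp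
  qed
  show "lo ! i \<le> cval_env C (\<psi>s ! i) (\<lambda>i. if i < k then \<iota> (H i) else \<iota> (E Y i))"
   "cval_env C (\<psi>s ! i) (\<lambda>i. if i < k then \<iota> (H i) else \<iota> (E Y i)) \<le> hi ! i" if "i < length \<psi>s" for i
   unfolding eq using val[OF that] by simp_all
 qed (assumption | rule \<iota>_C[OF EY] | rule \<iota>_C[OF H])+
 \<comment> \<open>Back in \<open>C\<close>: the value of \<open>\<tau>\<close> at the given tuples is small, so it is nearly attained.\<close>
 then have small: "cval C \<tau> (a' @ map \<iota> (cst e')) \<le> 2 * \<eta>" using approx by simp
 define ec where "ec i = (if i < n + length e' then (a' @ map \<iota> (cst e')) ! i else z0)" for i
 have ae: "a' @ map \<iota> (cst e') \<in> tuples (n + length e') (cuniv C)"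
  by (rule tuples_append[OF a'] , rule \<iota>_tuples, rule cst_tuples) (use e'U in \<open>simp add: tuples_def\<close>)
 have ec: "ec i \<in> cuniv C" for i
 proof (cases "i < n + length e'")
  case True
  have "(a' @ map \<iota> (cst e')) ! i \<in> set (a' @ map \<iota> (cst e'))" by (rule nth_mem) (use True tuplesD(1)[OF ae] in simp)
  from subsetD[OF tuplesD(2)[OF ae] this] show ?thesis using True by (simp add: ec_def)
 qed (simp add: ec_def z0)
 have "cval_env C \<tau> ec = cval C \<tau> (a' @ map \<iota> (cst e'))"
  by (rule cval_env_cong) (use fv\<tau> in \<open>auto simp: ec_def e'_def\<close>)
 then have small': "cval_env C (Near k \<psi>s lo hi) ec \<le> 2 * \<eta>" using small by (simp add: \<tau>_def)
 have s3: "2 * \<eta> < 3 * \<eta>" "3 * \<eta> < 1" using \<eta> by simp_all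
 obtain b where b: "\<forall>i. b i \<in> cuniv C" "\<forall>i<length \<psi>s.
  lo ! i - 3 * \<eta> \<le> cval_env C (\<psi>s ! i) (\<lambda>i. if i < k then b i else ec i) \<and>
  cval_env C (\<psi>s ! i) (\<lambda>i. if i < k then b i else ec i) \<le> hi ! i + 3 * \<eta>"
 proof -
  have "\<exists>b. (\<forall>i. b i \<in> cuniv C) \<and> (\<forall>i<length \<psi>s.
   lo ! i - 3 * \<eta> \<le> cval_env C (\<psi>s ! i) (\<lambda>i. if i < k then b i else ec i) \<and>
   cval_env C (\<psi>s ! i) (\<lambda>i. if i < k then b i else ec i) \<le> hi ! i + 3 * \<eta>)"
   by (rule Near_attained[OF struct_C wf\<psi> len(1) ec small' s3])
  then show ?thesis using that by blast
 qed
 define g where "g = map b [0..<k]"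
 let ?E = "\<lambda>i. if i < k then b i else ec i"
 have g: "g \<in> tuples k (cuniv C)" using b(1) by (auto simp: g_def tuples_def)
 have la: "length a' = k + N * m" using tuplesD(1)[OF a'] by (simp add: n_def)
 have Ey: "?E j = g ! j" if "j < k" for j using that by (simp add: g_def)
 have Ex: "?E (k + t) = concat as ! t" if "t < N * m" for t
 proof -
  have "?E (k + t) = a' ! (k + t)" using that la by (simp add: ec_def n_def nth_append)
  also have "\<dots> = concat as ! t" unfolding a'_def using nth_append_length_plus[of "replicate k z0" "concat as" t] by simp
  finally show ?thesis .
 qed
 have Ez: "?E (k + N * m + j) = map \<iota> (cst e') ! j" if "j < length e" for j
 proof -
  have "?E (k + N * m + j) = (a' @ map \<iota> (cst e')) ! (length a' + j)"
   using that la by (simp add: ec_def n_def e'_def)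
  also have "\<dots> = map \<iota> (cst e') ! j" by (rule nth_append_length_plus)
  finally show ?thesis .
 qed
 have asC: "set as \<subseteq> tuples m (cuniv C)" by (rule morley_list_tuples[OF as])
 have ld: "length (map \<iota> (cst l)) = length l" for l by simp
 have Ed: "?E (k + N * m + j) = map \<iota> (cst d) ! j" if "j < length (map \<iota> (cst d))" for j
 proof -
  have "j < length d" "j < length e" "j < length e'" using that de by (simp_all add: e'_def)
  then show ?thesis using Ez[of j] e'_nth(2)[of j] by simp
 qed
 have Ee: "?E (k + N * m + j) = map \<iota> (cst e) ! j" if "j < length (map \<iota> (cst e))" for j
 proof -
  have "j < length e" "j < length e'" using that by (simp_all add: e'_def)
  then show ?thesis using Ez[of j] e'_nth(1)[of j] by simp
 qed
 have B1: "map ?E (?v\<phi> i) = as ! i @ g @ map \<iota> (cst d)" if i: "i < N" for i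
  using block_env(1)[of as m "cuniv C" N g k ?E "map \<iota> (cst d)" i, OF asC N_def[symmetric] tuplesD(1)[OF g] Ey Ex Ed i]
  unfolding ld by blast
 have B2: "map ?E ([0..<k] @ ?zs e) = g @ map \<iota> (cst (d @ c))"
  using block_env(2)[of as m "cuniv C" N g k ?E "map \<iota> (cst e)", OF asC N_def[symmetric] tuplesD(1)[OF g] Ey Ex Ee]
  unfolding ld e_def by blast
 show ?thesis
 proof (intro bexI[OF _ g] conjI ballI)
  fix a assume "a \<in> set as"
  then obtain i where i: "i < N" "a = as ! i" unfolding N_def by (metis in_set_conv_nth)
  have "cval_env C (\<psi>s ! i) ?E \<le> B + 2 * \<eta> + 3 * \<eta>" using b(2) i(1) len(3) \<psi>1(3)[OF i(1)] by (metis trans_less_add1)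
  moreover have "cval_env C (\<psi>s ! i) ?E = cprob C \<phi> (a @ g @ map \<iota> (cst d))"
   unfolding \<psi>1(1)[OF i(1)] cval_env.simps B1[OF i(1)] i(2) ..
  ultimately show "cprob C \<phi> (a @ g @ map \<iota> (cst d)) \<le> B + eps" using \<eta> by linarith
 next
  fix \<theta> assume "\<theta> \<in> set \<theta>s"
  then obtain i where i: "i < length \<theta>s" "\<theta> = \<theta>s ! i" by (metis in_set_conv_nth)
  have "\<nu> {b \<in> X k. holds U \<theta> (b @ d @ c)} - 3 * \<eta> \<le> cval_env C (\<psi>s ! (N + i)) ?E \<and>
   cval_env C (\<psi>s ! (N + i)) ?E \<le> \<nu> {b \<in> X k. holds U \<theta> (b @ d @ c)} + 3 * \<eta>"
   using spec[OF b(2), of "N + i"] i(1) len(3) unfolding \<psi>2(2,3)[OF i(1)] i(2) by simp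
  moreover have "cval_env C (\<psi>s ! (N + i)) ?E = cprob C \<theta> (g @ map \<iota> (cst (d @ c)))"
   unfolding \<psi>2(1)[OF i(1)] cval_env.simps B2 i(2) ..
  ultimately show "\<bar>cprob C \<theta> (g @ map \<iota> (cst (d @ c))) - \<nu> {b \<in> X k. holds U \<theta> (b @ d @ c)}\<bar> \<le> eps"
   using \<eta> by linarith
 qed
qed

end

section \<open>The two iterated integrals\<close>

lemma param_cfms_mono: "A \<subseteq> B ==> param_cfms L A n \<subseteq> param_cfms L B n"
 unfolding param_cfms_def by (intro subsetI) (auto intro: order.trans)

lemma crealizes_mono: "crealizes L C B m p a ==> A \<subseteq> B ==> crealizes L C A m p a"
 unfolding crealizes_def using param_cfms_mono[of A B L m] by (meson subsetD)

context random_model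
begin

lemma randomize_M_sub: "randomize C \<iota> \<Omega> M \<subseteq> cuniv C"
proof -
 have "randomize C \<iota> \<Omega> M \<subseteq> randomize C \<iota> \<Omega> (univ U)" unfolding randomize_def
  by (intro closure_of_mono image_mono simple_rvs_mono M_sub)
 then show ?thesis using CU_sub by simp
qed

text \<open>The set \<open>W\<close> holds the parameters and the tuples constructed before; it is finite, so
saturation applies.\<close>

lemma realization_exists:
 assumes p: "is_r L U M m \<mu> \<Omega> C \<iota> p" and W: "finite W" "W \<subseteq> cuniv C"
 shows "\<exists>a. crealizes L C (randomize C \<iota> \<Omega> M \<union> W) m p a"
proof -
 let ?W = "randomize C \<iota> \<Omega> M \<union> W"
 have sub: "?W \<subseteq> cuniv C" by (rule Un_least[OF randomize_M_sub W(2)])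
 have unc: "uncountable_card \<kappa>'" using cmonster by (simp add: cmonster_def)
 have "small \<kappa>' ?W" by (rule small_Un_countable[OF unc small_rand countable_finite[OF W(1)]])
 moreover have "is_ctype L C ?W m p"
  unfolding is_ctype_def
 proof (intro allI impI)
  fix F eps assume F: "F \<subseteq> param_cfms L ?W m" "finite F" and eps: "0 < (eps::real)"
  have "F \<subseteq> param_cfms L (cuniv C) m" by (rule order.trans[OF F(1) param_cfms_mono[OF sub]])
  then show "\<exists>a\<in>tuples m (cuniv C). \<forall>(\<psi>, c)\<in>F. \<bar>cval C \<psi> (a @ c) - p \<psi> c\<bar> \<le> eps"
   using p F(2) eps unfolding is_r_def is_ctype_def by (elim conjE) (rule allE, assumption, elim impE, assumption+, elim allE[of _ eps] impE, assumption+)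
 qed
 ultimately show ?thesis using cmonster sub unfolding cmonster_def by (meson)
qed

text \<open>If the inequality failed, the Morley sequence and the witnesses from \<open>witness_exists\<close> could be chosen
alternately.  Each \<open>g_j\<close> is chosen against all the \<open>a_i\<close> that exist already, which gives the upper bound
for \<open>i \<le> j\<close>, and each later \<open>a_i\<close> realizes the type over \<open>g_j\<close>, which gives the lower bound for
\<open>i > j\<close>.  The error \<open>(I - B) / 8\<close> leaves a gap between \<open>B + eps\<close> and \<open>I - 3 eps\<close>.\<close>

lemma iterated_integrals_le:
 assumes \<mu>: "keisler L U m \<mu>" "definable_measure L U M m \<mu>" and p: "is_r L U M m \<mu> \<Omega> C \<iota> p"
  and gs: "generically_stable L C (randomize C \<iota> \<Omega> M) m p"
  and \<nu>: "keisler L U k \<nu>" and D: "D \<in> \<D> (m + k)"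
 shows "lint (X k) (\<D> k) \<nu> (\<lambda>b. \<mu> {a \<in> X m. a @ b \<in> D}) \<le> lint (X m) (\<D> m) \<mu> (\<lambda>a. \<nu> {b \<in> X k. a @ b \<in> D})"
proof (rule ccontr)
 define I where "I = lint (X k) (\<D> k) \<nu> (\<lambda>b. \<mu> {a \<in> X m. a @ b \<in> D})"
 define B where "B = lint (X m) (\<D> m) \<mu> (\<lambda>a. \<nu> {b \<in> X k. a @ b \<in> D})"
 assume "\<not> ?thesis"
 then have less: "B < I" by (simp add: I_def B_def)
 interpret \<mu>: charge "X m" "\<D> m" \<mu> by (rule keisler_charge_univ[OF \<mu>(1)])
 interpret \<nu>: charge "X k" "\<D> k" \<nu> by (rule keisler_charge_univ[OF \<nu>])
 obtain \<phi> d where \<phi>: "fm L (m + k + length d) \<phi>" and d: "set d \<subseteq> univ U" and D_eq: "D = defset U (m + k) \<phi> d"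
  using D by (rule definableE)
 define eps where "eps = (I - B) / 8"
 have eps: "0 < eps" using less by (simp add: eps_def)
 let ?k = "k + length d"
 have \<phi>': "fm L (m + ?k) \<phi>" using \<phi> by (simp add: add.assoc)
 obtain c R \<theta> where
  ca: "set c \<subseteq> M \<and> (\<forall>\<phi>'\<in>{\<phi>}. finite (R \<phi>') \<and> (\<forall>r\<in>R \<phi>'. fm L (?k + length c) (\<theta> \<phi>' r)) \<and>
   (\<forall>b\<in>X ?k. \<bar>\<mu> (defset U m \<phi>' b) - (\<Sum>r\<in>R \<phi>'. r * of_bool (holds U (\<theta> \<phi>' r) (b @ c)))\<bar> \<le> eps))"
  by (atomize_elim, rule definable_approx[OF \<mu>(2) _ _ eps]) (use \<phi>' in simp_all)
 define R' where "R' = R \<phi>"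
 define \<eta> where "\<eta> = \<theta> \<phi>"
 have c: "set c \<subseteq> M" and R: "finite R'"
  and \<eta>: "!!r. r \<in> R' ==> fm L (?k + length c) (\<eta> r)"
  and near: "!!b. b \<in> X ?k ==> \<bar>\<mu> (defset U m \<phi> b) - (\<Sum>r\<in>R'. r * of_bool (holds U (\<eta> r) (b @ c)))\<bar> \<le> eps"
 proof -
  note ca' = bspec[OF conjunct2[OF ca] insertI1]
  show "set c \<subseteq> M" by (rule conjunct1[OF ca])
  show "finite R'" unfolding R'_def by (rule conjunct1[OF ca'])
  show "fm L (?k + length c) (\<eta> r)" if "r \<in> R'" for r
   unfolding \<eta>_def by (rule bspec[OF conjunct1[OF conjunct2[OF ca']] that[unfolded R'_def]])
  show "\<bar>\<mu> (defset U m \<phi> b) - (\<Sum>r\<in>R'. r * of_bool (holds U (\<eta> r) (b @ c)))\<bar> \<le> eps" if "b \<in> X ?k" for b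
   unfolding \<eta>_def R'_def by (rule bspec[OF conjunct2[OF conjunct2[OF ca']] that])
 qed
 have dc: "set (d @ c) \<subseteq> univ U" unfolding set_append by (rule Un_least[OF d order.trans[OF c M_sub(1)]])
 let ?T = "\<lambda>r. {b \<in> X k. holds U (\<eta> r) (b @ d @ c)}"
 have T: "?T r \<in> \<D> k" if "r \<in> R'" for r
 proof -
  have "fm L (k + length (d @ c)) (\<eta> r)" using \<eta>[OF that] by (simp add: add.assoc)
  from definableI[OF this dc] show ?thesis by (simp add: defset_def)
 qed
 define h where "h b = (\<Sum>r\<in>R'. r * indicator (?T r) b)" for b
 have h_step: "step (X k) (\<D> k) h" unfolding h_def[abs_def]
  by (rule \<nu>.step_sum[OF R]) (rule \<nu>.step_combine[OF \<nu>.step_const \<nu>.step_indicator[OF T]])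
 have bd: "b @ d \<in> X ?k" if "b \<in> X k" for b by (rule tuples_append[OF that]) (use d in \<open>simp add: tuples_def\<close>)
 have h_near: "\<bar>\<mu> {a \<in> X m. a @ b \<in> D} - h b\<bar> \<le> eps" if b: "b \<in> X k" for b
 proof -
  have "h b = (\<Sum>r\<in>R'. r * of_bool (holds U (\<eta> r) ((b @ d) @ c)))"
   unfolding h_def by (rule sum.cong[OF refl]) (use b in \<open>simp add: indicator_def\<close>)
  then show ?thesis using near[OF bd[OF b]] unfolding D_eq defset_fibre[OF b] by simp
 qed
 have "\<bar>I - sint (X k) \<nu> h\<bar> \<le> eps" unfolding I_def by (rule \<nu>.lint_approx[OF h_step h_near])
 moreover have "sint (X k) \<nu> h = (\<Sum>r\<in>R'. r * \<nu> (?T r))"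
 proof -
  have "sint (X k) \<nu> h = (\<Sum>r\<in>R'. r * sint (X k) \<nu> (indicator (?T r)))"
   unfolding h_def[abs_def] by (rule \<nu>.sint_sum[OF R \<nu>.step_indicator[OF T]])
  also have "\<dots> = (\<Sum>r\<in>R'. r * \<nu> (?T r))"
   by (rule sum.cong[OF refl]) (simp only: \<nu>.sint_indicator[OF T])
  finally show ?thesis .
 qed
 ultimately have I_le: "I - eps \<le> (\<Sum>r\<in>R'. r * \<nu> (?T r))" by linarith
 define S where "S = (\<Sum>r\<in>R'. \<bar>r\<bar>)"
 have S: "0 \<le> S" unfolding S_def by (rule sum_nonneg) simp
 define \<delta> where "\<delta> = min eps (eps / (1 + S))"
 have \<delta>: "0 < \<delta>" "\<delta> \<le> eps" "S * \<delta> \<le> eps"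
 proof -
  show "0 < \<delta>" "\<delta> \<le> eps" using eps S by (simp_all add: \<delta>_def)
  have "S * \<delta> \<le> (1 + S) * (eps / (1 + S))" by (rule mult_mono) (use S \<open>0 < \<delta>\<close> in \<open>simp_all add: \<delta>_def\<close>)
  then show "S * \<delta> \<le> eps" using S by simp
 qed
 let ?d = "map \<iota> (cst d)" and ?RM = "randomize C \<iota> \<Omega> M"
 define A where "A = ?RM \<union> set ?d"
 have \<iota>A: "\<iota> ` SR M \<subseteq> A"
  unfolding A_def by (rule le_supI1, rule image_subsetI, rule \<iota>_randomize[OF M_sub(1)])
 have dA: "set (map \<iota> (cst (d @ c))) \<subseteq> A"
 proof -
  have "set (map \<iota> (cst c)) \<subseteq> \<iota> ` SR M" unfolding set_map[of \<iota>] by (rule image_mono[OF set_cst[OF c]])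
  then have "set (map \<iota> (cst c)) \<subseteq> A" by (rule order.trans[OF _ \<iota>A])
  moreover have "set ?d \<subseteq> A" unfolding A_def by (rule Un_upper2)
  ultimately show ?thesis unfolding map_append set_append by (rule Un_least[rotated])
 qed
 have dC: "?d \<in> tuples (length d) (cuniv C)" by (intro \<iota>_tuples cst_tuples) (use d in \<open>simp add: tuples_def\<close>)
 have bound: "sint (X m) \<mu> h \<le> B" if h: "step (X m) (\<D> m) h" "!!x. x \<in> X m ==> h x \<le> \<nu> {b \<in> X k. holds U \<phi> (x @ b @ d)}" for h
 proof -
  have eq: "{b \<in> X k. x @ b \<in> D} = {b \<in> X k. holds U \<phi> (x @ b @ d)}" if "x \<in> X m" for x
   using tuples_append[OF that] by (auto simp: D_eq defset_def)
  show ?thesis unfolding B_def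
  proof (rule \<mu>.lint_upper[OF h(1), where c = 1])
   show "h x \<le> \<nu> {b \<in> X k. x @ b \<in> D}" if "x \<in> X m" for x unfolding eq[OF that] by (rule h(2)[OF that])
   show "\<nu> {b \<in> X k. x @ b \<in> D} \<le> 1" if "x \<in> X m" for x by (rule \<nu>.nu_le_1[OF cofibre_univ[OF D that]])
  qed
 qed
 have witness: "\<exists>g\<in>tuples k (cuniv C). (\<forall>a\<in>set as. cprob C \<phi> (a @ g @ ?d) \<le> B + eps) \<and>
   I - 3 * eps \<le> type_prob m p \<phi> (g @ ?d)"
  if as: "morley_list L C A m p as" for as
 proof -
  obtain \<theta>s where \<theta>s: "set \<theta>s = \<eta> ` R'" by (atomize_elim, rule finite_list[OF finite_imageI[OF R]])
  have fm\<theta>s: "fm L (k + length (d @ c)) \<theta>" if "\<theta> \<in> set \<theta>s" for \<theta>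
  proof -
   from that obtain r where "r \<in> R'" "\<theta> = \<eta> r" unfolding \<theta>s by (elim imageE)
   then show ?thesis using \<eta>[of r] by (simp add: add.assoc)
  qed
  have "\<exists>g\<in>tuples k (cuniv C). (\<forall>a\<in>set as. cprob C \<phi> (a @ g @ map \<iota> (cst d)) \<le> B + \<delta>) \<and>
   (\<forall>\<theta>\<in>set \<theta>s. \<bar>cprob C \<theta> (g @ map \<iota> (cst (d @ c))) - \<nu> {b \<in> X k. holds U \<theta> (b @ d @ c)}\<bar> \<le> \<delta>)"
   by (rule witness_exists[OF \<mu> p \<nu> \<iota>A as \<phi> dc dA fm\<theta>s bound \<delta>(1)])
  then obtain g where g: "g \<in> tuples k (cuniv C)" "\<forall>a\<in>set as. cprob C \<phi> (a @ g @ ?d) \<le> B + \<delta>"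
   "\<forall>\<theta>\<in>set \<theta>s. \<bar>cprob C \<theta> (g @ map \<iota> (cst (d @ c))) - \<nu> {b \<in> X k. holds U \<theta> (b @ d @ c)}\<bar> \<le> \<delta>"
   by (elim bexE conjE)
  let ?c = "\<lambda>r. cprob C (\<eta> r) ((g @ ?d) @ map \<iota> (cst c))"
  have gd: "g @ ?d \<in> tuples ?k (cuniv C)" by (rule tuples_append[OF g(1) dC])
  have "(\<Sum>r\<in>R'. r * \<nu> (?T r)) - (\<Sum>r\<in>R'. r * ?c r) \<le> \<bar>\<Sum>r\<in>R'. r * (\<nu> (?T r) - ?c r)\<bar>"
   by (simp add: sum_subtractf right_diff_distrib)
  also have "\<dots> \<le> (\<Sum>r\<in>R'. \<bar>r * (\<nu> (?T r) - ?c r)\<bar>)" by (rule sum_abs)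
  also have "\<dots> \<le> (\<Sum>r\<in>R'. \<bar>r\<bar> * \<delta>)"
  proof (rule sum_mono)
   fix r assume "r \<in> R'"
   then have "\<eta> r \<in> set \<theta>s" by (simp add: \<theta>s)
   from bspec[OF g(3) this] have "\<bar>\<nu> (?T r) - ?c r\<bar> \<le> \<delta>" by (simp add: abs_minus_commute)
   then show "\<bar>r * (\<nu> (?T r) - ?c r)\<bar> \<le> \<bar>r\<bar> * \<delta>" unfolding abs_mult by (rule mult_left_mono) simp
  qed
  also have "\<dots> \<le> eps" using \<delta>(3) by (simp add: S_def sum_distrib_right)
  finally have "I - 2 * eps \<le> (\<Sum>r\<in>R'. r * ?c r)" using I_le by linarith
  moreover have "\<bar>type_prob m p \<phi> (g @ ?d) - (\<Sum>r\<in>R'. r * ?c r)\<bar> \<le> eps"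
   by (rule type_prob_approx[OF p \<phi>' c R \<eta> near gd])
  ultimately have "I - 3 * eps \<le> type_prob m p \<phi> (g @ ?d)" by linarith
  moreover have "cprob C \<phi> (a @ g @ ?d) \<le> B + eps" if "a \<in> set as" for a
   using bspec[OF g(2) that] \<delta>(2) by linarith
  ultimately show ?thesis using g(1) by (intro bexI[of _ g] conjI ballI)
 qed
 \<comment> \<open>The lists of pairs \<open>(a_i, g_i)\<close> built so far, the newest first.\<close>
 let ?as = "map fst" and ?gs = "\<lambda>s. set (concat (map snd s))"
 let ?P = "\<lambda>(n::nat) s. morley_list L C A m p (?as s) \<and> ?gs s \<subseteq> cuniv C \<and> (n = 0 --> s = [])"
 let ?Q = "\<lambda>s s'. \<exists>a g. s' = (a, g) # s \<and> crealizes L C (A \<union> set (concat (?as s)) \<union> ?gs s) m p a \<and>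
  g \<in> tuples k (cuniv C) \<and> (\<forall>a\<in>set (?as s'). cprob C \<phi> (a @ g @ ?d) \<le> B + eps) \<and>
  I - 3 * eps \<le> type_prob m p \<phi> (g @ ?d)"
 have "\<exists>s. \<forall>n. ?P n (s n) \<and> ?Q (s n) (s (Suc n))"
 proof (rule dependent_nat_choice)
  show "\<exists>s. ?P 0 s" by (rule exI[of _ "[]"]) simp
 next
  fix s n assume s: "?P n s"
  have asC: "set (concat (?as s)) \<subseteq> cuniv C"
   using tuplesD(2)[OF concat_tuples[OF morley_list_tuples[OF conjunct1[OF s]]]] .
  let ?W = "set ?d \<union> set (concat (?as s)) \<union> ?gs s"
  have "?W \<subseteq> cuniv C" using asC s tuplesD(2)[OF dC] by (intro Un_least) simp_all
  from realization_exists[OF p _ this] obtain a where "crealizes L C (?RM \<union> ?W) m p a" by auto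
  then have a: "crealizes L C (A \<union> set (concat (?as s)) \<union> ?gs s) m p a" by (simp only: A_def Un_assoc)
  have ml: "morley_list L C A m p (a # ?as s)"
   unfolding morley_list.simps by (rule conjI[OF crealizes_mono[OF a Un_upper1] conjunct1[OF s]])
  from witness[OF ml] obtain g where g: "g \<in> tuples k (cuniv C)"
   "\<forall>a'\<in>set (a # ?as s). cprob C \<phi> (a' @ g @ ?d) \<le> B + eps" "I - 3 * eps \<le> type_prob m p \<phi> (g @ ?d)"
   by (elim bexE conjE)
  have as_eq: "?as ((a, g) # s) = a # ?as s" by simp
  show "\<exists>s'. ?P (Suc n) s' \<and> ?Q s s'"
  proof (rule exI[of _ "(a, g) # s"], rule conjI)
   have "?gs ((a, g) # s) \<subseteq> cuniv C"
    using tuplesD(2)[OF g(1)] conjunct1[OF conjunct2[OF s]] by simp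
   then show "?P (Suc n) ((a, g) # s)" unfolding as_eq by (intro conjI ml) simp_all
   show "?Q s ((a, g) # s)"
    by (rule exI[of _ a], rule exI[of _ g], unfold as_eq, intro conjI refl a g)
  qed
 qed
 then obtain s where s12: "\<forall>n. ?P n (s n) \<and> ?Q (s n) (s (Suc n))" by (elim exE)
 note s = conjunct1[OF spec[OF s12]] conjunct2[OF spec[OF s12]]
 define a where "a n = fst (hd (s (Suc n)))" for n
 define g where "g n = snd (hd (s (Suc n)))" for n
 have sSuc: "s (Suc n) = (a n, g n) # s n"
  and real: "crealizes L C (A \<union> set (concat (?as (s n))) \<union> ?gs (s n)) m p (a n)"
  and gC: "g n \<in> tuples k (cuniv C)"
  and upper: "a' \<in> set (?as (s (Suc n))) ==> cprob C \<phi> (a' @ g n @ ?d) \<le> B + eps"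
  and lower: "I - 3 * eps \<le> type_prob m p \<phi> (g n @ ?d)" for n a'
 proof -
  from s(2)[of n] obtain a1 g1 where ag: "s (Suc n) = (a1, g1) # s n \<and> crealizes L C (A \<union> set (concat (?as (s n))) \<union> ?gs (s n)) m p a1 \<and>
   g1 \<in> tuples k (cuniv C) \<and> (\<forall>a\<in>set (?as (s (Suc n))). cprob C \<phi> (a @ g1 @ ?d) \<le> B + eps) \<and>
   I - 3 * eps \<le> type_prob m p \<phi> (g1 @ ?d)" by (elim exE)
  have e: "a1 = a n" "g1 = g n" using conjunct1[OF ag] by (simp_all add: a_def g_def)
  note ag' = ag[unfolded e]
  show "s (Suc n) = (a n, g n) # s n" by (rule conjunct1[OF ag'])
  show "crealizes L C (A \<union> set (concat (?as (s n))) \<union> ?gs (s n)) m p (a n)" by (rule conjunct1[OF conjunct2[OF ag']])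
  show "g n \<in> tuples k (cuniv C)" by (rule conjunct1[OF conjunct2[OF conjunct2[OF ag']]])
  show "cprob C \<phi> (a' @ g n @ ?d) \<le> B + eps" if "a' \<in> set (?as (s (Suc n)))"
   by (rule bspec[OF conjunct1[OF conjunct2[OF conjunct2[OF conjunct2[OF ag']]]] that])
  show "I - 3 * eps \<le> type_prob m p \<phi> (g n @ ?d)" by (rule conjunct2[OF conjunct2[OF conjunct2[OF conjunct2[OF ag']]]])
 qed
 have set_s: "set (s n) = (\<lambda>i. (a i, g i)) ` {..<n}" for n
 proof (induction n)
  case 0
  then show ?case using s(1)[of 0] by simp
 next
  case (Suc n)
  then show ?case by (simp add: sSuc lessThan_Suc)
 qed
 have mem_a: "a i \<in> set (?as (s n))" and mem_g: "g i \<in> set (map snd (s n))" if "i < n" for i n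
 proof -
  have "(a i, g i) \<in> set (s n)" unfolding set_s by (rule imageI) (use that in simp)
  from imageI[OF this, of fst] imageI[OF this, of snd]
  show "a i \<in> set (?as (s n))" "g i \<in> set (map snd (s n))" by simp_all
 qed
 have "morley_sequence L C ?RM m p a"
  unfolding morley_sequence_def
 proof
  fix i
  have "?RM \<union> (\<Union>j<i. set (a j)) \<subseteq> A \<union> set (concat (?as (s i))) \<union> ?gs (s i)"
  proof (intro Un_least UN_least)
   show "?RM \<subseteq> A \<union> set (concat (?as (s i))) \<union> ?gs (s i)" unfolding A_def by (intro le_supI1 Un_upper1)
   show "set (a j) \<subseteq> A \<union> set (concat (?as (s i))) \<union> ?gs (s i)" if "j \<in> {..<i}" for j
   proof (rule le_supI1, rule le_supI2)
    show "set (a j) \<subseteq> set (concat (?as (s i)))"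
     unfolding set_concat by (rule UN_upper[OF mem_a]) (use that in simp)
   qed
  qed
  from crealizes_mono[OF real this] show "crealizes L C (?RM \<union> (\<Union>j<i. set (a j))) m p (a i)" .
 qed
 moreover have bC: "g j @ ?d \<in> tuples ?k (cuniv C)" for j by (rule tuples_append[OF gC dC])
 moreover have val: "cval C (CProb \<phi> [0..<m + ?k]) (a i @ g j @ ?d) = cprob C \<phi> (a i @ g j @ ?d)" for i j
  by (rule cval_CProb) (use real[of i] tuplesD(1)[OF bC[of j]] in \<open>simp add: crealizes_def tuples_def\<close>)
 moreover have "cprob C \<phi> (a i @ g j @ ?d) \<le> B + eps" if "i \<le> j" for i j
  by (rule upper, rule mem_a) (use that in simp)
 moreover have "I - 3 * eps \<le> cprob C \<phi> (a i @ g j @ ?d)" if "j < i" for i j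
 proof -
  have "set (g j @ ?d) \<subseteq> A \<union> set (concat (?as (s i))) \<union> ?gs (s i)"
   unfolding set_append
  proof (rule Un_least)
   show "set (g j) \<subseteq> A \<union> set (concat (?as (s i))) \<union> ?gs (s i)"
    unfolding set_concat[of "map snd (s i)"] by (rule le_supI2, rule UN_upper[OF mem_g[OF that]])
   show "set ?d \<subseteq> A \<union> set (concat (?as (s i))) \<union> ?gs (s i)" unfolding A_def by (intro le_supI1 Un_upper2)
  qed
  then have "(CProb \<phi> [0..<m + ?k], g j @ ?d) \<in> param_cfms L (A \<union> set (concat (?as (s i))) \<union> ?gs (s i)) m"
   using \<phi>' tuplesD(1)[OF bC[of j]] unfolding param_cfms_def cfm_def by (auto simp del: set_concat set_append)
  then have "cval C (CProb \<phi> [0..<m + ?k]) (a i @ g j @ ?d) = p (CProb \<phi> [0..<m + ?k]) (g j @ ?d)"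
   using real[of i] unfolding crealizes_def by (meson case_prodD)
  then show ?thesis using lower[of j] val[of i j] tuplesD(1)[OF bC[of j]] by (simp add: type_prob_def)
 qed
 moreover have "cfm L (m + ?k) (CProb \<phi> [0..<m + ?k])" using \<phi>' by (auto simp: cfm_def)
 moreover have "B + eps < I - 3 * eps" unfolding eps_def using less by (simp add: field_simps)
 ultimately have "\<exists>\<psi> k a b r s. cfm L (m + k) \<psi> \<and> morley_sequence L C ?RM m p a \<and>
   (\<forall>j. b j \<in> tuples k (cuniv C)) \<and> r < s \<and> (\<forall>i j. i \<le> j --> cval C \<psi> (a i @ b j) \<le> r) \<and>
   (\<forall>i j. i > j --> cval C \<psi> (a i @ b j) \<ge> s)"
  by (intro exI[of _ "CProb \<phi> [0..<m + ?k]"] exI[of _ ?k] exI[of _ a] exI[of _ "\<lambda>j. g j @ ?d"]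
    exI[of _ "B + eps"] exI[of _ "I - 3 * eps"] conjI allI impI) (simp_all only: val)
 then show False using gs unfolding generically_stable_def by (elim conjE notE)
qed

end

section \<open>Symmetry of the powers\<close>

text \<open>On points, renaming the blocks of variables acts in the opposite direction: \<open>permute_blocks\<close> is the
preimage under \<open>bperm\<close> of the inverse permutation.  Preimages are what integrals transform along.\<close>

definition bperm :: "nat => nat => (nat => nat) => 'x list => 'x list" where
 "bperm m n \<sigma> w = concat (map (\<lambda>i. map (\<lambda>j. w ! (\<sigma> i * m + j)) [0..<m]) [0..<n])"

lemma block_index:
 assumes "i < n" "j < m"
 shows "i * m + j < n * (m::nat)"
proof -
 have "i * m + j < Suc i * m" using assms by simp
 also have "\<dots> \<le> n * m" using assms by (intro mult_le_mono1) simp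
 finally show ?thesis .
qed

lemma bperm_tuples:
 assumes "w \<in> tuples (n * m) S" "\<sigma> permutes {..<n}"
 shows "bperm m n \<sigma> w \<in> tuples (n * m) S"
proof -
 let ?xs = "map (\<lambda>i. map (\<lambda>j. w ! (\<sigma> i * m + j)) [0..<m]) [0..<n]"
 have "w ! (\<sigma> i * m + j) \<in> S" if "i < n" "j < m" for i j
 proof -
  have "\<sigma> i < n" using permutes_in_image[OF assms(2), of i] that(1) by simp
  then have "w ! (\<sigma> i * m + j) \<in> set w" using block_index[of "\<sigma> i" n j m] that(2) tuplesD(1)[OF assms(1)] by simp
  then show ?thesis by (rule subsetD[OF tuplesD(2)[OF assms(1)]])
 qed
 then have "set ?xs \<subseteq> tuples m S" by (auto simp: tuples_def)
 from concat_tuples[OF this] show ?thesis by (simp add: bperm_def)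
qed

lemma bperm_nth:
 assumes "i < n" "j < m"
 shows "bperm m n \<sigma> w ! (i * m + j) = w ! (\<sigma> i * m + j)"
proof -
 let ?xs = "map (\<lambda>i. map (\<lambda>j. w ! (\<sigma> i * m + j)) [0..<m]) [0..<n]"
 have "concat ?xs ! (i * m + j) = ?xs ! i ! j"
  by (rule nth_concat_block[of _ m UNIV]) (use assms in \<open>auto simp: tuples_def\<close>)
 then show ?thesis using assms by (simp add: bperm_def)
qed

text \<open>The order of composition is reversed because \<open>\<sigma>\<close> acts on positions.\<close>

lemma bperm_comp:
 assumes "\<sigma> permutes {..<n}"
 shows "bperm m n \<sigma> (bperm m n \<tau> w) = bperm m n (\<tau> \<circ> \<sigma>) w"
proof -
 have "map (\<lambda>j. bperm m n \<tau> w ! (\<sigma> i * m + j)) [0..<m] = map (\<lambda>j. w ! ((\<tau> \<circ> \<sigma>) i * m + j)) [0..<m]"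
  if "i < n" for i
 proof -
  have "\<sigma> i < n" using permutes_in_image[OF assms, of i] that by simp
  then show ?thesis by (intro map_cong refl) (simp add: bperm_nth)
 qed
 then show ?thesis unfolding bperm_def[of m n \<sigma>] bperm_def[of m n "\<tau> \<circ> \<sigma>"]
  by (intro arg_cong[where f = concat] map_cong refl) simp
qed

lemma bperm_id: "length w = n * m ==> bperm m n id w = w"
 using concat_blocks[of w n m] by (simp add: bperm_def blocks_def)

lemma permute_blocks_eq:
 assumes D: "D \<subseteq> tuples (n * m) S" and \<sigma>: "\<sigma> permutes {..<n}"
 shows "permute_blocks m n \<sigma> D = {w \<in> tuples (n * m) S. bperm m n (inv \<sigma>) w \<in> D}"
proof (intro equalityI subsetI)
 fix w assume "w \<in> permute_blocks m n \<sigma> D"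
 then obtain xs where xs: "w = concat (map (\<lambda>i. xs ! \<sigma> i) [0..<n])" "length xs = n"
  "\<forall>x\<in>set xs. length x = m" "concat xs \<in> D" unfolding permute_blocks_def by blast
 have xs': "set xs \<subseteq> tuples m UNIV" using xs(3) by (auto simp: tuples_def)
 have v: "concat xs \<in> tuples (n * m) S" by (rule subsetD[OF D xs(4)])
 have "map (\<lambda>j. concat xs ! (\<sigma> i * m + j)) [0..<m] = xs ! \<sigma> i" if "i < n" for i
 proof -
  have si: "\<sigma> i < length xs" using permutes_in_image[OF \<sigma>, of i] that xs(2) by simp
  then have "length (xs ! \<sigma> i) = m" using xs(3) nth_mem by blast
  then show ?thesis by (intro nth_equalityI) (simp_all add: nth_concat_block[OF xs' si])
 qed
 then have w: "w = bperm m n \<sigma> (concat xs)" unfolding bperm_def xs(1)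
  by (intro arg_cong[where f = concat] map_cong refl) simp
 have "bperm m n (inv \<sigma>) w = bperm m n (\<sigma> \<circ> inv \<sigma>) (concat xs)"
  unfolding w by (rule bperm_comp[OF permutes_inv[OF \<sigma>]])
 also have "\<dots> = concat xs" unfolding permutes_inv_o(1)[OF \<sigma>] by (rule bperm_id[OF tuplesD(1)[OF v]])
 finally show "w \<in> {w \<in> tuples (n * m) S. bperm m n (inv \<sigma>) w \<in> D}"
  using xs(4) bperm_tuples[OF v \<sigma>] w by simp
next
 fix w assume "w \<in> {w \<in> tuples (n * m) S. bperm m n (inv \<sigma>) w \<in> D}"
 then have w: "w \<in> tuples (n * m) S" "bperm m n (inv \<sigma>) w \<in> D" by simp_all
 let ?v = "bperm m n (inv \<sigma>) w"
 have v: "?v \<in> tuples (n * m) S" by (rule subsetD[OF D w(2)])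
 have "bperm m n \<sigma> ?v = bperm m n (inv \<sigma> \<circ> \<sigma>) w" by (rule bperm_comp[OF \<sigma>])
 also have "\<dots> = w" unfolding permutes_inv_o(2)[OF \<sigma>] by (rule bperm_id[OF tuplesD(1)[OF w(1)]])
 finally have "w = bperm m n \<sigma> ?v" by simp
 also have "\<dots> = concat (map (\<lambda>i. blocks m n ?v ! \<sigma> i) [0..<n])"
  unfolding bperm_def[of m n \<sigma>]
 proof (intro arg_cong[where f = concat] map_cong refl)
  fix i assume "i \<in> set [0..<n]"
  then have "\<sigma> i < n" using permutes_in_image[OF \<sigma>, of i] by simp
  then show "map (\<lambda>j. ?v ! (\<sigma> i * m + j)) [0..<m] = blocks m n ?v ! \<sigma> i" by (simp add: blocks_def)
 qed
 finally have eq: "w = concat (map (\<lambda>i. blocks m n ?v ! \<sigma> i) [0..<n])" .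
 have "length (blocks m n ?v) = n \<and> (\<forall>x\<in>set (blocks m n ?v). length x = m) \<and> concat (blocks m n ?v) \<in> D"
  using blocks_tuples[OF v] w(2) concat_blocks[OF tuplesD(1)[OF v]] by (auto simp: tuples_def)
 then show "w \<in> permute_blocks m n \<sigma> D" unfolding permute_blocks_def
  by (intro CollectI exI[of _ "blocks m n ?v"] conjI eq) simp_all
qed

lemma bperm_shift:
 assumes x: "length x = m" and "\<sigma> 0 = 0" "!!i. i < n ==> \<sigma> (Suc i) = Suc (\<tau> i)"
 shows "bperm m (Suc n) \<sigma> (x @ z) = x @ bperm m n \<tau> z"
proof -
 have up: "[0..<Suc n] = 0 # map Suc [0..<n]" by (simp add: map_Suc_upt upt_conv_Cons del: upt_Suc)
 have 1: "map (\<lambda>j. (x @ z) ! (\<sigma> 0 * m + j)) [0..<m] = x"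
  using x assms(2) by (intro nth_equalityI) (simp_all add: nth_append)
 have 2: "map (\<lambda>j. (x @ z) ! (\<sigma> (Suc i) * m + j)) [0..<m] = map (\<lambda>j. z ! (\<tau> i * m + j)) [0..<m]" if "i < n" for i
 proof (intro map_cong refl)
  fix j
  have "(x @ z) ! (\<sigma> (Suc i) * m + j) = (x @ z) ! (length x + (\<tau> i * m + j))"
   using assms(3)[OF that] x by (simp add: add.assoc)
  then show "(x @ z) ! (\<sigma> (Suc i) * m + j) = z ! (\<tau> i * m + j)" by (simp only: nth_append_length_plus)
 qed
 have "bperm m (Suc n) \<sigma> (x @ z) = x @ concat (map (\<lambda>i. map (\<lambda>j. (x @ z) ! (\<sigma> (Suc i) * m + j)) [0..<m]) [0..<n])"
  unfolding bperm_def up by (simp only: list.map concat.simps 1 map_map comp_def)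
 also have "map (\<lambda>i. map (\<lambda>j. (x @ z) ! (\<sigma> (Suc i) * m + j)) [0..<m]) [0..<n] = map (\<lambda>i. map (\<lambda>j. z ! (\<tau> i * m + j)) [0..<m]) [0..<n]"
  by (rule map_cong[OF refl]) (rule 2, simp)
 finally show ?thesis by (simp only: bperm_def)
qed

lemma bperm_swap:
 assumes "length a = m" "length b = m" "length z = n * m"
 shows "bperm m (Suc (Suc n)) (Transposition.transpose 0 1) (a @ b @ z) = b @ a @ z"
proof -
 let ?w = "a @ b @ z" and ?\<sigma> = "Transposition.transpose 0 (1::nat)"
 have up: "[0..<Suc (Suc n)] = 0 # 1 # map (\<lambda>i. Suc (Suc i)) [0..<n]"
  by (rule nth_equalityI) (auto simp: nth_Cons split: nat.split simp del: upt_Suc)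
 have 0: "map (\<lambda>j. ?w ! (?\<sigma> 0 * m + j)) [0..<m] = b"
  using assms by (intro nth_equalityI) (simp_all add: nth_append)
 have 1: "map (\<lambda>j. ?w ! (?\<sigma> 1 * m + j)) [0..<m] = a"
  using assms by (intro nth_equalityI) (simp_all add: nth_append)
 have 2: "map (\<lambda>j. ?w ! (?\<sigma> (Suc (Suc i)) * m + j)) [0..<m] = map (\<lambda>j. z ! (i * m + j)) [0..<m]" for i
 proof (intro map_cong refl)
  fix j
  have "?\<sigma> (Suc (Suc i)) * m + j = length (a @ b) + (i * m + j)" using assms by (simp add: Transposition.transpose_def)
  then have "?w ! (?\<sigma> (Suc (Suc i)) * m + j) = ((a @ b) @ z) ! (length (a @ b) + (i * m + j))" by (simp only: append_assoc)
  then show "?w ! (?\<sigma> (Suc (Suc i)) * m + j) = z ! (i * m + j)" by (simp only: nth_append_length_plus)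
 qed
 have "bperm m (Suc (Suc n)) ?\<sigma> ?w = b @ a @ concat (blocks m n z)"
  unfolding bperm_def up blocks_def by (simp only: list.map concat.simps 0 1 2 map_map comp_def)
 then show ?thesis using concat_blocks[OF assms(3)] by simp
qed

lemma lint_measure_cong:
 assumes "!!D. D \<in> \<A> ==> \<nu> D = \<nu>' D"
 shows "lint X \<A> \<nu> f = lint X \<A> \<nu>' f"
 unfolding lint_def
proof (rule SUP_cong[OF refl])
 fix h assume "h \<in> {h. step X \<A> h \<and> (\<forall>x\<in>X. h x \<le> f x)}"
 then have "{x \<in> X. h x = r} \<in> \<A>" for r by (simp add: step_def)
 then show "sint X \<nu> h = sint X \<nu>' h" unfolding sint_def by (intro sum.cong refl) (simp add: assms)
qed

lemma eq_if_close:
 fixes a b :: real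
 assumes "!!eps. 0 < eps ==> \<bar>a - b\<bar> \<le> 4 * eps"
 shows "a = b"
proof (rule ccontr)
 assume "a \<noteq> b"
 then have "0 < \<bar>a - b\<bar> / 8" by simp
 from assms[OF this] show False using \<open>a \<noteq> b\<close> by simp
qed

context charge
begin

lemma sint_over:
 assumes "finite R" "h ` X \<subseteq> R"
 shows "sint X \<nu> h = (\<Sum>r\<in>R. r * \<nu> {x \<in> X. h x = r})"
 unfolding sint_def
proof (rule sum.mono_neutral_left[OF assms], rule ballI)
 fix r assume "r \<in> R - h ` X"
 then have "{x \<in> X. h x = r} = {}" by auto
 then show "r * \<nu> {x \<in> X. h x = r} = 0" by (simp only: nu_empty mult_zero_right)
qed

text \<open>Only step functions have to be transported, since \<open>f\<close> is a uniform limit of them.\<close>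

lemma lint_invariant:
 assumes \<tau>: "!!x. x \<in> X ==> \<tau> x \<in> X" and pre: "!!D. D \<in> \<A> ==> {x \<in> X. \<tau> x \<in> D} \<in> \<A>"
  and inv: "!!D. D \<in> \<A> ==> \<nu> {x \<in> X. \<tau> x \<in> D} = \<nu> D" and f: "tame X \<A> f"
 shows "lint X \<A> \<nu> (\<lambda>x. f (\<tau> x)) = lint X \<A> \<nu> f"
proof (rule eq_if_close)
 fix eps :: real assume eps: "0 < eps"
 obtain h where h: "step X \<A> h" "\<forall>x\<in>X. \<bar>f x - h x\<bar> \<le> eps" using f eps unfolding tame_def by meson
 have fin: "finite (h ` X)" and lev: "{x \<in> X. h x = r} \<in> \<A>" for r using h(1) by (simp_all add: step_def)
 have sub: "(\<lambda>x. h (\<tau> x)) ` X \<subseteq> h ` X" by (rule image_subsetI) (rule imageI[OF \<tau>])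
 have eq: "{x \<in> X. h (\<tau> x) = r} = {x \<in> X. \<tau> x \<in> {y \<in> X. h y = r}}" for r using \<tau> by auto
 have st: "step X \<A> (\<lambda>x. h (\<tau> x))"
  unfolding step_def using finite_subset[OF sub fin] pre[OF lev] by (simp only: eq simp_thms)
 have "sint X \<nu> (\<lambda>x. h (\<tau> x)) = (\<Sum>r\<in>h ` X. r * \<nu> {x \<in> X. h (\<tau> x) = r})" by (rule sint_over[OF fin sub])
 also have "\<dots> = sint X \<nu> h" unfolding sint_def by (simp only: eq inv[OF lev])
 finally have s: "sint X \<nu> (\<lambda>x. h (\<tau> x)) = sint X \<nu> h" .
 have "\<bar>lint X \<A> \<nu> (\<lambda>x. f (\<tau> x)) - sint X \<nu> (\<lambda>x. h (\<tau> x))\<bar> \<le> eps"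
  by (rule lint_approx[OF st]) (rule bspec[OF h(2) \<tau>])
 moreover have "\<bar>lint X \<A> \<nu> f - sint X \<nu> h\<bar> \<le> eps" by (rule lint_approx[OF h(1)]) (rule bspec[OF h(2)])
 ultimately show "\<bar>lint X \<A> \<nu> (\<lambda>x. f (\<tau> x)) - lint X \<A> \<nu> f\<bar> \<le> 4 * eps" using s eps by linarith
qed

lemma lint_sum:
 assumes "finite I" "!!i. i \<in> I ==> tame X \<A> (f i)"
 shows "tame X \<A> (\<lambda>x. \<Sum>i\<in>I. c i * f i x) \<and> lint X \<A> \<nu> (\<lambda>x. \<Sum>i\<in>I. c i * f i x) = (\<Sum>i\<in>I. c i * lint X \<A> \<nu> (f i))"
 using assms
proof (induction I rule: finite_induct)
 case empty
 show ?case using tame_step[OF step_const[of 0]] lint_step[OF step_const[of 0]] sint_const[of 0] by simp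
next
 case (insert i I)
 have IH: "tame X \<A> (\<lambda>x. \<Sum>i\<in>I. c i * f i x)" "lint X \<A> \<nu> (\<lambda>x. \<Sum>i\<in>I. c i * f i x) = (\<Sum>i\<in>I. c i * lint X \<A> \<nu> (f i))"
  using insert.IH insert.prems by simp_all
 have i: "tame X \<A> (f i)" using insert.prems by simp
 have eq: "(\<lambda>x. \<Sum>j\<in>insert i I. c j * f j x) = (\<lambda>x. c i * f i x + 1 * (\<Sum>j\<in>I. c j * f j x))"
  using insert.hyps by simp
 show ?case unfolding eq using tame_linear[OF i IH(1), of "c i" 1] lint_linear[OF i IH(1), of "c i" 1] IH(2) insert.hyps by simp
qed

end

locale symmetric_measure = monster_model L \<kappa> U M
 for L :: "('f, 'r) lang" and \<kappa> :: "'k rel" and U :: "('a, 'f, 'r) struct" and M :: "'a set" +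
 fixes m :: nat and \<mu> :: "'a list set => real"
 assumes keisler: "keisler L U m \<mu>" and definable: "definable_measure L U M m \<mu>"
  and symmetric: "D \<in> \<D> (m + m) ==> lint (X m) (\<D> m) \<mu> (\<lambda>b. \<mu> {a \<in> X m. a @ b \<in> D})
   = lint (X m) (\<D> m) \<mu> (\<lambda>a. \<mu> {b \<in> X m. a @ b \<in> D})"
begin

sublocale \<mu>: charge "X m" "\<D> m" \<mu> by (rule keisler_charge_univ[OF keisler])

abbreviation "pw \<equiv> morley_power L \<kappa> U M m \<mu>"

abbreviation "prd k \<nu> \<equiv> \<lambda>D. lint (X k) (\<D> k) \<nu> (\<lambda>z. \<mu> {a \<in> X m. a @ z \<in> D})"

lemma fibre_tame:
 assumes "D \<in> \<D> (m + k)"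
 shows "tame (X k) (\<D> k) (\<lambda>z. \<mu> {a \<in> X m. a @ z \<in> D})"
 by (rule definable_fibre_tame[OF definable assms M_sub(1) order.refl])

lemma product_keisler:
 assumes \<nu>: "keisler L U k \<nu>"
 shows "keisler L U (m + k) (prd k \<nu>)"
proof -
 interpret \<nu>: charge "X k" "\<D> k" \<nu> by (rule keisler_charge_univ[OF \<nu>])
 let ?F = "\<lambda>D z. \<mu> {a \<in> X m. a @ z \<in> D}"
 have "0 \<le> prd k \<nu> D" if D: "D \<in> \<D> (m + k)" for D
 proof -
  have "sint (X k) \<nu> (\<lambda>_. 0) \<le> prd k \<nu> D"
  proof (rule \<nu>.lint_upper[OF \<nu>.step_const, where c = 1])
   show "0 \<le> ?F D z" if "z \<in> X k" for z by (rule \<mu>.nonneg[OF fibre_univ[OF D that]])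
   show "?F D z \<le> 1" if "z \<in> X k" for z by (rule \<mu>.nu_le_1[OF fibre_univ[OF D that]])
  qed
  then show ?thesis by (simp only: \<nu>.sint_const)
 qed
 moreover have "prd k \<nu> (X (m + k)) = 1"
 proof -
  have "prd k \<nu> (X (m + k)) = lint (X k) (\<D> k) \<nu> (\<lambda>_. 1)"
  proof (rule \<nu>.lint_cong)
   fix z assume z: "z \<in> X k"
   have "{a \<in> X m. a @ z \<in> X (m + k)} = X m" using tuples_append[OF _ z] by auto
   then show "?F (X (m + k)) z = 1" using \<mu>.total by simp
  qed
  then show ?thesis using \<nu>.lint_step[OF \<nu>.step_const[of 1]] \<nu>.sint_const[of 1] by simp
 qed
 moreover have "prd k \<nu> (D \<union> E) = prd k \<nu> D + prd k \<nu> E"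
  if D: "D \<in> \<D> (m + k)" and E: "E \<in> \<D> (m + k)" and disj: "D \<inter> E = {}" for D E
 proof -
  have "prd k \<nu> (D \<union> E) = lint (X k) (\<D> k) \<nu> (\<lambda>z. 1 * ?F D z + 1 * ?F E z)"
  proof (rule \<nu>.lint_cong)
   fix z assume z: "z \<in> X k"
   have "{a \<in> X m. a @ z \<in> D \<union> E} = {a \<in> X m. a @ z \<in> D} \<union> {a \<in> X m. a @ z \<in> E}" by auto
   moreover have "{a \<in> X m. a @ z \<in> D} \<inter> {a \<in> X m. a @ z \<in> E} = {}" using disj by auto
   ultimately show "?F (D \<union> E) z = 1 * ?F D z + 1 * ?F E z"
    using \<mu>.nu_Un[OF fibre_univ[OF D z] fibre_univ[OF E z]] by simp
  qed
  also have "\<dots> = 1 * prd k \<nu> D + 1 * prd k \<nu> E" by (rule \<nu>.lint_linear[OF fibre_tame[OF D] fibre_tame[OF E]])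
  finally show ?thesis by simp
 qed
 ultimately show ?thesis unfolding keisler_def additive_def by (intro conjI ballI impI)
qed

text \<open>A Fubini theorem in the only direction that is available for definable measures.  For indicators it is
the definition of the product, and both sides are continuous under uniform limits.\<close>

lemma iterate_integrals:
 assumes \<nu>: "keisler L U k \<nu>" and F: "tame (X (m + k)) (\<D> (m + k)) F"
 shows "lint (X (m + k)) (\<D> (m + k)) (prd k \<nu>) F
  = lint (X k) (\<D> k) \<nu> (\<lambda>z. lint (X m) (\<D> m) \<mu> (\<lambda>b. F (b @ z)))"
proof (rule eq_if_close)
 interpret \<nu>: charge "X k" "\<D> k" \<nu> by (rule keisler_charge_univ[OF \<nu>])
 interpret P: charge "X (m + k)" "\<D> (m + k)" "prd k \<nu>" by (rule keisler_charge_univ[OF product_keisler[OF \<nu>]])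
 fix eps :: real assume eps: "0 < eps"
 obtain h where h: "step (X (m + k)) (\<D> (m + k)) h" "\<forall>x\<in>X (m + k). \<bar>F x - h x\<bar> \<le> eps"
  using F eps unfolding tame_def by meson
 let ?R = "h ` X (m + k)" and ?H = "\<lambda>r. {x \<in> X (m + k). h x = r}"
 have fin: "finite ?R" and lev: "?H r \<in> \<D> (m + k)" for r using h(1) by (simp_all add: step_def)
 define Q where "Q z = (\<Sum>r\<in>?R. r * \<mu> {b \<in> X m. b @ z \<in> ?H r})" for z
 have sP: "sint (X (m + k)) (prd k \<nu>) h = lint (X k) (\<D> k) \<nu> Q"
  unfolding sint_def Q_def[abs_def] by (rule conjunct2[OF \<nu>.lint_sum[OF fin fibre_tame[OF lev]], symmetric])
 have Qt: "tame (X k) (\<D> k) Q"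
  unfolding Q_def[abs_def] by (rule conjunct1[OF \<nu>.lint_sum[OF fin fibre_tame[OF lev]]])
 have near: "\<bar>lint (X m) (\<D> m) \<mu> (\<lambda>b. F (b @ z)) - Q z\<bar> \<le> eps" if z: "z \<in> X k" for z
 proof -
  have eq: "{b \<in> X m. h (b @ z) = r} = {b \<in> X m. b @ z \<in> ?H r}" for r using tuples_append[OF _ z] by auto
  have sub: "(\<lambda>b. h (b @ z)) ` X m \<subseteq> ?R" by (rule image_subsetI) (rule imageI[OF tuples_append[OF _ z]])
  have st: "step (X m) (\<D> m) (\<lambda>b. h (b @ z))"
   unfolding step_def using finite_subset[OF sub fin] fibre_univ[OF lev z] by (simp only: eq simp_thms)
  have "sint (X m) \<mu> (\<lambda>b. h (b @ z)) = Q z" unfolding \<mu>.sint_over[OF fin sub] Q_def by (simp only: eq)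
  moreover have "\<bar>lint (X m) (\<D> m) \<mu> (\<lambda>b. F (b @ z)) - sint (X m) \<mu> (\<lambda>b. h (b @ z))\<bar> \<le> eps"
   by (rule \<mu>.lint_approx[OF st]) (rule bspec[OF h(2) tuples_append[OF _ z]])
  ultimately show ?thesis by simp
 qed
 obtain h2 where h2: "step (X k) (\<D> k) h2" "\<forall>z\<in>X k. \<bar>Q z - h2 z\<bar> \<le> eps" using Qt eps unfolding tame_def by meson
 have "\<bar>lint (X (m + k)) (\<D> (m + k)) (prd k \<nu>) F - sint (X (m + k)) (prd k \<nu>) h\<bar> \<le> eps"
  by (rule P.lint_approx[OF h(1)]) (rule bspec[OF h(2)])
 moreover have "\<bar>lint (X k) (\<D> k) \<nu> Q - sint (X k) \<nu> h2\<bar> \<le> eps"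
  by (rule \<nu>.lint_approx[OF h2(1)]) (rule bspec[OF h2(2)])
 moreover have "\<bar>lint (X k) (\<D> k) \<nu> (\<lambda>z. lint (X m) (\<D> m) \<mu> (\<lambda>b. F (b @ z))) - sint (X k) \<nu> h2\<bar> \<le> 2 * eps"
 proof (rule \<nu>.lint_approx[OF h2(1)])
  fix z assume z: "z \<in> X k"
  show "\<bar>lint (X m) (\<D> m) \<mu> (\<lambda>b. F (b @ z)) - h2 z\<bar> \<le> 2 * eps" using near[OF z] bspec[OF h2(2) z] by linarith
 qed
 ultimately show "\<bar>lint (X (m + k)) (\<D> (m + k)) (prd k \<nu>) F
  - lint (X k) (\<D> k) \<nu> (\<lambda>z. lint (X m) (\<D> m) \<mu> (\<lambda>b. F (b @ z)))\<bar> \<le> 4 * eps" using sP by linarith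
qed

text \<open>The recursion for powers starts at \<open>n = 1\<close>.  It extends to \<open>n = 0\<close>, where the integral is taken over
the single empty tuple; this makes the exchange of two blocks uniform in the length of the tail.\<close>

lemma power_step_if:
 assumes \<nu>: "keisler L U (n * m) (pw n)" and D: "D \<in> \<D> (m + n * m)"
 shows "pw (Suc n) D = prd (n * m) (pw n) D"
proof (cases n)
 case 0
 have D0: "D \<subseteq> X m" using definable_tuples[OF D] 0 by simp
 interpret \<nu>: charge "X 0" "\<D> 0" "pw 0" by (rule keisler_charge_univ) (use \<nu> 0 in simp)
 have "prd 0 (pw 0) D = lint (X 0) (\<D> 0) (pw 0) (\<lambda>_. \<mu> D)"
 proof (rule \<nu>.lint_cong)
  fix z :: "'a list" assume "z \<in> X 0"
  then have "{a \<in> X m. a @ z \<in> D} = D" using D0 by (auto simp: tuples_def)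
  then show "\<mu> {a \<in> X m. a @ z \<in> D} = \<mu> D" by (rule arg_cong)
 qed
 also have "\<dots> = \<mu> D" using \<nu>.lint_step[OF \<nu>.step_const] \<nu>.sint_const by simp
 finally show ?thesis using 0 by simp
next
 case (Suc n')
 show ?thesis unfolding Suc morley_power.simps(3)
  by (rule morley_lint[OF definable \<nu>[unfolded Suc] D[unfolded Suc]])
qed

lemma power_keisler: "keisler L U (n * m) (pw n)"
proof (induction n)
 case 0
 show ?case by (auto simp: keisler_def additive_def tuples_def)
next
 case (Suc n)
 have eq: "pw (Suc n) D = prd (n * m) (pw n) D" if "D \<in> \<D> (m + n * m)" for D
  by (rule power_step_if[OF Suc.IH that])
 have k: "keisler L U (m + n * m) (prd (n * m) (pw n))" by (rule product_keisler[OF Suc.IH])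
 interpret algebra "X (m + n * m)" "\<D> (m + n * m)" by (rule definable_algebra[OF univ_ne order.refl])
 show ?case unfolding mult_Suc keisler_def additive_def
 proof (intro conjI ballI impI)
  show "0 \<le> pw (Suc n) D" if "D \<in> \<D> (m + n * m)" for D
   unfolding eq[OF that] using k that unfolding keisler_def by (elim conjE bspec)
  show "pw (Suc n) (X (m + n * m)) = 1" unfolding eq[OF top] using k unfolding keisler_def by (elim conjE)
  show "pw (Suc n) (D \<union> E) = pw (Suc n) D + pw (Suc n) E"
   if "D \<in> \<D> (m + n * m)" "E \<in> \<D> (m + n * m)" "D \<inter> E = {}" for D E
   unfolding eq[OF that(1)] eq[OF that(2)] eq[OF Un[OF that(1,2)]]
   using k that unfolding keisler_def additive_def by (elim conjE) (drule bspec, assumption, drule bspec, assumption, erule mp)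
 qed
qed

lemmas power_step = power_step_if[OF power_keisler]

definition invar :: "nat => (nat => nat) => bool" where
 "invar n \<sigma> \<longleftrightarrow> (\<forall>D\<in>\<D> (n * m). pw n {w \<in> X (n * m). bperm m n \<sigma> w \<in> D} = pw n D)"

lemma bperm_definable:
 assumes D: "D \<in> \<D> (n * m)" and \<sigma>: "\<sigma> permutes {..<n}"
 shows "{w \<in> X (n * m). bperm m n \<sigma> w \<in> D} \<in> \<D> (n * m)"
proof -
 let ?vs = "concat (map (\<lambda>i. map (\<lambda>j. \<sigma> i * m + j) [0..<m]) [0..<n])"
 have "set (map (\<lambda>i. map (\<lambda>j. \<sigma> i * m + j) [0..<m]) [0..<n]) \<subseteq> tuples m {..<n * m}"
  unfolding set_map
 proof (rule image_subsetI)
  fix i assume "i \<in> set [0..<n]"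
  then have "\<sigma> i < n" using permutes_in_image[OF \<sigma>, of i] by simp
  then have "set (map (\<lambda>j. \<sigma> i * m + j) [0..<m]) \<subseteq> {..<n * m}"
   unfolding set_map by (intro image_subsetI) (simp add: block_index)
  then show "map (\<lambda>j. \<sigma> i * m + j) [0..<m] \<in> tuples m {..<n * m}" by (simp add: tuples_def)
 qed
 from concat_tuples[OF this] have vs: "length ?vs = n * m" "set ?vs \<subseteq> {..<n * m + length []}"
  unfolding tuples_def by (simp_all del: length_concat set_concat)
 have pre: "{w \<in> X (n * m). map (nth (w @ [])) ?vs \<in> D} \<in> definable L U (univ U \<union> set []) (n * m)"
  by (rule definable_preimage[OF D vs]) simp
 have eq: "map (nth (w @ [])) ?vs = bperm m n \<sigma> w" for w by (simp add: bperm_def map_concat comp_def)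
 show ?thesis using pre unfolding eq list.set Un_empty_right .
qed

lemma invar_comp:
 assumes \<sigma>: "\<sigma> permutes {..<n}" "invar n \<sigma>" and \<tau>: "\<tau> permutes {..<n}" "invar n \<tau>"
 shows "invar n (\<tau> \<circ> \<sigma>)"
 unfolding invar_def
proof
 fix D assume D: "D \<in> \<D> (n * m)"
 let ?D = "{w \<in> X (n * m). bperm m n \<sigma> w \<in> D}"
 have eq: "{w \<in> X (n * m). bperm m n (\<tau> \<circ> \<sigma>) w \<in> D} = {w \<in> X (n * m). bperm m n \<tau> w \<in> ?D}"
  using bperm_tuples[OF _ \<tau>(1)] by (simp only: bperm_comp[OF \<sigma>(1), symmetric]) blast
 have 1: "pw n {w \<in> X (n * m). bperm m n \<tau> w \<in> ?D} = pw n ?D"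
  by (rule bspec[OF \<tau>(2)[unfolded invar_def] bperm_definable[OF D \<sigma>(1)]])
 have 2: "pw n ?D = pw n D" by (rule bspec[OF \<sigma>(2)[unfolded invar_def] D])
 show "pw n {w \<in> X (n * m). bperm m n (\<tau> \<circ> \<sigma>) w \<in> D} = pw n D"
  by (rule trans[OF arg_cong[where f = "pw n", OF eq] trans[OF 1 2]])
qed

text \<open>A permutation that fixes the first block changes, in the iterated integral, only the variables with
respect to which the power \<open>pw n\<close> integrates.\<close>

lemma invar_shift:
 assumes \<sigma>: "\<sigma> permutes {..<Suc n}" "\<sigma> 0 = 0" "!!i. i < n ==> \<sigma> (Suc i) = Suc (\<tau> i)"
  and \<tau>: "\<tau> permutes {..<n}" "invar n \<tau>"
 shows "invar (Suc n) \<sigma>"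
 unfolding invar_def
proof
 fix D assume D: "D \<in> \<D> (Suc n * m)"
 let ?E = "{w \<in> X (Suc n * m). bperm m (Suc n) \<sigma> w \<in> D}"
 interpret P: charge "X (n * m)" "\<D> (n * m)" "pw n" by (rule keisler_charge_univ[OF power_keisler])
 have D': "D \<in> \<D> (m + n * m)" "?E \<in> \<D> (m + n * m)" using D bperm_definable[OF D \<sigma>(1)] by simp_all
 have "pw (Suc n) ?E = lint (X (n * m)) (\<D> (n * m)) (pw n) (\<lambda>z. \<mu> {a \<in> X m. a @ bperm m n \<tau> z \<in> D})"
  unfolding power_step[OF D'(2)]
 proof (rule P.lint_cong)
  fix z assume z: "z \<in> X (n * m)"
  have "{a \<in> X m. a @ z \<in> ?E} = {a \<in> X m. a @ bperm m n \<tau> z \<in> D}"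
  proof (intro Collect_cong conj_cong refl)
   fix a assume a: "a \<in> X m"
   have "a @ z \<in> X (Suc n * m)" using tuples_append[OF a z] by simp
   then show "a @ z \<in> ?E \<longleftrightarrow> a @ bperm m n \<tau> z \<in> D"
    using bperm_shift[of a m \<sigma> n \<tau> z, OF tuplesD(1)[OF a] \<sigma>(2,3)] by simp
  qed
  then show "\<mu> {a \<in> X m. a @ z \<in> ?E} = \<mu> {a \<in> X m. a @ bperm m n \<tau> z \<in> D}" by (rule arg_cong)
 qed
 also have "\<dots> = lint (X (n * m)) (\<D> (n * m)) (pw n) (\<lambda>z. \<mu> {a \<in> X m. a @ z \<in> D})"
 proof (rule P.lint_invariant[OF _ _ _ fibre_tame[OF D'(1)]])
  show "bperm m n \<tau> z \<in> X (n * m)" if "z \<in> X (n * m)" for z by (rule bperm_tuples[OF that \<tau>(1)])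
  show "{z \<in> X (n * m). bperm m n \<tau> z \<in> E} \<in> \<D> (n * m)" if "E \<in> \<D> (n * m)" for E
   by (rule bperm_definable[OF that \<tau>(1)])
  show "pw n {z \<in> X (n * m). bperm m n \<tau> z \<in> E} = pw n E" if "E \<in> \<D> (n * m)" for E
   using \<tau>(2) that unfolding invar_def by (rule bspec)
 qed
 also have "\<dots> = pw (Suc n) D" by (rule power_step[OF D'(1), symmetric])
 finally show "pw (Suc n) ?E = pw (Suc n) D" .
qed

lemma power_two_steps:
 assumes D: "D \<in> \<D> (m + (m + n * m))"
 shows "pw (Suc (Suc n)) D = lint (X (n * m)) (\<D> (n * m)) (pw n)
  (\<lambda>z. lint (X m) (\<D> m) \<mu> (\<lambda>b. \<mu> {a \<in> X m. a @ b @ z \<in> D}))"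
proof -
 have "pw (Suc (Suc n)) D = prd (m + n * m) (pw (Suc n)) D" using power_step[of D "Suc n"] D by simp
 also have "\<dots> = prd (m + n * m) (prd (n * m) (pw n)) D"
  by (rule lint_measure_cong) (rule power_step)
 also have "\<dots> = lint (X (n * m)) (\<D> (n * m)) (pw n) (\<lambda>z. lint (X m) (\<D> m) \<mu> (\<lambda>b. \<mu> {a \<in> X m. a @ b @ z \<in> D}))"
  by (rule iterate_integrals[OF power_keisler fibre_tame[OF D]])
 finally show ?thesis .
qed

lemma invar_swap: "invar (Suc (Suc n)) (Transposition.transpose 0 1)"
 unfolding invar_def
proof
 fix D assume D: "D \<in> \<D> (Suc (Suc n) * m)"
 let ?E = "{w \<in> X (Suc (Suc n) * m). bperm m (Suc (Suc n)) (Transposition.transpose 0 1) w \<in> D}"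
 interpret P: charge "X (n * m)" "\<D> (n * m)" "pw n" by (rule keisler_charge_univ[OF power_keisler])
 have perm: "Transposition.transpose 0 1 permutes {..<Suc (Suc n)}" by (rule permutes_swap_id) simp_all
 have D': "D \<in> \<D> (m + (m + n * m))" "?E \<in> \<D> (m + (m + n * m))" using D bperm_definable[OF D perm] by simp_all
 have "D \<in> \<D> ((m + m) + n * m)" using D'(1) by (simp only: add.assoc)
 note Dz = fibre_univ[OF this]
 show "pw (Suc (Suc n)) ?E = pw (Suc (Suc n)) D"
  unfolding power_two_steps[OF D'(1)] power_two_steps[OF D'(2)]
 proof (rule P.lint_cong)
  fix z assume z: "z \<in> X (n * m)"
  let ?D = "{x \<in> X (m + m). x @ z \<in> D}"
  have in_E: "a @ b @ z \<in> ?E \<longleftrightarrow> b @ a @ z \<in> D" if "a \<in> X m" "b \<in> X m" for a b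
   using bperm_swap[of a m b z n, OF tuplesD(1)[OF that(1)] tuplesD(1)[OF that(2)] tuplesD(1)[OF z]]
    tuples_append[OF that(1) tuples_append[OF that(2) z]] by simp
  have in_D: "a @ b \<in> ?D \<longleftrightarrow> a @ b @ z \<in> D" if "a \<in> X m" "b \<in> X m" for a b
   using tuples_append[OF that] by simp
  have "lint (X m) (\<D> m) \<mu> (\<lambda>b. \<mu> {a \<in> X m. a @ b @ z \<in> ?E}) = lint (X m) (\<D> m) \<mu> (\<lambda>b. \<mu> {a \<in> X m. b @ a \<in> ?D})"
   by (rule \<mu>.lint_cong, rule arg_cong[where f = \<mu>], intro Collect_cong conj_cong refl) (simp only: in_E in_D)
  also have "\<dots> = lint (X m) (\<D> m) \<mu> (\<lambda>b. \<mu> {a \<in> X m. a @ b \<in> ?D})" by (rule symmetric[OF Dz[OF z], symmetric])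
  also have "\<dots> = lint (X m) (\<D> m) \<mu> (\<lambda>b. \<mu> {a \<in> X m. a @ b @ z \<in> D})"
   by (rule \<mu>.lint_cong, rule arg_cong[where f = \<mu>], intro Collect_cong conj_cong refl) (simp only: in_D)
  finally show "lint (X m) (\<D> m) \<mu> (\<lambda>b. \<mu> {a \<in> X m. a @ b @ z \<in> ?E}) = lint (X m) (\<D> m) \<mu> (\<lambda>b. \<mu> {a \<in> X m. a @ b @ z \<in> D})" .
 qed
qed

lemma invar_id: "invar n id"
 unfolding invar_def
proof
 fix D assume D: "D \<in> \<D> (n * m)"
 have "{w \<in> X (n * m). bperm m n id w \<in> D} = D"
  using definable_tuples[OF D] bperm_id[OF tuplesD(1)] by fastforce
 then show "pw n {w \<in> X (n * m). bperm m n id w \<in> D} = pw n D" by (rule arg_cong)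
qed

text \<open>Transpositions away from \<open>0\<close> come from the smaller power, the transposition of \<open>0\<close> and \<open>1\<close> from the
symmetry of \<open>\<mu> \<otimes> \<mu>\<close>, and the one of \<open>0\<close> and \<open>b\<close> is conjugate to it by a transposition away from \<open>0\<close>.\<close>

lemma invar_transpose: "a < b ==> b < n ==> invar n (Transposition.transpose a b)"
proof (induction n arbitrary: a b)
 case (Suc n)
 have pos: "invar (Suc n) (Transposition.transpose (Suc a') (Suc b'))" if "a' < b'" "b' < n" for a' b'
 proof (rule invar_shift[where \<tau> = "Transposition.transpose a' b'"])
  show "Transposition.transpose (Suc a') (Suc b') permutes {..<Suc n}" "Transposition.transpose a' b' permutes {..<n}"
   using that by (intro permutes_swap_id; simp)+
  show "Transposition.transpose (Suc a') (Suc b') (Suc i) = Suc (Transposition.transpose a' b' i)" for i by (simp add: Transposition.transpose_def)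
  show "invar n (Transposition.transpose a' b')" by (rule Suc.IH[OF that])
 qed (simp add: Transposition.transpose_def)
 show ?case
 proof (cases a)
  case (Suc a')
  then obtain b' where "b = Suc b'" "a' < b'" "b' < n" using Suc.prems by (cases b) auto
  then show ?thesis using pos Suc by simp
 next
  case 0
  obtain n' where n': "n = Suc n'" using Suc.prems 0 by (cases n) auto
  have swap: "invar (Suc n) (Transposition.transpose 0 1)" unfolding n' by (rule invar_swap)
  show ?thesis
  proof (cases "b = 1")
   case True
   then show ?thesis using swap 0 by simp
  next
   case False
   then have b: "1 < b" "b < Suc n" using Suc.prems 0 by simp_all
   have c: "invar (Suc n) (Transposition.transpose 1 b)" using pos[of 0 "b - 1"] b by simp
   have p: "Transposition.transpose 1 b permutes {..<Suc n}" "Transposition.transpose 0 1 permutes {..<Suc n}"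
    using b by (intro permutes_swap_id; simp)+
   have "Transposition.transpose 1 b \<circ> (Transposition.transpose 0 1 \<circ> Transposition.transpose 1 b) = Transposition.transpose 0 b"
    using b by (auto simp: Transposition.transpose_def fun_eq_iff)
   moreover have "invar (Suc n) (Transposition.transpose 1 b \<circ> (Transposition.transpose 0 1 \<circ> Transposition.transpose 1 b))"
    by (intro invar_comp p swap c permutes_compose)
   ultimately show ?thesis using 0 by simp
  qed
 qed
qed simp

lemma invar_permutation:
 assumes "\<sigma> permutes {..<n}"
 shows "invar n \<sigma>"
 using assms finite_lessThan
proof (induction rule: permutes_induct)
 case id
 show ?case by (rule invar_id)
next
 case (swap a b p)
 have "invar n (Transposition.transpose a b)"
 proof (cases a b rule: linorder_cases)
  case less
  then show ?thesis using swap by (intro invar_transpose) simp_all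
 next
  case equal
  then show ?thesis using invar_id by simp
 next
  case greater
  then show ?thesis using swap invar_transpose[of b a n] by (simp add: Transposition.transpose_commute)
 qed
 moreover have "Transposition.transpose a b permutes {..<n}" using swap by (intro permutes_swap_id)
 ultimately show ?case using swap by (intro invar_comp)
qed

lemma morley_power_symmetric:
 assumes \<sigma>: "\<sigma> permutes {..<n}" and D: "D \<in> \<D> (n * m)"
 shows "pw n D = pw n (permute_blocks m n \<sigma> D)"
 unfolding permute_blocks_eq[OF definable_tuples[OF D] \<sigma>]
 using bspec[OF invar_permutation[OF permutes_inv[OF \<sigma>], unfolded invar_def] D] by simp

end

theorem corollary4p8:
  fixes L :: "('f, 'r) lang"
    and \<kappa> :: "'k rel"
    and U :: "('a, 'f, 'r) struct"
    and M :: "'a set"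
    and m k :: nat
    and \<mu> \<nu> :: "'a list set \<Rightarrow> real"
    and \<Omega> :: "'w measure"
    and \<kappa>' :: "'l rel"
    and C :: "('c, 'f, 'r) cstruct"
    and \<iota> :: "('w \<Rightarrow> 'a) \<Rightarrow> 'c"
  assumes "countable_lang L"
    and "monster L \<kappa> U"
    and "small_model L \<kappa> U M"
    and "atomless_prob_space \<Omega>"
    and "random_monster L U M \<Omega> \<kappa>' C \<iota>"
    and "keisler L U m \<mu>"
    and "irgs L U M m \<mu> \<Omega> C \<iota>"
    and "keisler L U k \<nu>"
    and "fin_sat_measure L U M k \<nu>"
  shows "(morley_wd L \<kappa> U M k m \<nu> \<mu> \<and>
          (\<forall>D\<in>definable L U (univ U) (m + k).
             morley L \<kappa> U M m k \<mu> \<nu> D = morley L \<kappa> U M k m \<nu> \<mu> (swap_blocks m D))) \<and>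
         (\<forall>n \<sigma>. \<sigma> permutes {..<n} \<longrightarrow>
          (\<forall>D\<in>definable L U (univ U) (n * m).
             morley_power L \<kappa> U M m \<mu> n D = morley_power L \<kappa> U M m \<mu> n (permute_blocks m n \<sigma> D)))"
proof -
 interpret random_model L \<kappa> U M \<Omega> \<kappa>' C \<iota> by unfold_locales (rule assms)+
 obtain p where \<mu>: "definable_measure L U M m \<mu>" and p: "is_r L U M m \<mu> \<Omega> C \<iota> p"
  and gs: "generically_stable L C (randomize C \<iota> \<Omega> M) m p" using assms(7) unfolding irgs_def by blast
 note core = iterated_integrals_le[OF assms(6) \<mu> p gs]
 note products = commuting_products[OF assms(6) \<mu> assms(8,9) core[OF assms(8)]]
 interpret \<mu>: charge "X m" "\<D> m" \<mu> by (rule keisler_charge_univ[OF assms(6)])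
 have eq: "lint (X m) (\<D> m) \<mu> (\<lambda>b. \<mu> {a \<in> X m. a @ b \<in> D}) = lint (X m) (\<D> m) \<mu> (\<lambda>a. \<mu> {b \<in> X m. a @ b \<in> D})"
  if D: "D \<in> \<D> (m + m)" for D
 proof (rule antisym)
  \<comment> \<open>The reverse inequality is the same one for the set with the two blocks exchanged.\<close>
  let ?E = "swap_blocks m D"
  have E: "?E \<in> \<D> (m + m)" by (rule swap_blocks_definable[OF D order.refl])
  have sw: "b @ a \<in> ?E \<longleftrightarrow> a @ b \<in> D" if "a \<in> X m" for a b by (rule swap_mem[OF tuplesD(1)[OF that]])
  have "lint (X m) (\<D> m) \<mu> (\<lambda>a. \<mu> {b \<in> X m. a @ b \<in> D}) = lint (X m) (\<D> m) \<mu> (\<lambda>b. \<mu> {a \<in> X m. a @ b \<in> ?E})"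
   by (rule \<mu>.lint_cong, rule arg_cong[where f = \<mu>], intro Collect_cong conj_cong refl) (simp only: sw)
  also have "\<dots> \<le> lint (X m) (\<D> m) \<mu> (\<lambda>a. \<mu> {b \<in> X m. a @ b \<in> ?E})" by (rule core[OF assms(6) E])
  also have "\<dots> = lint (X m) (\<D> m) \<mu> (\<lambda>b. \<mu> {a \<in> X m. a @ b \<in> D})"
   by (rule \<mu>.lint_cong, rule arg_cong[where f = \<mu>], intro Collect_cong conj_cong refl) (simp only: sw)
  finally show "lint (X m) (\<D> m) \<mu> (\<lambda>a. \<mu> {b \<in> X m. a @ b \<in> D}) \<le> lint (X m) (\<D> m) \<mu> (\<lambda>b. \<mu> {a \<in> X m. a @ b \<in> D})" .
 qed (rule core[OF assms(6) D])
 interpret symmetric_measure L \<kappa> U M m \<mu> by unfold_locales (rule assms(6) \<mu> eq, assumption?)+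
 show ?thesis
  by (intro conjI ballI allI impI products morley_power_symmetric)
qed

end
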